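(* Let $\mathcal R$ be a small preadditive category such that $Mod\text{-}\mathcal R$ is locally noetherian, and let $\tau=(\mathcal T,\mathcal F)$ be a hereditary torsion theory on $Mod\text{-}\mathcal R$. For $k\ge 0$ put $\mathbb L_\tau^k:=\mathbb T^k\circ \mathbb S^k\circ \mathbb E_\tau:FI_{\mathcal R}\to FI_{\mathcal R}$. Then there is a functor $\mathbb L_\tau:FI_{\mathcal R}\longrightarrow Cl(\hat{\mathcal T})$ and a canonical morphism $$l_\tau (\mathscr V): \mathscr V\longrightarrow \mathbb L_\tau(\mathscr V):=\underset{k\geq 0}{\varinjlim}\ \mathbb L_\tau^k(\mathscr V)$$ for each $\mathscr V\in FI_{\mathcal R}$. (In particular, for each $\mathscr V\in FI_{\mathcal R}$ the object $\varinjlim_{k\ge 0}\mathbb L^k_\tau(\mathscr V)$ is $\hat{\mathcal T}$-closed.)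
   Context: $FI$ is the category of finite sets and injections; $[n]=\{1,\dots,n\}$, $[0]=\emptyset$. For a small preadditive category $\mathcal R$, a right $\mathcal R$-module is an (additive) functor $\mathcal R^{op}\to Ab$, and $Mod\text{-}\mathcal R$ is the category of these. $FI_{\mathcal R}$ is the (Grothendieck) category of functors $\mathscr V:FI\to Mod\text{-}\mathcal R$, and $\mathscr V_n:=\mathscr V([n])$. An object $X$ of a Grothendieck category is finitely generated if $Hom(X,-)$ preserves filtered colimits of monomorphisms; noetherian if all its subobjects are finitely generated; the category is locally noetherian if it has a set of noetherian generators. A torsion theory on an abelian category is a pair $(\mathcal T,\mathcal F)$ of full replete subcategories with $Hom(T,F)=0$ for all $T\in\mathcal T,F\in\mathcal F$ and such that every object $X$ fits in a short exact sequence $0\to T\to X\to F\to 0$ with $T\in\mathcal T$, $F\in\mathcal F$; it is hereditary if $\mathcal T$ is closed under subobjects. A Serre subcategory is a full subcategory closed under subobjects, quotients and extensions. For a Serre subcategory $\mathcal C$ of a Grothendieck category $\mathcal A$: a morphism $u$ is a $\mathcal C$-isomorphism if $Ker(u),Coker(u)\in\mathcal C$; an object $L$ is $\mathcal C$-closed if $Hom(u,L):Hom(B,L)\to Hom(A,L)$ is an isomorphism for every $\mathcal C$-isomorphism $u:A\to B$; a $\mathcal C$-envelope of $A$ is a $\mathcal C$-isomorphism $A\to A_{\mathcal C}$ with $A_{\mathcal C}$ $\mathcal C$-closed. $Cl(\mathcal C)$ is the full subcategory of $\mathcal C$-closed objects. $\hat{\mathcal T}$ is the Serre subcategory of $FI_{\mathcal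 R}$ with objects those $\mathscr V\in FI_{\mathcal R}$ such that $\mathscr V_n\in\mathcal T$ for $n\gg0$. $\mathbb E_\tau:Mod\text{-}\mathcal R\to Mod\text{-}\mathcal R$ takes a module $V$ to its $\mathcal T$-envelope (torsion envelope), with canonical map $V\to\mathbb E_\tau(V)$ (the unit of the adjunction between the reflector $Mod\text{-}\mathcal R\to Cl(\mathcal T)$ and the inclusion). Also $\mathbb E_\tau:FI_{\mathcal R}\to FI_{\mathcal R}$ denotes $\mathbb E_\tau(\mathscr V)(S):=\mathbb E_\tau(\mathscr V(S))$, with induced canonical morphism $i_\tau(\mathscr V):\mathscr V\to\mathbb E_\tau(\mathscr V)$. For each $a\ge0$, $[-a]$ is a fixed set of cardinality $a$, and $\mathbb S^a:FI_{\mathcal R}\to FI_{\mathcal R}$ is the shift functor $(\mathbb S^a\mathscr V)(S):=\mathscr V(S\sqcup[-a])$; $\mathbb S:=\mathbb S^1$, and $\mathbb S^a$ is the $a$-fold iterate of $\mathbb S$. $\mathbb T=\mathbb T^1$ is a right adjoint of $\mathbb S$, and its $a$-fold iterate $\mathbb T^a$ is a right adjoint of $\mathbb S^a$. The morphism $l^k_\tau(\mathscr V):\mathscr V\to\mathbb L^k_\tau(\mathscr V)$ is the composite of $i_\tau(\mathscr V)$ with the unit $\mathbb E_\tau(\mathscr V)\to\mathbb T^k\mathbb S^k\mathbb E_\tau(\mathscr V)$. The transition maps of the colimit are $c^k_\tau:\mathbb L^k_\tau=\mathbb T^k\mathbb S^k\mathbb E_\tau\to\mathbb T^k(\mathbb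 T\mathbb S)\mathbb S^k\mathbb E_\tau=\mathbb L^{k+1}_\tau$ induced by the unit $Id\to\mathbb T\mathbb S$ of the adjunction $(\mathbb S,\mathbb T)$; they satisfy $l^{k+1}_\tau=c^k_\tau\circ l^k_\tau$, and $l_\tau(\mathscr V)$ is the morphism to the colimit determined by the $l^k_\tau(\mathscr V)$. *)

theory Defs
  imports "HOL-Algebra.Group" "HOL-Library.FuncSet"
begin

section \<open>Universes\<close>

text \<open>
  "Small" is relative to a predicate on the subsets of a type \<open>'u\<close>; the closure conditions are those
  of the sets of cardinality less than an uncountable regular cardinal. Every Grothendieck universe
  containing an infinite set gives an instance, and so does \<open>\<lambda>_. True\<close> on any infinite type.
\<close>

locale universe =
  fixes small :: "'u set \<Rightarrow> bool"
  assumes small_infinite: "\<exists>A. small A \<and> infinite A"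
    and small_subset: "small A \<Longrightarrow> B \<subseteq> A \<Longrightarrow> small B"
    and small_image: "small A \<Longrightarrow> small (f ` A)"
    and small_Union: "small I \<Longrightarrow> (\<And>i. i \<in> I \<Longrightarrow> small (F i)) \<Longrightarrow> small (\<Union>i\<in>I. F i)"


section \<open>Categories, functors, natural transformations\<close>

record ('o, 'a) category =
  Obj :: "'o set"
  Arr :: "'a set"
  Dom :: "'a \<Rightarrow> 'o"
  Cod :: "'a \<Rightarrow> 'o"
  Ident :: "'o \<Rightarrow> 'a"
  Comp :: "'a \<Rightarrow> 'a \<Rightarrow> 'a"

definition Hom :: "('o, 'a, 'z) category_scheme \<Rightarrow> 'o \<Rightarrow> 'o \<Rightarrow> 'a set" where
  "Hom C X Y = {f \<in> Arr C. Dom C f = X \<and> Cod C f = Y}"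

locale category =
  fixes C :: "('o, 'a, 'z) category_scheme"
  assumes Dom_Obj: "f \<in> Arr C \<Longrightarrow> Dom C f \<in> Obj C"
    and Cod_Obj: "f \<in> Arr C \<Longrightarrow> Cod C f \<in> Obj C"
    and Ident_Hom: "X \<in> Obj C \<Longrightarrow> Ident C X \<in> Hom C X X"
    and Comp_Hom: "f \<in> Hom C X Y \<Longrightarrow> g \<in> Hom C Y Z \<Longrightarrow> Comp C g f \<in> Hom C X Z"
    and Comp_assoc: "f \<in> Hom C W X \<Longrightarrow> g \<in> Hom C X Y \<Longrightarrow> h \<in> Hom C Y Z \<Longrightarrow>
      Comp C h (Comp C g f) = Comp C (Comp C h g) f"
    and Comp_Ident_right: "f \<in> Hom C X Y \<Longrightarrow> Comp C f (Ident C X) = f"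
    and Comp_Ident_left: "f \<in> Hom C X Y \<Longrightarrow> Comp C (Ident C Y) f = f"

definition small_category :: "('u set \<Rightarrow> bool) \<Rightarrow> ('o, 'a, 'z) category_scheme \<Rightarrow> bool" where
  "small_category small C \<longleftrightarrow> (\<exists>\<phi>. inj_on \<phi> (Arr C) \<and> small (\<phi> ` Arr C))"

definition full_subcategory ::
    "('o, 'a, 'z) category_scheme \<Rightarrow> 'o set \<Rightarrow> ('o, 'a) category" where
  "full_subcategory C \<P> =
    \<lparr>Obj = Obj C \<inter> \<P>, Arr = {f \<in> Arr C. Dom C f \<in> \<P> \<and> Cod C f \<in> \<P>},
     Dom = Dom C, Cod = Cod C, Ident = Ident C, Comp = Comp C\<rparr>"

record ('o, 'a) preadditive = "('o, 'a) category" +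
  Add :: "'a \<Rightarrow> 'a \<Rightarrow> 'a"
  Zero :: "'o \<Rightarrow> 'o \<Rightarrow> 'a"

locale preadditive_category = category C
  for C :: "('o, 'a, 'z) preadditive_scheme" +
  assumes Hom_comm_group: "X \<in> Obj C \<Longrightarrow> Y \<in> Obj C \<Longrightarrow>
      comm_group \<lparr>carrier = Hom C X Y, monoid.mult = Add C, one = Zero C X Y\<rparr>"
    and Comp_Add_right: "f \<in> Hom C X Y \<Longrightarrow> f' \<in> Hom C X Y \<Longrightarrow> g \<in> Hom C Y Z \<Longrightarrow>
      Comp C g (Add C f f') = Add C (Comp C g f) (Comp C g f')"
    and Comp_Add_left: "f \<in> Hom C X Y \<Longrightarrow> g \<in> Hom C Y Z \<Longrightarrow> g' \<in> Hom C Y Z \<Longrightarrow>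
      Comp C (Add C g g') f = Add C (Comp C g f) (Comp C g' f)"

definition opposite :: "('o, 'a, 'z) preadditive_scheme \<Rightarrow> ('o, 'a) preadditive" where
  "opposite C =
    \<lparr>Obj = Obj C, Arr = Arr C, Dom = Cod C, Cod = Dom C, Ident = Ident C,
     Comp = (\<lambda>g f. Comp C f g), Add = Add C, Zero = (\<lambda>X Y. Zero C Y X)\<rparr>"

record ('o1, 'a1, 'o2, 'a2) cfunctor =
  FObj :: "'o1 \<Rightarrow> 'o2"
  FArr :: "'a1 \<Rightarrow> 'a2"

text \<open>Extensionality makes equality of functors coincide with equality of records.\<close>

definition is_functor ::
    "('o1, 'a1, 'y) category_scheme \<Rightarrow> ('o2, 'a2, 'z) category_scheme \<Rightarrow>
     ('o1, 'a1, 'o2, 'a2) cfunctor \<Rightarrow> bool" where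
  "is_functor C D F \<longleftrightarrow>
    FObj F \<in> Obj C \<rightarrow>\<^sub>E Obj D \<and> FArr F \<in> Arr C \<rightarrow>\<^sub>E Arr D \<and>
    (\<forall>f \<in> Arr C. Dom D (FArr F f) = FObj F (Dom C f) \<and> Cod D (FArr F f) = FObj F (Cod C f)) \<and>
    (\<forall>X \<in> Obj C. FArr F (Ident C X) = Ident D (FObj F X)) \<and>
    (\<forall>f \<in> Arr C. \<forall>g \<in> Arr C. Cod C f = Dom C g \<longrightarrow>
      FArr F (Comp C g f) = Comp D (FArr F g) (FArr F f))"

definition is_additive ::
    "('o1, 'a1, 'y) preadditive_scheme \<Rightarrow> ('o2, 'a2, 'z) preadditive_scheme \<Rightarrow>
     ('o1, 'a1, 'o2, 'a2) cfunctor \<Rightarrow> bool" where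
  "is_additive C D F \<longleftrightarrow> (\<forall>X \<in> Obj C. \<forall>Y \<in> Obj C. \<forall>f \<in> Hom C X Y. \<forall>g \<in> Hom C X Y.
    FArr F (Add C f g) = Add D (FArr F f) (FArr F g))"

definition id_functor :: "('o, 'a, 'z) category_scheme \<Rightarrow> ('o, 'a, 'o, 'a) cfunctor" where
  "id_functor C = \<lparr>FObj = (\<lambda>X \<in> Obj C. X), FArr = (\<lambda>f \<in> Arr C. f)\<rparr>"

definition functor_comp ::
    "('o1, 'a1, 'z) category_scheme \<Rightarrow> ('o2, 'a2, 'o3, 'a3) cfunctor \<Rightarrow>
     ('o1, 'a1, 'o2, 'a2) cfunctor \<Rightarrow> ('o1, 'a1, 'o3, 'a3) cfunctor" where
  "functor_comp C G F =
    \<lparr>FObj = (\<lambda>X \<in> Obj C. FObj G (FObj F X)), FArr = (\<lambda>f \<in> Arr C. FArr G (FArr F f))\<rparr>"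

primrec functor_pow ::
    "('o, 'a, 'z) category_scheme \<Rightarrow> ('o, 'a, 'o, 'a) cfunctor \<Rightarrow> nat \<Rightarrow> ('o, 'a, 'o, 'a) cfunctor"
where
  "functor_pow C F 0 = id_functor C"
| "functor_pow C F (Suc n) = functor_comp C F (functor_pow C F n)"

text \<open>
  Arrows carrying their source and target: homomorphisms of abelian groups, injections of finite
  sets, and natural transformations (with \<open>Map\<close> the family of components).
\<close>

record ('o, 'f) arrow =
  Src :: 'o
  Trg :: 'o
  Map :: 'f

definition is_nat_trans ::
    "('o1, 'a1, 'y) category_scheme \<Rightarrow> ('o2, 'a2, 'z) category_scheme \<Rightarrow>
     (('o1, 'a1, 'o2, 'a2) cfunctor, 'o1 \<Rightarrow> 'a2) arrow \<Rightarrow> bool" where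
  "is_nat_trans C D \<alpha> \<longleftrightarrow>
    is_functor C D (Src \<alpha>) \<and> is_functor C D (Trg \<alpha>) \<and>
    Map \<alpha> \<in> (\<Pi>\<^sub>E X \<in> Obj C. Hom D (FObj (Src \<alpha>) X) (FObj (Trg \<alpha>) X)) \<and>
    (\<forall>f \<in> Arr C. Comp D (Map \<alpha> (Cod C f)) (FArr (Src \<alpha>) f) =
                 Comp D (FArr (Trg \<alpha>) f) (Map \<alpha> (Dom C f)))"

definition functor_category ::
    "('o1, 'a1, 'y) category_scheme \<Rightarrow> ('o2, 'a2, 'z) category_scheme \<Rightarrow>
     (('o1, 'a1, 'o2, 'a2) cfunctor, (('o1, 'a1, 'o2, 'a2) cfunctor, 'o1 \<Rightarrow> 'a2) arrow) category"
where
  "functor_category C D =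
    \<lparr>Obj = {F. is_functor C D F}, Arr = {\<alpha>. is_nat_trans C D \<alpha>}, Dom = Src, Cod = Trg,
     Ident = (\<lambda>F. \<lparr>Src = F, Trg = F, Map = (\<lambda>X \<in> Obj C. Ident D (FObj F X))\<rparr>),
     Comp = (\<lambda>\<beta> \<alpha>. \<lparr>Src = Src \<alpha>, Trg = Trg \<beta>,
                      Map = (\<lambda>X \<in> Obj C. Comp D (Map \<beta> X) (Map \<alpha> X))\<rparr>)\<rparr>"

definition precomp_functor ::
    "('o0, 'a0, 'x) category_scheme \<Rightarrow> ('o1, 'a1, 'y) category_scheme \<Rightarrow>
     ('o2, 'a2, 'z) category_scheme \<Rightarrow> ('o0, 'a0, 'o1, 'a1) cfunctor \<Rightarrow>
     (('o1, 'a1, 'o2, 'a2) cfunctor, (('o1, 'a1, 'o2, 'a2) cfunctor, 'o1 \<Rightarrow> 'a2) arrow,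
      ('o0, 'a0, 'o2, 'a2) cfunctor, (('o0, 'a0, 'o2, 'a2) cfunctor, 'o0 \<Rightarrow> 'a2) arrow) cfunctor"
where
  "precomp_functor B C D P =
    \<lparr>FObj = (\<lambda>V \<in> Obj (functor_category C D). functor_comp B V P),
     FArr = (\<lambda>\<alpha> \<in> Arr (functor_category C D).
       \<lparr>Src = functor_comp B (Src \<alpha>) P, Trg = functor_comp B (Trg \<alpha>) P,
        Map = (\<lambda>X \<in> Obj B. Map \<alpha> (FObj P X))\<rparr>)\<rparr>"

definition postcomp_functor ::
    "('o0, 'a0, 'x) category_scheme \<Rightarrow> ('o1, 'a1, 'y) category_scheme \<Rightarrow>
     ('o1, 'a1, 'o2, 'a2) cfunctor \<Rightarrow>
     (('o0, 'a0, 'o1, 'a1) cfunctor, (('o0, 'a0, 'o1, 'a1) cfunctor, 'o0 \<Rightarrow> 'a1) arrow,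
      ('o0, 'a0, 'o2, 'a2) cfunctor, (('o0, 'a0, 'o2, 'a2) cfunctor, 'o0 \<Rightarrow> 'a2) arrow) cfunctor"
where
  "postcomp_functor B C G =
    \<lparr>FObj = (\<lambda>V \<in> Obj (functor_category B C). functor_comp B G V),
     FArr = (\<lambda>\<alpha> \<in> Arr (functor_category B C).
       \<lparr>Src = functor_comp B G (Src \<alpha>), Trg = functor_comp B G (Trg \<alpha>),
        Map = (\<lambda>X \<in> Obj B. FArr G (Map \<alpha> X))\<rparr>)\<rparr>"

definition is_adjunction ::
    "('o1, 'a1, 'y) category_scheme \<Rightarrow> ('o2, 'a2, 'z) category_scheme \<Rightarrow>
     ('o1, 'a1, 'o2, 'a2) cfunctor \<Rightarrow> ('o2, 'a2, 'o1, 'a1) cfunctor \<Rightarrow>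
     (('o1, 'a1, 'o1, 'a1) cfunctor, 'o1 \<Rightarrow> 'a1) arrow \<Rightarrow>
     (('o2, 'a2, 'o2, 'a2) cfunctor, 'o2 \<Rightarrow> 'a2) arrow \<Rightarrow> bool" where
  "is_adjunction C D F G \<eta> \<epsilon> \<longleftrightarrow>
    is_functor C D F \<and> is_functor D C G \<and>
    \<eta> \<in> Hom (functor_category C C) (id_functor C) (functor_comp C G F) \<and>
    \<epsilon> \<in> Hom (functor_category D D) (functor_comp D F G) (id_functor D) \<and>
    (\<forall>X \<in> Obj C. Comp D (Map \<epsilon> (FObj F X)) (FArr F (Map \<eta> X)) = Ident D (FObj F X)) \<and>
    (\<forall>Y \<in> Obj D. Comp C (FArr G (Map \<epsilon> Y)) (Map \<eta> (FObj G Y)) = Ident C (FObj G Y))"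


section \<open>Kernels, cokernels, exact sequences\<close>

definition is_iso :: "('o, 'a, 'z) category_scheme \<Rightarrow> 'a \<Rightarrow> bool" where
  "is_iso C f \<longleftrightarrow> f \<in> Arr C \<and> (\<exists>g \<in> Hom C (Cod C f) (Dom C f).
    Comp C g f = Ident C (Dom C f) \<and> Comp C f g = Ident C (Cod C f))"

definition is_mono :: "('o, 'a, 'z) category_scheme \<Rightarrow> 'a \<Rightarrow> bool" where
  "is_mono C m \<longleftrightarrow> m \<in> Arr C \<and> (\<forall>X \<in> Obj C. inj_on (Comp C m) (Hom C X (Dom C m)))"

definition is_zero_object :: "('o, 'a, 'z) category_scheme \<Rightarrow> 'o \<Rightarrow> bool" where
  "is_zero_object C Z \<longleftrightarrow>
    Z \<in> Obj C \<and> (\<forall>X \<in> Obj C. (\<exists>!f. f \<in> Hom C X Z) \<and> (\<exists>!f. f \<in> Hom C Z X))"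

definition is_zero_arrow :: "('o, 'a, 'z) category_scheme \<Rightarrow> 'a \<Rightarrow> bool" where
  "is_zero_arrow C f \<longleftrightarrow> f \<in> Arr C \<and>
    (\<exists>Z. is_zero_object C Z \<and> (\<exists>g \<in> Hom C (Dom C f) Z. \<exists>h \<in> Hom C Z (Cod C f). f = Comp C h g))"

definition is_kernel :: "('o, 'a, 'z) category_scheme \<Rightarrow> 'a \<Rightarrow> 'a \<Rightarrow> bool" where
  "is_kernel C u k \<longleftrightarrow> u \<in> Arr C \<and> k \<in> Arr C \<and> Cod C k = Dom C u \<and> is_zero_arrow C (Comp C u k) \<and>
    (\<forall>h \<in> Arr C. Cod C h = Dom C u \<and> is_zero_arrow C (Comp C u h) \<longrightarrow>
      (\<exists>!h'. h' \<in> Hom C (Dom C h) (Dom C k) \<and> Comp C k h' = h))"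

definition is_cokernel :: "('o, 'a, 'z) category_scheme \<Rightarrow> 'a \<Rightarrow> 'a \<Rightarrow> bool" where
  "is_cokernel C u q \<longleftrightarrow> u \<in> Arr C \<and> q \<in> Arr C \<and> Dom C q = Cod C u \<and> is_zero_arrow C (Comp C q u) \<and>
    (\<forall>h \<in> Arr C. Dom C h = Cod C u \<and> is_zero_arrow C (Comp C h u) \<longrightarrow>
      (\<exists>!h'. h' \<in> Hom C (Cod C q) (Cod C h) \<and> Comp C h' q = h))"

definition is_short_exact :: "('o, 'a, 'z) category_scheme \<Rightarrow> 'a \<Rightarrow> 'a \<Rightarrow> bool" where
  "is_short_exact C i p \<longleftrightarrow> is_kernel C p i \<and> is_cokernel C i p"


section \<open>Torsion theories, closed objects, envelopes\<close>

text \<open>Full subcategories are given by their sets of objects.\<close>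

definition is_replete :: "('o, 'a, 'z) category_scheme \<Rightarrow> 'o set \<Rightarrow> bool" where
  "is_replete C \<P> \<longleftrightarrow> (\<forall>f. is_iso C f \<and> Dom C f \<in> \<P> \<longrightarrow> Cod C f \<in> \<P>)"

definition is_torsion_theory ::
    "('o, 'a, 'z) category_scheme \<Rightarrow> 'o set \<Rightarrow> 'o set \<Rightarrow> bool" where
  "is_torsion_theory C \<T> \<F> \<longleftrightarrow>
    \<T> \<subseteq> Obj C \<and> \<F> \<subseteq> Obj C \<and> is_replete C \<T> \<and> is_replete C \<F> \<and>
    (\<forall>T \<in> \<T>. \<forall>F \<in> \<F>. \<forall>f \<in> Hom C T F. is_zero_arrow C f) \<and>
    (\<forall>X \<in> Obj C. \<exists>T \<in> \<T>. \<exists>F \<in> \<F>. \<exists>i \<in> Hom C T X. \<exists>p \<in> Hom C X F. is_short_exact C i p)"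

definition is_hereditary_torsion_theory ::
    "('o, 'a, 'z) category_scheme \<Rightarrow> 'o set \<Rightarrow> 'o set \<Rightarrow> bool" where
  "is_hereditary_torsion_theory C \<T> \<F> \<longleftrightarrow>
    is_torsion_theory C \<T> \<F> \<and> (\<forall>m. is_mono C m \<and> Cod C m \<in> \<T> \<longrightarrow> Dom C m \<in> \<T>)"

definition is_iso_mod :: "('o, 'a, 'z) category_scheme \<Rightarrow> 'o set \<Rightarrow> 'a \<Rightarrow> bool" where
  "is_iso_mod C \<S> u \<longleftrightarrow> u \<in> Arr C \<and>
    (\<exists>k. is_kernel C u k \<and> Dom C k \<in> \<S>) \<and> (\<exists>q. is_cokernel C u q \<and> Cod C q \<in> \<S>)"

definition is_closed_object :: "('o, 'a, 'z) category_scheme \<Rightarrow> 'o set \<Rightarrow> 'o \<Rightarrow> bool" where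
  "is_closed_object C \<S> L \<longleftrightarrow> L \<in> Obj C \<and>
    (\<forall>u. is_iso_mod C \<S> u \<longrightarrow> bij_betw (\<lambda>g. Comp C g u) (Hom C (Cod C u) L) (Hom C (Dom C u) L))"

definition Cl :: "('o, 'a, 'z) category_scheme \<Rightarrow> 'o set \<Rightarrow> ('o, 'a) category" where
  "Cl C \<S> = full_subcategory C {L. is_closed_object C \<S> L}"

definition is_envelope :: "('o, 'a, 'z) category_scheme \<Rightarrow> 'o set \<Rightarrow> 'o \<Rightarrow> 'a \<Rightarrow> bool" where
  "is_envelope C \<S> A e \<longleftrightarrow> is_iso_mod C \<S> e \<and> Dom C e = A \<and> is_closed_object C \<S> (Cod C e)"

definition is_envelope_functor ::
    "('o, 'a, 'z) category_scheme \<Rightarrow> 'o set \<Rightarrow> ('o, 'a, 'o, 'a) cfunctor \<Rightarrow>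
     (('o, 'a, 'o, 'a) cfunctor, 'o \<Rightarrow> 'a) arrow \<Rightarrow> bool" where
  "is_envelope_functor C \<S> E e \<longleftrightarrow>
    is_functor C C E \<and> e \<in> Hom (functor_category C C) (id_functor C) E \<and>
    (\<forall>A \<in> Obj C. is_envelope C \<S> A (Map e A))"


section \<open>Colimits and finiteness conditions\<close>

definition is_filtered :: "('j, 'k, 'z) category_scheme \<Rightarrow> bool" where
  "is_filtered J \<longleftrightarrow> category J \<and> Obj J \<noteq> {} \<and>
    (\<forall>i \<in> Obj J. \<forall>j \<in> Obj J. \<exists>k \<in> Obj J. Hom J i k \<noteq> {} \<and> Hom J j k \<noteq> {}) \<and>
    (\<forall>i \<in> Obj J. \<forall>j \<in> Obj J. \<forall>a \<in> Hom J i j. \<forall>b \<in> Hom J i j.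
      \<exists>k \<in> Obj J. \<exists>c \<in> Hom J j k. Comp J c a = Comp J c b)"

definition is_cocone ::
    "('j, 'k, 'y) category_scheme \<Rightarrow> ('o, 'a, 'z) category_scheme \<Rightarrow>
     ('j, 'k, 'o, 'a) cfunctor \<Rightarrow> 'o \<Rightarrow> ('j \<Rightarrow> 'a) \<Rightarrow> bool" where
  "is_cocone J C D L \<iota> \<longleftrightarrow> L \<in> Obj C \<and> (\<forall>j \<in> Obj J. \<iota> j \<in> Hom C (FObj D j) L) \<and>
    (\<forall>a \<in> Arr J. Comp C (\<iota> (Cod J a)) (FArr D a) = \<iota> (Dom J a))"

definition is_colimit ::
    "('j, 'k, 'y) category_scheme \<Rightarrow> ('o, 'a, 'z) category_scheme \<Rightarrow>
     ('j, 'k, 'o, 'a) cfunctor \<Rightarrow> 'o \<Rightarrow> ('j \<Rightarrow> 'a) \<Rightarrow> bool" where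
  "is_colimit J C D L \<iota> \<longleftrightarrow> is_cocone J C D L \<iota> \<and>
    (\<forall>L' \<iota>'. is_cocone J C D L' \<iota>' \<longrightarrow>
      (\<exists>!h. h \<in> Hom C L L' \<and> (\<forall>j \<in> Obj J. Comp C h (\<iota> j) = \<iota>' j)))"

text \<open>
  The filtered colimit of the sets \<open>Hom C X (FObj D j)\<close> is their disjoint union modulo
  identification at a later stage. The last two conjuncts say that the comparison map from it to
  \<open>Hom C X L\<close> is surjective and injective.
\<close>

definition Hom_preserves_colimit ::
    "('j, 'k, 'y) category_scheme \<Rightarrow> ('o, 'a, 'z) category_scheme \<Rightarrow> 'o \<Rightarrow>
     ('j, 'k, 'o, 'a) cfunctor \<Rightarrow> 'o \<Rightarrow> ('j \<Rightarrow> 'a) \<Rightarrow> bool" where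
  "Hom_preserves_colimit J C X D L \<iota> \<longleftrightarrow>
    (\<forall>f \<in> Hom C X L. \<exists>j \<in> Obj J. \<exists>g \<in> Hom C X (FObj D j). f = Comp C (\<iota> j) g) \<and>
    (\<forall>i \<in> Obj J. \<forall>j \<in> Obj J. \<forall>f \<in> Hom C X (FObj D i). \<forall>g \<in> Hom C X (FObj D j).
      Comp C (\<iota> i) f = Comp C (\<iota> j) g \<longrightarrow>
      (\<exists>k \<in> Obj J. \<exists>a \<in> Hom J i k. \<exists>b \<in> Hom J j k. Comp C (FArr D a) f = Comp C (FArr D b) g))"

definition is_finitely_generated ::
    "('u set \<Rightarrow> bool) \<Rightarrow> ('o, 'a, 'z) category_scheme \<Rightarrow> 'o \<Rightarrow> bool" where
  "is_finitely_generated small C X \<longleftrightarrow> X \<in> Obj C \<and>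
    (\<forall>(J :: ('u, 'u) category) D L \<iota>.
      is_filtered J \<and> small (Obj J) \<and> small (Arr J) \<and> is_functor J C D \<and>
      (\<forall>a \<in> Arr J. is_mono C (FArr D a)) \<and> is_colimit J C D L \<iota> \<longrightarrow>
      Hom_preserves_colimit J C X D L \<iota>)"

definition is_noetherian ::
    "('u set \<Rightarrow> bool) \<Rightarrow> ('o, 'a, 'z) category_scheme \<Rightarrow> 'o \<Rightarrow> bool" where
  "is_noetherian small C X \<longleftrightarrow> X \<in> Obj C \<and>
    (\<forall>m. is_mono C m \<and> Cod C m = X \<longrightarrow> is_finitely_generated small C (Dom C m))"

definition is_generating :: "('o, 'a, 'z) category_scheme \<Rightarrow> 'o set \<Rightarrow> bool" where
  "is_generating C \<G> \<longleftrightarrow> \<G> \<subseteq> Obj C \<and>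
    (\<forall>X \<in> Obj C. \<forall>Y \<in> Obj C. \<forall>f \<in> Hom C X Y. \<forall>g \<in> Hom C X Y. f \<noteq> g \<longrightarrow>
      (\<exists>G \<in> \<G>. \<exists>h \<in> Hom C G X. Comp C f h \<noteq> Comp C g h))"

definition is_locally_noetherian ::
    "('u set \<Rightarrow> bool) \<Rightarrow> ('o, 'a, 'z) category_scheme \<Rightarrow> bool" where
  "is_locally_noetherian small C \<longleftrightarrow> (\<exists>(I :: 'u set) G.
    small I \<and> is_generating C (G ` I) \<and> (\<forall>i \<in> I. is_noetherian small C (G i)))"

definition is_seq_cocone ::
    "('o, 'a, 'z) category_scheme \<Rightarrow> (nat \<Rightarrow> 'o) \<Rightarrow> (nat \<Rightarrow> 'a) \<Rightarrow> 'o \<Rightarrow> (nat \<Rightarrow> 'a) \<Rightarrow> bool" where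
  "is_seq_cocone C X c L \<iota> \<longleftrightarrow>
    L \<in> Obj C \<and> (\<forall>k. \<iota> k \<in> Hom C (X k) L \<and> Comp C (\<iota> (Suc k)) (c k) = \<iota> k)"

definition is_seq_colimit ::
    "('o, 'a, 'z) category_scheme \<Rightarrow> (nat \<Rightarrow> 'o) \<Rightarrow> (nat \<Rightarrow> 'a) \<Rightarrow> 'o \<Rightarrow> (nat \<Rightarrow> 'a) \<Rightarrow> bool" where
  "is_seq_colimit C X c L \<iota> \<longleftrightarrow> is_seq_cocone C X c L \<iota> \<and>
    (\<forall>L' \<iota>'. is_seq_cocone C X c L' \<iota>' \<longrightarrow>
      (\<exists>!h. h \<in> Hom C L L' \<and> (\<forall>k. Comp C h (\<iota> k) = \<iota>' k)))"


section \<open>Modules over a preadditive category\<close>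

type_synonym 'u ab_arr = "('u monoid, 'u \<Rightarrow> 'u) arrow"

definition Ab :: "('u set \<Rightarrow> bool) \<Rightarrow> ('u monoid, 'u ab_arr) preadditive" where
  "Ab small =
    \<lparr>Obj = {A. comm_group A \<and> small (carrier A)},
     Arr = {f. comm_group (Src f) \<and> small (carrier (Src f)) \<and>
               comm_group (Trg f) \<and> small (carrier (Trg f)) \<and>
               Map f \<in> hom (Src f) (Trg f) \<inter> extensional (carrier (Src f))},
     Dom = Src, Cod = Trg,
     Ident = (\<lambda>A. \<lparr>Src = A, Trg = A, Map = (\<lambda>x \<in> carrier A. x)\<rparr>),
     Comp = (\<lambda>g f. \<lparr>Src = Src f, Trg = Trg g, Map = compose (carrier (Src f)) (Map g) (Map f)\<rparr>),
     Add = (\<lambda>f g. \<lparr>Src = Src f, Trg = Trg f,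
                   Map = (\<lambda>x \<in> carrier (Src f). Map f x \<otimes>\<^bsub>Trg f\<^esub> Map g x)\<rparr>),
     Zero = (\<lambda>A B. \<lparr>Src = A, Trg = B, Map = (\<lambda>x \<in> carrier A. \<one>\<^bsub>B\<^esub>)\<rparr>)\<rparr>"

type_synonym ('r, 'm, 'u) module_obj = "('r, 'm, 'u monoid, 'u ab_arr) cfunctor"
type_synonym ('r, 'm, 'u) module_arr = "(('r, 'm, 'u) module_obj, 'r \<Rightarrow> 'u ab_arr) arrow"

definition Mod :: "('u set \<Rightarrow> bool) \<Rightarrow> ('r, 'm) preadditive \<Rightarrow>
    (('r, 'm, 'u) module_obj, ('r, 'm, 'u) module_arr) category" where
  "Mod small R = full_subcategory (functor_category (opposite R) (Ab small))
    {M. is_additive (opposite R) (Ab small) M}"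


section \<open>FI-modules\<close>

text \<open>
  Finite sets are finite sets of natural numbers. The disjoint union of \<open>S\<close> with the \<open>a\<close>-element set
  \<open>{..<a}\<close> is realised as \<open>{..<a} \<union> (\<lambda>x. x + a) ` S\<close>; with this choice the shift by \<open>a\<close> is
  the \<open>a\<close>-fold iterate of the shift by \<open>1\<close> on the nose.
\<close>

type_synonym FI_arr = "(nat set, nat \<Rightarrow> nat) arrow"

definition FI :: "(nat set, FI_arr) category" where
  "FI =
    \<lparr>Obj = {S. finite S},
     Arr = {f. finite (Src f) \<and> finite (Trg f) \<and> Map f \<in> Src f \<rightarrow>\<^sub>E Trg f \<and> inj_on (Map f) (Src f)},
     Dom = Src, Cod = Trg,
     Ident = (\<lambda>S. \<lparr>Src = S, Trg = S, Map = (\<lambda>x \<in> S. x)\<rparr>),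
     Comp = (\<lambda>g f. \<lparr>Src = Src f, Trg = Trg g, Map = compose (Src f) (Map g) (Map f)\<rparr>)\<rparr>"

definition disj_add :: "nat \<Rightarrow> nat set \<Rightarrow> nat set" where
  "disj_add a S = {..<a} \<union> (\<lambda>x. x + a) ` S"

definition FI_add :: "nat \<Rightarrow> (nat set, FI_arr, nat set, FI_arr) cfunctor" where
  "FI_add a =
    \<lparr>FObj = (\<lambda>S \<in> Obj FI. disj_add a S),
     FArr = (\<lambda>f \<in> Arr FI. \<lparr>Src = disj_add a (Src f), Trg = disj_add a (Trg f),
       Map = (\<lambda>x \<in> disj_add a (Src f). if x < a then x else Map f (x - a) + a)\<rparr>)\<rparr>"

type_synonym ('r, 'm, 'u) FImod_obj =
  "(nat set, FI_arr, ('r, 'm, 'u) module_obj, ('r, 'm, 'u) module_arr) cfunctor"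
type_synonym ('r, 'm, 'u) FImod_arr =
  "(('r, 'm, 'u) FImod_obj, nat set \<Rightarrow> ('r, 'm, 'u) module_arr) arrow"
type_synonym ('r, 'm, 'u) FImod_functor =
  "(('r, 'm, 'u) FImod_obj, ('r, 'm, 'u) FImod_arr,
    ('r, 'm, 'u) FImod_obj, ('r, 'm, 'u) FImod_arr) cfunctor"
type_synonym ('r, 'm, 'u) FImod_nat_trans =
  "(('r, 'm, 'u) FImod_functor, ('r, 'm, 'u) FImod_obj \<Rightarrow> ('r, 'm, 'u) FImod_arr) arrow"
type_synonym ('r, 'm, 'u) module_functor =
  "(('r, 'm, 'u) module_obj, ('r, 'm, 'u) module_arr,
    ('r, 'm, 'u) module_obj, ('r, 'm, 'u) module_arr) cfunctor"
type_synonym ('r, 'm, 'u) module_nat_trans =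
  "(('r, 'm, 'u) module_functor, ('r, 'm, 'u) module_obj \<Rightarrow> ('r, 'm, 'u) module_arr) arrow"

definition FIMod :: "('u set \<Rightarrow> bool) \<Rightarrow> ('r, 'm) preadditive \<Rightarrow>
    (('r, 'm, 'u) FImod_obj, ('r, 'm, 'u) FImod_arr) category" where
  "FIMod small R = functor_category FI (Mod small R)"

definition shift :: "('u set \<Rightarrow> bool) \<Rightarrow> ('r, 'm) preadditive \<Rightarrow> nat \<Rightarrow>
    ('r, 'm, 'u) FImod_functor" where
  "shift small R a = precomp_functor FI FI (Mod small R) (FI_add a)"

definition torsion_hat :: "('u set \<Rightarrow> bool) \<Rightarrow> ('r, 'm) preadditive \<Rightarrow>
    ('r, 'm, 'u) module_obj set \<Rightarrow> ('r, 'm, 'u) FImod_obj set" where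
  "torsion_hat small R \<T> = {V \<in> Obj (FIMod small R). \<exists>N. \<forall>n\<ge>N. FObj V {1..n} \<in> \<T>}"

definition FI_envelope :: "('u set \<Rightarrow> bool) \<Rightarrow> ('r, 'm) preadditive \<Rightarrow>
    ('r, 'm, 'u) module_functor \<Rightarrow> ('r, 'm, 'u) FImod_functor" where
  "FI_envelope small R E = postcomp_functor FI (Mod small R) E"

definition i_map :: "('r, 'm, 'u) module_functor \<Rightarrow> ('r, 'm, 'u) module_nat_trans \<Rightarrow>
    ('r, 'm, 'u) FImod_obj \<Rightarrow> ('r, 'm, 'u) FImod_arr" where
  "i_map E e V = \<lparr>Src = V, Trg = functor_comp FI E V, Map = (\<lambda>S \<in> Obj FI. Map e (FObj V S))\<rparr>"

text \<open>The unit of the composite adjunction between the \<open>k\<close>-fold iterates of \<open>shift small R 1\<close> and \<open>T\<close>.\<close>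

primrec unit_pow :: "('u set \<Rightarrow> bool) \<Rightarrow> ('r, 'm) preadditive \<Rightarrow>
    ('r, 'm, 'u) FImod_functor \<Rightarrow> ('r, 'm, 'u) FImod_nat_trans \<Rightarrow> nat \<Rightarrow>
    ('r, 'm, 'u) FImod_obj \<Rightarrow> ('r, 'm, 'u) FImod_arr" where
  "unit_pow small R T \<eta> 0 W = Ident (FIMod small R) W"
| "unit_pow small R T \<eta> (Suc k) W = Comp (FIMod small R)
    (FArr (functor_pow (FIMod small R) T k) (Map \<eta> (FObj (shift small R k) W)))
    (unit_pow small R T \<eta> k W)"

definition L_functor :: "('u set \<Rightarrow> bool) \<Rightarrow> ('r, 'm) preadditive \<Rightarrow>
    ('r, 'm, 'u) module_functor \<Rightarrow> ('r, 'm, 'u) FImod_functor \<Rightarrow> nat \<Rightarrow>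
    ('r, 'm, 'u) FImod_functor" where
  "L_functor small R E T k = functor_comp (FIMod small R) (functor_pow (FIMod small R) T k)
    (functor_comp (FIMod small R) (shift small R k) (FI_envelope small R E))"

definition l_map :: "('u set \<Rightarrow> bool) \<Rightarrow> ('r, 'm) preadditive \<Rightarrow>
    ('r, 'm, 'u) module_functor \<Rightarrow> ('r, 'm, 'u) module_nat_trans \<Rightarrow>
    ('r, 'm, 'u) FImod_functor \<Rightarrow> ('r, 'm, 'u) FImod_nat_trans \<Rightarrow> nat \<Rightarrow>
    ('r, 'm, 'u) FImod_obj \<Rightarrow> ('r, 'm, 'u) FImod_arr" where
  "l_map small R E e T \<eta> k V = Comp (FIMod small R)
    (unit_pow small R T \<eta> k (FObj (FI_envelope small R E) V)) (i_map E e V)"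

definition c_map :: "('u set \<Rightarrow> bool) \<Rightarrow> ('r, 'm) preadditive \<Rightarrow>
    ('r, 'm, 'u) module_functor \<Rightarrow> ('r, 'm, 'u) FImod_functor \<Rightarrow>
    ('r, 'm, 'u) FImod_nat_trans \<Rightarrow> nat \<Rightarrow> ('r, 'm, 'u) FImod_obj \<Rightarrow> ('r, 'm, 'u) FImod_arr" where
  "c_map small R E T \<eta> k V = FArr (functor_pow (FIMod small R) T k)
    (Map \<eta> (FObj (shift small R k) (FObj (FI_envelope small R E) V)))"

end

(*
An FI-module L is closed for the hat class as soon as every value L(S) is T-closed and L extends
canonically from large sets: for each N, elements of L(S) correspond to the compatible families
(y_phi in L(X)), phi : S -> X injective with |X| >= N. Indeed a morphism A -> L extends along a
hat-isomorphism A -> B first on large sets, by closedness of the values of L, and then everywhere.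

Write W for E_tau(V) and Z_k for T^k S^k W. By the universal property of the adjunction of S^k and
T^k, an element of Z_k(S) is the same as a family of elements v_theta of W(X + [k]), indexed by the
injections theta : S -> X + [k] and natural in X. As W has T-closed values, so has Z_k. Gabriel's
criterion says that M is T-closed iff every homomorphism to M from a dense right ideal extends
uniquely to the representable module; since Mod-R is locally noetherian, dense right ideals are
finitely generated, and therefore the sequential colimit L of the Z_k has closed values too. A
compatible family over |X| >= N glues to an element of L(S): a value at S + [N] determines elements
of W(X + [k]) for k large, and compatibility makes them a natural family.
*)

theory Submission
  imports Defs "HOL-Library.Nat_Bijection" "HOL-Algebra.Product_Groups"
begin

text \<open>Modules are functors whose carriers are small subsets of one type \<open>'u\<close>.
  Smallness is closed under small unions but in general not under infinite products, so the natural
  families v_theta have no ready place in \<open>'u\<close>. They are coded: every theta : S -> X +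
  [k] arises from some theta' : S -> Y + [k] with Y a subset of S, so finitely many members
  determine a family.

  Two finiteness effects drive the colimit. An injection S -> X + [k] extends along any S -> S' once
  k >= |S'|, so pushing forward is injective at late stages and hence in L. Two injections of P into
  a large set factor through a common set with 2|P| points, so the independence needed for gluing
  amounts to finitely many equalities, which hold from some stage on.

  Lifting a homomorphism on a dense ideal to one stage of the colimit needs more than generators:
  the relations among them must hold there too. Generators are adjoined one at a time, and the
  relations of a new one over the earlier ones form a right ideal, which is finitely generated
  again.\<close>

no_notation FactGroup (infixl \<open>Mod\<close> 65)

section \<open>Categories\<close>

lemma HomI: "f \<in> Arr C \<Longrightarrow> Dom C f = X \<Longrightarrow> Cod C f = Y \<Longrightarrow> f \<in> Hom C X Y"
  by (simp add: Hom_def)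

lemma HomD: "f \<in> Hom C X Y \<Longrightarrow> f \<in> Arr C" "f \<in> Hom C X Y \<Longrightarrow> Dom C f = X" "f \<in> Hom C X Y \<Longrightarrow> Cod C f = Y"
  by (simp_all add: Hom_def)

lemma Arr_Hom: "f \<in> Arr C \<Longrightarrow> f \<in> Hom C (Dom C f) (Cod C f)"
  by (simp add: Hom_def)

lemma (in category) Hom_Obj: "f \<in> Hom C X Y \<Longrightarrow> X \<in> Obj C" "f \<in> Hom C X Y \<Longrightarrow> Y \<in> Obj C"
  using Dom_Obj Cod_Obj by (auto simp: Hom_def)

lemma functor_FObj: "is_functor C D F \<Longrightarrow> X \<in> Obj C \<Longrightarrow> FObj F X \<in> Obj D"
  by (auto simp: is_functor_def)

lemma functor_FArr: "is_functor C D F \<Longrightarrow> f \<in> Hom C X Y \<Longrightarrow> FArr F f \<in> Hom D (FObj F X) (FObj F Y)"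
  by (auto simp: is_functor_def Hom_def)

lemma functor_Ident: "is_functor C D F \<Longrightarrow> X \<in> Obj C \<Longrightarrow> FArr F (Ident C X) = Ident D (FObj F X)"
  by (auto simp: is_functor_def)

lemma functor_Comp:
  "is_functor C D F \<Longrightarrow> f \<in> Hom C X Y \<Longrightarrow> g \<in> Hom C Y Z \<Longrightarrow>
    FArr F (Comp C g f) = Comp D (FArr F g) (FArr F f)"
  by (auto simp: is_functor_def Hom_def)

lemma functor_eqI:
  assumes "is_functor C D F" "is_functor C D' G"
    and "\<And>X. X \<in> Obj C \<Longrightarrow> FObj F X = FObj G X" "\<And>f. f \<in> Arr C \<Longrightarrow> FArr F f = FArr G f"
  shows "F = G"
proof -
  have "FObj F = FObj G" "FArr F = FArr G"
    using assms by (auto simp: is_functor_def PiE_iff intro!: extensionalityI)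
  then show ?thesis by simp
qed

definition mk_functor :: "('o1, 'a1, 'z) category_scheme \<Rightarrow> ('o1 \<Rightarrow> 'o2) \<Rightarrow> ('a1 \<Rightarrow> 'a2) \<Rightarrow>
    ('o1, 'a1, 'o2, 'a2) cfunctor" where
  "mk_functor C F0 F1 = \<lparr>FObj = restrict F0 (Obj C), FArr = restrict F1 (Arr C)\<rparr>"

lemma mk_functor_simps [simp]:
  "X \<in> Obj C \<Longrightarrow> FObj (mk_functor C F0 F1) X = F0 X"
  "f \<in> Arr C \<Longrightarrow> FArr (mk_functor C F0 F1) f = F1 f"
  "f \<in> Hom C X Y \<Longrightarrow> FArr (mk_functor C F0 F1) f = F1 f"
  by (auto simp: mk_functor_def Hom_def)

lemma (in category) is_functor_mk_functor:
  assumes "\<And>X. X \<in> Obj C \<Longrightarrow> F0 X \<in> Obj D"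
    and arr: "\<And>f X Y. f \<in> Hom C X Y \<Longrightarrow> F1 f \<in> Hom D (F0 X) (F0 Y)"
    and "\<And>X. X \<in> Obj C \<Longrightarrow> F1 (Ident C X) = Ident D (F0 X)"
    and comp: "\<And>f g X Y Z. f \<in> Hom C X Y \<Longrightarrow> g \<in> Hom C Y Z \<Longrightarrow> F1 (Comp C g f) = Comp D (F1 g) (F1 f)"
  shows "is_functor C D (mk_functor C F0 F1)"
proof -
  have "F1 f \<in> Arr D" "Dom D (F1 f) = F0 (Dom C f)" "Cod D (F1 f) = F0 (Cod C f)" if "f \<in> Arr C" for f
    using arr[OF Arr_Hom[OF that]] by (auto simp: Hom_def)
  moreover have "F1 (Comp C g f) = Comp D (F1 g) (F1 f)" "Comp C g f \<in> Arr C"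
    if "f \<in> Arr C" "g \<in> Arr C" "Cod C f = Dom C g" for f g
    using that Arr_Hom[OF that(1)] Arr_Hom[OF that(2)] comp Comp_Hom HomD(1) by metis+
  moreover have "Ident C X \<in> Arr C" if "X \<in> Obj C" for X
    using Ident_Hom[OF that] by (simp add: Hom_def)
  ultimately show ?thesis
    using assms(1,3) Dom_Obj Cod_Obj unfolding is_functor_def mk_functor_def by auto
qed

lemma (in category) is_functor_id_functor: "is_functor C C (id_functor C)"
proof -
  have "id_functor C = mk_functor C (\<lambda>X. X) (\<lambda>f. f)"
    by (simp add: id_functor_def mk_functor_def)
  then show ?thesis by (simp add: is_functor_mk_functor)
qed

lemma FObj_functor_comp [simp]: "X \<in> Obj C \<Longrightarrow> FObj (functor_comp C G F) X = FObj G (FObj F X)"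
  by (simp add: functor_comp_def)

lemma FArr_functor_comp [simp]:
  "f \<in> Arr C \<Longrightarrow> FArr (functor_comp C G F) f = FArr G (FArr F f)"
  "f \<in> Hom C X Y \<Longrightarrow> FArr (functor_comp C G F) f = FArr G (FArr F f)"
  by (simp_all add: functor_comp_def Hom_def)

lemma id_functor_simps [simp]:
  "X \<in> Obj C \<Longrightarrow> FObj (id_functor C) X = X" "f \<in> Arr C \<Longrightarrow> FArr (id_functor C) f = f"
  "f \<in> Hom C X Y \<Longrightarrow> FArr (id_functor C) f = f"
  by (simp_all add: id_functor_def Hom_def)

lemma (in category) is_functor_functor_comp:
  assumes F: "is_functor C D F" and G: "is_functor D E G"
  shows "is_functor C E (functor_comp C G F)"
proof -
  have "functor_comp C G F = mk_functor C (\<lambda>X. FObj G (FObj F X)) (\<lambda>f. FArr G (FArr F f))"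
    by (simp add: functor_comp_def mk_functor_def)
  moreover have "is_functor C E (mk_functor C (\<lambda>X. FObj G (FObj F X)) (\<lambda>f. FArr G (FArr F f)))"
    using functor_FObj[OF F] functor_FObj[OF G] functor_FArr[OF F] functor_FArr[OF G]
      functor_Ident[OF F] functor_Ident[OF G]
    by (intro is_functor_mk_functor)
      (auto simp: functor_Comp[OF F] functor_Comp[OF G functor_FArr[OF F] functor_FArr[OF F]])
  ultimately show ?thesis by simp
qed

lemma (in category) is_functor_functor_pow:
  "is_functor C C F \<Longrightarrow> is_functor C C (functor_pow C F n)"
  by (induction n) (auto intro: is_functor_id_functor is_functor_functor_comp)

section \<open>Natural transformations and functor categories\<close>

lemma Obj_functor_category [simp]: "F \<in> Obj (functor_category C D) \<longleftrightarrow> is_functor C D F"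
  by (simp add: functor_category_def)

lemma Hom_functor_category:
  "\<alpha> \<in> Hom (functor_category C D) F G \<longleftrightarrow> is_nat_trans C D \<alpha> \<and> Src \<alpha> = F \<and> Trg \<alpha> = G"
  by (simp add: functor_category_def Hom_def)

lemma nat_trans_functor:
  assumes "\<alpha> \<in> Hom (functor_category C D) F G"
  shows "is_functor C D F" "is_functor C D G"
  using assms by (auto simp: Hom_functor_category is_nat_trans_def)

lemma nat_trans_component:
  "\<alpha> \<in> Hom (functor_category C D) F G \<Longrightarrow> X \<in> Obj C \<Longrightarrow> Map \<alpha> X \<in> Hom D (FObj F X) (FObj G X)"
  by (auto simp: Hom_functor_category is_nat_trans_def)

lemma nat_trans_natural:
  "\<alpha> \<in> Hom (functor_category C D) F G \<Longrightarrow> f \<in> Hom C X Y \<Longrightarrow>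
    Comp D (Map \<alpha> Y) (FArr F f) = Comp D (FArr G f) (Map \<alpha> X)"
  using HomD[of f C X Y] by (auto simp: Hom_functor_category is_nat_trans_def)

lemma nat_trans_eqI:
  assumes "\<alpha> \<in> Hom (functor_category C D) F G" "\<beta> \<in> Hom (functor_category C D) F G"
    and "\<And>X. X \<in> Obj C \<Longrightarrow> Map \<alpha> X = Map \<beta> X"
  shows "\<alpha> = \<beta>"
proof -
  have "Map \<alpha> = Map \<beta>"
    using assms by (auto simp: Hom_functor_category is_nat_trans_def PiE_iff intro!: extensionalityI)
  then show ?thesis using assms by (auto simp: Hom_functor_category)
qed

definition mk_nat :: "('o1, 'a1, 'z) category_scheme \<Rightarrow> ('o1, 'a1, 'o2, 'a2) cfunctor \<Rightarrow>
    ('o1, 'a1, 'o2, 'a2) cfunctor \<Rightarrow> ('o1 \<Rightarrow> 'a2) \<Rightarrow>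
    (('o1, 'a1, 'o2, 'a2) cfunctor, 'o1 \<Rightarrow> 'a2) arrow" where
  "mk_nat C F G m = \<lparr>Src = F, Trg = G, Map = restrict m (Obj C)\<rparr>"

lemma Map_mk_nat [simp]: "X \<in> Obj C \<Longrightarrow> Map (mk_nat C F G m) X = m X"
  by (simp add: mk_nat_def)

lemma (in category) mk_nat_Hom:
  assumes "is_functor C D F" "is_functor C D G"
    and "\<And>X. X \<in> Obj C \<Longrightarrow> m X \<in> Hom D (FObj F X) (FObj G X)"
    and nat: "\<And>f X Y. f \<in> Hom C X Y \<Longrightarrow> Comp D (m Y) (FArr F f) = Comp D (FArr G f) (m X)"
  shows "mk_nat C F G m \<in> Hom (functor_category C D) F G"
proof -
  have "Comp D (m (Cod C f)) (FArr F f) = Comp D (FArr G f) (m (Dom C f))" if "f \<in> Arr C" for f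
    using nat[OF Arr_Hom[OF that]] .
  then show ?thesis
    using assms(1-3) Dom_Obj Cod_Obj by (auto simp: Hom_functor_category is_nat_trans_def mk_nat_def)
qed

lemma Ident_functor_category:
  "Ident (functor_category C D) F = mk_nat C F F (\<lambda>X. Ident D (FObj F X))"
  by (simp add: functor_category_def mk_nat_def)

lemma Comp_functor_category:
  assumes "\<alpha> \<in> Hom (functor_category C D) F G" "\<beta> \<in> Hom (functor_category C D) G H"
  shows "Comp (functor_category C D) \<beta> \<alpha> = mk_nat C F H (\<lambda>X. Comp D (Map \<beta> X) (Map \<alpha> X))"
  using assms by (simp add: functor_category_def mk_nat_def Hom_def)

lemma Map_Comp_functor_category [simp]:
  "X \<in> Obj C \<Longrightarrow> Map (Comp (functor_category C D) \<beta> \<alpha>) X = Comp D (Map \<beta> X) (Map \<alpha> X)"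
  by (simp add: functor_category_def)

lemma Map_Ident_functor_category [simp]:
  "X \<in> Obj C \<Longrightarrow> Map (Ident (functor_category C D) F) X = Ident D (FObj F X)"
  by (simp add: functor_category_def)

lemma category_functor_category:
  assumes "category C" "category D"
  shows "category (functor_category C D)"
proof -
  interpret C: category C by fact
  interpret D: category D by fact
  let ?F = "functor_category C D"
  have id: "Ident ?F F \<in> Hom ?F F F" if "is_functor C D F" for F
    unfolding Ident_functor_category
    using that functor_FObj[OF that]
    by (intro C.mk_nat_Hom)
      (auto simp: D.Ident_Hom D.Comp_Ident_left[OF functor_FArr[OF that]] D.Comp_Ident_right[OF functor_FArr[OF that]])
  have comp: "Comp ?F \<beta> \<alpha> \<in> Hom ?F F H"
    if a: "\<alpha> \<in> Hom ?F F G" and b: "\<beta> \<in> Hom ?F G H" for F G H \<alpha> \<beta>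
    unfolding Comp_functor_category[OF a b]
  proof (intro C.mk_nat_Hom)
    show "is_functor C D F" "is_functor C D H" using a b by (auto dest: nat_trans_functor)
    show "Comp D (Map \<beta> X) (Map \<alpha> X) \<in> Hom D (FObj F X) (FObj H X)" if "X \<in> Obj C" for X
      using nat_trans_component[OF a that] nat_trans_component[OF b that] by (rule D.Comp_Hom)
    fix f X Y assume f: "f \<in> Hom C X Y"
    have X: "X \<in> Obj C" and Y: "Y \<in> Obj C" using C.Hom_Obj[OF f] .
    note F = functor_FArr[OF nat_trans_functor(1)[OF a] f]
    note G = functor_FArr[OF nat_trans_functor(2)[OF a] f]
    note H = functor_FArr[OF nat_trans_functor(2)[OF b] f]
    note aX = nat_trans_component[OF a X] note aY = nat_trans_component[OF a Y]
    note bX = nat_trans_component[OF b X] note bY = nat_trans_component[OF b Y]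
    show "Comp D (Comp D (Map \<beta> Y) (Map \<alpha> Y)) (FArr F f) = Comp D (FArr H f) (Comp D (Map \<beta> X) (Map \<alpha> X))"
      using D.Comp_assoc[OF F aY bY] D.Comp_assoc[OF aX G bY] D.Comp_assoc[OF aX bX H]
        nat_trans_natural[OF a f] nat_trans_natural[OF b f] by simp
  qed
  show ?thesis
  proof
    show "Dom ?F f \<in> Obj ?F" if "f \<in> Arr ?F" for f
      using nat_trans_functor(1)[OF Arr_Hom[OF that]] by simp
    show "Cod ?F f \<in> Obj ?F" if "f \<in> Arr ?F" for f
      using nat_trans_functor(2)[OF Arr_Hom[OF that]] by simp
    show "Ident ?F X \<in> Hom ?F X X" if "X \<in> Obj ?F" for X using id that by simp
    show "Comp ?F g f \<in> Hom ?F X Z" if "f \<in> Hom ?F X Y" "g \<in> Hom ?F Y Z" for f g X Y Z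
      using comp that by blast
    show "Comp ?F h (Comp ?F g f) = Comp ?F (Comp ?F h g) f"
      if f: "f \<in> Hom ?F W X" and g: "g \<in> Hom ?F X Y" and h: "h \<in> Hom ?F Y Z" for f g h W X Y Z
      by (rule nat_trans_eqI[OF comp[OF comp[OF f g] h] comp[OF f comp[OF g h]]])
        (simp add: D.Comp_assoc[OF nat_trans_component[OF f] nat_trans_component[OF g] nat_trans_component[OF h]])
    show "Comp ?F f (Ident ?F X) = f" if f: "f \<in> Hom ?F X Y" for f X Y
      by (rule nat_trans_eqI[OF comp[OF id[OF nat_trans_functor(1)[OF f]] f] f])
        (simp add: D.Comp_Ident_right[OF nat_trans_component[OF f]])
    show "Comp ?F (Ident ?F Y) f = f" if f: "f \<in> Hom ?F X Y" for f X Y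
      by (rule nat_trans_eqI[OF comp[OF f id[OF nat_trans_functor(2)[OF f]]] f])
        (simp add: D.Comp_Ident_left[OF nat_trans_component[OF f]])
  qed
qed

section \<open>Full subcategories and opposite categories\<close>

lemma Obj_full_subcategory [simp]: "X \<in> Obj (full_subcategory C P) \<longleftrightarrow> X \<in> Obj C \<and> X \<in> P"
  by (simp add: full_subcategory_def)

lemma Hom_full_subcategory:
  "f \<in> Hom (full_subcategory C P) X Y \<longleftrightarrow> f \<in> Hom C X Y \<and> X \<in> P \<and> Y \<in> P"
  by (auto simp: full_subcategory_def Hom_def)

lemma full_subcategory_simps [simp]:
  "Ident (full_subcategory C P) = Ident C" "Comp (full_subcategory C P) = Comp C"
  "Dom (full_subcategory C P) = Dom C" "Cod (full_subcategory C P) = Cod C"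
  by (simp_all add: full_subcategory_def)

lemma (in category) category_full_subcategory: "category (full_subcategory C P)"
proof
  show "Dom (full_subcategory C P) f \<in> Obj (full_subcategory C P)"
    "Cod (full_subcategory C P) f \<in> Obj (full_subcategory C P)"
    if "f \<in> Arr (full_subcategory C P)" for f
    using that Dom_Obj Cod_Obj by (auto simp: full_subcategory_def)
qed (auto simp: Hom_full_subcategory intro: Ident_Hom Comp_Hom Comp_assoc Comp_Ident_left Comp_Ident_right)

lemma opposite_simps [simp]:
  "Obj (opposite C) = Obj C" "Arr (opposite C) = Arr C" "Dom (opposite C) = Cod C" "Cod (opposite C) = Dom C"
  "Ident (opposite C) = Ident C" "Comp (opposite C) = (\<lambda>g f. Comp C f g)" "Add (opposite C) = Add C"
  by (simp_all add: opposite_def)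

lemma Hom_opposite [simp]: "Hom (opposite C) X Y = Hom C Y X"
  by (auto simp: Hom_def)

lemma category_opposite:
  assumes "category C"
  shows "category (opposite C)"
proof -
  interpret category C by fact
  show ?thesis
  proof
    show "Comp (opposite C) h (Comp (opposite C) g f) = Comp (opposite C) (Comp (opposite C) h g) f"
      if "f \<in> Hom (opposite C) W X" "g \<in> Hom (opposite C) X Y" "h \<in> Hom (opposite C) Y Z" for f g h W X Y Z
      using that Comp_assoc[of h Z Y g X f W] by simp
  qed (auto intro: Dom_Obj Cod_Obj Ident_Hom Comp_Hom Comp_Ident_left Comp_Ident_right)
qed

section \<open>Modules in terms of elements\<close>

text \<open>A right \<open>R\<close>-module with carriers in any type \<open>'x\<close> and without
  size restriction. Coherent sequences, natural families and arrows of \<open>R\<close> live outside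
  \<open>'u\<close>; constructions with them are first carried out as a \<open>rep\<close> and then
  coded into \<open>'u\<close>.\<close>

locale rep =
  fixes R :: "('r, 'm) preadditive" and G :: "'r \<Rightarrow> 'x monoid" and \<rho> :: "'m \<Rightarrow> 'x \<Rightarrow> 'x"
  assumes comm_group: "r \<in> Obj R \<Longrightarrow> comm_group (G r)"
    and hom: "a \<in> Hom R t r \<Longrightarrow> \<rho> a \<in> hom (G r) (G t)"
    and ident: "r \<in> Obj R \<Longrightarrow> x \<in> carrier (G r) \<Longrightarrow> \<rho> (Ident R r) x = x"
    and comp: "a \<in> Hom R t r \<Longrightarrow> b \<in> Hom R s t \<Longrightarrow> x \<in> carrier (G r) \<Longrightarrow>
      \<rho> (Comp R a b) x = \<rho> b (\<rho> a x)"
    and add: "a \<in> Hom R t r \<Longrightarrow> a' \<in> Hom R t r \<Longrightarrow> x \<in> carrier (G r) \<Longrightarrow>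
      \<rho> (Add R a a') x = \<rho> a x \<otimes>\<^bsub>G t\<^esub> \<rho> a' x"

lemma hom_invI:
  "h \<in> hom G H \<Longrightarrow> comm_group G \<Longrightarrow> comm_group H \<Longrightarrow> x \<in> carrier G \<Longrightarrow> h (inv\<^bsub>G\<^esub> x) = inv\<^bsub>H\<^esub> h x"
  by (auto intro!: group_hom.hom_inv simp: group_hom_def group_hom_axioms_def comm_group.axioms)

lemma hom_oneI: "h \<in> hom G H \<Longrightarrow> comm_group G \<Longrightarrow> comm_group H \<Longrightarrow> h \<one>\<^bsub>G\<^esub> = \<one>\<^bsub>H\<^esub>"
  by (auto intro!: hom_one comm_group.axioms)

lemma comm_group_closed:
  assumes "comm_group G"
  shows "\<one>\<^bsub>G\<^esub> \<in> carrier G" "x \<in> carrier G \<Longrightarrow> y \<in> carrier G \<Longrightarrow> x \<otimes>\<^bsub>G\<^esub> y \<in> carrier G"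
    "x \<in> carrier G \<Longrightarrow> inv\<^bsub>G\<^esub> x \<in> carrier G"
proof -
  interpret comm_group G by fact
  show "\<one>\<^bsub>G\<^esub> \<in> carrier G" "x \<in> carrier G \<Longrightarrow> y \<in> carrier G \<Longrightarrow> x \<otimes>\<^bsub>G\<^esub> y \<in> carrier G"
    "x \<in> carrier G \<Longrightarrow> inv\<^bsub>G\<^esub> x \<in> carrier G" by auto
qed

lemma comm_group_eq_iff:
  assumes "comm_group G" "x \<in> carrier G" "y \<in> carrier G"
  shows "x \<otimes>\<^bsub>G\<^esub> inv\<^bsub>G\<^esub> y = \<one>\<^bsub>G\<^esub> \<longleftrightarrow> x = y"
proof -
  interpret comm_group G by fact
  show ?thesis using assms(2,3) r_inv inv_equality[of x "inv\<^bsub>G\<^esub> y"] inv_inv by fastforce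
qed

lemma comm_group_cancel:
  assumes "comm_group G" "x \<in> carrier G" "y \<in> carrier G"
  shows "(x \<otimes>\<^bsub>G\<^esub> inv\<^bsub>G\<^esub> y) \<otimes>\<^bsub>G\<^esub> y = x" "y \<otimes>\<^bsub>G\<^esub> (x \<otimes>\<^bsub>G\<^esub> inv\<^bsub>G\<^esub> y) = x"
    "(x \<otimes>\<^bsub>G\<^esub> y) \<otimes>\<^bsub>G\<^esub> inv\<^bsub>G\<^esub> y = x" "(y \<otimes>\<^bsub>G\<^esub> x) \<otimes>\<^bsub>G\<^esub> inv\<^bsub>G\<^esub> y = x"
proof -
  interpret comm_group G by fact
  show "(x \<otimes>\<^bsub>G\<^esub> inv\<^bsub>G\<^esub> y) \<otimes>\<^bsub>G\<^esub> y = x" "y \<otimes>\<^bsub>G\<^esub> (x \<otimes>\<^bsub>G\<^esub> inv\<^bsub>G\<^esub> y) = x"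
    "(x \<otimes>\<^bsub>G\<^esub> y) \<otimes>\<^bsub>G\<^esub> inv\<^bsub>G\<^esub> y = x" "(y \<otimes>\<^bsub>G\<^esub> x) \<otimes>\<^bsub>G\<^esub> inv\<^bsub>G\<^esub> y = x"
    using assms(2,3) by (simp_all add: m_assoc m_lcomm m_comm)
qed

context rep begin

lemma closed: "a \<in> Hom R t r \<Longrightarrow> x \<in> carrier (G r) \<Longrightarrow> \<rho> a x \<in> carrier (G t)"
  by (rule hom_in_carrier[OF hom])

lemma mult: "a \<in> Hom R t r \<Longrightarrow> x \<in> carrier (G r) \<Longrightarrow> y \<in> carrier (G r) \<Longrightarrow>
    \<rho> a (x \<otimes>\<^bsub>G r\<^esub> y) = \<rho> a x \<otimes>\<^bsub>G t\<^esub> \<rho> a y"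
  by (rule hom_mult[OF hom])

end

section \<open>Modules, their homomorphisms and their actions, fibre by fibre\<close>

locale module_category = universe small + preadditive_category R
  for small :: "'u set \<Rightarrow> bool" and R :: "('r, 'm) preadditive" +
  assumes small_R: "small_category small R"

text \<open>A separate name keeps the value of a module at an object of \<open>R\<close> apart from
  the value of an FI-module at a finite set; both are \<open>FObj\<close> underneath.\<close>

definition fib :: "('r, 'm, 'u) module_obj \<Rightarrow> 'r \<Rightarrow> 'u monoid" where "fib M r = FObj M r"
abbreviation el :: "('r, 'm, 'u) module_obj \<Rightarrow> 'r \<Rightarrow> 'u set" where "el M r \<equiv> carrier (fib M r)"
abbreviation neut :: "('r, 'm, 'u) module_obj \<Rightarrow> 'r \<Rightarrow> 'u" where "neut M r \<equiv> \<one>\<^bsub>fib M r\<^esub>"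
abbreviation fib_mult :: "'u \<Rightarrow> ('r, 'm, 'u) module_obj \<Rightarrow> 'r \<Rightarrow> 'u \<Rightarrow> 'u" (\<open>(_ \<cdot>[_,_]/ _)\<close> [70, 0, 0, 71] 70) where
  "x \<cdot>[M,r] y \<equiv> x \<otimes>\<^bsub>fib M r\<^esub> y"
definition act :: "('r, 'm, 'u) module_obj \<Rightarrow> 'm \<Rightarrow> 'u \<Rightarrow> 'u" where "act M a = Map (FArr M a)"
definition app :: "('r, 'm, 'u) module_arr \<Rightarrow> 'r \<Rightarrow> 'u \<Rightarrow> 'u" where "app f r = Map (Map f r)"

lemma Obj_Ab: "A \<in> Obj (Ab small) \<longleftrightarrow> comm_group A \<and> small (carrier A)"
  by (simp add: Ab_def)

lemma Hom_Ab: "f \<in> Hom (Ab small) A B \<longleftrightarrow> A \<in> Obj (Ab small) \<and> B \<in> Obj (Ab small) \<and>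
    Src f = A \<and> Trg f = B \<and> Map f \<in> hom A B \<and> Map f \<in> extensional (carrier A)"
  by (auto simp: Hom_def Ab_def)

lemma Comp_Ab [simp]:
  "Comp (Ab small) g f = \<lparr>Src = Src f, Trg = Trg g, Map = compose (carrier (Src f)) (Map g) (Map f)\<rparr>"
  by (simp add: Ab_def)

lemma Ident_Ab [simp]: "Ident (Ab small) A = \<lparr>Src = A, Trg = A, Map = (\<lambda>x \<in> carrier A. x)\<rparr>"
  by (simp add: Ab_def)

lemma category_Ab: "category (Ab small)"
proof
  show "Dom (Ab small) f \<in> Obj (Ab small)" "Cod (Ab small) f \<in> Obj (Ab small)" if "f \<in> Arr (Ab small)" for f
    using that by (auto simp: Ab_def)
  show "Ident (Ab small) X \<in> Hom (Ab small) X X" if "X \<in> Obj (Ab small)" for X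
    using that by (auto simp: Hom_Ab hom_def Obj_Ab intro: comm_group_closed)
  show "Comp (Ab small) g f \<in> Hom (Ab small) X Z"
    if "f \<in> Hom (Ab small) X Y" "g \<in> Hom (Ab small) Y Z" for f g X Y Z
    using that by (auto simp: Hom_Ab hom_def compose_def Pi_iff Obj_Ab comm_group_closed)
  show "Comp (Ab small) h (Comp (Ab small) g f) = Comp (Ab small) (Comp (Ab small) h g) f"
    if "f \<in> Hom (Ab small) W X" "g \<in> Hom (Ab small) X Y" "h \<in> Hom (Ab small) Y Z" for f g h W X Y Z
    using that by (auto simp: Hom_Ab hom_def compose_def Pi_iff fun_eq_iff)
  show "Comp (Ab small) f (Ident (Ab small) X) = f" if "f \<in> Hom (Ab small) X Y" for f X Y
    using that by (auto simp: Hom_Ab compose_def fun_eq_iff extensional_def intro!: arrow.equality)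
  show "Comp (Ab small) (Ident (Ab small) Y) f = f" if "f \<in> Hom (Ab small) X Y" for f X Y
    using that by (auto simp: Hom_Ab compose_def fun_eq_iff extensional_def hom_def Pi_iff intro!: arrow.equality)
qed

context module_category begin

abbreviation "Md \<equiv> Mod small R"

lemma category_module_functors: "category (functor_category (opposite R) (Ab small))"
  using category_functor_category[OF category_opposite[OF category_axioms] category_Ab] .

sublocale Md: category Md
  unfolding Mod_def by (rule category.category_full_subcategory[OF category_module_functors])

sublocale op: category "opposite R"
  by (rule category_opposite[OF category_axioms])

lemma Obj_Mod: "M \<in> Obj Md \<longleftrightarrow> is_functor (opposite R) (Ab small) M \<and> is_additive (opposite R) (Ab small) M"
  by (simp add: Mod_def)

lemma Hom_Mod: "f \<in> Hom Md M N \<longleftrightarrow> M \<in> Obj Md \<and> N \<in> Obj Md \<and>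
    f \<in> Hom (functor_category (opposite R) (Ab small)) M N"
  by (auto simp: Mod_def Hom_full_subcategory nat_trans_functor)

lemma fib_comm_group: "M \<in> Obj Md \<Longrightarrow> r \<in> Obj R \<Longrightarrow> comm_group (fib M r)"
  and fib_small: "M \<in> Obj Md \<Longrightarrow> r \<in> Obj R \<Longrightarrow> small (el M r)"
  using functor_FObj[of "opposite R" "Ab small" M r] by (auto simp: Obj_Mod fib_def Obj_Ab)

lemma module_rep: 
  assumes M: "M \<in> Obj Md"
  shows "rep R (fib M) (act M)"
proof (rule rep.intro)
  have F: "is_functor (opposite R) (Ab small) M" and A: "is_additive (opposite R) (Ab small) M"
    using M by (auto simp: Obj_Mod)
  have arr: "FArr M a \<in> Hom (Ab small) (fib M r) (fib M t)" if "a \<in> Hom R t r" for a t r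
    using functor_FArr[OF F, of a r t] that by (simp add: fib_def)
  show "comm_group (fib M r)" if "r \<in> Obj R" for r using M that by (rule fib_comm_group)
  show "act M a \<in> hom (fib M r) (fib M t)" if "a \<in> Hom R t r" for a t r
    using arr[OF that] by (simp add: Hom_Ab act_def)
  show "act M (Ident R r) x = x" if "r \<in> Obj R" "x \<in> el M r" for r x
    using functor_Ident[OF F, of r] that by (simp add: act_def fib_def)
  show "act M (Comp R a b) x = act M b (act M a x)"
    if "a \<in> Hom R t r" "b \<in> Hom R s t" "x \<in> el M r" for a b t r s x
    using functor_Comp[OF F, of a r t b s] that arr[OF that(1)] by (auto simp: act_def compose_def Hom_Ab)
  show "act M (Add R a a') x = act M a x \<cdot>[M,t] act M a' x"
    if a: "a \<in> Hom R t r" "a' \<in> Hom R t r" and "x \<in> el M r" for a a' t r x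
  proof -
    have "FArr M (Add R a a') = Add (Ab small) (FArr M a) (FArr M a')"
      using A a Hom_Obj[OF a(1)] by (auto simp: is_additive_def)
    then show ?thesis using arr[OF a(1)] that(3) by (auto simp: act_def Ab_def Hom_def)
  qed
qed

lemmas act_closed = rep.closed[OF module_rep]
  and act_hom = rep.hom[OF module_rep]
  and act_mult = rep.mult[OF module_rep]
  and act_Ident = rep.ident[OF module_rep]
  and act_Comp = rep.comp[OF module_rep]
  and act_Add = rep.add[OF module_rep]

lemma app_hom: "f \<in> Hom Md M N \<Longrightarrow> r \<in> Obj R \<Longrightarrow> app f r \<in> hom (fib M r) (fib N r)"
  using nat_trans_component[of f "opposite R" "Ab small" M N r] by (simp add: Hom_Mod app_def fib_def Hom_Ab)

lemma app_closed: "f \<in> Hom Md M N \<Longrightarrow> r \<in> Obj R \<Longrightarrow> x \<in> el M r \<Longrightarrow> app f r x \<in> el N r"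
  by (rule hom_in_carrier[OF app_hom])

lemma app_mult: "f \<in> Hom Md M N \<Longrightarrow> r \<in> Obj R \<Longrightarrow> x \<in> el M r \<Longrightarrow> y \<in> el M r \<Longrightarrow>
    app f r (x \<cdot>[M,r] y) = app f r x \<cdot>[N,r] app f r y"
  by (rule hom_mult[OF app_hom])

lemma Hom_Mod_Obj: "f \<in> Hom Md M N \<Longrightarrow> M \<in> Obj Md" "f \<in> Hom Md M N \<Longrightarrow> N \<in> Obj Md"
  by (simp_all add: Hom_Mod)

lemma app_one: "f \<in> Hom Md M N \<Longrightarrow> r \<in> Obj R \<Longrightarrow> app f r (neut M r) = neut N r"
  by (rule hom_oneI) (auto intro: app_hom fib_comm_group Hom_Mod_Obj)

lemma app_inv: "f \<in> Hom Md M N \<Longrightarrow> r \<in> Obj R \<Longrightarrow> x \<in> el M r \<Longrightarrow>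
    app f r (inv\<^bsub>fib M r\<^esub> x) = inv\<^bsub>fib N r\<^esub> app f r x"
  by (rule hom_invI) (auto intro: app_hom fib_comm_group Hom_Mod_Obj)

lemma act_one: "M \<in> Obj Md \<Longrightarrow> a \<in> Hom R t r \<Longrightarrow> act M a (neut M r) = neut M t"
  by (rule hom_oneI) (auto intro: act_hom fib_comm_group Hom_Obj)

lemma act_inv: "M \<in> Obj Md \<Longrightarrow> a \<in> Hom R t r \<Longrightarrow> x \<in> el M r \<Longrightarrow>
    act M a (inv\<^bsub>fib M r\<^esub> x) = inv\<^bsub>fib M t\<^esub> act M a x"
  by (rule hom_invI) (auto intro: act_hom fib_comm_group Hom_Obj)

lemma app_act:
  assumes "f \<in> Hom Md M N" "a \<in> Hom R t r" "x \<in> el M r"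
  shows "app f t (act M a x) = act N a (app f r x)"
proof -
  have f: "f \<in> Hom (functor_category (opposite R) (Ab small)) M N" using assms(1) by (simp add: Hom_Mod)
  have "Comp (Ab small) (Map f t) (FArr M a) = Comp (Ab small) (FArr N a) (Map f r)"
    using nat_trans_natural[OF f, unfolded Hom_opposite, OF assms(2)] .
  moreover have "FArr M a \<in> Hom (Ab small) (fib M r) (fib M t)"
    using functor_FArr[OF nat_trans_functor(1)[OF f], of a r t] assms(2) by (simp add: fib_def)
  moreover have "Map f r \<in> Hom (Ab small) (fib M r) (fib N r)"
    using nat_trans_component[OF f, of r] Hom_Obj[OF assms(2)] by (simp add: fib_def)
  ultimately show ?thesis
    using assms(3) by (auto simp: act_def app_def Hom_Ab compose_def dest!: fun_cong[of _ _ x])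
qed

lemma module_arrow_eqI:
  assumes "f \<in> Hom Md M N" "g \<in> Hom Md M N"
    and "\<And>r x. r \<in> Obj R \<Longrightarrow> x \<in> el M r \<Longrightarrow> app f r x = app g r x"
  shows "f = g"
proof -
  have f: "f \<in> Hom (functor_category (opposite R) (Ab small)) M N"
    and g: "g \<in> Hom (functor_category (opposite R) (Ab small)) M N"
    using assms(1,2) by (simp_all add: Hom_Mod)
  show ?thesis
  proof (rule nat_trans_eqI[OF f g])
    fix r assume "r \<in> Obj (opposite R)"
    then have "Map f r \<in> Hom (Ab small) (fib M r) (fib N r)" "Map g r \<in> Hom (Ab small) (fib M r) (fib N r)"
      and "\<And>x. x \<in> el M r \<Longrightarrow> Map (Map f r) x = Map (Map g r) x"
      using nat_trans_component[OF f, of r] nat_trans_component[OF g, of r] assms(3)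
      by (simp_all add: fib_def app_def)
    then show "Map f r = Map g r"
      by (auto simp: Hom_Ab intro!: arrow.equality intro: extensionalityI)
  qed
qed

definition mk_arr :: "('r, 'm, 'u) module_obj \<Rightarrow> ('r, 'm, 'u) module_obj \<Rightarrow> ('r \<Rightarrow> 'u \<Rightarrow> 'u) \<Rightarrow>
    ('r, 'm, 'u) module_arr" where
  "mk_arr M N h = mk_nat (opposite R) M N
    (\<lambda>r. \<lparr>Src = fib M r, Trg = fib N r, Map = restrict (h r) (el M r)\<rparr>)"

lemma app_mk_arr [simp]: "r \<in> Obj R \<Longrightarrow> x \<in> el M r \<Longrightarrow> app (mk_arr M N h) r x = h r x"
  by (simp add: mk_arr_def app_def)

lemma mk_arr_Hom:
  assumes M: "M \<in> Obj Md" and N: "N \<in> Obj Md"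
    and h: "\<And>r. r \<in> Obj R \<Longrightarrow> h r \<in> hom (fib M r) (fib N r)"
    and nat: "\<And>t r a x. a \<in> Hom R t r \<Longrightarrow> x \<in> el M r \<Longrightarrow> h t (act M a x) = act N a (h r x)"
  shows "mk_arr M N h \<in> Hom Md M N"
proof -
  have MN: "is_functor (opposite R) (Ab small) M" "is_functor (opposite R) (Ab small) N"
    using M N by (auto simp: Obj_Mod)
  have "mk_arr M N h \<in> Hom (functor_category (opposite R) (Ab small)) M N"
    unfolding mk_arr_def
  proof (intro op.mk_nat_Hom MN)
    show "\<lparr>Src = fib M r, Trg = fib N r, Map = restrict (h r) (el M r)\<rparr>
        \<in> Hom (Ab small) (FObj M r) (FObj N r)" if "r \<in> Obj (opposite R)" for r
      using that h[of r] fib_comm_group[OF M] fib_comm_group[OF N] fib_small[OF M] fib_small[OF N]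
      by (auto simp: Hom_Ab Obj_Ab fib_def hom_def Pi_iff comm_group_closed)
    fix a r t assume a: "a \<in> Hom (opposite R) r t"
    have "FArr M a \<in> Hom (Ab small) (fib M r) (fib M t)" "FArr N a \<in> Hom (Ab small) (fib N r) (fib N t)"
      using functor_FArr[OF MN(1) a] functor_FArr[OF MN(2) a] by (simp_all add: fib_def)
    then show "Comp (Ab small) \<lparr>Src = fib M t, Trg = fib N t, Map = restrict (h t) (el M t)\<rparr> (FArr M a) =
       Comp (Ab small) (FArr N a) \<lparr>Src = fib M r, Trg = fib N r, Map = restrict (h r) (el M r)\<rparr>"
      using nat[of a t r] a by (auto simp: Hom_Ab compose_def fun_eq_iff act_def hom_def Pi_iff)
  qed
  then show ?thesis using M N by (simp add: Hom_Mod)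
qed

lemma Mod_Comp_simps [simp]:
  "Comp Md = Comp (functor_category (opposite R) (Ab small))"
  "Ident Md = Ident (functor_category (opposite R) (Ab small))"
  by (simp_all add: Mod_def)

lemma app_Comp:
  assumes "f \<in> Hom Md M N" "r \<in> Obj R" "x \<in> el M r"
  shows "app (Comp Md g f) r x = app g r (app f r x)"
proof -
  have "Map f r \<in> Hom (Ab small) (fib M r) (fib N r)"
    using assms nat_trans_component[of f "opposite R" "Ab small" M N r] by (simp add: fib_def Hom_Mod)
  then show ?thesis using assms(2,3) by (simp add: app_def Hom_Ab compose_def)
qed

lemma app_Ident: "r \<in> Obj R \<Longrightarrow> x \<in> el M r \<Longrightarrow> app (Ident Md M) r x = x"
  by (simp add: app_def fib_def)

declare Mod_Comp_simps [simp del]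

text \<open>
  The only source of new modules: subobjects, quotients, sequential colimits and objects whose
  natural construction lives on another type are all obtained by an appropriate choice of \<open>q\<close>.
\<close>

lemma module_of_rep:
  assumes rep: "rep R G \<rho>"
    and cong_mult: "\<And>r x x' y y'. r \<in> Obj R \<Longrightarrow> x \<in> carrier (G r) \<Longrightarrow> x' \<in> carrier (G r) \<Longrightarrow>
      y \<in> carrier (G r) \<Longrightarrow> y' \<in> carrier (G r) \<Longrightarrow> q r x = q r x' \<Longrightarrow> q r y = q r y' \<Longrightarrow>
      q r (x \<otimes>\<^bsub>G r\<^esub> y) = q r (x' \<otimes>\<^bsub>G r\<^esub> y')"
    and cong_act: "\<And>t r a x x'. a \<in> Hom R t r \<Longrightarrow> x \<in> carrier (G r) \<Longrightarrow> x' \<in> carrier (G r) \<Longrightarrow>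
      q r x = q r x' \<Longrightarrow> q t (\<rho> a x) = q t (\<rho> a x')"
    and sm: "\<And>r. r \<in> Obj R \<Longrightarrow> small (q r ` carrier (G r))"
  shows "\<exists>M \<in> Obj Md. (\<forall>r \<in> Obj R. el M r = q r ` carrier (G r) \<and> q r \<in> hom (G r) (fib M r)) \<and>
    (\<forall>t r a x. a \<in> Hom R t r \<and> x \<in> carrier (G r) \<longrightarrow> act M a (q r x) = q t (\<rho> a x))"
proof -
  interpret rep R G \<rho> by fact
  \<comment> \<open>\<open>q r\<close> may identify elements. Sums and actions on its image are
    computed on chosen representatives, and the congruence assumptions make the choice
    irrelevant.\<close>
  define \<iota> where "\<iota> r = inv_into (carrier (G r)) (q r)" for r
  have \<iota>: "\<iota> r (q r x) \<in> carrier (G r)" "q r (\<iota> r (q r x)) = q r x" if "x \<in> carrier (G r)" for r x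
    using that by (auto simp: \<iota>_def inv_into_into f_inv_into_f)
  define H where "H r = \<lparr>carrier = q r ` carrier (G r), monoid.mult = (\<lambda>x y. q r (\<iota> r x \<otimes>\<^bsub>G r\<^esub> \<iota> r y)),
      one = q r \<one>\<^bsub>G r\<^esub>\<rparr>" for r
  have H_mult: "q r (\<iota> r (q r x) \<otimes>\<^bsub>G r\<^esub> \<iota> r (q r y)) = q r (x \<otimes>\<^bsub>G r\<^esub> y)"
    if "r \<in> Obj R" "x \<in> carrier (G r)" "y \<in> carrier (G r)" for r x y
    using that by (intro cong_mult) (auto simp: \<iota>)
  have H_act: "q t (\<rho> a (\<iota> r (q r x))) = q t (\<rho> a x)" if "a \<in> Hom R t r" "x \<in> carrier (G r)" for a t r x
    using that by (intro cong_act) (auto simp: \<iota>)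
  have hom_H: "q r \<in> hom (G r) (H r)" if "r \<in> Obj R" for r
    using that H_mult[OF that] by (auto simp: hom_def H_def)
  have H: "comm_group (H r)" if "r \<in> Obj R" for r
    using comm_group.hom_imp_img_comm_group[OF comm_group[OF that] hom_H[OF that]] by (simp add: H_def)
  define M where "M = mk_functor (opposite R) H
    (\<lambda>a. \<lparr>Src = H (Cod R a), Trg = H (Dom R a),
      Map = (\<lambda>y \<in> carrier (H (Cod R a)). q (Dom R a) (\<rho> a (\<iota> (Cod R a) y)))\<rparr>)"
  have F: "is_functor (opposite R) (Ab small) M"
    unfolding M_def
  proof (intro op.is_functor_mk_functor)
    show "H r \<in> Obj (Ab small)" if "r \<in> Obj (opposite R)" for r
      using that H[of r] sm[of r] by (auto simp: Obj_Ab H_def)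
    show "\<lparr>Src = H (Cod R a), Trg = H (Dom R a),
        Map = (\<lambda>y \<in> carrier (H (Cod R a)). q (Dom R a) (\<rho> a (\<iota> (Cod R a) y)))\<rparr> \<in> Hom (Ab small) (H r) (H t)"
      if a: "a \<in> Hom (opposite R) r t" for a r t
    proof -
      have a': "a \<in> Hom R t r" using a by simp
      have "(\<lambda>y. q t (\<rho> a (\<iota> r y))) \<in> hom (H r) (H t)"
        using H_act[OF a'] H_mult Hom_Obj[OF a'] closed[OF a'] mult[OF a']
        by (auto simp: hom_def H_def comm_group_closed[OF comm_group])
      then show ?thesis
        using H sm Hom_Obj[OF a'] HomD[OF a'] comm_group_closed(2)[OF H]
        by (auto simp: Hom_Ab Obj_Ab H_def hom_def)
    qed
    show "\<lparr>Src = H (Cod R (Ident (opposite R) r)), Trg = H (Dom R (Ident (opposite R) r)),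
        Map = (\<lambda>y \<in> carrier (H (Cod R (Ident (opposite R) r))).
          q (Dom R (Ident (opposite R) r)) (\<rho> (Ident (opposite R) r) (\<iota> (Cod R (Ident (opposite R) r)) y)))\<rparr>
      = Ident (Ab small) (H r)" if "r \<in> Obj (opposite R)" for r
      using that HomD[OF Ident_Hom[of r]] ident by (auto simp: H_def \<iota> fun_eq_iff)
    fix a b r s t assume "a \<in> Hom (opposite R) r t" "b \<in> Hom (opposite R) t s"
    then have a: "a \<in> Hom R t r" and b: "b \<in> Hom R s t" by auto
    have "q s (\<rho> (Comp R a b) (\<iota> r (q r x))) = q s (\<rho> b (\<iota> t (q t (\<rho> a (\<iota> r (q r x))))))"
      if "x \<in> carrier (G r)" for x
      using H_act[OF Comp_Hom[OF b a] that] H_act[OF a that] H_act[OF b closed[OF a that]] comp[OF a b that]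
      by simp
    moreover have "q t (\<rho> a (\<iota> r (q r x))) \<in> q t ` carrier (G t)" if "x \<in> carrier (G r)" for x
      using that closed[OF a] H_act[OF a that] by auto
    ultimately show "\<lparr>Src = H (Cod R (Comp (opposite R) b a)), Trg = H (Dom R (Comp (opposite R) b a)),
        Map = (\<lambda>y \<in> carrier (H (Cod R (Comp (opposite R) b a))).
          q (Dom R (Comp (opposite R) b a)) (\<rho> (Comp (opposite R) b a) (\<iota> (Cod R (Comp (opposite R) b a)) y)))\<rparr>
      = Comp (Ab small) \<lparr>Src = H (Cod R b), Trg = H (Dom R b),
          Map = (\<lambda>y \<in> carrier (H (Cod R b)). q (Dom R b) (\<rho> b (\<iota> (Cod R b) y)))\<rparr>
        \<lparr>Src = H (Cod R a), Trg = H (Dom R a),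
          Map = (\<lambda>y \<in> carrier (H (Cod R a)). q (Dom R a) (\<rho> a (\<iota> (Cod R a) y)))\<rparr>"
      using HomD[OF a] HomD[OF b] HomD[OF Comp_Hom[OF b a]]
      by (auto simp: H_def fun_eq_iff compose_def)
  qed
  have fib: "fib M r = H r" if "r \<in> Obj R" for r using that by (simp add: M_def fib_def)
  have act: "act M a (q r x) = q t (\<rho> a x)" if "a \<in> Hom R t r" "x \<in> carrier (G r)" for a t r x
    using that HomD[OF that(1)] Hom_Obj[OF that(1)] H_act[OF that] by (simp add: act_def M_def H_def)
  have "is_additive (opposite R) (Ab small) M"
    unfolding is_additive_def
  proof (intro ballI, unfold Hom_opposite)
    fix r t a a' assume a: "a \<in> Hom R t r" "a' \<in> Hom R t r" and rt: "r \<in> Obj (opposite R)" "t \<in> Obj (opposite R)"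
    have a'': "Add R a a' \<in> Hom R t r"
      using comm_group_closed(2)[OF Hom_comm_group[of t r]] a rt by simp
    note * = HomD[OF a''] HomD[OF a(1)] HomD[OF a(2)]
    have "q t (\<rho> (Add R a a') (\<iota> r (q r x))) =
        q t (\<iota> t (q t (\<rho> a (\<iota> r (q r x)))) \<otimes>\<^bsub>G t\<^esub> \<iota> t (q t (\<rho> a' (\<iota> r (q r x)))))" if "x \<in> carrier (G r)" for x
      using add[OF a \<iota>(1)[OF that]] rt H_mult[of t] closed[OF a(1) \<iota>(1)[OF that]] closed[OF a(2) \<iota>(1)[OF that]]
      by simp
    then show "FArr M (Add (opposite R) a a') = Add (Ab small) (FArr M a) (FArr M a')"
      using rt by (auto simp: M_def H_def fun_eq_iff Ab_def *)
  qed
  with F have "M \<in> Obj Md" by (simp add: Obj_Mod)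
  moreover have "q r \<in> hom (G r) (fib M r)" if "r \<in> Obj R" for r
    using hom_H[OF that] fib[OF that] by simp
  moreover have "el M r = q r ` carrier (G r)" if "r \<in> Obj R" for r
    using fib[OF that] by (simp add: H_def)
  ultimately show ?thesis using act by blast
qed

end

section \<open>Submodules, quotients, kernels and cokernels\<close>

context universe begin

lemma small_finite: "finite A \<Longrightarrow> small A"
proof (cases "A = {}")
  case True
  then show ?thesis using small_infinite small_subset by blast
next
  case False
  assume A: "finite A"
  obtain B where B: "small B" "infinite B" using small_infinite by blast
  obtain B' where B': "B' \<subseteq> B" "finite B'" "card B' = card A"
    using infinite_arbitrarily_large[OF B(2)] by metis
  then obtain f where "bij_betw f B' A" using A finite_same_card_bij by blast
  then show ?thesis using small_image[OF small_subset[OF B(1) B'(1)], of f] by (simp add: bij_betw_def)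
qed

lemma small_countable: "\<exists>\<nu> :: nat \<Rightarrow> 'u. inj \<nu> \<and> small (range \<nu>)"
proof -
  obtain B where B: "small B" "infinite B" using small_infinite by blast
  then obtain \<nu> :: "nat \<Rightarrow> 'u" where "inj \<nu>" "range \<nu> \<subseteq> B" using infinite_countable_subset by metis
  then show ?thesis using small_subset[OF B(1)] by blast
qed

text \<open>\<open>small_Union\<close> takes its index set inside \<open>'u\<close>, hence the
  detour through a small copy of the natural numbers.\<close>

lemma small_UN_nat: "(\<And>n :: nat. small (F n)) \<Longrightarrow> small (\<Union>n. F n)"
proof -
  assume F: "\<And>n. small (F n)"
  obtain \<nu> :: "nat \<Rightarrow> 'u" where \<nu>: "inj \<nu>" "small (range \<nu>)" using small_countable by blast
  have "small (\<Union>i \<in> range \<nu>. F (inv_into UNIV \<nu> i))" using \<nu>(2) F by (intro small_Union)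
  then show ?thesis using \<nu>(1) by simp
qed

text \<open>An infinite type is equinumerous with its square. The injection codes pairs back into
  \<open>'u\<close>, where every carrier has to live.\<close>

lemma pairing:
  includes cardinal_syntax
  shows "\<exists>\<pi> :: 'u \<times> 'u \<Rightarrow> 'u. inj \<pi>"
proof -
  have "infinite (UNIV :: 'u set)" using small_infinite finite_subset[OF subset_UNIV] by metis
  then have "|(UNIV :: 'u set) \<times> (UNIV :: 'u set)| =o |UNIV :: 'u set|" by (rule card_of_Times_same_infinite)
  then obtain f :: "'u \<times> 'u \<Rightarrow> 'u" where "bij_betw f (UNIV \<times> UNIV) UNIV" using card_of_ordIso by blast
  then show ?thesis by (auto simp: bij_betw_def)
qed

lemma small_Times: "small A \<Longrightarrow> small B \<Longrightarrow> small (f ` (A \<times> B))"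
proof -
  assume A: "small A" and B: "small B"
  have "small (\<Union>a \<in> A. (\<lambda>b. f (a, b)) ` B)" using A B by (intro small_Union small_image)
  moreover have "(\<Union>a \<in> A. (\<lambda>b. f (a, b)) ` B) = f ` (A \<times> B)" by auto
  ultimately show ?thesis by simp
qed

end

section \<open>Stable subgroups, submodules and quotients\<close>

lemma (in comm_group) quotient_mult:
  assumes "x \<in> carrier G" "y \<in> carrier G" "z \<in> carrier G"
  shows "(x \<otimes> inv y) \<otimes> (y \<otimes> inv z) = x \<otimes> inv z"
proof -
  have "inv y \<otimes> (y \<otimes> inv z) = inv z" using assms by (simp add: m_assoc[symmetric])
  then show ?thesis using assms by (simp add: m_assoc)
qed

lemma (in comm_group) inv_quotient:
  assumes "x \<in> carrier G" "y \<in> carrier G"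
  shows "inv (x \<otimes> inv y) = y \<otimes> inv x"
  using assms by (simp add: inv_mult_group)

text \<open>Stated for an arbitrary \<open>rep\<close> in order to cover two cases at once:
  submodules of a module, with elements in \<open>'u\<close>, and right ideals of \<open>R\<close>,
  with elements in \<open>'m\<close>.\<close>

definition subrep :: "('r, 'm) preadditive \<Rightarrow> ('r \<Rightarrow> 'x monoid) \<Rightarrow> ('m \<Rightarrow> 'x \<Rightarrow> 'x) \<Rightarrow> ('r \<Rightarrow> 'x set) \<Rightarrow> bool" where
  "subrep R G \<rho> D \<longleftrightarrow> (\<forall>r \<in> Obj R. subgroup (D r) (G r)) \<and>
    (\<forall>t r a x. a \<in> Hom R t r \<and> x \<in> D r \<longrightarrow> \<rho> a x \<in> D t)"

lemma subrepD:
  assumes "subrep R G \<rho> D" "r \<in> Obj R"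
  shows "subgroup (D r) (G r)" "x \<in> D r \<Longrightarrow> x \<in> carrier (G r)" "\<one>\<^bsub>G r\<^esub> \<in> D r"
    "x \<in> D r \<Longrightarrow> y \<in> D r \<Longrightarrow> x \<otimes>\<^bsub>G r\<^esub> y \<in> D r" "x \<in> D r \<Longrightarrow> inv\<^bsub>G r\<^esub> x \<in> D r"
  using assms subgroup.mem_carrier subgroup.one_closed subgroup.m_closed subgroup.m_inv_closed
  by (fastforce simp: subrep_def)+

lemma subrep_act: "subrep R G \<rho> D \<Longrightarrow> a \<in> Hom R t r \<Longrightarrow> x \<in> D r \<Longrightarrow> \<rho> a x \<in> D t"
  by (auto simp: subrep_def)

lemma (in rep) subrepI:
  assumes "\<And>r x. r \<in> Obj R \<Longrightarrow> x \<in> D r \<Longrightarrow> x \<in> carrier (G r)"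
    and "\<And>r. r \<in> Obj R \<Longrightarrow> \<one>\<^bsub>G r\<^esub> \<in> D r"
    and "\<And>r x y. r \<in> Obj R \<Longrightarrow> x \<in> D r \<Longrightarrow> y \<in> D r \<Longrightarrow> x \<otimes>\<^bsub>G r\<^esub> inv\<^bsub>G r\<^esub> y \<in> D r"
    and "\<And>t r a x. a \<in> Hom R t r \<Longrightarrow> x \<in> D r \<Longrightarrow> \<rho> a x \<in> D t"
  shows "subrep R G \<rho> D"
  unfolding subrep_def
proof (intro conjI ballI)
  fix r assume r: "r \<in> Obj R"
  interpret comm_group "G r" using comm_group[OF r] .
  have inv: "inv\<^bsub>G r\<^esub> y \<in> D r" if "y \<in> D r" for y
    using assms(3)[OF r assms(2)[OF r] that] assms(1)[OF r that] by simp
  show "subgroup (D r) (G r)"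
  proof (rule subgroupI)
    show "D r \<subseteq> carrier (G r)" "D r \<noteq> {}" using assms(1,2)[OF r] by auto
    show "a \<otimes>\<^bsub>G r\<^esub> b \<in> D r" if "a \<in> D r" "b \<in> D r" for a b
      using assms(3)[OF r that(1) inv[OF that(2)]] assms(1)[OF r that(2)] by simp
  qed (use inv in auto)
qed (use assms(4) in auto)

lemma rep_subrep:
  assumes "rep R G \<rho>" "preadditive_category R" and D: "subrep R G \<rho> D"
  shows "rep R (\<lambda>r. (G r)\<lparr>carrier := D r\<rparr>) \<rho>"
proof -
  interpret rep R G \<rho> by fact
  interpret preadditive_category R by fact
  show ?thesis
  proof (rule rep.intro)
    show "comm_group ((G r)\<lparr>carrier := D r\<rparr>)" if "r \<in> Obj R" for r
    proof -
      interpret G: comm_group "G r" using comm_group[OF that] .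
      show ?thesis
        using subgroup.subgroup_is_group[OF subrepD(1)[OF D that] G.is_group] subrepD(2)[OF D that]
        by (intro group.group_comm_groupI) (auto simp: G.m_comm)
    qed
    show "\<rho> a \<in> hom ((G r)\<lparr>carrier := D r\<rparr>) ((G t)\<lparr>carrier := D t\<rparr>)" if "a \<in> Hom R t r" for a t r
      using that subrep_act[OF D that] subrepD(2)[OF D Hom_Obj(2)[OF that]] mult[OF that]
      by (auto simp: hom_def)
  next
    fix r x assume "r \<in> Obj R" "x \<in> carrier ((G r)\<lparr>carrier := D r\<rparr>)"
    then show "\<rho> (Ident R r) x = x" using ident subrepD(2)[OF D] by simp
  next
    fix a t r b s x assume "a \<in> Hom R t r" "b \<in> Hom R s t" "x \<in> carrier ((G r)\<lparr>carrier := D r\<rparr>)"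
    then show "\<rho> (Comp R a b) x = \<rho> b (\<rho> a x)" using comp subrepD(2)[OF D Hom_Obj(2)] by simp
  next
    fix a a' t r x assume "a \<in> Hom R t r" "a' \<in> Hom R t r" "x \<in> carrier ((G r)\<lparr>carrier := D r\<rparr>)"
    then show "\<rho> (Add R a a') x = \<rho> a x \<otimes>\<^bsub>(G t)\<lparr>carrier := D t\<rparr>\<^esub> \<rho> a' x"
      using add subrepD(2)[OF D Hom_Obj(2)] by simp
  qed
qed

context module_category begin

text \<open>The representable functor Hom(-, r), kept as a \<open>rep\<close> on arrows of
  \<open>R\<close>. A right ideal below \<open>r\<close> is a stable subgroup of it; a copy of it
  among the modules is provided by \<open>representable\<close>.\<close>

abbreviation yoneda :: "'r \<Rightarrow> 'r \<Rightarrow> 'm monoid" where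
  "yoneda r \<equiv> \<lambda>t. \<lparr>carrier = Hom R t r, monoid.mult = Add R, one = Zero R t r\<rparr>"

abbreviation precomp :: "'m \<Rightarrow> 'm \<Rightarrow> 'm" where
  "precomp \<equiv> \<lambda>b a. Comp R a b"

abbreviation right_ideal :: "'r \<Rightarrow> ('r \<Rightarrow> 'm set) \<Rightarrow> bool" where
  "right_ideal r \<equiv> subrep R (yoneda r) precomp"

lemma neut_closed: "M \<in> Obj Md \<Longrightarrow> r \<in> Obj R \<Longrightarrow> neut M r \<in> el M r"
  and fib_mult_closed: "M \<in> Obj Md \<Longrightarrow> r \<in> Obj R \<Longrightarrow> x \<in> el M r \<Longrightarrow> y \<in> el M r \<Longrightarrow> x \<cdot>[M,r] y \<in> el M r"
  and fib_inv_closed: "M \<in> Obj Md \<Longrightarrow> r \<in> Obj R \<Longrightarrow> x \<in> el M r \<Longrightarrow> inv\<^bsub>fib M r\<^esub> x \<in> el M r"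
  using comm_group_closed[OF fib_comm_group] by blast+

lemma rep_zero:
  assumes rep: "rep R G \<rho>" and tr: "t \<in> Obj R" "r \<in> Obj R" and x: "x \<in> carrier (G r)"
  shows "\<rho> (Zero R t r) x = \<one>\<^bsub>G t\<^esub>"
proof -
  interpret rep R G \<rho> by fact
  interpret G: comm_group "G t" using comm_group[OF tr(1)] .
  interpret H: comm_group "yoneda r t" using Hom_comm_group[OF tr] .
  have 0: "Zero R t r \<in> Hom R t r" using H.one_closed by simp
  have "Add R (Zero R t r) (Zero R t r) = Zero R t r" using H.l_one[OF H.one_closed] by simp
  then show ?thesis using add[OF 0 0 x] closed[OF 0 x] G.l_cancel_one by simp
qed

definition neg :: "'r \<Rightarrow> 'm" where
  "neg s = inv\<^bsub>yoneda s s\<^esub> Ident R s"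

lemma neg_Hom: "s \<in> Obj R \<Longrightarrow> neg s \<in> Hom R s s"
  unfolding neg_def using comm_group_closed(3)[OF Hom_comm_group, of s s "Ident R s"] Ident_Hom by simp

lemma rep_neg:
  assumes rep: "rep R G \<rho>" and s: "s \<in> Obj R" and x: "x \<in> carrier (G s)"
  shows "\<rho> (neg s) x = inv\<^bsub>G s\<^esub> x"
proof -
  interpret rep R G \<rho> by fact
  interpret G: comm_group "G s" using comm_group[OF s] .
  interpret H: comm_group "yoneda s s" using Hom_comm_group[OF s s] .
  have "Add R (neg s) (Ident R s) = Zero R s s" using H.l_inv[of "Ident R s"] Ident_Hom[OF s] by (simp add: neg_def)
  then have "\<rho> (neg s) x \<otimes>\<^bsub>G s\<^esub> x = \<one>\<^bsub>G s\<^esub>"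
    using add[OF neg_Hom[OF s] Ident_Hom[OF s] x] ident[OF s x] rep_zero[OF rep s s x] by simp
  then show ?thesis using G.inv_equality[OF _ x closed[OF neg_Hom[OF s] x]] by simp
qed

text \<open>Closure under inverses is automatic: inversion is the action of \<open>neg r\<close>,
  the negative of the identity, so it follows from stability under the action.\<close>

lemma subrep_of_mult:
  assumes rep: "rep R G \<rho>" and car: "\<And>r x. r \<in> Obj R \<Longrightarrow> x \<in> D r \<Longrightarrow> x \<in> carrier (G r)"
    and one: "\<And>r. r \<in> Obj R \<Longrightarrow> \<one>\<^bsub>G r\<^esub> \<in> D r"
    and mult: "\<And>r x y. r \<in> Obj R \<Longrightarrow> x \<in> D r \<Longrightarrow> y \<in> D r \<Longrightarrow> x \<otimes>\<^bsub>G r\<^esub> y \<in> D r"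
    and act: "\<And>t r a x. a \<in> Hom R t r \<Longrightarrow> x \<in> D r \<Longrightarrow> \<rho> a x \<in> D t"
  shows "subrep R G \<rho> D"
proof (rule rep.subrepI[OF rep car one _ act])
  fix r x y assume r: "r \<in> Obj R" and x: "x \<in> D r" and y: "y \<in> D r"
  show "x \<otimes>\<^bsub>G r\<^esub> inv\<^bsub>G r\<^esub> y \<in> D r"
    using mult[OF r x act[OF neg_Hom[OF r] y]] rep_neg[OF rep r car[OF r y]] by simp
qed

abbreviation submodule :: "('r, 'm, 'u) module_obj \<Rightarrow> ('r \<Rightarrow> 'u set) \<Rightarrow> bool" where
  "submodule M \<equiv> subrep R (fib M) (act M)"

lemma submodule_object:
  assumes M: "M \<in> Obj Md" and D: "submodule M D"
  shows "\<exists>N \<in> Obj Md. \<exists>i \<in> Hom Md N M. \<forall>r \<in> Obj R. el N r = D r \<and> (\<forall>x \<in> D r. app i r x = x)"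
proof -
  have "rep R (\<lambda>r. (fib M r)\<lparr>carrier := D r\<rparr>) (act M)"
    using rep_subrep[OF module_rep[OF M] preadditive_category_axioms D] .
  then obtain N where N: "N \<in> Obj Md" "\<And>r. r \<in> Obj R \<Longrightarrow> el N r = D r"
    "\<And>r. r \<in> Obj R \<Longrightarrow> (\<lambda>x. x) \<in> hom ((fib M r)\<lparr>carrier := D r\<rparr>) (fib N r)"
    "\<And>t r a x. a \<in> Hom R t r \<Longrightarrow> x \<in> D r \<Longrightarrow> act N a x = act M a x"
    using module_of_rep[of "\<lambda>r. (fib M r)\<lparr>carrier := D r\<rparr>" "act M" "\<lambda>r x. x"] 
      small_subset[OF fib_small[OF M]] subrepD(2)[OF D] by (auto simp: subset_iff)
  have "mk_arr N M (\<lambda>r x. x) \<in> Hom Md N M"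
    using N(2,3,4) Hom_Obj subrepD(2)[OF D] by (intro mk_arr_Hom M N(1)) (auto simp: hom_def)
  then show ?thesis using N(1,2) by (intro bexI[of _ N] bexI[of _ "mk_arr N M (\<lambda>r x. x)"]) auto
qed

lemma quotient_object:
  assumes M: "M \<in> Obj Md" and D: "submodule M D"
  shows "\<exists>Q \<in> Obj Md. \<exists>p \<in> Hom Md M Q. \<forall>r \<in> Obj R. app p r ` el M r = el Q r \<and>
    {x \<in> el M r. app p r x = neut Q r} = D r"
proof -
  \<comment> \<open>The quotient consists of chosen coset representatives rather than cosets, so its
    carrier stays inside \<open>el M r\<close> and is small. The predicate behind
    \<open>SOME\<close> depends only on the coset of \<open>x\<close>, which is why elements of one
    coset receive the same representative.\<close>
  define q where "q r x = (SOME y. y \<in> el M r \<and> x \<cdot>[M,r] inv\<^bsub>fib M r\<^esub> y \<in> D r)" for r x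
  have q_in: "q r x \<in> el M r \<and> x \<cdot>[M,r] inv\<^bsub>fib M r\<^esub> (q r x) \<in> D r"
    and q_eq: "x' \<in> el M r \<Longrightarrow> q r x = q r x' \<longleftrightarrow> x \<cdot>[M,r] inv\<^bsub>fib M r\<^esub> x' \<in> D r"
    if r: "r \<in> Obj R" and x: "x \<in> el M r" for r x x'
  proof -
    interpret G: comm_group "fib M r" using fib_comm_group[OF M r] .
    note D' = subrepD[OF D r]
    have *: "q r x \<in> el M r \<and> x \<cdot>[M,r] inv\<^bsub>fib M r\<^esub> (q r x) \<in> D r"
      if x: "x \<in> el M r" for x
      unfolding q_def by (rule someI[of _ x]) (use x D' in auto)
    show "q r x \<in> el M r \<and> x \<cdot>[M,r] inv\<^bsub>fib M r\<^esub> (q r x) \<in> D r" using *[OF x] .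
    assume x': "x' \<in> el M r"
    show "q r x = q r x' \<longleftrightarrow> x \<cdot>[M,r] inv\<^bsub>fib M r\<^esub> x' \<in> D r"
    proof
      assume eq: "q r x = q r x'"
      have "x \<cdot>[M,r] inv\<^bsub>fib M r\<^esub> x' =
          (x \<cdot>[M,r] inv\<^bsub>fib M r\<^esub> (q r x)) \<cdot>[M,r] inv\<^bsub>fib M r\<^esub> (x' \<cdot>[M,r] inv\<^bsub>fib M r\<^esub> (q r x'))"
        using eq *[OF x] *[OF x'] x x' by (simp add: G.inv_quotient G.quotient_mult)
      then show "x \<cdot>[M,r] inv\<^bsub>fib M r\<^esub> x' \<in> D r" using *[OF x] *[OF x'] D' by simp
    next
      assume d: "x \<cdot>[M,r] inv\<^bsub>fib M r\<^esub> x' \<in> D r"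
      have "x \<cdot>[M,r] inv\<^bsub>fib M r\<^esub> y \<in> D r \<longleftrightarrow> x' \<cdot>[M,r] inv\<^bsub>fib M r\<^esub> y \<in> D r" if y: "y \<in> el M r" for y
      proof -
        have "x \<cdot>[M,r] inv\<^bsub>fib M r\<^esub> y =
            (x \<cdot>[M,r] inv\<^bsub>fib M r\<^esub> x') \<cdot>[M,r] (x' \<cdot>[M,r] inv\<^bsub>fib M r\<^esub> y)"
          using x x' y by (simp add: G.quotient_mult)
        moreover have "x' \<cdot>[M,r] inv\<^bsub>fib M r\<^esub> y =
            inv\<^bsub>fib M r\<^esub> (x \<cdot>[M,r] inv\<^bsub>fib M r\<^esub> x') \<cdot>[M,r] (x \<cdot>[M,r] inv\<^bsub>fib M r\<^esub> y)"
          using x x' y by (simp add: G.inv_quotient G.quotient_mult)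
        ultimately show ?thesis using D'(4,5) d by metis
      qed
      then show "q r x = q r x'" unfolding q_def by (intro arg_cong[of _ _ Eps]) auto
    qed
  qed
  have "\<exists>Q \<in> Obj Md. (\<forall>r \<in> Obj R. el Q r = q r ` el M r \<and> q r \<in> hom (fib M r) (fib Q r)) \<and>
    (\<forall>t r a x. a \<in> Hom R t r \<and> x \<in> el M r \<longrightarrow> act Q a (q r x) = q t (act M a x))"
  proof (rule module_of_rep[OF module_rep[OF M]])
    fix r x x' y y' assume r: "r \<in> Obj R" and xy: "x \<in> el M r" "x' \<in> el M r"
      "y \<in> el M r" "y' \<in> el M r" and eq: "q r x = q r x'" "q r y = q r y'"
    interpret G: comm_group "fib M r" using fib_comm_group[OF M r] .
    have "(x \<cdot>[M,r] y) \<cdot>[M,r] inv\<^bsub>fib M r\<^esub> (x' \<cdot>[M,r] y') =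
      (x \<cdot>[M,r] inv\<^bsub>fib M r\<^esub> x') \<cdot>[M,r] (y \<cdot>[M,r] inv\<^bsub>fib M r\<^esub> y')"
      using xy by (simp add: G.inv_mult G.m_assoc G.m_lcomm)
    then show "q r (x \<cdot>[M,r] y) = q r (x' \<cdot>[M,r] y')"
      using eq xy subrepD(4)[OF D r] by (simp add: q_eq[OF r])
  next
    fix t r a x x' assume a: "a \<in> Hom R t r" and x: "x \<in> el M r" "x' \<in> el M r" "q r x = q r x'"
    note r = Hom_Obj[OF a]
    have "act M a (x \<cdot>[M,r] inv\<^bsub>fib M r\<^esub> x') \<in> D t"
      using subrep_act[OF D a] x q_eq[OF r(2)] by simp
    then show "q t (act M a x) = q t (act M a x')"
      using x act_closed[OF M a] fib_inv_closed[OF M r(2)]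
      by (simp add: q_eq[OF r(1)] act_mult[OF M a] act_inv[OF M a])
  next
    fix r assume r: "r \<in> Obj R"
    show "small (q r ` el M r)" using q_in[OF r] by (intro small_subset[OF fib_small[OF M r]]) auto
  qed
  then obtain Q where Q: "Q \<in> Obj Md" "\<And>r. r \<in> Obj R \<Longrightarrow> el Q r = q r ` el M r"
    "\<And>r. r \<in> Obj R \<Longrightarrow> q r \<in> hom (fib M r) (fib Q r)"
    "\<And>t r a x. a \<in> Hom R t r \<Longrightarrow> x \<in> el M r \<Longrightarrow> act Q a (q r x) = q t (act M a x)"
    by auto
  have p: "mk_arr M Q q \<in> Hom Md M Q" using Q by (intro mk_arr_Hom M) auto
  have "app (mk_arr M Q q) r x = neut Q r \<longleftrightarrow> x \<in> D r" if r: "r \<in> Obj R" and x: "x \<in> el M r" for r x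
  proof -
    have "q r (neut M r) = neut Q r" using hom_oneI[OF Q(3)] fib_comm_group M Q(1) r by blast
    then show ?thesis
      using q_eq[OF r x, of "neut M r"] r x comm_group_closed[OF fib_comm_group[OF M r]]
        group.inv_equality[OF comm_group.axioms(2)[OF fib_comm_group[OF M r]], of "neut M r" "neut M r"]
        monoid.r_one[OF group.is_monoid[OF comm_group.axioms(2)[OF fib_comm_group[OF M r]]]]
      by simp
  qed
  then show ?thesis
    using p Q(1,2) subrepD(2)[OF D]
    by (intro bexI[of _ Q] bexI[of _ "mk_arr M Q q"]) (auto simp: image_iff)
qed

lemma zero_module: "\<exists>Z \<in> Obj Md. \<forall>r \<in> Obj R. el Z r = {neut Z r}"
proof -
  define G :: "'r \<Rightarrow> unit monoid" where "G r = \<lparr>carrier = UNIV, monoid.mult = (\<lambda>_ _. ()), one = ()\<rparr>" for r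
  have G: "comm_group (G r)" for r unfolding G_def by (rule comm_groupI) auto
  have "rep R G (\<lambda>_ x. x)" by (rule rep.intro) (use G in \<open>auto simp: hom_def G_def\<close>)
  then obtain Z where Z: "Z \<in> Obj Md" "\<And>r. r \<in> Obj R \<Longrightarrow> el Z r = range (\<lambda>_ :: unit. undefined)"
    using module_of_rep[of G "\<lambda>_ x. x" "\<lambda>_ _. undefined"] small_finite by (auto simp: G_def)
  then show ?thesis using neut_closed[OF Z(1)] by (intro bexI[of _ Z]) auto
qed

lemma factor_through_mono:
  assumes i: "i \<in> Hom Md N M" and inj: "\<And>r. r \<in> Obj R \<Longrightarrow> inj_on (app i r) (el N r)"
    and f: "f \<in> Hom Md A M"
    and im: "\<And>r x. r \<in> Obj R \<Longrightarrow> x \<in> el A r \<Longrightarrow> app f r x \<in> app i r ` el N r"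
  shows "\<exists>g \<in> Hom Md A N. Comp Md i g = f"
proof -
  note O = Hom_Mod_Obj[OF i] Hom_Mod_Obj[OF f]
  define h where "h r x = inv_into (el N r) (app i r) (app f r x)" for r x
  have h: "h r x \<in> el N r" "app i r (h r x) = app f r x"
    if "r \<in> Obj R" "x \<in> el A r" for r x
    using im[OF that] by (auto simp: h_def inv_into_into f_inv_into_f)
  have eq: "y = y'" if "r \<in> Obj R" "y \<in> el N r" "y' \<in> el N r" "app i r y = app i r y'" for r y y'
    using inj_onD[OF inj[OF that(1)] that(4)] that by simp
  have "mk_arr A N h \<in> Hom Md A N"
  proof (intro mk_arr_Hom O)
    show "h r \<in> hom (fib A r) (fib N r)" if r: "r \<in> Obj R" for r
    proof (rule homI)
      fix x y assume xy: "x \<in> el A r" "y \<in> el A r"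
      show "h r (x \<cdot>[A,r] y) = h r x \<cdot>[N,r] h r y"
        using r xy h comm_group_closed(2)[OF fib_comm_group] O
        by - (rule eq[OF r]; simp add: app_mult[OF i] app_mult[OF f])
    qed (use r h in auto)
    show "h t (act A a x) = act N a (h r x)" if a: "a \<in> Hom R t r" and x: "x \<in> el A r" for t r a x
      using x h Hom_Obj[OF a] act_closed[OF _ a] O app_act[OF i a] app_act[OF f a]
      by - (rule eq[OF Hom_Obj(1)[OF a]]; simp)
  qed
  moreover from this have "Comp Md i (mk_arr A N h) = f"
    using h by (intro module_arrow_eqI[OF Md.Comp_Hom[OF _ i] f]) (auto simp: app_Comp)
  ultimately show ?thesis by blast
qed

lemma app_eq_iff:
  assumes f: "f \<in> Hom Md A B" and r: "r \<in> Obj R" and x: "x \<in> el A r" "y \<in> el A r"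
  shows "app f r x = app f r y \<longleftrightarrow> app f r (x \<cdot>[A,r] inv\<^bsub>fib A r\<^esub> y) = neut B r"
proof -
  note O = Hom_Mod_Obj[OF f]
  show ?thesis
    using x r app_closed[OF f r] comm_group_eq_iff[OF fib_comm_group[OF O(2) r]]
      comm_group_closed[OF fib_comm_group[OF O(1) r]]
    by (simp add: app_mult[OF f r] app_inv[OF f r])
qed

lemma factor_through_epi:
  assumes p: "p \<in> Hom Md M Q" and surj: "\<And>r. r \<in> Obj R \<Longrightarrow> app p r ` el M r = el Q r"
    and f: "f \<in> Hom Md M B"
    and ker: "\<And>r x. r \<in> Obj R \<Longrightarrow> x \<in> el M r \<Longrightarrow> app p r x = neut Q r \<Longrightarrow> app f r x = neut B r"
  shows "\<exists>g \<in> Hom Md Q B. Comp Md g p = f"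
proof -
  note O = Hom_Mod_Obj[OF p] Hom_Mod_Obj[OF f]
  define h where "h r y = app f r (inv_into (el M r) (app p r) y)" for r y
  have h: "h r (app p r x) = app f r x" if r: "r \<in> Obj R" and x: "x \<in> el M r" for r x
  proof -
    define x' where "x' = inv_into (el M r) (app p r) (app p r x)"
    have x': "x' \<in> el M r" "app p r x' = app p r x"
      using x by (auto simp: x'_def inv_into_into f_inv_into_f)
    then have "app f r x' = app f r x"
      using app_eq_iff[OF p r] app_eq_iff[OF f r] x ker[OF r] comm_group_closed[OF fib_comm_group[OF O(1) r]] by simp
    then show ?thesis by (simp add: h_def x'_def)
  qed
  have ex: "\<exists>x \<in> el M r. y = app p r x" if "r \<in> Obj R" "y \<in> el Q r" for r y
    using surj that by blast
  have "mk_arr Q B h \<in> Hom Md Q B"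
  proof (intro mk_arr_Hom O)
    show "h r \<in> hom (fib Q r) (fib B r)" if r: "r \<in> Obj R" for r
    proof (rule homI)
      show "h r y \<in> el B r" if "y \<in> el Q r" for y
        using ex[OF r that] h[OF r] app_closed[OF f r] by auto
      fix y y' assume "y \<in> el Q r" "y' \<in> el Q r"
      then obtain x x' where x: "x \<in> el M r" "x' \<in> el M r" "y = app p r x" "y' = app p r x'"
        using ex[OF r] by metis
      then show "h r (y \<cdot>[Q,r] y') = h r y \<cdot>[B,r] h r y'"
        using h[OF r] fib_mult_closed[OF O(1) r]
        by (simp add: app_mult[OF p r, symmetric] app_mult[OF f r])
    qed
    show "h t (act Q a y) = act B a (h r y)" if a: "a \<in> Hom R t r" and y: "y \<in> el Q r" for t r a y
    proof -
      obtain x where x: "x \<in> el M r" "y = app p r x" using ex[OF Hom_Obj(2)[OF a] y] by blast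
      then show ?thesis
        using h Hom_Obj[OF a] act_closed[OF O(1) a] by (simp add: app_act[OF p a, symmetric] app_act[OF f a])
    qed
  qed
  moreover from this have "Comp Md (mk_arr Q B h) p = f"
    using h app_closed[OF p] by (intro module_arrow_eqI[OF Md.Comp_Hom[OF p] f]) (auto simp: app_Comp[OF p])
  ultimately show ?thesis by blast
qed

section \<open>Zero arrows, kernels and cokernels of modules\<close>

lemma is_zero_object_Mod: "is_zero_object Md Z \<longleftrightarrow> Z \<in> Obj Md \<and> (\<forall>r \<in> Obj R. el Z r = {neut Z r})"
proof -
  have triv: "is_zero_object Md Z" if Z: "Z \<in> Obj Md" "\<And>r. r \<in> Obj R \<Longrightarrow> el Z r = {neut Z r}" for Z
    unfolding is_zero_object_def
  proof (intro conjI ballI Z)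
    fix X assume X: "X \<in> Obj Md"
    have 1: "neut Z r \<cdot>[Z,r] neut Z r = neut Z r" "neut X r \<cdot>[X,r] neut X r = neut X r" if "r \<in> Obj R" for r
      using fib_comm_group[OF Z(1) that] fib_comm_group[OF X that]
      by (simp_all add: comm_group_def group_def monoid.l_one monoid.one_closed)
    have "mk_arr X Z (\<lambda>r _. neut Z r) \<in> Hom Md X Z"
      using 1 Z act_one[OF Z(1)] by (intro mk_arr_Hom X Z(1)) (auto simp: hom_def)
    moreover have "f = g" if "f \<in> Hom Md X Z" "g \<in> Hom Md X Z" for f g
      using that app_closed[OF that(1)] app_closed[OF that(2)] Z(2) by (intro module_arrow_eqI) auto
    ultimately show "\<exists>!f. f \<in> Hom Md X Z" by blast
    have "mk_arr Z X (\<lambda>r _. neut X r) \<in> Hom Md Z X"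
      using 1 act_one[OF X] neut_closed[OF X] by (intro mk_arr_Hom X Z(1)) (auto simp: hom_def)
    moreover have "f = g" if "f \<in> Hom Md Z X" "g \<in> Hom Md Z X" for f g
      using that app_one[OF that(1)] app_one[OF that(2)] Z(2) by (intro module_arrow_eqI) auto
    ultimately show "\<exists>!f. f \<in> Hom Md Z X" by blast
  qed
  show ?thesis
  proof
    assume Z: "is_zero_object Md Z"
    then have ZO: "Z \<in> Obj Md" by (simp add: is_zero_object_def)
    have 1: "neut Z r \<cdot>[Z,r] neut Z r = neut Z r" if "r \<in> Obj R" for r
      using fib_comm_group[OF ZO that] by (simp add: comm_group_def group_def monoid.l_one monoid.one_closed)
    have "mk_arr Z Z (\<lambda>r _. neut Z r) \<in> Hom Md Z Z"
      using 1 act_one[OF ZO] neut_closed[OF ZO] by (intro mk_arr_Hom ZO) (auto simp: hom_def)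
    moreover have "Ident Md Z \<in> Hom Md Z Z" using Md.Ident_Hom[OF ZO] .
    \<comment> \<open>A zero object has a single endomorphism, so its zero map is its identity and
      every fibre collapses.\<close>
    ultimately have eq: "mk_arr Z Z (\<lambda>r _. neut Z r) = Ident Md Z"
      using Z ZO unfolding is_zero_object_def by blast
    have "x = neut Z r" if "r \<in> Obj R" "x \<in> el Z r" for r x
      using that arg_cong[OF eq, of "\<lambda>f. app f r x"] by (simp add: app_Ident)
    then show "Z \<in> Obj Md \<and> (\<forall>r \<in> Obj R. el Z r = {neut Z r})"
      using ZO neut_closed[OF ZO] by blast
  qed (use triv in blast)
qed

lemma is_zero_arrow_Mod:
  assumes f: "f \<in> Hom Md A B"
  shows "is_zero_arrow Md f \<longleftrightarrow> (\<forall>r \<in> Obj R. \<forall>x \<in> el A r. app f r x = neut B r)"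
proof
  assume "is_zero_arrow Md f"
  then obtain Z g h where Z: "is_zero_object Md Z" and g: "g \<in> Hom Md A Z" and h: "h \<in> Hom Md Z B" and eq: "f = Comp Md h g"
    using HomD[OF f] by (auto simp: is_zero_arrow_def)
  show "\<forall>r \<in> Obj R. \<forall>x \<in> el A r. app f r x = neut B r"
  proof (intro ballI)
    fix r x assume r: "r \<in> Obj R" and x: "x \<in> el A r"
    have "app g r x = neut Z r" using app_closed[OF g r x] Z r by (auto simp: is_zero_object_Mod)
    then show "app f r x = neut B r" using r x app_one[OF h r] by (simp add: eq app_Comp[OF g])
  qed
next
  assume 0: "\<forall>r \<in> Obj R. \<forall>x \<in> el A r. app f r x = neut B r"
  note O = Hom_Mod_Obj[OF f]
  obtain Z where Z: "is_zero_object Md Z" using zero_module is_zero_object_Mod by blast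
  then obtain g h where g: "g \<in> Hom Md A Z" and h: "h \<in> Hom Md Z B"
    using O unfolding is_zero_object_def by (metis (no_types, lifting))
  have "app g r x = neut Z r" if "r \<in> Obj R" "x \<in> el A r" for r x
    using app_closed[OF g that] Z that by (auto simp: is_zero_object_Mod)
  then have "Comp Md h g = f"
    using 0 app_one[OF h] by (intro module_arrow_eqI[OF Md.Comp_Hom[OF g h] f]) (simp add: app_Comp[OF g])
  then show "is_zero_arrow Md f" using Z g h HomD[OF f] by (auto simp: is_zero_arrow_def)
qed

lemma injective_is_mono:
  assumes i: "i \<in> Hom Md N M" and inj: "\<And>r. r \<in> Obj R \<Longrightarrow> inj_on (app i r) (el N r)"
  shows "is_mono Md i"
  unfolding is_mono_def
proof (intro conjI ballI inj_onI)
  show "i \<in> Arr Md" using HomD[OF i] by simp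
  fix X f g assume f: "f \<in> Hom Md X (Dom Md i)" and g: "g \<in> Hom Md X (Dom Md i)" and eq: "Comp Md i f = Comp Md i g"
  have f': "f \<in> Hom Md X N" and g': "g \<in> Hom Md X N" using f g HomD[OF i] by auto
  show "f = g"
  proof (rule module_arrow_eqI[OF f' g'])
    fix r x assume r: "r \<in> Obj R" and x: "x \<in> el X r"
    have "app i r (app f r x) = app i r (app g r x)"
      using arg_cong[OF eq, of "\<lambda>f. app f r x"] r x by (simp add: app_Comp[OF f'] app_Comp[OF g'])
    then show "app f r x = app g r x"
      using inj_onD[OF inj[OF r]] app_closed[OF f' r x] app_closed[OF g' r x] by blast
  qed
qed

lemma kernel_subrep:
  assumes u: "u \<in> Hom Md A B"
  shows "submodule A (\<lambda>r. {x \<in> el A r. app u r x = neut B r})"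
proof -
  note O = Hom_Mod_Obj[OF u]
  show ?thesis
  proof (rule rep.subrepI[OF module_rep[OF O(1)]])
    fix r x y assume r: "r \<in> Obj R" and "x \<in> {x \<in> el A r. app u r x = neut B r}"
      and "y \<in> {x \<in> el A r. app u r x = neut B r}"
    then show "x \<cdot>[A,r] inv\<^bsub>fib A r\<^esub> y \<in> {x \<in> el A r. app u r x = neut B r}"
      using app_eq_iff[OF u r, of x y] comm_group_closed[OF fib_comm_group[OF O(1) r]] by simp
  qed (auto simp: app_one[OF u] neut_closed[OF O(1)] app_act[OF u] act_one[OF O(2)]
      intro: act_closed[OF O(1)])
qed

lemma image_subrep:
  assumes u: "u \<in> Hom Md A B" and D: "submodule A D"
  shows "submodule B (\<lambda>r. app u r ` D r)"
proof -
  note O = Hom_Mod_Obj[OF u]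
  show ?thesis
  proof (rule rep.subrepI[OF module_rep[OF O(2)]])
    fix r x y assume r: "r \<in> Obj R" and "x \<in> app u r ` D r" "y \<in> app u r ` D r"
    then obtain x' y' where "x' \<in> D r" "y' \<in> D r" "x = app u r x'" "y = app u r y'" by auto
    moreover from this have "x \<cdot>[B,r] inv\<^bsub>fib B r\<^esub> y = app u r (x' \<cdot>[A,r] inv\<^bsub>fib A r\<^esub> y')"
      using subrepD[OF D r] by (simp add: app_mult[OF u r] app_inv[OF u r])
    ultimately show "x \<cdot>[B,r] inv\<^bsub>fib B r\<^esub> y \<in> app u r ` D r" using subrepD[OF D r] by simp
  next
    fix t r a x assume a: "a \<in> Hom R t r" and "x \<in> app u r ` D r"
    then obtain x' where "x' \<in> D r" "x = app u r x'" by auto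
    then show "act B a x \<in> app u t ` D t"
      using app_act[OF u a, of x'] subrep_act[OF D a] subrepD(2)[OF D Hom_Obj(2)[OF a]] by (metis image_eqI)
  qed (use subrepD(2,3)[OF D] app_closed[OF u] app_one[OF u, symmetric] in auto)
qed

lemma carrier_subrep: "M \<in> Obj Md \<Longrightarrow> submodule M (\<lambda>r. el M r)"
  by (intro rep.subrepI[OF module_rep]) (auto intro!: comm_group_closed fib_comm_group intro: act_closed)

lemma is_kernel_of_fibres:
  assumes u: "u \<in> Hom Md A B" and k: "k \<in> Hom Md K A"
    and inj: "\<And>r. r \<in> Obj R \<Longrightarrow> inj_on (app k r) (el K r)"
    and im: "\<And>r. r \<in> Obj R \<Longrightarrow> app k r ` el K r = {x \<in> el A r. app u r x = neut B r}"
  shows "is_kernel Md u k"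
  unfolding is_kernel_def
proof (intro conjI ballI impI; (elim conjE)?)
  show "u \<in> Arr Md" "k \<in> Arr Md" "Cod Md k = Dom Md u" using HomD[OF u] HomD[OF k] by auto
  show "is_zero_arrow Md (Comp Md u k)"
    using im unfolding is_zero_arrow_Mod[OF Md.Comp_Hom[OF k u]] by (auto simp: app_Comp[OF k])
  fix h assume h: "h \<in> Arr Md" "Cod Md h = Dom Md u" and 0: "is_zero_arrow Md (Comp Md u h)"
  have h': "h \<in> Hom Md (Dom Md h) A" using Arr_Hom[OF h(1)] h(2) HomD[OF u] by simp
  have "\<exists>h''\<in>Hom Md (Dom Md h) K. Comp Md k h'' = h"
    using 0 app_closed[OF h'] unfolding is_zero_arrow_Mod[OF Md.Comp_Hom[OF h' u]]
    by (intro factor_through_mono[OF k inj h']) (auto simp: app_Comp[OF h'] im)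
  moreover have "g = g'" if "g \<in> Hom Md (Dom Md h) K" "g' \<in> Hom Md (Dom Md h) K" "Comp Md k g = Comp Md k g'" for g g'
    using injective_is_mono[OF k inj] that HomD[OF k] Md.Hom_Obj(1)[OF h'] unfolding is_mono_def inj_on_def by metis
  ultimately show "\<exists>!h'. h' \<in> Hom Md (Dom Md h) (Dom Md k) \<and> Comp Md k h' = h"
    using HomD[OF k] by (metis (no_types, lifting))
qed

lemma is_cokernel_of_fibres:
  assumes u: "u \<in> Hom Md A B" and q: "q \<in> Hom Md B Q"
    and surj: "\<And>r. r \<in> Obj R \<Longrightarrow> app q r ` el B r = el Q r"
    and ker: "\<And>r. r \<in> Obj R \<Longrightarrow> {x \<in> el B r. app q r x = neut Q r} = app u r ` el A r"
  shows "is_cokernel Md u q"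
  unfolding is_cokernel_def
proof (intro conjI ballI impI; (elim conjE)?)
  show "u \<in> Arr Md" "q \<in> Arr Md" "Dom Md q = Cod Md u" using HomD[OF u] HomD[OF q] by auto
  show "is_zero_arrow Md (Comp Md q u)"
    using ker unfolding is_zero_arrow_Mod[OF Md.Comp_Hom[OF u q]] by (auto simp: app_Comp[OF u])
  fix h assume h: "h \<in> Arr Md" "Dom Md h = Cod Md u" and 0: "is_zero_arrow Md (Comp Md h u)"
  have h': "h \<in> Hom Md B (Cod Md h)" using Arr_Hom[OF h(1)] h(2) HomD[OF u] by simp
  have "app h r x = neut (Cod Md h) r"
    if r: "r \<in> Obj R" and x: "x \<in> el B r" "app q r x = neut Q r" for r x
  proof -
    obtain y where "y \<in> el A r" "x = app u r y" using ker[OF r] x by blast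
    then show ?thesis using 0 r unfolding is_zero_arrow_Mod[OF Md.Comp_Hom[OF u h']] by (simp add: app_Comp[OF u])
  qed
  then have "\<exists>h''\<in>Hom Md Q (Cod Md h). Comp Md h'' q = h"
    by (intro factor_through_epi[OF q surj h'])
  moreover have "g = g'" if g: "g \<in> Hom Md Q (Cod Md h)" "g' \<in> Hom Md Q (Cod Md h)" "Comp Md g q = Comp Md g' q" for g g'
  proof (rule module_arrow_eqI[OF g(1,2)])
    fix r x assume r: "r \<in> Obj R" and "x \<in> el Q r"
    then obtain y where y: "y \<in> el B r" "x = app q r y" using surj[OF r] by blast
    show "app g r x = app g' r x" using arg_cong[OF g(3), of "\<lambda>f. app f r y"] r y by (simp add: app_Comp[OF q])
  qed
  ultimately show "\<exists>!h'. h' \<in> Hom Md (Cod Md q) (Cod Md h) \<and> Comp Md h' q = h"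
    using HomD[OF q] by (metis (no_types, lifting))
qed

lemma kernel_exists:
  assumes u: "u \<in> Hom Md A B"
  shows "\<exists>K. \<exists>k \<in> Hom Md K A. \<forall>r \<in> Obj R. inj_on (app k r) (el K r) \<and>
    app k r ` el K r = {x \<in> el A r. app u r x = neut B r}"
proof -
  obtain K k where "k \<in> Hom Md K A" and
    "\<forall>r \<in> Obj R. el K r = {x \<in> el A r. app u r x = neut B r} \<and>
      (\<forall>x \<in> {x \<in> el A r. app u r x = neut B r}. app k r x = x)"
    using submodule_object[OF Hom_Mod_Obj(1)[OF u] kernel_subrep[OF u]] by (elim bexE) (rule that)
  then show ?thesis by (intro exI[of _ K] bexI[of _ k]) (auto simp: inj_on_def image_iff)
qed

lemma cokernel_exists:
  assumes u: "u \<in> Hom Md A B"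
  shows "\<exists>Q. \<exists>q \<in> Hom Md B Q. \<forall>r \<in> Obj R. app q r ` el B r = el Q r \<and>
    {x \<in> el B r. app q r x = neut Q r} = app u r ` el A r"
  using quotient_object[OF Hom_Mod_Obj(2)[OF u] image_subrep[OF u carrier_subrep[OF Hom_Mod_Obj(1)[OF u]]]]
  by blast

end

section \<open>FI-modules in terms of elements\<close>

lemma Obj_FI [simp]: "S \<in> Obj FI \<longleftrightarrow> finite S"
  by (simp add: FI_def)

lemma Hom_FI: "\<phi> \<in> Hom FI S X \<longleftrightarrow> finite S \<and> finite X \<and> Src \<phi> = S \<and> Trg \<phi> = X \<and>
    Map \<phi> \<in> S \<rightarrow>\<^sub>E X \<and> inj_on (Map \<phi>) S"
  by (auto simp: FI_def Hom_def)

lemma Comp_FI: "Comp FI g f = \<lparr>Src = Src f, Trg = Trg g, Map = compose (Src f) (Map g) (Map f)\<rparr>"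
  by (simp add: FI_def)

lemma Ident_FI: "Ident FI S = \<lparr>Src = S, Trg = S, Map = (\<lambda>x \<in> S. x)\<rparr>"
  by (simp add: FI_def)

lemma Map_Comp_FI: "\<phi> \<in> Hom FI S X \<Longrightarrow> x \<in> S \<Longrightarrow> Map (Comp FI \<psi> \<phi>) x = Map \<psi> (Map \<phi> x)"
  by (simp add: Comp_FI Hom_FI compose_def)

lemma Map_Ident_FI: "x \<in> S \<Longrightarrow> Map (Ident FI S) x = x"
  by (simp add: FI_def)

lemma Map_FI_in: "\<phi> \<in> Hom FI S X \<Longrightarrow> x \<in> S \<Longrightarrow> Map \<phi> x \<in> X"
  by (auto simp: Hom_FI)

lemma Map_FI_inj: "\<phi> \<in> Hom FI S X \<Longrightarrow> inj_on (Map \<phi>) S"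
  by (auto simp: Hom_FI)

lemma FI_arrow_eqI:
  assumes "\<phi> \<in> Hom FI S X" "\<psi> \<in> Hom FI S X" "\<And>x. x \<in> S \<Longrightarrow> Map \<phi> x = Map \<psi> x"
  shows "\<phi> = \<psi>"
  using assms by (auto simp: Hom_FI intro!: arrow.equality intro: PiE_ext)

lemma category_FI: "category FI"
proof
  show "Dom FI f \<in> Obj FI" "Cod FI f \<in> Obj FI" if "f \<in> Arr FI" for f
    using that by (auto simp: FI_def)
  show "Ident FI X \<in> Hom FI X X" if "X \<in> Obj FI" for X
    using that by (auto simp: Hom_FI Ident_FI inj_on_def)
  show comp: "Comp FI g f \<in> Hom FI X Z" if "f \<in> Hom FI X Y" "g \<in> Hom FI Y Z" for f g X Y Z
    using that comp_inj_on[of "Map f" X "Map g"] 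
    by (auto simp: Hom_FI Comp_FI compose_def PiE_iff inj_on_def)
  show "Comp FI h (Comp FI g f) = Comp FI (Comp FI h g) f"
    if "f \<in> Hom FI W X" "g \<in> Hom FI X Y" "h \<in> Hom FI Y Z" for f g h W X Y Z
    using that by (auto simp: Comp_FI Hom_FI compose_def fun_eq_iff)
  show "Comp FI f (Ident FI X) = f" if "f \<in> Hom FI X Y" for f X Y
    using that by (auto simp: Comp_FI Hom_FI compose_def fun_eq_iff Ident_FI PiE_iff extensional_def intro!: arrow.equality)
  show "Comp FI (Ident FI Y) f = f" if "f \<in> Hom FI X Y" for f X Y
    using that by (auto simp: Comp_FI Hom_FI compose_def fun_eq_iff Ident_FI PiE_iff extensional_def intro!: arrow.equality)
qed

interpretation FI: category FI by (rule category_FI)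

definition mk_inj :: "nat set \<Rightarrow> nat set \<Rightarrow> (nat \<Rightarrow> nat) \<Rightarrow> FI_arr" where
  "mk_inj S X f = \<lparr>Src = S, Trg = X, Map = restrict f S\<rparr>"

lemma mk_inj_Hom: "finite S \<Longrightarrow> finite X \<Longrightarrow> f ` S \<subseteq> X \<Longrightarrow> inj_on f S \<Longrightarrow> mk_inj S X f \<in> Hom FI S X"
  by (auto simp: Hom_FI mk_inj_def inj_on_def)

lemma Map_mk_inj [simp]: "x \<in> S \<Longrightarrow> Map (mk_inj S X f) x = f x"
  by (simp add: mk_inj_def)

lemma choice1E:
  assumes "\<And>x. A x \<Longrightarrow> \<exists>y. P x y"
  obtains f where "\<And>x. A x \<Longrightarrow> P x (f x)"
  using assms by metis

lemma choice2E:
  assumes "\<And>x. A x \<Longrightarrow> \<exists>y z. P x y z"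
  obtains f g where "\<And>x. A x \<Longrightarrow> P x (f x) (g x)"
  using assms by metis

text \<open>Source and target can be read off an arrow of \<open>FI\<close>, so the choice may
  depend on \<phi> alone although the property mentions S and X.\<close>

lemma FI_choiceE:
  assumes "\<And>\<phi> S X. \<phi> \<in> Hom FI S X \<Longrightarrow> \<exists>g. P S X \<phi> g"
  obtains f where "\<And>\<phi> S X. \<phi> \<in> Hom FI S X \<Longrightarrow> P S X \<phi> (f \<phi>)"
proof (rule that)
  show "P S X \<phi> (SOME g. P (Src \<phi>) (Trg \<phi>) \<phi> g)" if "\<phi> \<in> Hom FI S X" for \<phi> S X
    using assms[OF that] that by (auto simp: Hom_FI intro: someI_ex)
qed

context module_category begin

abbreviation "FM \<equiv> FIMod small R"

lemma category_FIMod: "category FM"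
  unfolding FIMod_def by (rule category_functor_category[OF category_FI Md.category_axioms])

sublocale FM: category FM by (rule category_FIMod)

lemma Obj_FIMod: "V \<in> Obj FM \<longleftrightarrow> is_functor FI Md V"
  by (simp add: FIMod_def)

abbreviation push :: "('r, 'm, 'u) FImod_obj \<Rightarrow> FI_arr \<Rightarrow> 'r \<Rightarrow> 'u \<Rightarrow> 'u" where
  "push V \<phi> r x \<equiv> app (FArr V \<phi>) r x"

abbreviation comp_at :: "('r, 'm, 'u) FImod_arr \<Rightarrow> nat set \<Rightarrow> 'r \<Rightarrow> 'u \<Rightarrow> 'u" where
  "comp_at \<alpha> S r x \<equiv> app (Map \<alpha> S) r x"

lemma FObj_Mod: "V \<in> Obj FM \<Longrightarrow> finite S \<Longrightarrow> FObj V S \<in> Obj Md"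
  by (simp add: Obj_FIMod functor_FObj)

lemma FArr_Mod: "V \<in> Obj FM \<Longrightarrow> \<phi> \<in> Hom FI S X \<Longrightarrow> FArr V \<phi> \<in> Hom Md (FObj V S) (FObj V X)"
  by (simp add: Obj_FIMod functor_FArr)

lemma Hom_FI_finite: "\<phi> \<in> Hom FI S X \<Longrightarrow> finite S" "\<phi> \<in> Hom FI S X \<Longrightarrow> finite X"
  by (auto simp: Hom_FI)

lemma push_Comp:
  assumes "V \<in> Obj FM" "\<phi> \<in> Hom FI S X" "\<psi> \<in> Hom FI X Y" "r \<in> Obj R" "x \<in> el (FObj V S) r"
  shows "push V (Comp FI \<psi> \<phi>) r x = push V \<psi> r (push V \<phi> r x)"
  using assms functor_Comp[of FI Md V \<phi> S X \<psi> Y] by (simp add: Obj_FIMod app_Comp[OF functor_FArr])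

lemma push_Ident:
  "V \<in> Obj FM \<Longrightarrow> finite S \<Longrightarrow> r \<in> Obj R \<Longrightarrow> x \<in> el (FObj V S) r \<Longrightarrow> push V (Ident FI S) r x = x"
  by (simp add: Obj_FIMod functor_Ident app_Ident)

lemma push_closed: "V \<in> Obj FM \<Longrightarrow> \<phi> \<in> Hom FI S X \<Longrightarrow> r \<in> Obj R \<Longrightarrow> x \<in> el (FObj V S) r \<Longrightarrow>
    push V \<phi> r x \<in> el (FObj V X) r"
  by (rule app_closed[OF FArr_Mod])

lemmas Hom_FIMod_Obj = FM.Hom_Obj

lemma component_Mod: "\<alpha> \<in> Hom FM V W \<Longrightarrow> finite S \<Longrightarrow> Map \<alpha> S \<in> Hom Md (FObj V S) (FObj W S)"
  using nat_trans_component[of \<alpha> FI Md V W S] by (simp add: FIMod_def)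

lemma component_push:
  assumes "\<alpha> \<in> Hom FM V W" "\<phi> \<in> Hom FI S X" "r \<in> Obj R" "x \<in> el (FObj V S) r"
  shows "comp_at \<alpha> X r (push V \<phi> r x) = push W \<phi> r (comp_at \<alpha> S r x)"
proof -
  have "Comp Md (Map \<alpha> X) (FArr V \<phi>) = Comp Md (FArr W \<phi>) (Map \<alpha> S)"
    using nat_trans_natural[of \<alpha> FI Md V W \<phi> S X] assms by (simp add: FIMod_def)
  then show ?thesis
    using assms app_Comp[OF FArr_Mod[OF Hom_FIMod_Obj(1)[OF assms(1)] assms(2)] assms(3,4), of "Map \<alpha> X"]
      app_Comp[OF component_Mod[OF assms(1) Hom_FI_finite(1)[OF assms(2)]] assms(3,4), of "FArr W \<phi>"]
    by simp
qed

lemma component_Comp: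
  assumes "\<alpha> \<in> Hom FM V W" "finite S" "r \<in> Obj R" "x \<in> el (FObj V S) r"
  shows "comp_at (Comp FM \<beta> \<alpha>) S r x = comp_at \<beta> S r (comp_at \<alpha> S r x)"
  using assms app_Comp[OF component_Mod] by (simp add: FIMod_def)

lemma component_Ident:
  "finite S \<Longrightarrow> r \<in> Obj R \<Longrightarrow> x \<in> el (FObj V S) r \<Longrightarrow> comp_at (Ident FM V) S r x = x"
  by (simp add: FIMod_def app_Ident)

lemma FI_module_arrow_eqI:
  assumes "\<alpha> \<in> Hom FM V W" "\<beta> \<in> Hom FM V W"
    and "\<And>S r x. finite S \<Longrightarrow> r \<in> Obj R \<Longrightarrow> x \<in> el (FObj V S) r \<Longrightarrow> comp_at \<alpha> S r x = comp_at \<beta> S r x"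
  shows "\<alpha> = \<beta>"
proof (rule nat_trans_eqI)
  show "\<alpha> \<in> Hom (functor_category FI Md) V W" "\<beta> \<in> Hom (functor_category FI Md) V W"
    using assms(1,2) by (simp_all add: FIMod_def)
  show "Map \<alpha> S = Map \<beta> S" if "S \<in> Obj FI" for S
    using that assms(3) by (intro module_arrow_eqI[OF component_Mod[OF assms(1)] component_Mod[OF assms(2)]]) auto
qed

lemma mk_nat_FIMod:
  assumes V: "V \<in> Obj FM" and W: "W \<in> Obj FM" 
    and h: "\<And>S. finite S \<Longrightarrow> h S \<in> Hom Md (FObj V S) (FObj W S)"
    and nat: "\<And>S X \<phi> r x. \<phi> \<in> Hom FI S X \<Longrightarrow> r \<in> Obj R \<Longrightarrow> x \<in> el (FObj V S) r \<Longrightarrow>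
      app (h X) r (push V \<phi> r x) = push W \<phi> r (app (h S) r x)"
  shows "mk_nat FI V W h \<in> Hom FM V W"
  unfolding FIMod_def
proof (rule FI.mk_nat_Hom)
  show "is_functor FI Md V" "is_functor FI Md W" using V W by (simp_all add: Obj_FIMod)
  show "h S \<in> Hom Md (FObj V S) (FObj W S)" if "S \<in> Obj FI" for S using h that by simp
  fix \<phi> S X assume \<phi>: "\<phi> \<in> Hom FI S X"
  note S = Hom_FI_finite[OF \<phi>]
  show "Comp Md (h X) (FArr V \<phi>) = Comp Md (FArr W \<phi>) (h S)"
    using nat[OF \<phi>] S
    by (intro module_arrow_eqI[OF Md.Comp_Hom[OF FArr_Mod[OF V \<phi>] h] Md.Comp_Hom[OF h FArr_Mod[OF W \<phi>]]])
      (auto simp: app_Comp[OF FArr_Mod[OF V \<phi>]] app_Comp[OF h])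
qed

lemma mk_functor_FIMod:
  assumes M: "\<And>S. finite S \<Longrightarrow> M S \<in> Obj Md"
    and f: "\<And>S X \<phi>. \<phi> \<in> Hom FI S X \<Longrightarrow> f \<phi> \<in> Hom Md (M S) (M X)"
    and id: "\<And>S r x. finite S \<Longrightarrow> r \<in> Obj R \<Longrightarrow> x \<in> el (M S) r \<Longrightarrow> app (f (Ident FI S)) r x = x"
    and comp: "\<And>S X Y \<phi> \<psi> r x. \<phi> \<in> Hom FI S X \<Longrightarrow> \<psi> \<in> Hom FI X Y \<Longrightarrow> r \<in> Obj R \<Longrightarrow> x \<in> el (M S) r \<Longrightarrow>
      app (f (Comp FI \<psi> \<phi>)) r x = app (f \<psi>) r (app (f \<phi>) r x)"
  shows "mk_functor FI M f \<in> Obj FM"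
  unfolding Obj_FIMod
proof (rule FI.is_functor_mk_functor)
  show "M S \<in> Obj Md" if "S \<in> Obj FI" for S using M that by simp
  show "f \<phi> \<in> Hom Md (M S) (M X)" if "\<phi> \<in> Hom FI S X" for \<phi> S X using f that by simp
  show "f (Ident FI S) = Ident Md (M S)" if "S \<in> Obj FI" for S
    using that id M by (intro module_arrow_eqI[OF f[OF FI.Ident_Hom] Md.Ident_Hom]) (auto simp: app_Ident)
  show "f (Comp FI \<psi> \<phi>) = Comp Md (f \<psi>) (f \<phi>)" if "\<phi> \<in> Hom FI S X" "\<psi> \<in> Hom FI X Y" for \<phi> \<psi> S X Y
    using that comp by (intro module_arrow_eqI[OF f[OF FI.Comp_Hom] Md.Comp_Hom[OF f f]]) (auto simp: app_Comp[OF f])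
qed

section \<open>Subfunctors, quotients and zero arrows of FI-modules\<close>

lemma subfunctor:
  assumes V: "V \<in> Obj FM" and D: "\<And>S. finite S \<Longrightarrow> submodule (FObj V S) (D S)"
    and push: "\<And>S X \<phi> r x. \<phi> \<in> Hom FI S X \<Longrightarrow> r \<in> Obj R \<Longrightarrow> x \<in> D S r \<Longrightarrow> push V \<phi> r x \<in> D X r"
  shows "\<exists>N \<in> Obj FM. \<exists>i \<in> Hom FM N V. \<forall>S. finite S \<longrightarrow>
    (\<forall>r \<in> Obj R. el (FObj N S) r = D S r \<and> (\<forall>x \<in> D S r. comp_at i S r x = x))"
proof -
  have "\<exists>N i. i \<in> Hom Md N (FObj V S) \<and> (\<forall>r \<in> Obj R. el N r = D S r \<and> (\<forall>x \<in> D S r. app i r x = x))"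
    if "finite S" for S
    using submodule_object[OF FObj_Mod[OF V that] D[OF that]] by blast
  then obtain N i where i: "\<And>S. finite S \<Longrightarrow> i S \<in> Hom Md (N S) (FObj V S)"
    and N: "\<And>S r. finite S \<Longrightarrow> r \<in> Obj R \<Longrightarrow> el (N S) r = D S r"
    and i_eq: "\<And>S r x. finite S \<Longrightarrow> r \<in> Obj R \<Longrightarrow> x \<in> D S r \<Longrightarrow> app (i S) r x = x"
    by metis
  have "\<exists>g. g \<in> Hom Md (N S) (N X) \<and> Comp Md (i X) g = Comp Md (FArr V \<phi>) (i S)" if \<phi>: "\<phi> \<in> Hom FI S X" for S X \<phi>
    using Hom_FI_finite[OF \<phi>] N i_eq push[OF \<phi>]
    by (intro factor_through_mono[OF i _ Md.Comp_Hom[OF i FArr_Mod[OF V \<phi>]], unfolded Bex_def])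
      (auto simp: inj_on_def app_Comp[OF i] image_iff)
  then obtain g where g': "\<And>\<phi> S X. \<phi> \<in> Hom FI S X \<Longrightarrow>
      g \<phi> \<in> Hom Md (N S) (N X) \<and> Comp Md (i X) (g \<phi>) = Comp Md (FArr V \<phi>) (i S)"
    by (rule FI_choiceE) (assumption, rule that)
  note g = g'[THEN conjunct1] g'[THEN conjunct2]
  have g_eq: "app (g \<phi>) r x = push V \<phi> r x" if \<phi>: "\<phi> \<in> Hom FI S X" and r: "r \<in> Obj R" and x: "x \<in> D S r" for \<phi> S X r x
  proof -
    note fin = Hom_FI_finite[OF \<phi>]
    have "app (i X) r (app (g \<phi>) r x) = push V \<phi> r (app (i S) r x)"
      using arg_cong[OF g(2)[OF \<phi>], of "\<lambda>f. app f r x"] r x N[OF fin(1) r]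
      by (simp add: app_Comp[OF g(1)[OF \<phi>]] app_Comp[OF i[OF fin(1)]])
    then show ?thesis
      using i_eq[OF fin(2) r] i_eq[OF fin(1) r x] app_closed[OF g(1)[OF \<phi>] r, of x] N[OF _ r] fin x by simp
  qed
  have NF: "mk_functor FI N g \<in> Obj FM"
  proof (rule mk_functor_FIMod)
    show "N S \<in> Obj Md" if "finite S" for S using Hom_Mod_Obj(1)[OF i[OF that]] .
    show "g \<phi> \<in> Hom Md (N S) (N X)" if "\<phi> \<in> Hom FI S X" for S X \<phi> using g(1)[OF that] .
    show "app (g (Ident FI S)) r x = x" if "finite S" "r \<in> Obj R" "x \<in> el (N S) r" for S r x
      using that g_eq[OF FI.Ident_Hom, of S r x] push_Ident[OF V] subrepD(2)[OF D] N by simp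
    show "app (g (Comp FI \<psi> \<phi>)) r x = app (g \<psi>) r (app (g \<phi>) r x)"
      if \<phi>: "\<phi> \<in> Hom FI S X" and \<psi>: "\<psi> \<in> Hom FI X Y" and r: "r \<in> Obj R" and "x \<in> el (N S) r" for S X Y \<phi> \<psi> r x
    proof -
      have x: "x \<in> D S r" using that(4) N[OF Hom_FI_finite(1)[OF \<phi>] r] by simp
      then show ?thesis
        using g_eq[OF \<phi> r x] g_eq[OF \<psi> r push[OF \<phi> r x]] g_eq[OF FI.Comp_Hom[OF \<phi> \<psi>] r x]
          push_Comp[OF V \<phi> \<psi> r] subrepD(2)[OF D[OF Hom_FI_finite(1)[OF \<phi>]] r] by simp
    qed
  qed
  have "mk_nat FI (mk_functor FI N g) V i \<in> Hom FM (mk_functor FI N g) V"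
  proof (rule mk_nat_FIMod[OF NF V])
    fix S X \<phi> r x assume \<phi>: "\<phi> \<in> Hom FI S X" and r: "r \<in> Obj R" and "x \<in> el (FObj (mk_functor FI N g) S) r"
    then have x: "x \<in> D S r" using N[OF Hom_FI_finite(1)[OF \<phi>]] Hom_FI_finite(1)[OF \<phi>] by simp
    then show "app (i X) r (push (mk_functor FI N g) \<phi> r x) = push V \<phi> r (app (i S) r x)"
      using \<phi> r push[OF \<phi> r x] i_eq Hom_FI_finite[OF \<phi>] by (simp add: g_eq)
  qed (use i in auto)
  then show ?thesis
    using NF N i_eq by (intro bexI[of _ "mk_functor FI N g"] bexI[of _ "mk_nat FI (mk_functor FI N g) V i"]) auto
qed

text \<open>Pointwise cokernels form a functor: each \<open>q S\<close> is onto and pushing forward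
  preserves the image of \<open>u\<close>, so the structure maps of \<open>B\<close>
  descend.\<close>

lemma quotient_functor:
  assumes u: "u \<in> Hom FM A B"
  shows "\<exists>Q. \<exists>q \<in> Hom FM B Q. \<forall>S. finite S \<longrightarrow> (\<forall>r \<in> Obj R.
    app (Map q S) r ` el (FObj B S) r = el (FObj Q S) r \<and>
    {x \<in> el (FObj B S) r. comp_at q S r x = neut (FObj Q S) r} = app (Map u S) r ` el (FObj A S) r)"
proof -
  note B = Hom_FIMod_Obj(2)[OF u] and A = Hom_FIMod_Obj(1)[OF u]
  have "\<exists>Q q. q \<in> Hom Md (FObj B S) Q \<and> (\<forall>r \<in> Obj R. app q r ` el (FObj B S) r = el Q r \<and>
    {x \<in> el (FObj B S) r. app q r x = neut Q r} = app (Map u S) r ` el (FObj A S) r)"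
    if "finite S" for S
    using cokernel_exists[OF component_Mod[OF u that]] by blast
  then obtain Q q where "\<And>S. finite S \<Longrightarrow> q S \<in> Hom Md (FObj B S) (Q S) \<and>
      (\<forall>r \<in> Obj R. app (q S) r ` el (FObj B S) r = el (Q S) r \<and>
      {x \<in> el (FObj B S) r. app (q S) r x = neut (Q S) r} = app (Map u S) r ` el (FObj A S) r)"
    by (rule choice2E) (assumption, rule that)
  then have q: "\<And>S. finite S \<Longrightarrow> q S \<in> Hom Md (FObj B S) (Q S)"
    and surj: "\<And>S r. finite S \<Longrightarrow> r \<in> Obj R \<Longrightarrow> app (q S) r ` el (FObj B S) r = el (Q S) r"
    and ker: "\<And>S r. finite S \<Longrightarrow> r \<in> Obj R \<Longrightarrow>
      {x \<in> el (FObj B S) r. app (q S) r x = neut (Q S) r} = app (Map u S) r ` el (FObj A S) r"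
    by simp_all
  have "\<exists>g. g \<in> Hom Md (Q S) (Q X) \<and> Comp Md g (q S) = Comp Md (q X) (FArr B \<phi>)" if \<phi>: "\<phi> \<in> Hom FI S X" for S X \<phi>
  proof (rule factor_through_epi[OF q surj Md.Comp_Hom[OF FArr_Mod[OF B \<phi>] q], unfolded Bex_def])
    fix r x assume r: "r \<in> Obj R" and x: "x \<in> el (FObj B S) r" "app (q S) r x = neut (Q S) r"
    then obtain y where y: "y \<in> el (FObj A S) r" "x = comp_at u S r y"
      using ker[OF Hom_FI_finite(1)[OF \<phi>] r] by blast
    have "push B \<phi> r x = comp_at u X r (push A \<phi> r y)" using component_push[OF u \<phi> r y(1)] y(2) by simp
    then have "app (q X) r (push B \<phi> r x) = neut (Q X) r"
      using ker[OF Hom_FI_finite(2)[OF \<phi>] r] push_closed[OF A \<phi> r y(1)] by blast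
    then show "app (Comp Md (q X) (FArr B \<phi>)) r x = neut (Q X) r"
      using r x by (simp add: app_Comp[OF FArr_Mod[OF B \<phi>]])
  qed (use Hom_FI_finite[OF \<phi>] in auto)
  then obtain g where g': "\<And>\<phi> S X. \<phi> \<in> Hom FI S X \<Longrightarrow>
      g \<phi> \<in> Hom Md (Q S) (Q X) \<and> Comp Md (g \<phi>) (q S) = Comp Md (q X) (FArr B \<phi>)"
    by (rule FI_choiceE) (assumption, rule that)
  note g = g'[THEN conjunct1] g'[THEN conjunct2]
  have g_eq: "app (g \<phi>) r (app (q S) r x) = app (q X) r (push B \<phi> r x)"
    if \<phi>: "\<phi> \<in> Hom FI S X" and r: "r \<in> Obj R" and x: "x \<in> el (FObj B S) r" for \<phi> S X r x
    using arg_cong[OF g(2)[OF \<phi>], of "\<lambda>f. app f r x"] r x Hom_FI_finite[OF \<phi>]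
    by (simp add: app_Comp[OF q] app_Comp[OF FArr_Mod[OF B \<phi>]])
  have ex: "\<exists>x \<in> el (FObj B S) r. y = app (q S) r x" if "finite S" "r \<in> Obj R" "y \<in> el (Q S) r" for S r y
    using surj that by blast
  have QF: "mk_functor FI Q g \<in> Obj FM"
  proof (rule mk_functor_FIMod)
    show "Q S \<in> Obj Md" if "finite S" for S using Hom_Mod_Obj(2)[OF q[OF that]] .
    show "g \<phi> \<in> Hom Md (Q S) (Q X)" if "\<phi> \<in> Hom FI S X" for S X \<phi> using g(1)[OF that] .
    show "app (g (Ident FI S)) r y = y" if S: "finite S" and r: "r \<in> Obj R" and y: "y \<in> el (Q S) r" for S r y
      using ex[OF S r y] S g_eq[OF FI.Ident_Hom r] push_Ident[OF B S r] by auto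
    show "app (g (Comp FI \<psi> \<phi>)) r y = app (g \<psi>) r (app (g \<phi>) r y)"
      if \<phi>: "\<phi> \<in> Hom FI S X" and \<psi>: "\<psi> \<in> Hom FI X Y" and r: "r \<in> Obj R" and y: "y \<in> el (Q S) r" for S X Y \<phi> \<psi> r y
      using ex[OF Hom_FI_finite(1)[OF \<phi>] r y] g_eq[OF \<phi> r] g_eq[OF \<psi> r push_closed[OF B \<phi> r]]
        g_eq[OF FI.Comp_Hom[OF \<phi> \<psi>] r] push_Comp[OF B \<phi> \<psi> r] by auto
  qed
  have "mk_nat FI B (mk_functor FI Q g) q \<in> Hom FM B (mk_functor FI Q g)"
    using q Hom_FI_finite by (intro mk_nat_FIMod[OF B QF]) (auto simp: g_eq)
  then show ?thesis
    using surj ker by (intro exI[of _ "mk_functor FI Q g"] bexI[of _ "mk_nat FI B (mk_functor FI Q g) q"]) auto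
qed

definition zero_nat :: "('r, 'm, 'u) FImod_obj \<Rightarrow> ('r, 'm, 'u) FImod_obj \<Rightarrow> ('r, 'm, 'u) FImod_arr" where
  "zero_nat V W = mk_nat FI V W (\<lambda>S. mk_arr (FObj V S) (FObj W S) (\<lambda>r _. neut (FObj W S) r))"

lemma comp_at_zero_nat [simp]:
  "finite S \<Longrightarrow> r \<in> Obj R \<Longrightarrow> x \<in> el (FObj V S) r \<Longrightarrow> comp_at (zero_nat V W) S r x = neut (FObj W S) r"
  by (simp add: zero_nat_def)

lemma zero_nat_Hom:
  assumes V: "V \<in> Obj FM" and W: "W \<in> Obj FM"
  shows "zero_nat V W \<in> Hom FM V W"
  unfolding zero_nat_def
proof (rule mk_nat_FIMod[OF V W])
  fix S :: "nat set" assume S: "finite S"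
  show "mk_arr (FObj V S) (FObj W S) (\<lambda>r _. neut (FObj W S) r) \<in> Hom Md (FObj V S) (FObj W S)"
  proof (intro mk_arr_Hom FObj_Mod V W S)
    show "(\<lambda>_. neut (FObj W S) r) \<in> hom (fib (FObj V S) r) (fib (FObj W S) r)" if "r \<in> Obj R" for r
      using fib_comm_group[OF FObj_Mod[OF W S] that]
      by (auto simp: hom_def comm_group_def group_def intro: monoid.one_closed monoid.l_one[symmetric])
  qed (simp add: act_one[OF FObj_Mod[OF W S]])
next
  fix S X \<phi> r x assume \<phi>: "\<phi> \<in> Hom FI S X" and r: "r \<in> Obj R" and x: "x \<in> el (FObj V S) r"
  then show "app (mk_arr (FObj V X) (FObj W X) (\<lambda>r _. neut (FObj W X) r)) r (push V \<phi> r x) =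
      push W \<phi> r (app (mk_arr (FObj V S) (FObj W S) (\<lambda>r _. neut (FObj W S) r)) r x)"
    using push_closed[OF V \<phi> r x] app_one[OF FArr_Mod[OF W \<phi>] r] by simp
qed

lemma is_zero_arrow_FIMod:
  assumes \<alpha>: "\<alpha> \<in> Hom FM V W"
  shows "is_zero_arrow FM \<alpha> \<longleftrightarrow>
    (\<forall>S r x. finite S \<and> r \<in> Obj R \<and> x \<in> el (FObj V S) r \<longrightarrow> comp_at \<alpha> S r x = neut (FObj W S) r)"
proof
  note O = Hom_FIMod_Obj[OF \<alpha>]
  {
    assume "is_zero_arrow FM \<alpha>"
    then obtain Z g h where Z: "is_zero_object FM Z" and g: "g \<in> Hom FM V Z" and h: "h \<in> Hom FM Z W" and eq: "\<alpha> = Comp FM h g"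
      using HomD[OF \<alpha>] by (auto simp: is_zero_arrow_def)
    have ZO: "Z \<in> Obj FM" using Hom_FIMod_Obj[OF g] by simp
    have eq': "zero_nat Z Z = Ident FM Z"
      using Z ZO zero_nat_Hom[OF ZO ZO] FM.Ident_Hom[OF ZO] unfolding is_zero_object_def by blast
    have triv: "y = neut (FObj Z S) r" if "finite S" "r \<in> Obj R" "y \<in> el (FObj Z S) r" for S r y
      using arg_cong[OF eq', of "\<lambda>f. comp_at f S r y"] that by (simp add: component_Ident)
    show "\<forall>S r x. finite S \<and> r \<in> Obj R \<and> x \<in> el (FObj V S) r \<longrightarrow> comp_at \<alpha> S r x = neut (FObj W S) r"
    proof (intro allI impI, elim conjE)
      fix S r x assume S: "finite S" and r: "r \<in> Obj R" and x: "x \<in> el (FObj V S) r"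
      have "comp_at g S r x = neut (FObj Z S) r" using triv[OF S r app_closed[OF component_Mod[OF g S] r x]] .
      then show "comp_at \<alpha> S r x = neut (FObj W S) r"
        using app_one[OF component_Mod[OF h S] r] by (simp add: eq component_Comp[OF g S r x])
    qed
  }
  assume 0: "\<forall>S r x. finite S \<and> r \<in> Obj R \<and> x \<in> el (FObj V S) r \<longrightarrow> comp_at \<alpha> S r x = neut (FObj W S) r"
  obtain Z0 where Z0: "Z0 \<in> Obj Md" "\<And>r. r \<in> Obj R \<Longrightarrow> el Z0 r = {neut Z0 r}" using zero_module by blast
  \<comment> \<open>The constant FI-module on a zero module is a zero object, and the given arrow
    factors through it.\<close>
  define Z where "Z = mk_functor FI (\<lambda>_. Z0) (\<lambda>_. Ident Md Z0)"
  have ZO: "Z \<in> Obj FM"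
    unfolding Z_def by (rule mk_functor_FIMod) (auto simp: Z0(1) app_Ident intro: Md.Ident_Hom)
  have triv: "el (FObj Z S) r = {neut (FObj Z S) r}" if "finite S" "r \<in> Obj R" for S r
    using that Z0(2) by (simp add: Z_def)
  have uniq1: "f = g" if f: "f \<in> Hom FM X Z" and g: "g \<in> Hom FM X Z" for X f g
  proof (rule FI_module_arrow_eqI[OF f g])
    fix S r x assume *: "finite S" "r \<in> Obj R" "x \<in> el (FObj X S) r"
    show "comp_at f S r x = comp_at g S r x"
      using app_closed[OF component_Mod[OF f *(1)] *(2,3)] app_closed[OF component_Mod[OF g *(1)] *(2,3)] triv[OF *(1,2)] by simp
  qed
  have uniq2: "f = g" if f: "f \<in> Hom FM Z X" and g: "g \<in> Hom FM Z X" for X f g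
  proof (rule FI_module_arrow_eqI[OF f g])
    fix S r x assume *: "finite S" "r \<in> Obj R" "x \<in> el (FObj Z S) r"
    show "comp_at f S r x = comp_at g S r x"
      using app_one[OF component_Mod[OF f *(1)] *(2)] app_one[OF component_Mod[OF g *(1)] *(2)] triv[OF *(1,2)] *(3) by simp
  qed
  have Z: "is_zero_object FM Z"
    unfolding is_zero_object_def using ZO zero_nat_Hom uniq1 uniq2 by blast
  note g = zero_nat_Hom[OF O(1) ZO] and h = zero_nat_Hom[OF ZO O(2)]
  have "Comp FM (zero_nat Z W) (zero_nat V Z) = \<alpha>"
    using 0 triv by (intro FI_module_arrow_eqI[OF FM.Comp_Hom[OF g h] \<alpha>]) (simp add: component_Comp[OF g])
  then show "is_zero_arrow FM \<alpha>" using HomD[OF \<alpha>] g h unfolding is_zero_arrow_def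
    by (intro conjI exI[of _ Z] bexI[of _ "zero_nat V Z"] bexI[of _ "zero_nat Z W"] Z) simp_all
qed

end

section \<open>Abstract kernels and cokernels seen on elements\<close>

context module_category begin

text \<open>A kernel is given only by its universal property. The elements killed by
  \<open>u\<close> form a subfunctor of \<open>A\<close>; its inclusion factors through
  \<open>k\<close>, and this places all of them in the image of \<open>k\<close>.\<close>

lemma kernel_elements:
  assumes u: "u \<in> Hom FM A B" and ker: "is_kernel FM u k" and S: "finite S" and r: "r \<in> Obj R"
  shows "{x \<in> el (FObj A S) r. comp_at u S r x = neut (FObj B S) r} \<subseteq>
    comp_at k S r ` el (FObj (Dom FM k) S) r"
proof
  note O = Hom_FIMod_Obj[OF u]
  let ?D = "\<lambda>S r. {x \<in> el (FObj A S) r. comp_at u S r x = neut (FObj B S) r}"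
  fix x assume x: "x \<in> ?D S r"
  have "\<exists>N \<in> Obj FM. \<exists>i \<in> Hom FM N A. \<forall>S. finite S \<longrightarrow>
    (\<forall>r \<in> Obj R. el (FObj N S) r = ?D S r \<and> (\<forall>x \<in> ?D S r. comp_at i S r x = x))"
    using push_closed[OF O(1)] component_push[OF u] app_one[OF FArr_Mod[OF O(2)]]
    by (intro subfunctor[OF O(1) kernel_subrep[OF component_Mod[OF u]]]) simp_all
  then obtain N i where i: "i \<in> Hom FM N A"
    and *: "\<forall>S. finite S \<longrightarrow> (\<forall>r \<in> Obj R. el (FObj N S) r = ?D S r \<and> (\<forall>x \<in> ?D S r. comp_at i S r x = x))"
    by (elim bexE) (rule that)
  have N: "el (FObj N S) r = ?D S r" and i_eq: "x \<in> el (FObj N S) r \<Longrightarrow> comp_at i S r x = x"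
    if "finite S" "r \<in> Obj R" for S r x
    using * that by blast+
  have "is_zero_arrow FM (Comp FM u i)"
    unfolding is_zero_arrow_FIMod[OF FM.Comp_Hom[OF i u]]
  proof (intro allI impI; elim conjE)
    fix S r x assume S: "finite S" "r \<in> Obj R" and x: "x \<in> el (FObj N S) r"
    then show "comp_at (Comp FM u i) S r x = neut (FObj B S) r"
      using component_Comp[OF i S x] i_eq[OF S x] N[OF S] by simp
  qed
  then have 0: "Cod FM i = Dom FM u \<and> is_zero_arrow FM (Comp FM u i)" using HomD(3)[OF i] HomD(2)[OF u] by simp
  have "\<forall>h \<in> Arr FM. Cod FM h = Dom FM u \<and> is_zero_arrow FM (Comp FM u h) \<longrightarrow>
      (\<exists>!h'. h' \<in> Hom FM (Dom FM h) (Dom FM k) \<and> Comp FM k h' = h)"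
    using ker unfolding is_kernel_def by (elim conjE)
  from mp[OF bspec[OF this HomD(1)[OF i]] 0]
  obtain h where "h \<in> Hom FM (Dom FM i) (Dom FM k)" and eq: "Comp FM k h = i" by (elim ex1E conjE) (rule that)
  then have h: "h \<in> Hom FM N (Dom FM k)" using HomD(2)[OF i] by simp
  have xN: "x \<in> el (FObj N S) r" using x N[OF S r] by simp
  have "x = comp_at k S r (comp_at h S r x)"
    using component_Comp[OF h S r xN, of k] i_eq[OF S r xN] eq by simp
  then show "x \<in> comp_at k S r ` el (FObj (Dom FM k) S) r"
    by (rule image_eqI) (rule app_closed[OF component_Mod[OF h S] r xN])
qed

text \<open>The image of \<open>u\<close> dies under \<open>q\<close> because their composite is a
  zero arrow. Conversely the pointwise cokernel \<open>p\<close> factors through \<open>q\<close>,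
  so whatever \<open>q\<close> kills is killed by \<open>p\<close> and therefore comes from
  \<open>A\<close>.\<close>

lemma cokernel_elements:
  assumes u: "u \<in> Hom FM A B" and coker: "is_cokernel FM u q" and S: "finite S" and r: "r \<in> Obj R"
  shows "{x \<in> el (FObj B S) r. comp_at q S r x = neut (FObj (Cod FM q) S) r} =
    comp_at u S r ` el (FObj A S) r"
proof (intro equalityI subsetI)
  have q: "q \<in> Hom FM B (Cod FM q)" using coker HomD[OF u] by (auto simp: is_cokernel_def intro: HomI)
  have "is_zero_arrow FM (Comp FM q u)" using coker by (simp add: is_cokernel_def)
  then have qu: "comp_at q S r (comp_at u S r y) = neut (FObj (Cod FM q) S) r" if "y \<in> el (FObj A S) r" for y
    using component_Comp[OF u S r that, of q] S r that unfolding is_zero_arrow_FIMod[OF FM.Comp_Hom[OF u q]] by simp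
  show "x \<in> {x \<in> el (FObj B S) r. comp_at q S r x = neut (FObj (Cod FM q) S) r}"
    if "x \<in> comp_at u S r ` el (FObj A S) r" for x
    using that qu app_closed[OF component_Mod[OF u S] r] by auto
  obtain Q p where p: "p \<in> Hom FM B Q"
    and *: "\<forall>S. finite S \<longrightarrow> (\<forall>r \<in> Obj R. app (Map p S) r ` el (FObj B S) r = el (FObj Q S) r \<and>
      {x \<in> el (FObj B S) r. comp_at p S r x = neut (FObj Q S) r} = app (Map u S) r ` el (FObj A S) r)"
    using quotient_functor[OF u] by (elim exE bexE) (rule that)
  have ker: "{x \<in> el (FObj B S) r. comp_at p S r x = neut (FObj Q S) r} = app (Map u S) r ` el (FObj A S) r"
    if "finite S" "r \<in> Obj R" for S r
    by (rule *[rule_format, OF that, THEN conjunct2])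
  have "is_zero_arrow FM (Comp FM p u)"
    unfolding is_zero_arrow_FIMod[OF FM.Comp_Hom[OF u p]] using ker by (auto simp: component_Comp[OF u])
  then have 0: "Dom FM p = Cod FM u \<and> is_zero_arrow FM (Comp FM p u)" using HomD(2)[OF p] HomD(3)[OF u] by simp
  have "\<forall>h \<in> Arr FM. Dom FM h = Cod FM u \<and> is_zero_arrow FM (Comp FM h u) \<longrightarrow>
      (\<exists>!h'. h' \<in> Hom FM (Cod FM q) (Cod FM h) \<and> Comp FM h' q = h)"
    using coker unfolding is_cokernel_def by (elim conjE)
  from mp[OF bspec[OF this HomD(1)[OF p]] 0]
  obtain h where "h \<in> Hom FM (Cod FM q) (Cod FM p)" and eq: "Comp FM h q = p" by (elim ex1E conjE) (rule that)
  then have h: "h \<in> Hom FM (Cod FM q) Q" using HomD(3)[OF p] by simp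
  fix x assume "x \<in> {x \<in> el (FObj B S) r. comp_at q S r x = neut (FObj (Cod FM q) S) r}"
  then have x: "x \<in> el (FObj B S) r" "comp_at q S r x = neut (FObj (Cod FM q) S) r" by simp_all
  have "comp_at p S r x = neut (FObj Q S) r"
    using component_Comp[OF q S r x(1), of h] x(2) eq app_one[OF component_Mod[OF h S] r] by simp
  then show "x \<in> comp_at u S r ` el (FObj A S) r" using ker[OF S r] x(1) by blast
qed

section \<open>Representable modules\<close>

lemma representable_rep:
  assumes r: "r \<in> Obj R"
  shows "rep R (yoneda r) precomp"
proof (rule rep.intro)
  show "comm_group (yoneda r t)" if "t \<in> Obj R" for t
    using Hom_comm_group[OF that r] .
  show "(\<lambda>a. Comp R a b) \<in> hom (yoneda r t)
      (yoneda r s)" if "b \<in> Hom R s t" for b s t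
    using Comp_Hom[OF that] Comp_Add_left[OF that] by (auto simp: hom_def)
qed (auto intro: Comp_Ident_right Comp_assoc Comp_Add_right)

text \<open>The arrows of \<open>R\<close> have type \<open>'m\<close>. The injection \<phi>
  supplied by smallness of \<open>R\<close> carries Hom(-, r) to an object of the module category,
  to which closedness and the generators can be applied.\<close>

lemma representable:
  assumes r: "r \<in> Obj R"
  shows "\<exists>H \<in> Obj Md. \<exists>\<phi>. inj_on \<phi> (Arr R) \<and> (\<forall>t \<in> Obj R. el H t = \<phi> ` Hom R t r) \<and>
    (\<forall>t a a'. a \<in> Hom R t r \<and> a' \<in> Hom R t r \<longrightarrow> \<phi> (Add R a a') = \<phi> a \<cdot>[H,t] \<phi> a') \<and>
    (\<forall>s t a b. a \<in> Hom R t r \<and> b \<in> Hom R s t \<longrightarrow> act H b (\<phi> a) = \<phi> (Comp R a b))"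
proof -
  obtain \<phi> :: "'m \<Rightarrow> 'u" where \<phi>: "inj_on \<phi> (Arr R)" "small (\<phi> ` Arr R)"
    using small_R unfolding small_category_def by blast
  let ?G = "yoneda r"
  have eq: "a = a'" if "a \<in> Hom R t r" "a' \<in> Hom R t r" "\<phi> a = \<phi> a'" for a a' t
    using inj_onD[OF \<phi>(1) that(3)] HomD(1)[OF that(1)] HomD(1)[OF that(2)] by simp
  have "\<exists>H \<in> Obj Md. (\<forall>t \<in> Obj R. el H t = \<phi> ` carrier (?G t) \<and> \<phi> \<in> hom (?G t) (fib H t)) \<and>
    (\<forall>s t b a. b \<in> Hom R s t \<and> a \<in> carrier (?G t) \<longrightarrow> act H b (\<phi> a) = \<phi> (Comp R a b))"
  proof (rule module_of_rep[OF representable_rep[OF r]])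
    show "small (\<phi> ` carrier (?G t))" for t
      by (rule small_subset[OF \<phi>(2)]) (auto dest: HomD)
  next
    fix t x x' y y' assume "x \<in> carrier (?G t)" "x' \<in> carrier (?G t)" "y \<in> carrier (?G t)" "y' \<in> carrier (?G t)"
      "\<phi> x = \<phi> x'" "\<phi> y = \<phi> y'"
    then show "\<phi> (x \<otimes>\<^bsub>?G t\<^esub> y) = \<phi> (x' \<otimes>\<^bsub>?G t\<^esub> y')" using eq[of x t x'] eq[of y t y'] by simp
  next
    fix s t b x x' assume "x \<in> carrier (?G t)" "x' \<in> carrier (?G t)" "\<phi> x = \<phi> x'"
    then show "\<phi> (Comp R x b) = \<phi> (Comp R x' b)" using eq[of x t x'] by simp
  qed
  then show ?thesis
    using \<phi>(1) Hom_Obj by (elim bexE, intro bexI exI[of _ \<phi>]) (auto simp: hom_def)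
qed

end

section \<open>Hereditary torsion classes and the hat class\<close>

locale hereditary_class = module_category small R
  for small :: "'u set \<Rightarrow> bool" and R :: "('r, 'm) preadditive" +
  fixes \<T> :: "('r, 'm, 'u) module_obj set"
  assumes T_Obj: "M \<in> \<T> \<Longrightarrow> M \<in> Obj Md" and T_nonempty: "\<T> \<noteq> {}"
    and T_mono: "is_mono Md m \<Longrightarrow> Cod Md m \<in> \<T> \<Longrightarrow> Dom Md m \<in> \<T>"
begin

lemma T_injective:
  assumes i: "i \<in> Hom Md N M" and "\<And>r. r \<in> Obj R \<Longrightarrow> inj_on (app i r) (el N r)" and "M \<in> \<T>"
  shows "N \<in> \<T>"
  using T_mono[OF injective_is_mono[OF assms(1,2)]] assms(3) HomD[OF i] by simp

text \<open>\<open>torsion_hat\<close> looks only at the sets \<open>{1..n}\<close>. A bijection of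
  \<open>X\<close> onto \<open>{1..card X}\<close> has a left inverse in \<open>FI\<close>, so it
  induces an injective map of modules, and closure under subobjects transfers torsion to the value
  at \<open>X\<close>.\<close>

lemma torsion_hat_eventually:
  assumes "V \<in> torsion_hat small R \<T>"
  shows "\<exists>N. \<forall>X. finite X \<and> N \<le> card X \<longrightarrow> FObj V X \<in> \<T>"
proof -
  obtain N where V: "V \<in> Obj FM" and N: "\<And>n. n \<ge> N \<Longrightarrow> FObj V {1..n} \<in> \<T>"
    using assms by (auto simp: torsion_hat_def)
  have "FObj V X \<in> \<T>" if X: "finite X" "N \<le> card X" for X
  proof -
    obtain f where f: "bij_betw f X {1..card X}"
      using finite_same_card_bij[of X "{1..card X}"] X by auto
    define \<phi> where "\<phi> = mk_inj X {1..card X} f"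
    define \<psi> where "\<psi> = mk_inj {1..card X} X (inv_into X f)"
    have \<phi>: "\<phi> \<in> Hom FI X {1..card X}"
      unfolding \<phi>_def using f X by (intro mk_inj_Hom) (auto simp: bij_betw_def)
    have \<psi>: "\<psi> \<in> Hom FI {1..card X} X"
      unfolding \<psi>_def using bij_betw_inv_into[OF f] X by (intro mk_inj_Hom) (auto simp: bij_betw_def)
    have "Map \<phi> x = f x" "Map \<psi> (f x) = x" if "x \<in> X" for x
      using that bij_betwE[OF f] bij_betw_inv_into_left[OF f] by (simp_all add: \<phi>_def \<psi>_def)
    then have *: "Comp FI \<psi> \<phi> = Ident FI X"
      using X(1)
      by (intro FI_arrow_eqI[OF FI.Comp_Hom[OF \<phi> \<psi>] FI.Ident_Hom])
        (auto simp: Map_Comp_FI[OF \<phi>] Map_Ident_FI)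
    have "inj_on (app (FArr V \<phi>) r) (el (FObj V X) r)" if r: "r \<in> Obj R" for r
    proof (rule inj_onI)
      fix x y assume xy: "x \<in> el (FObj V X) r" "y \<in> el (FObj V X) r" "push V \<phi> r x = push V \<phi> r y"
      then show "x = y"
        using push_Comp[OF V \<phi> \<psi> r xy(1)] push_Comp[OF V \<phi> \<psi> r xy(2)] push_Ident[OF V X(1) r] by (simp add: *)
    qed
    then show ?thesis by (rule T_injective[OF FArr_Mod[OF V \<phi>] _ N[OF X(2)]])
  qed
  then show ?thesis by blast
qed

text \<open>A fibrewise form of having torsion kernel and cokernel. \<open>k\<close> only has to
  cover the elements killed by \<open>u\<close> and may fail to be injective; \<open>q\<close> only
  has to have the image of \<open>u\<close> as its kernel and may fail to be onto.\<close>

definition torsion_iso :: "('r, 'm, 'u) module_obj \<Rightarrow> ('r, 'm, 'u) module_obj \<Rightarrow> ('r, 'm, 'u) module_arr \<Rightarrow> bool" where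
  "torsion_iso A B u \<longleftrightarrow> u \<in> Hom Md A B \<and>
    (\<exists>K \<in> \<T>. \<exists>k \<in> Hom Md K A. \<forall>r \<in> Obj R.
      {x \<in> el A r. app u r x = neut B r} \<subseteq> app k r ` el K r) \<and>
    (\<exists>Q \<in> \<T>. \<exists>q \<in> Hom Md B Q. \<forall>r \<in> Obj R.
      {x \<in> el B r. app q r x = neut Q r} = app u r ` el A r)"

lemma pointwise_torsion_iso:
  assumes u: "u \<in> Hom FM A B" and iso: "is_iso_mod FM (torsion_hat small R \<T>) u"
  shows "\<exists>N. \<forall>X. finite X \<and> N \<le> card X \<longrightarrow> torsion_iso (FObj A X) (FObj B X) (Map u X)"
proof -
  obtain k q where k: "is_kernel FM u k" "Dom FM k \<in> torsion_hat small R \<T>"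
    and q: "is_cokernel FM u q" "Cod FM q \<in> torsion_hat small R \<T>"
    using iso by (auto simp: is_iso_mod_def)
  obtain N1 where N1: "\<And>X. finite X \<Longrightarrow> N1 \<le> card X \<Longrightarrow> FObj (Dom FM k) X \<in> \<T>"
    using torsion_hat_eventually[OF k(2)] by blast
  obtain N2 where N2: "\<And>X. finite X \<Longrightarrow> N2 \<le> card X \<Longrightarrow> FObj (Cod FM q) X \<in> \<T>"
    using torsion_hat_eventually[OF q(2)] by blast
  have kH: "k \<in> Hom FM (Dom FM k) A" using k(1) HomD[OF u] by (auto simp: is_kernel_def intro: HomI)
  have qH: "q \<in> Hom FM B (Cod FM q)" using q(1) HomD[OF u] by (auto simp: is_cokernel_def intro: HomI)
  \<comment> \<open>Kernel and cokernel become torsion from different cardinalities on; the maximum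
    serves both.\<close>
  have "torsion_iso (FObj A X) (FObj B X) (Map u X)" if X: "finite X" "max N1 N2 \<le> card X" for X
  proof -
    have N: "N1 \<le> card X" "N2 \<le> card X" using X(2) by simp_all
    show ?thesis
      unfolding torsion_iso_def
      by (intro conjI component_Mod[OF u X(1)] bexI[OF _ N1[OF X(1) N(1)]] bexI[OF _ N2[OF X(1) N(2)]]
        bexI[OF _ component_Mod[OF kH X(1)]] bexI[OF _ component_Mod[OF qH X(1)]] ballI
        kernel_elements[OF u k(1) X(1)] cokernel_elements[OF u q(1) X(1)])
  qed
  then show ?thesis by blast
qed

text \<open>Applied to the inclusion of a dense ideal into a representable module: the cokernel of
  \<open>u\<close> embeds into the torsion module \<open>Q\<close>, so heredity makes it
  torsion.\<close>

lemma is_iso_modI: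
  assumes u: "u \<in> Hom Md A B" and inj: "\<And>r. r \<in> Obj R \<Longrightarrow> inj_on (app u r) (el A r)"
    and v: "v \<in> Hom Md B Q" and Q: "Q \<in> \<T>"
    and ker: "\<And>r. r \<in> Obj R \<Longrightarrow> {x \<in> el B r. app v r x = neut Q r} = app u r ` el A r"
  shows "is_iso_mod Md \<T> u"
  unfolding is_iso_mod_def
proof (intro conjI)
  show "u \<in> Arr Md" using HomD[OF u] by simp
  obtain K k where k: "k \<in> Hom Md K A"
    and k': "\<forall>r \<in> Obj R. inj_on (app k r) (el K r) \<and>
      app k r ` el K r = {x \<in> el A r. app u r x = neut B r}"
    using kernel_exists[OF u] by (elim exE bexE) (rule that)
  have "is_kernel Md u k" by (rule is_kernel_of_fibres[OF u k]) (use k' in auto)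
  moreover have "K \<in> \<T>"
  proof -
    have "x = neut K r" if r: "r \<in> Obj R" and x: "x \<in> el K r" for r x
    proof -
      have "app u r (app k r x) = neut B r" using k' r x by blast
      then have "app k r x = app k r (neut K r)"
        using inj_onD[OF inj[OF r]] app_one[OF u r] app_one[OF k r] app_closed[OF k r x]
          neut_closed[OF Hom_Mod_Obj(1)[OF u] r] by metis
      from inj_onD[OF conjunct1[OF bspec[OF k' r]] this x] show ?thesis
        using neut_closed[OF Hom_Mod_Obj(1)[OF k] r] by simp
    qed
    \<comment> \<open>The kernel has only neutral elements, so every arrow out of it is injective.
      The composite into \<open>Q\<close> is taken merely to exhibit it as a subobject of a torsion
      module.\<close>
    then have "inj_on (app (Comp Md v (Comp Md u k)) r) (el K r)" if "r \<in> Obj R" for r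
      using that by (metis inj_onI)
    then show ?thesis by (rule T_injective[OF Md.Comp_Hom[OF Md.Comp_Hom[OF k u] v] _ Q])
  qed
  ultimately show "\<exists>k. is_kernel Md u k \<and> Dom Md k \<in> \<T>" using HomD[OF k] by blast
  obtain P p where p: "p \<in> Hom Md B P"
    and p': "\<forall>r \<in> Obj R. app p r ` el B r = el P r \<and>
      {x \<in> el B r. app p r x = neut P r} = app u r ` el A r"
    using cokernel_exists[OF u] by (elim exE bexE) (rule that)
  have "is_cokernel Md u p" by (rule is_cokernel_of_fibres[OF u p]) (use p' in auto)
  moreover have "P \<in> \<T>"
  proof -
    have surj: "app p r ` el B r = el P r"
      and kp: "{x \<in> el B r. app p r x = neut P r} = app u r ` el A r" if "r \<in> Obj R" for r
      using p' that by blast+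
    have eq: "app p r x = neut P r \<longleftrightarrow> app v r x = neut Q r" if "r \<in> Obj R" "x \<in> el B r" for r x
      using kp[OF that(1)] ker[OF that(1)] that(2) by blast
    obtain g where g: "g \<in> Hom Md P Q" "Comp Md g p = v"
      using factor_through_epi[OF p surj v] eq by blast
    have "inj_on (app g r) (el P r)" if r: "r \<in> Obj R" for r
    proof (rule inj_onI)
      fix y y' assume y: "y \<in> el P r" "y' \<in> el P r" and e: "app g r y = app g r y'"
      obtain x where x1: "x \<in> el B r" "y = app p r x" using surj[OF r] y(1) by blast
      obtain x' where x2: "x' \<in> el B r" "y' = app p r x'" using surj[OF r] y(2) by blast
      note x = x1 x2
      have "app v r x = app v r x'"
        using e x r by (simp add: g(2)[symmetric] app_Comp[OF p])
      then show "y = y'"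
        using app_eq_iff[OF v r x(1,3)] app_eq_iff[OF p r x(1,3)] eq[OF r] x
          comm_group_closed[OF fib_comm_group[OF Hom_Mod_Obj(1)[OF v] r]] by simp
    qed
    then show ?thesis by (rule T_injective[OF g(1) _ Q])
  qed
  ultimately show "\<exists>q. is_cokernel Md u q \<and> Cod Md q \<in> \<T>" using HomD[OF p] by blast
qed

end

section \<open>The Gabriel topology of a hereditary torsion class\<close>

text \<open>For \<open>Q\<close> torsion these are the dense right ideals of the Gabriel topology.
  Such an ideal is the kernel of the map from the representable module to \<open>Q\<close> given by
  \<open>q\<close>, so the quotient by it embeds into \<open>Q\<close>; conversely a dense ideal is
  the annihilator of the class of the identity in the torsion quotient.\<close>

definition ann :: "('r, 'm) preadditive \<Rightarrow> ('r, 'm, 'u) module_obj \<Rightarrow> 'r \<Rightarrow> 'u \<Rightarrow> 'r \<Rightarrow> 'm set" where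
  "ann R Q r q t = {a \<in> Hom R t r. act Q a q = neut Q t}"

text \<open>One function on arrows serves all objects t at once, because an arrow determines its
  domain.\<close>

definition ideal_hom :: "('r, 'm) preadditive \<Rightarrow> ('r, 'm, 'u) module_obj \<Rightarrow> ('r \<Rightarrow> 'm set) \<Rightarrow> ('m \<Rightarrow> 'u) \<Rightarrow> bool" where
  "ideal_hom R M I f \<longleftrightarrow>
    (\<forall>t \<in> Obj R. \<forall>a \<in> I t. f a \<in> el M t \<and> (\<forall>a' \<in> I t. f (Add R a a') = f a \<cdot>[M,t] f a')) \<and>
    (\<forall>s t b a. b \<in> Hom R s t \<and> a \<in> I t \<longrightarrow> f (Comp R a b) = act M b (f a))"

context hereditary_class begin

text \<open>Gabriel's criterion in elements. By the Yoneda lemma a homomorphism from the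
  representable module is an element \<open>y\<close>, and its restriction to the ideal is
  \<open>a\<close> \<mapsto> \<open>act M a y\<close>, so the condition demands a unique extension.
  Dense ideals enter as annihilators of elements of torsion modules.\<close>

definition saturated :: "('r, 'm, 'u) module_obj \<Rightarrow> bool" where
  "saturated M \<longleftrightarrow> M \<in> Obj Md \<and>
    (\<forall>r Q q f. r \<in> Obj R \<and> Q \<in> \<T> \<and> q \<in> el Q r \<and> ideal_hom R M (ann R Q r q) f \<longrightarrow>
      (\<exists>!y. y \<in> el M r \<and> (\<forall>t \<in> Obj R. \<forall>a \<in> ann R Q r q t. f a = act M a y)))"

lemma saturatedD:
  assumes "saturated M" "r \<in> Obj R" "Q \<in> \<T>" "q \<in> el Q r" "ideal_hom R M (ann R Q r q) f"
  shows "\<exists>!y. y \<in> el M r \<and> (\<forall>t \<in> Obj R. \<forall>a \<in> ann R Q r q t. f a = act M a y)"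
  using assms unfolding saturated_def by blast

text \<open>A \<open>subrep\<close> is constrained only at objects of \<open>R\<close>, and the
  kernel to which this is applied is described only there.\<close>

lemma subrep_cong:
  assumes D: "subrep R G \<rho> D" and eq: "\<And>r. r \<in> Obj R \<Longrightarrow> D' r = D r"
  shows "subrep R G \<rho> D'"
  unfolding subrep_def
proof (intro conjI ballI allI impI; (elim conjE)?)
  show "subgroup (D' r) (G r)" if "r \<in> Obj R" for r using subrepD(1)[OF D that] eq[OF that] by simp
  fix t r a x assume a: "a \<in> Hom R t r" and "x \<in> D' r"
  then show "\<rho> a x \<in> D' t" using subrep_act[OF D a] eq[OF Hom_Obj(1)[OF a]] eq[OF Hom_Obj(2)[OF a]] by simp
qed

lemma ann_Hom: "a \<in> ann R Q r q t \<Longrightarrow> a \<in> Hom R t r"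
  by (simp add: ann_def)

lemma Add_Hom: "a \<in> Hom R t r \<Longrightarrow> a' \<in> Hom R t r \<Longrightarrow> Add R a a' \<in> Hom R t r"
  using comm_group_closed(2)[OF Hom_comm_group[of t r]] Hom_Obj[of a t r] by simp

lemma ann_Add: "Q \<in> \<T> \<Longrightarrow> q \<in> el Q r \<Longrightarrow> a \<in> ann R Q r q t \<Longrightarrow> a' \<in> ann R Q r q t \<Longrightarrow>
    Add R a a' \<in> ann R Q r q t"
  using Hom_Obj[of a t r] group.is_monoid[OF comm_group.axioms(2)[OF fib_comm_group[OF T_Obj]], of Q t]
    act_Add[OF T_Obj, of Q a t r a' q]
  by (simp add: ann_def Add_Hom monoid.l_one monoid.one_closed)

lemma ann_Comp: "Q \<in> \<T> \<Longrightarrow> q \<in> el Q r \<Longrightarrow> a \<in> ann R Q r q t \<Longrightarrow> b \<in> Hom R s t \<Longrightarrow>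
    Comp R a b \<in> ann R Q r q s"
  using act_Comp[OF T_Obj, of Q a t r b s q] act_one[OF T_Obj, of Q b s t] Comp_Hom[of b s t a r]
  by (simp add: ann_def)

lemma ideal_hom_orbit:
  assumes M: "M \<in> Obj Md" and y: "y \<in> el M r"
    and I: "\<And>t a. a \<in> I t \<Longrightarrow> a \<in> Hom R t r"
  shows "ideal_hom R M I (\<lambda>a. act M a y)"
  unfolding ideal_hom_def
  by (auto intro: act_closed[OF M I y] act_Add[OF M I I y] act_Comp[OF M I _ y])

text \<open>Both elements extend the orbit map of \<open>y\<close> on the ideal, so uniqueness
  identifies them. Thus equality in a saturated module may be tested along a dense ideal; taking
  \<open>y'\<close> neutral shows that no nonzero element is killed by one.\<close>

lemma saturated_unique:
  assumes "saturated M" "r \<in> Obj R" "Q \<in> \<T>" "q \<in> el Q r"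
    and y: "y \<in> el M r" "y' \<in> el M r"
    and eq: "\<And>t a. t \<in> Obj R \<Longrightarrow> a \<in> ann R Q r q t \<Longrightarrow> act M a y = act M a y'"
  shows "y = y'"
proof -
  have "M \<in> Obj Md" using assms(1) by (simp add: saturated_def)
  then have "ideal_hom R M (ann R Q r q) (\<lambda>a. act M a y)"
    by (rule ideal_hom_orbit[OF _ y(1) ann_Hom])
  from saturatedD[OF assms(1-4) this] show ?thesis using y eq by (metis (no_types, lifting))
qed

text \<open>The ideal, copied into the representable module \<open>H\<close> as a submodule
  \<open>I\<close>, has a quotient that embeds into \<open>Q\<close>, so its inclusion is an
  isomorphism modulo torsion. Closedness extends the homomorphism given by \<open>f\<close> from
  \<open>I\<close> to \<open>H\<close>, and the value of the extension at the identity arrow is the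
  required element.\<close>

lemma closed_imp_saturated:
  assumes closed: "is_closed_object Md \<T> M"
  shows "saturated M"
  unfolding saturated_def
proof (intro conjI allI impI; (elim conjE)?)
  show M: "M \<in> Obj Md" using closed by (simp add: is_closed_object_def)
  fix r Q q f assume r: "r \<in> Obj R" and Q: "Q \<in> \<T>" and q: "q \<in> el Q r" and f: "ideal_hom R M (ann R Q r q) f"
  note QO = T_Obj[OF Q]
  obtain H \<phi> where H: "H \<in> Obj Md" and \<phi>: "inj_on \<phi> (Arr R)" and fibH: "\<And>t. t \<in> Obj R \<Longrightarrow> el H t = \<phi> ` Hom R t r"
    and \<phi>_Add: "\<And>t a a'. a \<in> Hom R t r \<Longrightarrow> a' \<in> Hom R t r \<Longrightarrow> \<phi> (Add R a a') = \<phi> a \<cdot>[H,t] \<phi> a'"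
    and \<phi>_Comp: "\<And>s t a b. a \<in> Hom R t r \<Longrightarrow> b \<in> Hom R s t \<Longrightarrow> act H b (\<phi> a) = \<phi> (Comp R a b)"
    using representable[OF r] by auto
  define \<psi> where "\<psi> = inv_into (Arr R) \<phi>"
  have \<psi>: "\<psi> (\<phi> a) = a" if "a \<in> Hom R t r" for a t
    using inv_into_f_f[OF \<phi>] HomD(1)[OF that] by (simp add: \<psi>_def)
  have arrow: "mk_arr H N (\<lambda>t x. act N (\<psi> x) y) \<in> Hom Md H N"
    if N: "N \<in> Obj Md" and y: "y \<in> el N r" for N y
  proof (intro mk_arr_Hom H N)
    show "(\<lambda>x. act N (\<psi> x) y) \<in> hom (fib H t) (fib N t)" if t: "t \<in> Obj R" for t
    proof (rule homI)
      show "act N (\<psi> x) y \<in> el N t" if "x \<in> el H t" for x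
        using that fibH[OF t] \<psi> act_closed[OF N _ y] by auto
      fix x x' assume "x \<in> el H t" "x' \<in> el H t"
      then obtain a a' where a: "a \<in> Hom R t r" "a' \<in> Hom R t r" "x = \<phi> a" "x' = \<phi> a'" using fibH[OF t] by auto
      show "act N (\<psi> (x \<cdot>[H,t] x')) y = act N (\<psi> x) y \<cdot>[N,t] act N (\<psi> x') y"
        using \<phi>_Add[OF a(1,2)] \<psi>[OF Add_Hom[OF a(1,2)]] \<psi>[OF a(1)] \<psi>[OF a(2)] act_Add[OF N a(1,2) y] a(3,4) by simp
    qed
    fix t s b x assume b: "b \<in> Hom R s t" and "x \<in> el H t"
    then obtain a where a: "a \<in> Hom R t r" "x = \<phi> a" using fibH[OF Hom_Obj(2)[OF b]] by auto
    show "act N (\<psi> (act H b x)) y = act N b (act N (\<psi> x) y)"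
      using \<phi>_Comp[OF a(1) b] \<psi>[OF Comp_Hom[OF b a(1)]] \<psi>[OF a(1)] act_Comp[OF N a(1) b y] a(2) by simp
  qed
  let ?D = "\<lambda>t. \<phi> ` ann R Q r q t"
  define v where "v = mk_arr H Q (\<lambda>t x. act Q (\<psi> x) q)"
  have v: "v \<in> Hom Md H Q" unfolding v_def using arrow[OF QO q] .
  have kerv: "{x \<in> el H t. app v t x = neut Q t} = ?D t" if t: "t \<in> Obj R" for t
  proof -
    have "app v t (\<phi> a) = act Q a q" if "a \<in> Hom R t r" for a
      using that t \<psi>[OF that] fibH[OF t] by (simp add: v_def)
    then show ?thesis unfolding fibH[OF t] ann_def by auto
  qed
  have D: "submodule H ?D"
    by (rule subrep_cong[OF kernel_subrep[OF v]]) (simp add: kerv)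
  obtain I u where u: "u \<in> Hom Md I H"
    and *: "\<forall>t \<in> Obj R. el I t = ?D t \<and> (\<forall>x \<in> ?D t. app u t x = x)"
    using submodule_object[OF H D] by (elim bexE) (rule that)
  have I: "el I t = ?D t" and u_eq: "x \<in> ?D t \<Longrightarrow> app u t x = x" if "t \<in> Obj R" for t x
    using * that by blast+
  note IO = Hom_Mod_Obj(1)[OF u]
  have "is_iso_mod Md \<T> u"
  proof (rule is_iso_modI[OF u _ v Q])
    show "inj_on (app u t) (el I t)" if "t \<in> Obj R" for t
      using I[OF that] u_eq[OF that] by (simp add: inj_on_def)
    show "{x \<in> el H t. app v t x = neut Q t} = app u t ` el I t" if t: "t \<in> Obj R" for t
      unfolding kerv[OF t] using I[OF t] u_eq[OF t] by force
  qed
  then have bij: "bij_betw (\<lambda>g. Comp Md g u) (Hom Md H M) (Hom Md I M)"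
    using closed HomD[OF u] by (auto simp: is_closed_object_def)
  have I_mult: "x \<cdot>[I,t] x' = x \<cdot>[H,t] x'" and I_act: "b \<in> Hom R s t \<Longrightarrow> act I b x = act H b x"
    if t: "t \<in> Obj R" and x: "x \<in> ?D t" "x' \<in> ?D t" for t x x' s b
  proof -
    have "x \<cdot>[I,t] x' \<in> ?D t" using fib_mult_closed[OF IO t] I[OF t] x by simp
    then show "x \<cdot>[I,t] x' = x \<cdot>[H,t] x'"
      using app_mult[OF u t, of x x'] x u_eq[OF t] I[OF t] by simp
    assume b: "b \<in> Hom R s t"
    show "act I b x = act H b x"
      using app_act[OF u b, of x] x u_eq[OF t] u_eq[OF Hom_Obj(1)[OF b], of "act I b x"] I[OF t] I[OF Hom_Obj(1)[OF b]]
        act_closed[OF IO b, of x] by simp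
  qed
  have ann_arrow: "mk_arr I M (\<lambda>_ x. f (\<psi> x)) \<in> Hom Md I M"
  proof (intro mk_arr_Hom IO M)
    show "(\<lambda>x. f (\<psi> x)) \<in> hom (fib I t) (fib M t)" if t: "t \<in> Obj R" for t
    proof (rule homI)
      show "f (\<psi> x) \<in> el M t" if "x \<in> el I t" for x
        using that I[OF t] \<psi>[OF ann_Hom[of _ Q r q t]] f t by (auto simp: ideal_hom_def)
      fix x x' assume xI: "x \<in> el I t" "x' \<in> el I t"
      then obtain a a' where a: "a \<in> ann R Q r q t" "a' \<in> ann R Q r q t" "x = \<phi> a" "x' = \<phi> a'" using I[OF t] by auto
      note aH = ann_Hom[OF a(1)] ann_Hom[OF a(2)]
      show "f (\<psi> (x \<cdot>[I,t] x')) = f (\<psi> x) \<cdot>[M,t] f (\<psi> x')"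
        using I_mult[OF t, of x x'] xI I[OF t] \<phi>_Add[OF aH] \<psi>[OF Add_Hom[OF aH]] \<psi>[OF aH(1)] \<psi>[OF aH(2)] f a t
        by (simp add: ideal_hom_def)
    qed
    fix t s b x assume b: "b \<in> Hom R s t" and x: "x \<in> el I t"
    then obtain a where a: "a \<in> ann R Q r q t" "x = \<phi> a" using I[OF Hom_Obj(2)[OF b]] by auto
    show "f (\<psi> (act I b x)) = act M b (f (\<psi> x))"
      using I_act[OF Hom_Obj(2)[OF b] _ _ b, of x x] x I[OF Hom_Obj(2)[OF b]] \<phi>_Comp[OF ann_Hom[OF a(1)] b]
        \<psi>[OF Comp_Hom[OF b ann_Hom[OF a(1)]]] \<psi>[OF ann_Hom[OF a(1)]] f a b
      by (auto simp: ideal_hom_def)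
  qed
  then obtain G where G: "G \<in> Hom Md H M" "Comp Md G u = mk_arr I M (\<lambda>_ x. f (\<psi> x))"
    using bij unfolding bij_betw_def by (metis (no_types, lifting) imageE)
  define y where "y = app G r (\<phi> (Ident R r))"
  note idr = Ident_Hom[OF r]
  have idH: "\<phi> (Ident R r) \<in> el H r" using fibH[OF r] idr by simp
  have y: "y \<in> el M r" unfolding y_def using app_closed[OF G(1) r idH] .
  have fy: "f a = act M a y" if t: "t \<in> Obj R" and a: "a \<in> ann R Q r q t" for t a
  proof -
    have aI: "\<phi> a \<in> el I t" using I[OF t] a by simp
    have "f a = app (Comp Md G u) t (\<phi> a)"
      using \<psi>[OF ann_Hom[OF a]] t aI by (simp add: G(2))
    also have "\<dots> = app G t (\<phi> a)" using u_eq[OF t, of "\<phi> a"] a aI t by (simp add: app_Comp[OF u])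
    also have "\<dots> = act M a y"
      using app_act[OF G(1) ann_Hom[OF a] idH] \<phi>_Comp[OF idr ann_Hom[OF a]] Comp_Ident_left[OF ann_Hom[OF a]]
      by (simp add: y_def)
    finally show ?thesis .
  qed
  have "y' = y" if y': "y' \<in> el M r" and fy': "\<And>t a. t \<in> Obj R \<Longrightarrow> a \<in> ann R Q r q t \<Longrightarrow> f a = act M a y'" for y'
  proof -
    \<comment> \<open>The arrow from the representable module that sends the identity to
      \<open>z\<close>. Two solutions give arrows with the same restriction to \<open>I\<close>,
      which closedness forces to be equal.\<close>
    define G1 where "G1 z = mk_arr H M (\<lambda>t x. act M (\<psi> x) z)" for z
    have G1: "G1 z \<in> Hom Md H M" if "z \<in> el M r" for z unfolding G1_def using arrow[OF M that] .
    have "Comp Md (G1 y) u = Comp Md (G1 y') u"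
    proof (rule module_arrow_eqI[OF Md.Comp_Hom[OF u G1[OF y]] Md.Comp_Hom[OF u G1[OF y']]])
      fix t x assume t: "t \<in> Obj R" and x: "x \<in> el I t"
      then obtain a where a: "a \<in> ann R Q r q t" "x = \<phi> a" using I[OF t] by auto
      show "app (Comp Md (G1 y) u) t x = app (Comp Md (G1 y') u) t x"
        using t x a u_eq[OF t, of x] fy[OF t a(1)] fy'[OF t a(1)] \<psi>[OF ann_Hom[OF a(1)]] fibH[OF t] ann_Hom[OF a(1)]
        by (simp add: app_Comp[OF u] G1_def)
    qed
    then have "G1 y = G1 y'"
      using bij G1[OF y] G1[OF y'] unfolding bij_betw_def inj_on_def by blast
    then have "app (G1 y) r (\<phi> (Ident R r)) = app (G1 y') r (\<phi> (Ident R r))" by simp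
    then show "y' = y" using r idH \<psi>[OF idr] act_Ident[OF M r] y y' by (simp add: G1_def)
  qed
  then show "\<exists>!y. y \<in> el M r \<and> (\<forall>t \<in> Obj R. \<forall>a \<in> ann R Q r q t. f a = act M a y)"
    using y fy by (intro ex1I[of _ y]) simp_all
qed

text \<open>To extend \<open>g\<close> along \<open>u\<close>, fix \<open>b\<close> in
  \<open>B\<close>. The arrows \<open>a\<close> that move \<open>b\<close> into the image of
  \<open>u\<close> form a dense ideal, and sending \<open>a\<close> to the value of \<open>g\<close>
  at a preimage of \<open>act B a b\<close> is a homomorphism on that ideal. Saturation turns it
  into the only possible value at \<open>b\<close>.\<close>

lemma saturated_bij:
  assumes sat: "saturated M" and iso: "torsion_iso A B u"
  shows "bij_betw (\<lambda>g. Comp Md g u) (Hom Md B M) (Hom Md A M)"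
proof -
  have M: "M \<in> Obj Md" using sat by (simp add: saturated_def)
  have u: "u \<in> Hom Md A B" using iso by (simp add: torsion_iso_def)
  note O = Hom_Mod_Obj[OF u]
  obtain K k where k: "k \<in> Hom Md K A" "K \<in> \<T>"
    and kf: "\<forall>r \<in> Obj R. {x \<in> el A r. app u r x = neut B r} \<subseteq> app k r ` el K r"
    using iso unfolding torsion_iso_def by (elim conjE bexE) (rule that)
  obtain Q q where q: "q \<in> Hom Md B Q" "Q \<in> \<T>"
    and qf: "\<forall>r \<in> Obj R. {x \<in> el B r. app q r x = neut Q r} = app u r ` el A r"
    using iso unfolding torsion_iso_def by (elim conjE bexE) (rule that)
  have one: "neut M r \<in> el M r" if "r \<in> Obj R" for r
    using neut_closed[OF M that] .
  \<comment> \<open>An element killed by \<open>u\<close> comes from the torsion module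
    \<open>K\<close>. The annihilator of its preimage there is dense and kills
    \<open>app g r x\<close>, which is therefore neutral.\<close>
  have g_ker: "app g r x = neut M r" if g: "g \<in> Hom Md A M" and r: "r \<in> Obj R" and x: "x \<in> el A r" "app u r x = neut B r" for g r x
  proof -
    obtain x' where x': "x' \<in> el K r" "x = app k r x'" using bspec[OF kf r] x by blast
    show ?thesis
    proof (rule saturated_unique[OF sat r k(2) x'(1)])
      show "app g r x \<in> el M r" using app_closed[OF g r x(1)] .
      fix t a assume t: "t \<in> Obj R" and a: "a \<in> ann R K r x' t"
      then have aH: "a \<in> Hom R t r" and "act K a x' = neut K t" by (simp_all add: ann_def)
      then have "act A a x = neut A t" using app_act[OF k(1) aH x'(1)] app_one[OF k(1) t] x'(2) by simp
      then show "act M a (app g r x) = act M a (neut M r)"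
        using app_act[OF g aH x(1)] app_one[OF g t] act_one[OF M aH] by simp
    qed (use one r in auto)
  qed
  have g_eq: "app g r x = app g r x'" if g: "g \<in> Hom Md A M" and r: "r \<in> Obj R"
    and x: "x \<in> el A r" "x' \<in> el A r" "app u r x = app u r x'" for g r x x'
    using app_eq_iff[OF u r x(1,2)] app_eq_iff[OF g r x(1,2)] g_ker[OF g r] x comm_group_closed[OF fib_comm_group[OF O(1) r]] by simp
  \<comment> \<open>States that \<open>y\<close> is a value at \<open>b\<close> compatible with
    \<open>g\<close>. It is phrased through all preimages \<open>x\<close> instead of chosen ones,
    which makes additivity and linearity of the extension accessible.\<close>
  define P where "P g r b y \<longleftrightarrow> y \<in> el M r \<and> (\<forall>t a x. a \<in> Hom R t r \<and> x \<in> el A t \<and>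
    app u t x = act B a b \<longrightarrow> app g t x = act M a y)" for g :: "('r, 'm, 'u) module_arr" and r b y
  have qb: "app q r b \<in> el Q r" if "r \<in> Obj R" "b \<in> el B r" for r b
    using app_closed[OF q(1) that] .
  \<comment> \<open>The kernel of \<open>q\<close> is the image of \<open>u\<close>, so the
    annihilator of \<open>app q r b\<close> consists exactly of the arrows moving \<open>b\<close>
    into that image.\<close>
  have annI: "a \<in> ann R Q r (app q r b) t \<longleftrightarrow> a \<in> Hom R t r \<and> (\<exists>x \<in> el A t. app u t x = act B a b)"
    if t: "t \<in> Obj R" and r: "r \<in> Obj R" and b: "b \<in> el B r" for a t r b
  proof (cases "a \<in> Hom R t r")
    case True
    have "act Q a (app q r b) = neut Q t \<longleftrightarrow> act B a b \<in> app u t ` el A t"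
      unfolding bspec[OF qf t, symmetric] using app_act[OF q(1) True b] act_closed[OF O(2) True b] by simp
    then show ?thesis using True unfolding ann_def image_iff by (simp; metis)
  qed (simp add: ann_def)
  have P_ex: "\<exists>!y. P g r b y" if g: "g \<in> Hom Md A M" and r: "r \<in> Obj R" and b: "b \<in> el B r" for g r b
  proof -
    define pre where "pre a = (SOME x. x \<in> el A (Dom R a) \<and> app u (Dom R a) x = act B a b)" for a
    define f where "f a = app g (Dom R a) (pre a)" for a
    have pre: "pre a \<in> el A t \<and> app u t (pre a) = act B a b"
      if "a \<in> ann R Q r (app q r b) t" "t \<in> Obj R" for a t
    proof -
      have "Dom R a = t" using HomD(2)[OF ann_Hom[OF that(1)]] .
      moreover from this have "\<exists>x. x \<in> el A (Dom R a) \<and> app u (Dom R a) x = act B a b"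
        using that annI[OF that(2) r b] by auto
      ultimately show ?thesis using someI_ex[of "\<lambda>x. x \<in> el A (Dom R a) \<and> app u (Dom R a) x = act B a b"]
        by (simp add: pre_def)
    qed
    have f: "f a = app g t x"
      if "a \<in> ann R Q r (app q r b) t" "t \<in> Obj R" "x \<in> el A t" "app u t x = act B a b" for a t x
      using g_eq[OF g that(2) _ that(3)] pre[OF that(1,2)] that(4) HomD(2)[OF ann_Hom[OF that(1)]] by (simp add: f_def)
    have "ideal_hom R M (ann R Q r (app q r b)) f"
      unfolding ideal_hom_def
    proof (intro conjI ballI allI impI; (elim conjE)?)
      fix t a assume t: "t \<in> Obj R" and a: "a \<in> ann R Q r (app q r b) t"
      note p = pre[OF a t]
      show "f a \<in> el M t" using f[OF a t] p app_closed[OF g t] by auto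
      fix a' assume a': "a' \<in> ann R Q r (app q r b) t"
      note p' = pre[OF a' t]
      have "app u t (pre a \<cdot>[A,t] pre a') = act B (Add R a a') b"
        using p p' act_Add[OF O(2) ann_Hom[OF a] ann_Hom[OF a'] b] by (simp add: app_mult[OF u t])
      then have "f (Add R a a') = app g t (pre a \<cdot>[A,t] pre a')"
        using f[OF ann_Add[OF q(2) qb[OF r b] a a'] t] p p' fib_mult_closed[OF O(1) t] by simp
      then show "f (Add R a a') = f a \<cdot>[M,t] f a'"
        using f[OF a t, of "pre a"] f[OF a' t, of "pre a'"] p p' by (simp add: app_mult[OF g t])
    next
      fix s t c a assume c: "c \<in> Hom R s t" and a: "a \<in> ann R Q r (app q r b) t"
      note st = Hom_Obj[OF c]
      note p = pre[OF a st(2)]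
      have "app u s (act A c (pre a)) = act B (Comp R a c) b"
        using p app_act[OF u c] act_Comp[OF O(2) ann_Hom[OF a] c b] by simp
      then have "f (Comp R a c) = app g s (act A c (pre a))"
        using f[OF ann_Comp[OF q(2) qb[OF r b] a c] st(1)] p act_closed[OF O(1) c] by simp
      then show "f (Comp R a c) = act M c (f a)" using f[OF a st(2), of "pre a"] p app_act[OF g c] by simp
    qed
    from saturatedD[OF sat r q(2) qb[OF r b] this]
    have "\<exists>!y. y \<in> el M r \<and> (\<forall>t \<in> Obj R. \<forall>a \<in> ann R Q r (app q r b) t. f a = act M a y)" .
    moreover have "P g r b y \<longleftrightarrow> y \<in> el M r \<and> (\<forall>t \<in> Obj R. \<forall>a \<in> ann R Q r (app q r b) t. f a = act M a y)" for y
    proof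
      assume y: "P g r b y"
      show "y \<in> el M r \<and> (\<forall>t \<in> Obj R. \<forall>a \<in> ann R Q r (app q r b) t. f a = act M a y)"
        using y f pre ann_Hom unfolding P_def by metis
    next
      assume y: "y \<in> el M r \<and> (\<forall>t \<in> Obj R. \<forall>a \<in> ann R Q r (app q r b) t. f a = act M a y)"
      show "P g r b y"
        unfolding P_def
      proof (intro conjI allI impI; (elim conjE)?)
        fix t a x assume *: "a \<in> Hom R t r" "x \<in> el A t" "app u t x = act B a b"
        then have "a \<in> ann R Q r (app q r b) t" using annI[OF Hom_Obj(1)[OF *(1)] r b] by blast
        then show "app g t x = act M a y" using y f[OF _ Hom_Obj(1)[OF *(1)] *(2,3)] Hom_Obj(1)[OF *(1)] by simp
      qed (use y in simp)
    qed
    ultimately show ?thesis by simp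
  qed
  have P_mult: "P g r (b \<cdot>[B,r] b') (y \<cdot>[M,r] y')"
    if g: "g \<in> Hom Md A M" and r: "r \<in> Obj R" and b: "b \<in> el B r" "b' \<in> el B r"
      and y: "P g r b y" "P g r b' y'" for g r b b' y y'
    unfolding P_def
  proof (intro conjI allI impI; (elim conjE)?)
    have yM: "y \<in> el M r" "y' \<in> el M r" using y by (simp_all add: P_def)
    then show "y \<cdot>[M,r] y' \<in> el M r" using fib_mult_closed[OF M r] by simp
    fix t a x assume a: "a \<in> Hom R t r" and x: "x \<in> el A t" and ux: "app u t x = act B a (b \<cdot>[B,r] b')"
    note t = Hom_Obj(1)[OF a]
    have abM: "act B a b \<in> el B t" using act_closed[OF O(2) a b(1)] .
    show "app g t x = act M a (y \<cdot>[M,r] y')"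
    proof (rule saturated_unique[OF sat t q(2) qb[OF t abM]])
      show "app g t x \<in> el M t" using app_closed[OF g t x] .
      show "act M a (y \<cdot>[M,r] y') \<in> el M t"
        using act_closed[OF M a] yM fib_mult_closed[OF M r] by simp
      fix s c assume s: "s \<in> Obj R" and "c \<in> ann R Q t (app q t (act B a b)) s"
      then obtain x1 where c: "c \<in> Hom R s t" and x1: "x1 \<in> el A s" "app u s x1 = act B c (act B a b)"
        using annI[OF s t abM] by blast
      \<comment> \<open>The dense ideal only guarantees a preimage \<open>x1\<close> of the part
        coming from \<open>b\<close>. The remainder of \<open>act A c x\<close> is then
        automatically a preimage of the part coming from \<open>b'\<close>.\<close>
      define x2 where "x2 = act A c x \<cdot>[A,s] inv\<^bsub>fib A s\<^esub> x1"
      note ac = Comp_Hom[OF c a]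
      have xc: "act A c x \<in> el A s" using act_closed[OF O(1) c x] .
      have x2: "x2 \<in> el A s" unfolding x2_def using xc x1 comm_group_closed[OF fib_comm_group[OF O(1) s]] by simp
      have x12: "x1 \<cdot>[A,s] x2 = act A c x"
        unfolding x2_def using comm_group_cancel(2)[OF fib_comm_group[OF O(1) s] xc x1(1)] .
      have u1: "app u s x1 = act B (Comp R a c) b" using x1 act_Comp[OF O(2) a c b(1)] by simp
      have B12: "act B (Comp R a c) b \<in> el B s" "act B (Comp R a c) b' \<in> el B s"
        using act_closed[OF O(2) ac] b by auto
      have "app u s (act A c x) = act B (Comp R a c) b \<cdot>[B,s] act B (Comp R a c) b'"
        using app_act[OF u c x] ux act_Comp[OF O(2) a c] act_mult[OF O(2) ac b] b fib_mult_closed[OF O(2) r] by simp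
      then have u2: "app u s x2 = act B (Comp R a c) b'"
        using comm_group_cancel(4)[OF fib_comm_group[OF O(2) s] B12(2,1)] xc x1 u1 fib_inv_closed[OF O(1) s]
        by (simp add: x2_def app_mult[OF u s] app_inv[OF u s])
      have "act M c (app g t x) = app g s x1 \<cdot>[M,s] app g s x2"
        using app_act[OF g c x] x12 app_mult[OF g s x1(1) x2] by simp
      also have "\<dots> = act M (Comp R a c) y \<cdot>[M,s] act M (Comp R a c) y'"
        using y u1 u2 x1 x2 ac unfolding P_def by metis
      also have "\<dots> = act M c (act M a (y \<cdot>[M,r] y'))"
        using act_mult[OF M ac yM] act_Comp[OF M a c] yM fib_mult_closed[OF M r] by simp
      finally show "act M c (app g t x) = act M c (act M a (y \<cdot>[M,r] y'))" .
    qed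
  qed
  have P_act: "P g s (act B c b) (act M c y)" if c: "c \<in> Hom R s r" and b: "b \<in> el B r" and y: "P g r b y" for g r s c b y
    unfolding P_def
  proof (intro conjI allI impI; (elim conjE)?)
    have yM: "y \<in> el M r" using y by (simp add: P_def)
    then show "act M c y \<in> el M s" using act_closed[OF M c] by simp
    fix t a x assume a: "a \<in> Hom R t s" and x: "x \<in> el A t" and ux: "app u t x = act B a (act B c b)"
    then have "app u t x = act B (Comp R c a) b" using act_Comp[OF O(2) c a b] by simp
    then have "app g t x = act M (Comp R c a) y" using y x Comp_Hom[OF a c] unfolding P_def by blast
    then show "app g t x = act M a (act M c y)" using act_Comp[OF M c a yM] by simp
  qed
  show ?thesis
  proof (rule bij_betwI')
    fix h h' assume h: "h \<in> Hom Md B M" and h': "h' \<in> Hom Md B M"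
    have P_h: "P (Comp Md h u) r b (app h r b)" if h: "h \<in> Hom Md B M" and r: "r \<in> Obj R" and b: "b \<in> el B r" for h r b
      unfolding P_def using app_closed[OF h r b] app_act[OF h _ b] Hom_Obj by (auto simp: app_Comp[OF u])
    show "(Comp Md h u = Comp Md h' u) = (h = h')"
    proof
      assume eq: "Comp Md h u = Comp Md h' u"
      show "h = h'"
      proof (rule module_arrow_eqI[OF h h'])
        fix r b assume rb: "r \<in> Obj R" "b \<in> el B r"
        show "app h r b = app h' r b"
          using P_h[OF h rb] P_h[OF h' rb] P_ex[OF Md.Comp_Hom[OF u h] rb] eq by (metis (no_types, lifting))
      qed
    qed simp
  next
    show "Comp Md h u \<in> Hom Md A M" if "h \<in> Hom Md B M" for h using Md.Comp_Hom[OF u that] .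
  next
    fix g assume g: "g \<in> Hom Md A M"
    define h where "h r b = (THE y. P g r b y)" for r b
    have Ph: "P g r b (h r b)" if "r \<in> Obj R" "b \<in> el B r" for r b
      unfolding h_def using theI'[OF P_ex[OF g that]] .
    have h_eq: "h r b = y" if "r \<in> Obj R" "b \<in> el B r" "P g r b y" for r b y
      using Ph[OF that(1,2)] P_ex[OF g that(1,2)] that(3) by blast
    have hH: "mk_arr B M h \<in> Hom Md B M"
    proof (intro mk_arr_Hom O M homI)
      show "h r b \<in> el M r" if "r \<in> Obj R" "b \<in> el B r" for r b
        using Ph[OF that] by (simp add: P_def)
      show "h r (b \<cdot>[B,r] b') = h r b \<cdot>[M,r] h r b'"
        if "r \<in> Obj R" "b \<in> el B r" "b' \<in> el B r" for r b b'
        using that Ph fib_mult_closed[OF O(2)] by (intro h_eq P_mult[OF g]) auto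
      show "h s (act B c b) = act M c (h r b)" if "c \<in> Hom R s r" "b \<in> el B r" for s r c b
        using that Ph Hom_Obj[OF that(1)] act_closed[OF O(2)] by (intro h_eq P_act[of c s r]) auto
    qed
    moreover have "Comp Md (mk_arr B M h) u = g"
    proof (rule module_arrow_eqI[OF Md.Comp_Hom[OF u hH] g])
      fix r x assume r: "r \<in> Obj R" and x: "x \<in> el A r"
      have "P g r (app u r x) (app g r x)"
        unfolding P_def
      proof (intro conjI allI impI; (elim conjE)?)
        show "app g r x \<in> el M r" using app_closed[OF g r x] .
        fix t a z assume a: "a \<in> Hom R t r" and z: "z \<in> el A t" "app u t z = act B a (app u r x)"
        then show "app g t z = act M a (app g r x)"
          using g_eq[OF g Hom_Obj(1)[OF a] z(1) act_closed[OF O(1) a x]] app_act[OF u a x] app_act[OF g a x] by simp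
      qed
      then show "app (Comp Md (mk_arr B M h) u) r x = app g r x"
        using r x app_closed[OF u r x] h_eq[OF r app_closed[OF u r x]] by (simp add: app_Comp[OF u])
    qed
    ultimately show "\<exists>h \<in> Hom Md B M. g = Comp Md h u" by blast
  qed
qed

end

section \<open>Sequential colimits\<close>

text \<open>The composite transition map from stage \<open>k\<close> to stage \<open>k + n\<close>,
  iterated on elements rather than composed as an arrow.\<close>

primrec ctr :: "(nat \<Rightarrow> ('r, 'm, 'u) module_arr) \<Rightarrow> 'r \<Rightarrow> nat \<Rightarrow> nat \<Rightarrow> 'u \<Rightarrow> 'u" where
  "ctr c r k 0 x = x"
| "ctr c r k (Suc n) x = app (c (k + n)) r (ctr c r k n x)"

lemma ctr_add: "ctr c r k (m + n) x = ctr c r (k + m) n (ctr c r k m x)"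
  by (induction n) (simp_all add: add.assoc)

context module_category begin

text \<open>The elementwise description of a sequential colimit: every element comes from some
  stage, and an element that becomes neutral in the limit does so at a finite stage. The universal
  property is derived from it.\<close>

definition direct_limit :: "(nat \<Rightarrow> ('r, 'm, 'u) module_obj) \<Rightarrow> (nat \<Rightarrow> ('r, 'm, 'u) module_arr) \<Rightarrow>
    ('r, 'm, 'u) module_obj \<Rightarrow> (nat \<Rightarrow> ('r, 'm, 'u) module_arr) \<Rightarrow> bool" where
  "direct_limit M c L \<iota> \<longleftrightarrow> (\<forall>k. c k \<in> Hom Md (M k) (M (Suc k)) \<and> \<iota> k \<in> Hom Md (M k) L) \<and>
    (\<forall>k. \<forall>r \<in> Obj R. \<forall>x \<in> el (M k) r. app (\<iota> (Suc k)) r (app (c k) r x) = app (\<iota> k) r x) \<and>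
    (\<forall>r \<in> Obj R. \<forall>z \<in> el L r. \<exists>k. \<exists>x \<in> el (M k) r. z = app (\<iota> k) r x) \<and>
    (\<forall>k. \<forall>r \<in> Obj R. \<forall>x \<in> el (M k) r. app (\<iota> k) r x = neut L r \<longrightarrow>
      (\<exists>n. ctr c r k n x = neut (M (k + n)) r))"

context
  fixes M :: "nat \<Rightarrow> ('r, 'm, 'u) module_obj" and c
  assumes c: "\<And>k. c k \<in> Hom Md (M k) (M (Suc k))"
begin

lemma ctr_closed: "r \<in> Obj R \<Longrightarrow> x \<in> el (M k) r \<Longrightarrow> ctr c r k n x \<in> el (M (k + n)) r"
  by (induction n) (auto intro: app_closed[OF c])

lemma ctr_mult: "r \<in> Obj R \<Longrightarrow> x \<in> el (M k) r \<Longrightarrow> y \<in> el (M k) r \<Longrightarrow>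
    ctr c r k n (x \<cdot>[(M k),r] y) = ctr c r k n x \<cdot>[(M (k + n)),r] ctr c r k n y"
  by (induction n) (simp_all add: app_mult[OF c] ctr_closed)

lemma ctr_one: "r \<in> Obj R \<Longrightarrow> ctr c r k n (neut (M k) r) = neut (M (k + n)) r"
  by (induction n) (simp_all add: app_one[OF c])

lemma ctr_act: "a \<in> Hom R t r \<Longrightarrow> x \<in> el (M k) r \<Longrightarrow>
    ctr c t k n (act (M k) a x) = act (M (k + n)) a (ctr c r k n x)"
  by (induction n) (simp_all add: app_act[OF c] ctr_closed Hom_Obj)

end

context
  fixes M :: "nat \<Rightarrow> ('r, 'm, 'u) module_obj" and c L \<iota>
  assumes dl: "direct_limit M c L \<iota>"
begin

lemma direct_limit_arr: "c k \<in> Hom Md (M k) (M (Suc k))" "\<iota> k \<in> Hom Md (M k) L"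
  using dl by (auto simp: direct_limit_def)

lemma direct_limit_ctr: "r \<in> Obj R \<Longrightarrow> x \<in> el (M k) r \<Longrightarrow> app (\<iota> (k + n)) r (ctr c r k n x) = app (\<iota> k) r x"
  using ctr_closed[where M = M and c = c, OF direct_limit_arr(1)] dl
  by (induction n) (simp_all add: direct_limit_def)

text \<open>The lower bound \<open>K\<close> allows several elements to be represented at a common
  stage.\<close>

lemma direct_limit_ex:
  assumes "r \<in> Obj R" "z \<in> el L r"
  shows "\<exists>k\<ge>K. \<exists>x \<in> el (M k) r. z = app (\<iota> k) r x"
proof -
  obtain k x where x: "x \<in> el (M k) r" "z = app (\<iota> k) r x"
    using dl assms unfolding direct_limit_def by blast
  then show ?thesis
    using direct_limit_ctr[OF assms(1) x(1), of K] ctr_closed[where M = M and c = c, OF direct_limit_arr(1) assms(1) x(1), of K]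
    by (intro exI[of _ "k + K"] conjI bexI[of _ "ctr c r k K x"]) simp_all
qed

lemma direct_limit_one:
  assumes "r \<in> Obj R" "x \<in> el (M k) r" "app (\<iota> k) r x = neut L r"
  shows "\<exists>n0. \<forall>n\<ge>n0. ctr c r k n x = neut (M (k + n)) r"
proof -
  obtain n0 where "ctr c r k n0 x = neut (M (k + n0)) r"
    using dl assms unfolding direct_limit_def by blast
  then have "ctr c r k (n0 + n) x = neut (M (k + (n0 + n))) r" for n
    using ctr_one[where M = M and c = c, OF direct_limit_arr(1) assms(1)] by (simp add: ctr_add add.assoc[symmetric])
  then show ?thesis by (metis le_Suc_ex)
qed

text \<open>Applies \<open>direct_limit_one\<close> to the difference. The conclusion is about all
  large \<open>n\<close>, so that finitely many equalities can be realised at one stage.\<close>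

lemma direct_limit_eq:
  assumes r: "r \<in> Obj R" and x: "x \<in> el (M k) r" "y \<in> el (M k) r" and eq: "app (\<iota> k) r x = app (\<iota> k) r y"
  shows "\<exists>n0. \<forall>n\<ge>n0. ctr c r k n x = ctr c r k n y"
proof -
  note g = fib_comm_group[OF Hom_Mod_Obj(1)[OF direct_limit_arr(2)] r]
  note cl = ctr_closed[where M = M and c = c, OF direct_limit_arr(1) r]
  define z where "z = x \<cdot>[(M k),r] inv\<^bsub>fib (M k) r\<^esub> y"
  have z: "z \<in> el (M k) r" "z \<cdot>[(M k),r] y = x"
    unfolding z_def using x comm_group_closed[OF g] comm_group_cancel(1)[OF g x] by auto
  have "app (\<iota> k) r z = neut L r" using app_eq_iff[OF direct_limit_arr(2) r x] eq by (simp add: z_def)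
  from direct_limit_one[OF r z(1) this] obtain n0 where n0: "\<And>n. n \<ge> n0 \<Longrightarrow> ctr c r k n z = neut (M (k + n)) r" by blast
  have "ctr c r k n x = ctr c r k n y" if "n \<ge> n0" for n
  proof -
    interpret G: comm_group "fib (M (k + n)) r" using g .
    show ?thesis
      using ctr_mult[where M = M and c = c, OF direct_limit_arr(1) r z(1) x(2), of n] n0[OF that] z(2) cl[OF x(2)] by simp
  qed
  then show ?thesis by blast
qed

lemma direct_limit_universal:
  assumes L': "L' \<in> Obj Md" and \<iota>': "\<And>k. \<iota>' k \<in> Hom Md (M k) L'"
    and comp: "\<And>k r x. r \<in> Obj R \<Longrightarrow> x \<in> el (M k) r \<Longrightarrow> app (\<iota>' (Suc k)) r (app (c k) r x) = app (\<iota>' k) r x"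
  shows "\<exists>h \<in> Hom Md L L'. \<forall>k. \<forall>r \<in> Obj R. \<forall>x \<in> el (M k) r. app h r (app (\<iota> k) r x) = app (\<iota>' k) r x"
proof -
  note cl = ctr_closed[where M = M and c = c, OF direct_limit_arr(1)]
  have comp': "app (\<iota>' (k + n)) r (ctr c r k n x) = app (\<iota>' k) r x" if "r \<in> Obj R" "x \<in> el (M k) r" for r k n x
    using that comp cl by (induction n) simp_all
  \<comment> \<open>Both representatives are moved to stage \<open>k + k'\<close>; equality in the
    limit becomes equality at a still later stage, where the cocone \<iota>' can be
    evaluated.\<close>
  have wd: "app (\<iota>' k) r x = app (\<iota>' k') r x'"
    if r: "r \<in> Obj R" and x: "x \<in> el (M k) r" "x' \<in> el (M k') r" and eq: "app (\<iota> k) r x = app (\<iota> k') r x'" for r k k' x x'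
  proof -
    have x1: "ctr c r k k' x \<in> el (M (k + k')) r" "ctr c r k' k x' \<in> el (M (k + k')) r"
      using cl[OF r x(1), of k'] cl[OF r x(2), of k] by (simp_all add: add.commute)
    have "app (\<iota> (k + k')) r (ctr c r k k' x) = app (\<iota> (k + k')) r (ctr c r k' k x')"
      using direct_limit_ctr[OF r x(1), of k'] direct_limit_ctr[OF r x(2), of k] eq by (simp add: add.commute)
    from direct_limit_eq[OF r x1 this] obtain n where n: "ctr c r (k + k') n (ctr c r k k' x) = ctr c r (k + k') n (ctr c r k' k x')" by blast
    have "app (\<iota>' k) r x = app (\<iota>' (k + k' + n)) r (ctr c r (k + k') n (ctr c r k k' x))"
      using comp'[OF r x1(1)] comp'[OF r x(1), of k'] by simp
    also have "\<dots> = app (\<iota>' k') r x'"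
      using comp'[OF r x1(2)] comp'[OF r x(2), of k] n by (simp add: add.commute)
    finally show ?thesis .
  qed
  define h where "h r z = (SOME y. \<exists>k. \<exists>x \<in> el (M k) r. z = app (\<iota> k) r x \<and> y = app (\<iota>' k) r x)" for r z
  have h: "h r (app (\<iota> k) r x) = app (\<iota>' k) r x" if r: "r \<in> Obj R" and x: "x \<in> el (M k) r" for r k x
    unfolding h_def
  proof (rule some_equality)
    show "\<exists>k' . \<exists>x' \<in> el (M k') r. app (\<iota> k) r x = app (\<iota> k') r x' \<and> app (\<iota>' k) r x = app (\<iota>' k') r x'"
      using x by blast
    fix y assume "\<exists>k'. \<exists>x' \<in> el (M k') r. app (\<iota> k) r x = app (\<iota> k') r x' \<and> y = app (\<iota>' k') r x'"
    then obtain k' x' where "x' \<in> el (M k') r" "app (\<iota> k) r x = app (\<iota> k') r x'" "y = app (\<iota>' k') r x'"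
      by blast
    then show "y = app (\<iota>' k) r x" using wd[OF r x] by simp
  qed
  have ex2: "\<exists>k. \<exists>x \<in> el (M k) r. \<exists>x' \<in> el (M k) r. z = app (\<iota> k) r x \<and> z' = app (\<iota> k) r x'"
    if r: "r \<in> Obj R" and z: "z \<in> el L r" "z' \<in> el L r" for r z z'
  proof -
    obtain k x where x: "x \<in> el (M k) r" "z = app (\<iota> k) r x" using direct_limit_ex[OF r z(1)] by blast
    obtain k' x' where k': "k' \<ge> k" "x' \<in> el (M k') r" "z' = app (\<iota> k') r x'" using direct_limit_ex[OF r z(2), of k] by blast
    have "ctr c r k (k' - k) x \<in> el (M k') r" "app (\<iota> k') r (ctr c r k (k' - k) x) = z"
      using cl[OF r x(1), of "k' - k"] direct_limit_ctr[OF r x(1), of "k' - k"] k'(1) x(2) by simp_all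
    then show ?thesis using k' by blast
  qed
  have LO: "L \<in> Obj Md" using Hom_Mod_Obj(2)[OF direct_limit_arr(2)] .
  have "mk_arr L L' h \<in> Hom Md L L'"
  proof (intro mk_arr_Hom LO L' homI)
    show "h r z \<in> el L' r" if r: "r \<in> Obj R" and z: "z \<in> el L r" for r z
      using direct_limit_ex[OF r z, of 0] h[OF r] app_closed[OF \<iota>' r] by auto
    show "h r (z \<cdot>[L,r] z') = h r z \<cdot>[L',r] h r z'"
      if r: "r \<in> Obj R" and z: "z \<in> el L r" "z' \<in> el L r" for r z z'
    proof -
      obtain k x x' where x: "x \<in> el (M k) r" "x' \<in> el (M k) r" "z = app (\<iota> k) r x" "z' = app (\<iota> k) r x'"
        using ex2[OF r z] by blast
      then show ?thesis
        using h[OF r] fib_mult_closed[OF Hom_Mod_Obj(1)[OF \<iota>'] r x(1,2)]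
        by (simp add: app_mult[OF direct_limit_arr(2) r, symmetric] app_mult[OF \<iota>' r])
    qed
    show "h t (act L a z) = act L' a (h r z)" if a: "a \<in> Hom R t r" and z: "z \<in> el L r" for t r a z
    proof -
      note tr = Hom_Obj[OF a]
      obtain k x where x: "x \<in> el (M k) r" "z = app (\<iota> k) r x" using direct_limit_ex[OF tr(2) z] by blast
      then show ?thesis
        using h tr act_closed[OF Hom_Mod_Obj(1)[OF \<iota>'] a x(1)]
        by (simp add: app_act[OF direct_limit_arr(2) a, symmetric] app_act[OF \<iota>' a])
    qed
  qed
  moreover have "app (mk_arr L L' h) r (app (\<iota> k) r x) = app (\<iota>' k) r x" if "r \<in> Obj R" "x \<in> el (M k) r" for k r x
    using that h app_closed[OF direct_limit_arr(2)] by simp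
  ultimately show ?thesis by blast
qed

end

text \<open>The colimit is realised by eventually coherent sequences modulo eventual equality, which
  makes addition and action componentwise. A class is named in \<open>'u\<close> by a pair of a
  stage and an element of that stage, so the carrier lies in a countable union of small
  sets.\<close>

lemma direct_limit_exists:
  assumes c: "\<And>k. c k \<in> Hom Md (M k) (M (Suc k))"
  shows "\<exists>L \<iota>. direct_limit M c L \<iota>"
proof -
  have MO: "M k \<in> Obj Md" for k using Hom_Mod_Obj(1)[OF c] .
  note cl = ctr_closed[where M = M and c = c, OF c]
  obtain \<pi> :: "'u \<times> 'u \<Rightarrow> 'u" where \<pi>: "inj \<pi>" using pairing by blast
  obtain \<nu> :: "nat \<Rightarrow> 'u" where \<nu>: "inj \<nu>" using small_countable by blast
  let ?coh = "\<lambda>r s. \<exists>n. \<forall>k\<ge>n. s (Suc k) = app (c k) r (s k)"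
  define G where "G r = \<lparr>carrier = {s. (\<forall>k. s k \<in> el (M k) r) \<and> ?coh r s},
    monoid.mult = (\<lambda>s s' k. s k \<cdot>[(M k),r] s' k), one = (\<lambda>k. neut (M k) r)\<rparr>" for r
  define \<rho> where "\<rho> a s = (\<lambda>k. act (M k) a (s k))" for a and s :: "nat \<Rightarrow> 'u"
  have G: "comm_group (G r)" if r: "r \<in> Obj R" for r
  proof (rule comm_groupI)
    note g = fib_comm_group[OF MO r]
    note gc = comm_group_closed[OF g]
    show "s \<otimes>\<^bsub>G r\<^esub> s' \<in> carrier (G r)" if "s \<in> carrier (G r)" "s' \<in> carrier (G r)" for s s'
    proof -
      have s: "\<And>k. s k \<in> el (M k) r" "\<And>k. s' k \<in> el (M k) r" and "?coh r s" "?coh r s'"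
        using that by (auto simp: G_def)
      then obtain m n where "\<forall>k\<ge>m. s (Suc k) = app (c k) r (s k)" "\<forall>k\<ge>n. s' (Suc k) = app (c k) r (s' k)" by blast
      then show ?thesis using s gc(2) by (auto simp: G_def app_mult[OF c r] intro!: exI[of _ "max m n"])
    qed
    show "\<one>\<^bsub>G r\<^esub> \<in> carrier (G r)" using gc(1) app_one[OF c r] by (simp add: G_def)
    fix s assume s: "s \<in> carrier (G r)"
    have "(\<lambda>k. inv\<^bsub>fib (M k) r\<^esub> s k) \<in> carrier (G r)"
    proof -
      obtain n where "\<forall>k. s k \<in> el (M k) r" "\<forall>k\<ge>n. s (Suc k) = app (c k) r (s k)"
        using s by (auto simp: G_def)
      then show ?thesis using gc(3) by (auto simp: G_def app_inv[OF c r] intro!: exI[of _ n])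
    qed
    moreover have "(\<lambda>k. inv\<^bsub>fib (M k) r\<^esub> s k) \<otimes>\<^bsub>G r\<^esub> s = \<one>\<^bsub>G r\<^esub>"
      using s by (auto simp: G_def group.l_inv[OF comm_group.axioms(2)[OF g]])
    ultimately show "\<exists>s' \<in> carrier (G r). s' \<otimes>\<^bsub>G r\<^esub> s = \<one>\<^bsub>G r\<^esub>" by blast
    show "\<one>\<^bsub>G r\<^esub> \<otimes>\<^bsub>G r\<^esub> s = s"
      using s by (auto simp: G_def monoid.l_one[OF group.is_monoid[OF comm_group.axioms(2)[OF g]]])
    fix s' assume s': "s' \<in> carrier (G r)"
    show "s \<otimes>\<^bsub>G r\<^esub> s' = s' \<otimes>\<^bsub>G r\<^esub> s"
      using s s' by (auto simp: G_def comm_monoid.m_comm[OF comm_group.axioms(1)[OF g]])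
    fix s'' assume s'': "s'' \<in> carrier (G r)"
    show "s \<otimes>\<^bsub>G r\<^esub> s' \<otimes>\<^bsub>G r\<^esub> s'' = s \<otimes>\<^bsub>G r\<^esub> (s' \<otimes>\<^bsub>G r\<^esub> s'')"
      using s s' s'' by (auto simp: G_def monoid.m_assoc[OF group.is_monoid[OF comm_group.axioms(2)[OF g]]])
  qed
  have rep: "rep R G \<rho>"
  proof (rule rep.intro)
    show "comm_group (G r)" if "r \<in> Obj R" for r using G[OF that] .
    show "\<rho> a \<in> hom (G r) (G t)" if a: "a \<in> Hom R t r" for a t r
    proof (rule homI)
      fix s assume "s \<in> carrier (G r)"
      then obtain n where s: "\<And>k. s k \<in> el (M k) r" "\<And>k. k \<ge> n \<Longrightarrow> s (Suc k) = app (c k) r (s k)"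
        by (auto simp: G_def)
      then show "\<rho> a s \<in> carrier (G t)"
        using act_closed[OF MO a] by (auto simp: G_def \<rho>_def app_act[OF c a] intro!: exI[of _ n])
      fix s' assume "s' \<in> carrier (G r)"
      then show "\<rho> a (s \<otimes>\<^bsub>G r\<^esub> s') = \<rho> a s \<otimes>\<^bsub>G t\<^esub> \<rho> a s'"
        using s(1) by (auto simp: G_def \<rho>_def act_mult[OF MO a])
    qed
    show "\<rho> (Ident R r) s = s" if "r \<in> Obj R" "s \<in> carrier (G r)" for r s
      using that act_Ident[OF MO] by (auto simp: G_def \<rho>_def)
    show "\<rho> (Comp R a b) x = \<rho> b (\<rho> a x)" if "a \<in> Hom R t r" "b \<in> Hom R s t" "x \<in> carrier (G r)" for a b t r s x
      using that(3) act_Comp[OF MO that(1,2)] by (auto simp: G_def \<rho>_def)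
    show "\<rho> (Add R a a') x = \<rho> a x \<otimes>\<^bsub>G t\<^esub> \<rho> a' x" if "a \<in> Hom R t r" "a' \<in> Hom R t r" "x \<in> carrier (G r)" for a a' t r x
      using that(3) act_Add[OF MO that(1,2)] by (auto simp: G_def \<rho>_def)
  qed
  define rel where "rel r s k x \<longleftrightarrow> x \<in> el (M k) r \<and> (\<exists>n\<ge>k. \<forall>j\<ge>n. s j = ctr c r k (j - k) x)" for r s k x
  \<comment> \<open>The code of a sequence is some pair (stage, element) whose orbit the sequence
    eventually follows. The admissible pairs depend only on the tail of \<open>s\<close>, so
    eventually equal sequences receive the same code.\<close>
  define q where "q r s = (SOME u. \<exists>k x. u = \<pi> (\<nu> k, x) \<and> rel r s k x)" for r s
  have rel_ex: "\<exists>k x. rel r s k x" if sG: "s \<in> carrier (G r)" for r s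
  proof -
    obtain n where s: "s n \<in> el (M n) r" "\<And>k. k \<ge> n \<Longrightarrow> s (Suc k) = app (c k) r (s k)" using sG by (auto simp: G_def)
    have "s (n + j) = ctr c r n j (s n)" for j using s(2) by (induction j) simp_all
    then have "s j = ctr c r n (j - n) (s n)" if "j \<ge> n" for j using that le_add_diff_inverse by metis
    then show ?thesis using s(1) unfolding rel_def by blast
  qed
  have q_rel: "\<exists>k x. q r s = \<pi> (\<nu> k, x) \<and> rel r s k x" if "s \<in> carrier (G r)" for r s
    unfolding q_def by (rule someI_ex) (use rel_ex[OF that] in blast)
  have q_eq: "q r s = q r s' \<longleftrightarrow> (\<exists>n. \<forall>j\<ge>n. s j = s' j)" if s: "s \<in> carrier (G r)" "s' \<in> carrier (G r)" for r s s'
  proof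
    assume eq: "q r s = q r s'"
    obtain k x where x: "q r s = \<pi> (\<nu> k, x)" "rel r s k x" using q_rel[OF s(1)] by blast
    obtain k' x' where x': "q r s' = \<pi> (\<nu> k', x')" "rel r s' k' x'" using q_rel[OF s(2)] by blast
    have e: "k' = k" "x' = x" using eq x(1) x'(1) \<pi> \<nu> by (auto simp: inj_eq)
    obtain m where m: "\<forall>j\<ge>m. s j = ctr c r k (j - k) x" using x(2) unfolding rel_def by blast
    obtain n where n: "\<forall>j\<ge>n. s' j = ctr c r k (j - k) x" using x'(2) unfolding rel_def e by blast
    show "\<exists>n. \<forall>j\<ge>n. s j = s' j" using m n by (intro exI[of _ "max m n"]) simp
  next
    assume "\<exists>n. \<forall>j\<ge>n. s j = s' j"
    then obtain n where n: "\<forall>j\<ge>n. s j = s' j" by blast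
    have "rel r s k x \<longleftrightarrow> rel r s' k x" for k x
    proof
      assume "rel r s k x"
      then obtain m where "x \<in> el (M k) r" "m \<ge> k" "\<forall>j\<ge>m. s j = ctr c r k (j - k) x" by (auto simp: rel_def)
      then show "rel r s' k x" using n unfolding rel_def by (intro conjI exI[of _ "max m n"]) auto
    next
      assume "rel r s' k x"
      then obtain m where "x \<in> el (M k) r" "m \<ge> k" "\<forall>j\<ge>m. s' j = ctr c r k (j - k) x" by (auto simp: rel_def)
      then show "rel r s k x" using n unfolding rel_def by (intro conjI exI[of _ "max m n"]) auto
    qed
    then show "q r s = q r s'" by (simp add: q_def)
  qed
  have "\<exists>L \<in> Obj Md. (\<forall>r \<in> Obj R. el L r = q r ` carrier (G r) \<and> q r \<in> hom (G r) (fib L r)) \<and>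
    (\<forall>t r a x. a \<in> Hom R t r \<and> x \<in> carrier (G r) \<longrightarrow> act L a (q r x) = q t (\<rho> a x))" (is "\<exists>L \<in> _. ?P L")
  proof (rule module_of_rep[OF rep])
    fix r x x' y y' assume r: "r \<in> Obj R" and xy: "x \<in> carrier (G r)" "x' \<in> carrier (G r)" "y \<in> carrier (G r)" "y' \<in> carrier (G r)"
      and "q r x = q r x'" "q r y = q r y'"
    then obtain m n where "\<forall>j\<ge>m. x j = x' j" "\<forall>j\<ge>n. y j = y' j" using q_eq by blast
    then have "\<exists>n. \<forall>j\<ge>n. (x \<otimes>\<^bsub>G r\<^esub> y) j = (x' \<otimes>\<^bsub>G r\<^esub> y') j" by (intro exI[of _ "max m n"]) (simp add: G_def)
    then show "q r (x \<otimes>\<^bsub>G r\<^esub> y) = q r (x' \<otimes>\<^bsub>G r\<^esub> y')" using q_eq comm_group_closed(2)[OF G[OF r]] xy by simp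
  next
    fix t r a x x' assume a: "a \<in> Hom R t r" and x: "x \<in> carrier (G r)" "x' \<in> carrier (G r)" and "q r x = q r x'"
    then obtain n where "\<forall>j\<ge>n. x j = x' j" using q_eq by blast
    then have "\<exists>n. \<forall>j\<ge>n. \<rho> a x j = \<rho> a x' j" by (intro exI[of _ n]) (simp add: \<rho>_def)
    then show "q t (\<rho> a x) = q t (\<rho> a x')" using q_eq[OF rep.closed[OF rep a x(1)] rep.closed[OF rep a x(2)]] by simp
  next
    fix r assume r: "r \<in> Obj R"
    have "small (\<Union>k. (\<lambda>x. \<pi> (\<nu> k, x)) ` el (M k) r)"
      by (intro small_UN_nat small_image fib_small MO r)
    moreover have "q r ` carrier (G r) \<subseteq> (\<Union>k. (\<lambda>x. \<pi> (\<nu> k, x)) ` el (M k) r)"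
      using q_rel by (fastforce simp: rel_def)
    ultimately show "small (q r ` carrier (G r))" by (rule small_subset)
  qed
  then obtain L where L: "L \<in> Obj Md" and *: "?P L" by (elim bexE) (rule that)
  have fibL: "el L r = q r ` carrier (G r)" and q_hom: "q r \<in> hom (G r) (fib L r)" if "r \<in> Obj R" for r
    using * that by blast+
  have actL: "act L a (q r x) = q t (\<rho> a x)" if "a \<in> Hom R t r" "x \<in> carrier (G r)" for a t r x
    using * that by blast
  \<comment> \<open>The sequence that represents an element of stage \<open>k\<close>. Its entries
    before \<open>k\<close> are neutral by convention; only the tail matters to the class.\<close>
  define sq where "sq r k x = (\<lambda>j. if j < k then (neut (M j) r) else ctr c r k (j - k) x)" for r k x
  have sq: "sq r k x \<in> carrier (G r)" if r: "r \<in> Obj R" and x: "x \<in> el (M k) r" for r k x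
    using cl[OF r x] neut_closed[OF MO r]
    by (auto simp: G_def sq_def Suc_diff_le not_less intro!: exI[of _ k])
      (metis le_add_diff_inverse)
  define \<iota> where "\<iota> k = mk_arr (M k) L (\<lambda>r x. q r (sq r k x))" for k
  have \<iota>: "\<iota> k \<in> Hom Md (M k) L" for k
    unfolding \<iota>_def
  proof (intro mk_arr_Hom MO L homI)
    show "q r (sq r k x) \<in> el L r" if "r \<in> Obj R" "x \<in> el (M k) r" for r x
      using sq[OF that] fibL[OF that(1)] by blast
    show "q r (sq r k (x \<cdot>[(M k),r] y)) = q r (sq r k x) \<cdot>[L,r] q r (sq r k y)"
      if r: "r \<in> Obj R" and x: "x \<in> el (M k) r" and y: "y \<in> el (M k) r" for r x y
    proof -
      have "sq r k (x \<cdot>[(M k),r] y) = sq r k x \<otimes>\<^bsub>G r\<^esub> sq r k y"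
        using ctr_mult[where M = M and c = c, OF c r x y] neut_closed[OF MO r]
        by (auto simp: sq_def G_def fun_eq_iff monoid.l_one[OF group.is_monoid[OF comm_group.axioms(2)[OF fib_comm_group[OF MO r]]]])
      then show ?thesis using hom_mult[OF q_hom[OF r] sq[OF r x] sq[OF r y]] by simp
    qed
    show "q t (sq t k (act (M k) a x)) = act L a (q r (sq r k x))" if a: "a \<in> Hom R t r" and x: "x \<in> el (M k) r" for t r a x
    proof -
      have "sq t k (act (M k) a x) = \<rho> a (sq r k x)"
        using ctr_act[where M = M and c = c, OF c a x] act_one[OF MO a] by (auto simp: sq_def \<rho>_def fun_eq_iff)
      then show ?thesis using actL[OF a sq[OF Hom_Obj(2)[OF a] x]] by simp
    qed
  qed
  have "direct_limit M c L \<iota>"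
    unfolding direct_limit_def
  proof (intro conjI allI ballI impI c \<iota>)
    fix k r x assume r: "r \<in> Obj R" and x: "x \<in> el (M k) r"
    have cx: "app (c k) r x \<in> el (M (Suc k)) r" using app_closed[OF c r x] .
    have "ctr c r k (Suc j) x = ctr c r (Suc k) j (app (c k) r x)" for j
      using ctr_add[of c r k 1 j x] by simp
    then have "sq r (Suc k) (app (c k) r x) (Suc k + i) = sq r k x (Suc k + i)" for i
      by (simp add: sq_def Suc_diff_le)
    then have "\<forall>j\<ge>Suc k. sq r (Suc k) (app (c k) r x) j = sq r k x j"
      using le_Suc_ex[of "Suc k"] by metis
    then have "q r (sq r (Suc k) (app (c k) r x)) = q r (sq r k x)"
      using q_eq[OF sq[OF r cx] sq[OF r x]] by blast
    then show "app (\<iota> (Suc k)) r (app (c k) r x) = app (\<iota> k) r x" using r x cx by (simp add: \<iota>_def)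
  next
    fix r z assume r: "r \<in> Obj R" and "z \<in> el L r"
    then obtain s where s: "s \<in> carrier (G r)" "z = q r s" using fibL by blast
    obtain k x where "rel r s k x" using rel_ex[OF s(1)] by blast
    then obtain n where x: "x \<in> el (M k) r" and n: "n \<ge> k" "\<forall>j\<ge>n. s j = ctr c r k (j - k) x" by (auto simp: rel_def)
    have "q r s = q r (sq r k x)" using q_eq[OF s(1) sq[OF r x]] n by (auto simp: sq_def intro!: exI[of _ n])
    then have "z = app (\<iota> k) r x" using s(2) r x by (simp add: \<iota>_def)
    then show "\<exists>k. \<exists>x \<in> el (M k) r. z = app (\<iota> k) r x" using x by blast
  next
    fix k r x assume r: "r \<in> Obj R" and x: "x \<in> el (M k) r" and 1: "app (\<iota> k) r x = neut L r"
    have "q r \<one>\<^bsub>G r\<^esub> = neut L r" using hom_oneI[OF q_hom[OF r] G[OF r] fib_comm_group[OF L r]] .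
    then have "q r (sq r k x) = q r \<one>\<^bsub>G r\<^esub>" using 1 r x by (simp add: \<iota>_def)
    then obtain n where "\<forall>j\<ge>n. sq r k x j = neut (M j) r"
      using q_eq[OF sq[OF r x] comm_group_closed(1)[OF G[OF r]]] by (auto simp: G_def)
    then have "sq r k x (k + n) = neut (M (k + n)) r" by simp
    then show "\<exists>n. ctr c r k n x = neut (M (k + n)) r" by (auto simp: sq_def)
  qed
  then show ?thesis by blast
qed

section \<open>Sequential colimits of FI-modules\<close>

lemma FI_direct_limit_exists:
  assumes c: "\<And>k. c k \<in> Hom FM (X k) (X (Suc k))"
  shows "\<exists>L \<iota>. (\<forall>k. \<iota> k \<in> Hom FM (X k) L) \<and>
    (\<forall>S. finite S \<longrightarrow> direct_limit (\<lambda>k. FObj (X k) S) (\<lambda>k. Map (c k) S) (FObj L S) (\<lambda>k. Map (\<iota> k) S))"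
proof -
  have XO: "X k \<in> Obj FM" for k using Hom_FIMod_Obj(1)[OF c] .
  have "\<exists>L \<iota>. direct_limit (\<lambda>k. FObj (X k) S) (\<lambda>k. Map (c k) S) L \<iota>" if "finite S" for S
    by (rule direct_limit_exists) (rule component_Mod[OF c that])
  then obtain L \<iota> where dl: "\<And>S. finite S \<Longrightarrow> direct_limit (\<lambda>k. FObj (X k) S) (\<lambda>k. Map (c k) S) (L S) (\<iota> S)"
    by (rule choice2E) (assumption, rule that)
  note \<iota> = direct_limit_arr(2)[OF dl]
  have LO: "L S \<in> Obj Md" if "finite S" for S using Hom_Mod_Obj(2)[OF \<iota>[OF that]] .
  have "\<exists>g. g \<in> Hom Md (L S) (L Y) \<and> (\<forall>k. \<forall>r \<in> Obj R. \<forall>x \<in> el (FObj (X k) S) r.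
      app g r (app (\<iota> S k) r x) = app (Comp Md (\<iota> Y k) (FArr (X k) \<phi>)) r x)" if \<phi>: "\<phi> \<in> Hom FI S Y" for S Y \<phi>
  proof (rule direct_limit_universal[OF dl, unfolded Bex_def])
    note fin = Hom_FI_finite[OF \<phi>]
    show "finite S" "L Y \<in> Obj Md" using fin LO by auto
    show "Comp Md (\<iota> Y k) (FArr (X k) \<phi>) \<in> Hom Md (FObj (X k) S) (L Y)" for k
      using Md.Comp_Hom[OF FArr_Mod[OF XO \<phi>] \<iota>[OF fin(2)]] .
    fix k r x assume r: "r \<in> Obj R" and x: "x \<in> el (FObj (X k) S) r"
    have "app (\<iota> Y (Suc k)) r (comp_at (c k) Y r (push (X k) \<phi> r x)) = app (\<iota> Y k) r (push (X k) \<phi> r x)"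
      using dl[OF fin(2)] r push_closed[OF XO \<phi> r x] unfolding direct_limit_def by blast
    then show "app (Comp Md (\<iota> Y (Suc k)) (FArr (X (Suc k)) \<phi>)) r (app (Map (c k) S) r x) =
        app (Comp Md (\<iota> Y k) (FArr (X k) \<phi>)) r x"
      using r x app_closed[OF component_Mod[OF c fin(1)] r x] component_push[OF c \<phi> r x]
      by (simp add: app_Comp[OF FArr_Mod[OF XO \<phi>]])
  qed
  then obtain g where g': "\<And>\<phi> S Y. \<phi> \<in> Hom FI S Y \<Longrightarrow> g \<phi> \<in> Hom Md (L S) (L Y) \<and>
      (\<forall>k. \<forall>r \<in> Obj R. \<forall>x \<in> el (FObj (X k) S) r.
        app (g \<phi>) r (app (\<iota> S k) r x) = app (Comp Md (\<iota> Y k) (FArr (X k) \<phi>)) r x)"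
    by (rule FI_choiceE) (assumption, rule that)
  note g = g'[THEN conjunct1]
  have g_eq: "app (g \<phi>) r (app (\<iota> S k) r x) = app (\<iota> Y k) r (push (X k) \<phi> r x)"
    if \<phi>: "\<phi> \<in> Hom FI S Y" and r: "r \<in> Obj R" and x: "x \<in> el (FObj (X k) S) r" for \<phi> S Y r k x
    using g'[OF \<phi>] r x app_Comp[OF FArr_Mod[OF XO \<phi>] r x] by simp
  note ex = direct_limit_ex[OF dl, where K = 0]
  have LF: "mk_functor FI L g \<in> Obj FM"
  proof (rule mk_functor_FIMod)
    show "app (g (Ident FI S)) r z = z" if S: "finite S" and r: "r \<in> Obj R" and z: "z \<in> el (L S) r" for S r z
      using ex[OF S r z] S g_eq[OF FI.Ident_Hom r] push_Ident[OF XO S r] by auto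
    show "app (g (Comp FI \<psi> \<phi>)) r z = app (g \<psi>) r (app (g \<phi>) r z)"
      if \<phi>: "\<phi> \<in> Hom FI S Y" and \<psi>: "\<psi> \<in> Hom FI Y Y'" and r: "r \<in> Obj R" and z: "z \<in> el (L S) r" for S Y Y' \<phi> \<psi> r z
      using ex[OF Hom_FI_finite(1)[OF \<phi>] r z] g_eq[OF \<phi> r] g_eq[OF \<psi> r push_closed[OF XO \<phi> r]]
        g_eq[OF FI.Comp_Hom[OF \<phi> \<psi>] r] push_Comp[OF XO \<phi> \<psi> r] by auto
  qed (use LO g in auto)
  have "mk_nat FI (X k) (mk_functor FI L g) (\<lambda>S. \<iota> S k) \<in> Hom FM (X k) (mk_functor FI L g)" for k
    using \<iota> Hom_FI_finite by (intro mk_nat_FIMod[OF XO LF]) (auto simp: g_eq)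
  then show ?thesis
    using dl by (intro exI[of _ "mk_functor FI L g"] exI[of _ "\<lambda>k. mk_nat FI (X k) (mk_functor FI L g) (\<lambda>S. \<iota> S k)"]) simp
qed

lemma FI_direct_limit_is_colimit:
  assumes \<iota>: "\<And>k. \<iota> k \<in> Hom FM (X k) L" and c: "\<And>k. c k \<in> Hom FM (X k) (X (Suc k))"
    and dl: "\<And>S. finite S \<Longrightarrow> direct_limit (\<lambda>k. FObj (X k) S) (\<lambda>k. Map (c k) S) (FObj L S) (\<lambda>k. Map (\<iota> k) S)"
  shows "is_seq_colimit FM X c L \<iota>"
  unfolding is_seq_colimit_def
proof (intro conjI allI impI)
  have LO: "L \<in> Obj FM" using Hom_FIMod_Obj(2)[OF \<iota>] .
  have "Comp FM (\<iota> (Suc k)) (c k) = \<iota> k" for k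
    using dl by (intro FI_module_arrow_eqI[OF FM.Comp_Hom[OF c \<iota>] \<iota>]) (simp add: component_Comp[OF c] direct_limit_def)
  then show "is_seq_cocone FM X c L \<iota>" using \<iota> LO by (simp add: is_seq_cocone_def)
  fix L' \<iota>' assume co: "is_seq_cocone FM X c L' \<iota>'"
  have L': "L' \<in> Obj FM" and \<iota>': "\<And>k. \<iota>' k \<in> Hom FM (X k) L'" and cc: "\<And>k. Comp FM (\<iota>' (Suc k)) (c k) = \<iota>' k"
    using co by (simp_all add: is_seq_cocone_def)
  have "\<exists>h \<in> Hom Md (FObj L S) (FObj L' S). \<forall>k. \<forall>r \<in> Obj R. \<forall>x \<in> el (FObj (X k) S) r.
      app h r (comp_at (\<iota> k) S r x) = comp_at (\<iota>' k) S r x" if S: "finite S" for S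
  proof (rule direct_limit_universal[OF dl[OF S] FObj_Mod[OF L' S] component_Mod[OF \<iota>' S]])
    fix k r x assume "r \<in> Obj R" "x \<in> el (FObj (X k) S) r"
    then show "comp_at (\<iota>' (Suc k)) S r (comp_at (c k) S r x) = comp_at (\<iota>' k) S r x"
      using arg_cong[OF cc[of k], of "\<lambda>f. comp_at f S r x"] S by (simp add: component_Comp[OF c])
  qed
  then obtain h where h: "\<And>S. finite S \<Longrightarrow> h S \<in> Hom Md (FObj L S) (FObj L' S)"
    and h_eq: "\<And>S k r x. finite S \<Longrightarrow> r \<in> Obj R \<Longrightarrow> x \<in> el (FObj (X k) S) r \<Longrightarrow>
      app (h S) r (comp_at (\<iota> k) S r x) = comp_at (\<iota>' k) S r x" by metis
  note ex = direct_limit_ex[OF dl, where K = 0]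
  have hH: "mk_nat FI L L' h \<in> Hom FM L L'"
  proof (rule mk_nat_FIMod[OF LO L' h])
    fix S Y \<phi> r z assume \<phi>: "\<phi> \<in> Hom FI S Y" and r: "r \<in> Obj R" and z: "z \<in> el (FObj L S) r"
    note fin = Hom_FI_finite[OF \<phi>]
    obtain k x where x: "x \<in> el (FObj (X k) S) r" "z = comp_at (\<iota> k) S r x" using ex[OF fin(1) r z] by blast
    show "app (h Y) r (push L \<phi> r z) = push L' \<phi> r (app (h S) r z)"
      using component_push[OF \<iota> \<phi> r x(1)] component_push[OF \<iota>' \<phi> r x(1)] x(2) h_eq[OF fin(1) r x(1)]
        h_eq[OF fin(2) r push_closed[OF Hom_FIMod_Obj(1)[OF \<iota>] \<phi> r x(1)]] by simp
  qed
  show "\<exists>!h. h \<in> Hom FM L L' \<and> (\<forall>k. Comp FM h (\<iota> k) = \<iota>' k)"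
  proof (intro ex1I conjI allI)
    show "mk_nat FI L L' h \<in> Hom FM L L'" by fact
    show "Comp FM (mk_nat FI L L' h) (\<iota> k) = \<iota>' k" for k
      using h_eq by (intro FI_module_arrow_eqI[OF FM.Comp_Hom[OF \<iota> hH] \<iota>']) (simp add: component_Comp[OF \<iota>])
    fix g assume g: "g \<in> Hom FM L L' \<and> (\<forall>k. Comp FM g (\<iota> k) = \<iota>' k)"
    show "g = mk_nat FI L L' h"
    proof (rule FI_module_arrow_eqI[OF conjunct1[OF g] hH])
      fix S r z assume S: "finite S" and r: "r \<in> Obj R" and z: "z \<in> el (FObj L S) r"
      obtain k x where x: "x \<in> el (FObj (X k) S) r" "z = comp_at (\<iota> k) S r x" using ex[OF S r z] by blast
      show "comp_at g S r z = comp_at (mk_nat FI L L' h) S r z"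
        using arg_cong[OF spec[OF conjunct2[OF g], of k], of "\<lambda>f. comp_at f S r x"] x h_eq[OF S r x(1)] S r
        by (simp add: component_Comp[OF \<iota>])
    qed
  qed
qed

lemma seq_colimit_unique:
  assumes L: "is_seq_colimit FM X c L \<iota>" and L': "is_seq_colimit FM X c L' \<iota>'"
  shows "\<exists>h \<in> Hom FM L L'. \<exists>h' \<in> Hom FM L' L. Comp FM h' h = Ident FM L \<and> Comp FM h h' = Ident FM L' \<and>
    (\<forall>k. Comp FM h (\<iota> k) = \<iota>' k) \<and> (\<forall>k. Comp FM h' (\<iota>' k) = \<iota> k)"
proof -
  have u: "\<exists>!h. h \<in> Hom FM L L' \<and> (\<forall>k. Comp FM h (\<iota> k) = \<iota>' k)"
    if "is_seq_colimit FM X c L \<iota>" "is_seq_colimit FM X c L' \<iota>'" for L L' \<iota> \<iota>'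
    using that by (simp add: is_seq_colimit_def)
  have co: "L \<in> Obj FM" "\<And>k. \<iota> k \<in> Hom FM (X k) L" "L' \<in> Obj FM" "\<And>k. \<iota>' k \<in> Hom FM (X k) L'"
    using L L' by (simp_all add: is_seq_colimit_def is_seq_cocone_def)
  obtain h where h: "h \<in> Hom FM L L'" "\<And>k. Comp FM h (\<iota> k) = \<iota>' k" using u[OF L L'] by blast
  obtain h' where h': "h' \<in> Hom FM L' L" "\<And>k. Comp FM h' (\<iota>' k) = \<iota> k" using u[OF L' L] by blast
  have "Comp FM (Comp FM h' h) (\<iota> k) = \<iota> k" "Comp FM (Comp FM h h') (\<iota>' k) = \<iota>' k" for k
    using FM.Comp_assoc[OF co(2) h(1) h'(1)] FM.Comp_assoc[OF co(4) h'(1) h(1)] h h' by simp_all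
  moreover have "Comp FM (Ident FM L) (\<iota> k) = \<iota> k" "Comp FM (Ident FM L') (\<iota>' k) = \<iota>' k" for k
    using FM.Comp_Ident_left[OF co(2)] FM.Comp_Ident_left[OF co(4)] by simp_all
  ultimately have "Comp FM h' h = Ident FM L" "Comp FM h h' = Ident FM L'"
    using u[OF L L] u[OF L' L'] FM.Comp_Hom[OF h(1) h'(1)] FM.Comp_Hom[OF h'(1) h(1)]
      FM.Ident_Hom[OF co(1)] FM.Ident_Hom[OF co(3)] by blast+
  then show ?thesis using h h' by blast
qed

end

section \<open>Right ideals are finitely generated\<close>

text \<open>Generation by a finite set is expressed through all stable subgroups containing it, so
  that linear combinations of generators never have to be written down.\<close>

definition fg_subrep :: "('r, 'm) preadditive \<Rightarrow> ('r \<Rightarrow> 'x monoid) \<Rightarrow> ('m \<Rightarrow> 'x \<Rightarrow> 'x) \<Rightarrow> ('r \<Rightarrow> 'x set) \<Rightarrow> bool" where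
  "fg_subrep R G \<rho> D \<longleftrightarrow> (\<exists>F. finite F \<and> (\<forall>(t, x) \<in> F. t \<in> Obj R \<and> x \<in> D t) \<and>
    (\<forall>J. subrep R G \<rho> J \<and> (\<forall>(t, x) \<in> F. x \<in> J t) \<longrightarrow> (\<forall>t \<in> Obj R. D t \<subseteq> J t)))"

lemma fg_subrepE:
  assumes "fg_subrep R G \<rho> D"
  obtains F where "finite F" "\<And>t x. (t, x) \<in> F \<Longrightarrow> t \<in> Obj R \<and> x \<in> D t"
    "\<And>J t. subrep R G \<rho> J \<Longrightarrow> (\<And>t x. (t, x) \<in> F \<Longrightarrow> x \<in> J t) \<Longrightarrow> t \<in> Obj R \<Longrightarrow> D t \<subseteq> J t"
proof -
  obtain F where F: "finite F \<and> (\<forall>(t, x) \<in> F. t \<in> Obj R \<and> x \<in> D t) \<and>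
      (\<forall>J. subrep R G \<rho> J \<and> (\<forall>(t, x) \<in> F. x \<in> J t) \<longrightarrow> (\<forall>t \<in> Obj R. D t \<subseteq> J t))"
    using assms unfolding fg_subrep_def by (rule exE)
  show thesis
  proof (rule that[OF conjunct1[OF F]])
    show "t \<in> Obj R \<and> x \<in> D t" if "(t, x) \<in> F" for t x using F that by blast
    show "D t \<subseteq> J t" if "subrep R G \<rho> J" "\<And>t x. (t, x) \<in> F \<Longrightarrow> x \<in> J t" "t \<in> Obj R" for J t
      using F that by blast
  qed
qed

definition noetherian_subrep :: "('r, 'm) preadditive \<Rightarrow> ('r \<Rightarrow> 'x monoid) \<Rightarrow> ('m \<Rightarrow> 'x \<Rightarrow> 'x) \<Rightarrow> ('r \<Rightarrow> 'x set) \<Rightarrow> bool" where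
  "noetherian_subrep R G \<rho> P \<longleftrightarrow>
    (\<forall>D. subrep R G \<rho> D \<and> (\<forall>t \<in> Obj R. D t \<subseteq> P t) \<longrightarrow> fg_subrep R G \<rho> D)"

context rep begin

lemma subrep_Int:
  assumes "subrep R G \<rho> D" "subrep R G \<rho> E"
  shows "subrep R G \<rho> (\<lambda>t. D t \<inter> E t)"
  using subrepD[OF assms(1)] subrepD[OF assms(2)] subrep_act[OF assms(1)] subrep_act[OF assms(2)]
  by (intro subrepI) auto

lemma subrep_generated:
  assumes "\<And>t x. (t, x) \<in> F \<Longrightarrow> t \<in> Obj R \<and> x \<in> carrier (G t)" "category R"
  shows "subrep R G \<rho> (\<lambda>t. {x \<in> carrier (G t). \<forall>J. subrep R G \<rho> J \<and> (\<forall>(t, x) \<in> F. x \<in> J t) \<longrightarrow> x \<in> J t})"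
proof (rule subrepI)
  fix r x y assume r: "r \<in> Obj R"
    and x: "x \<in> {x \<in> carrier (G r). \<forall>J. subrep R G \<rho> J \<and> (\<forall>(t, x) \<in> F. x \<in> J t) \<longrightarrow> x \<in> J r}"
    and y: "y \<in> {x \<in> carrier (G r). \<forall>J. subrep R G \<rho> J \<and> (\<forall>(t, x) \<in> F. x \<in> J t) \<longrightarrow> x \<in> J r}"
  then show "x \<otimes>\<^bsub>G r\<^esub> inv\<^bsub>G r\<^esub> y \<in> {x \<in> carrier (G r). \<forall>J. subrep R G \<rho> J \<and> (\<forall>(t, x) \<in> F. x \<in> J t) \<longrightarrow> x \<in> J r}"
    using comm_group_closed(2,3)[OF comm_group[OF r]] by (auto intro!: subrepD(4,5)[OF _ r])
next
  fix t r a x assume a: "a \<in> Hom R t r"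
    and x: "x \<in> {x \<in> carrier (G r). \<forall>J. subrep R G \<rho> J \<and> (\<forall>(t, x) \<in> F. x \<in> J t) \<longrightarrow> x \<in> J r}"
  show "\<rho> a x \<in> {x \<in> carrier (G t). \<forall>J. subrep R G \<rho> J \<and> (\<forall>(t, x) \<in> F. x \<in> J t) \<longrightarrow> x \<in> J t}"
  proof (intro CollectI conjI allI impI)
    show "\<rho> a x \<in> carrier (G t)" using closed[OF a] x by simp
    fix J assume J: "subrep R G \<rho> J \<and> (\<forall>(t, x) \<in> F. x \<in> J t)"
    then have "x \<in> J r" using x by blast
    then show "\<rho> a x \<in> J t" using subrep_act[OF conjunct1[OF J] a] by simp
  qed
next
  fix r assume r: "r \<in> Obj R"
  show "\<one>\<^bsub>G r\<^esub> \<in> {x \<in> carrier (G r). \<forall>J. subrep R G \<rho> J \<and> (\<forall>(t, x) \<in> F. x \<in> J t) \<longrightarrow> x \<in> J r}"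
    using comm_group_closed(1)[OF comm_group[OF r]] subrepD(3)[where G = G and \<rho> = \<rho>, OF _ r] by simp
qed simp

lemma subrep_sum:
  assumes P: "subrep R G \<rho> P" and Q: "subrep R G \<rho> Q" and "category R"
  shows "subrep R G \<rho> (\<lambda>t. {x \<otimes>\<^bsub>G t\<^esub> y |x y. x \<in> P t \<and> y \<in> Q t})"
proof (rule subrepI)
  interpret category R by fact
  fix r assume r: "r \<in> Obj R"
  interpret G: comm_group "G r" using comm_group[OF r] .
  note P' = subrepD[OF P r] and Q' = subrepD[OF Q r]
  show "x \<in> carrier (G r)" if "x \<in> {x \<otimes>\<^bsub>G r\<^esub> y |x y. x \<in> P r \<and> y \<in> Q r}" for x using that P' Q' by auto
  show "\<one>\<^bsub>G r\<^esub> \<in> {x \<otimes>\<^bsub>G r\<^esub> y |x y. x \<in> P r \<and> y \<in> Q r}" using P'(3) Q'(3) by force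
  fix a b assume "a \<in> {x \<otimes>\<^bsub>G r\<^esub> y |x y. x \<in> P r \<and> y \<in> Q r}" "b \<in> {x \<otimes>\<^bsub>G r\<^esub> y |x y. x \<in> P r \<and> y \<in> Q r}"
  then obtain x y x' y' where *: "x \<in> P r" "y \<in> Q r" "x' \<in> P r" "y' \<in> Q r" "a = x \<otimes>\<^bsub>G r\<^esub> y" "b = x' \<otimes>\<^bsub>G r\<^esub> y'"
    by blast
  have "a \<otimes>\<^bsub>G r\<^esub> inv\<^bsub>G r\<^esub> b = (x \<otimes>\<^bsub>G r\<^esub> inv\<^bsub>G r\<^esub> x') \<otimes>\<^bsub>G r\<^esub> (y \<otimes>\<^bsub>G r\<^esub> inv\<^bsub>G r\<^esub> y')"
    using * P'(2) Q'(2) by (simp add: G.inv_mult G.m_assoc G.m_lcomm)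
  then show "a \<otimes>\<^bsub>G r\<^esub> inv\<^bsub>G r\<^esub> b \<in> {x \<otimes>\<^bsub>G r\<^esub> y |x y. x \<in> P r \<and> y \<in> Q r}"
    using P'(4,5) Q'(4,5) * by blast
next
  interpret category R by fact
  fix t r a z assume a: "a \<in> Hom R t r" and "z \<in> {x \<otimes>\<^bsub>G r\<^esub> y |x y. x \<in> P r \<and> y \<in> Q r}"
  then obtain x y where *: "x \<in> P r" "y \<in> Q r" "z = x \<otimes>\<^bsub>G r\<^esub> y" by blast
  then have "\<rho> a z = \<rho> a x \<otimes>\<^bsub>G t\<^esub> \<rho> a y"
    using mult[OF a] subrepD(2)[OF P Hom_Obj(2)[OF a]] subrepD(2)[OF Q Hom_Obj(2)[OF a]] by simp
  then show "\<rho> a z \<in> {x \<otimes>\<^bsub>G t\<^esub> y |x y. x \<in> P t \<and> y \<in> Q t}"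
    using subrep_act[OF P a] subrep_act[OF Q a] * by blast
qed

text \<open>The extension argument for noetherian modules without forming a quotient: a stable
  subgroup \<open>D\<close> of the sum is controlled by its intersection with \<open>P\<close> and
  by the set of its \<open>Q\<close>-components, both of which are finitely generated.\<close>

lemma noetherian_sum:
  assumes P: "subrep R G \<rho> P" and Q: "subrep R G \<rho> Q" and "category R"
    and nP: "noetherian_subrep R G \<rho> P" and nQ: "noetherian_subrep R G \<rho> Q"
  shows "noetherian_subrep R G \<rho> (\<lambda>t. {x \<otimes>\<^bsub>G t\<^esub> y |x y. x \<in> P t \<and> y \<in> Q t})"
  unfolding noetherian_subrep_def
proof (intro allI impI; elim conjE)
  interpret category R by fact
  fix D assume D: "subrep R G \<rho> D" and DPQ: "\<forall>t \<in> Obj R. D t \<subseteq> {x \<otimes>\<^bsub>G t\<^esub> y |x y. x \<in> P t \<and> y \<in> Q t}"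
  \<comment> \<open>The possible \<open>Q\<close>-components of elements of \<open>E\<close>. It
    plays the part of the image of \<open>E\<close> modulo \<open>P\<close>.\<close>
  let ?proj = "\<lambda>E t. {y \<in> Q t. \<exists>x \<in> P t. x \<otimes>\<^bsub>G t\<^esub> y \<in> E t}"
  have proj: "subrep R G \<rho> (?proj E)" if E: "subrep R G \<rho> E" for E
  proof (rule subrepI)
    fix r assume r: "r \<in> Obj R"
    interpret G: comm_group "G r" using comm_group[OF r] .
    note P' = subrepD[OF P r] and Q' = subrepD[OF Q r] and E' = subrepD[OF E r]
    show "x \<in> carrier (G r)" if "x \<in> ?proj E r" for x using that Q' by auto
    have "\<one>\<^bsub>G r\<^esub> \<otimes>\<^bsub>G r\<^esub> \<one>\<^bsub>G r\<^esub> = \<one>\<^bsub>G r\<^esub>" by simp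
    then show "\<one>\<^bsub>G r\<^esub> \<in> ?proj E r" using P'(3) Q'(3) E'(3) by force
    fix y y' assume "y \<in> ?proj E r" "y' \<in> ?proj E r"
    then obtain x x' where *: "x \<in> P r" "x' \<in> P r" "y \<in> Q r" "y' \<in> Q r" "x \<otimes>\<^bsub>G r\<^esub> y \<in> E r" "x' \<otimes>\<^bsub>G r\<^esub> y' \<in> E r" by blast
    have "(x \<otimes>\<^bsub>G r\<^esub> inv\<^bsub>G r\<^esub> x') \<otimes>\<^bsub>G r\<^esub> (y \<otimes>\<^bsub>G r\<^esub> inv\<^bsub>G r\<^esub> y') = (x \<otimes>\<^bsub>G r\<^esub> y) \<otimes>\<^bsub>G r\<^esub> inv\<^bsub>G r\<^esub> (x' \<otimes>\<^bsub>G r\<^esub> y')"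
      using * P'(2) Q'(2) by (simp add: G.inv_mult G.m_assoc G.m_lcomm)
    then have "(x \<otimes>\<^bsub>G r\<^esub> inv\<^bsub>G r\<^esub> x') \<otimes>\<^bsub>G r\<^esub> (y \<otimes>\<^bsub>G r\<^esub> inv\<^bsub>G r\<^esub> y') \<in> E r" using * E'(4,5) by simp
    then show "y \<otimes>\<^bsub>G r\<^esub> inv\<^bsub>G r\<^esub> y' \<in> ?proj E r"
      using P'(4,5) Q'(4,5) * by blast
  next
    fix t r a y assume a: "a \<in> Hom R t r" and "y \<in> ?proj E r"
    then obtain x where *: "x \<in> P r" "y \<in> Q r" "x \<otimes>\<^bsub>G r\<^esub> y \<in> E r" by blast
    have "\<rho> a (x \<otimes>\<^bsub>G r\<^esub> y) = \<rho> a x \<otimes>\<^bsub>G t\<^esub> \<rho> a y"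
      using * mult[OF a] subrepD(2)[OF P Hom_Obj(2)[OF a]] subrepD(2)[OF Q Hom_Obj(2)[OF a]] by simp
    then have "\<rho> a x \<otimes>\<^bsub>G t\<^esub> \<rho> a y \<in> E t" using subrep_act[OF E a *(3)] by simp
    then show "\<rho> a y \<in> ?proj E t" using subrep_act[OF P a *(1)] subrep_act[OF Q a *(2)] by blast
  qed
  have "fg_subrep R G \<rho> (\<lambda>t. P t \<inter> D t)"
    using nP subrep_Int[OF P D] unfolding noetherian_subrep_def by blast
  then obtain F1 where F1: "finite F1" "\<And>t x. (t, x) \<in> F1 \<Longrightarrow> t \<in> Obj R \<and> x \<in> P t \<inter> D t"
    and F1': "\<And>J t. subrep R G \<rho> J \<Longrightarrow> (\<And>t x. (t, x) \<in> F1 \<Longrightarrow> x \<in> J t) \<Longrightarrow> t \<in> Obj R \<Longrightarrow> P t \<inter> D t \<subseteq> J t"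
    by (rule fg_subrepE) blast
  have "fg_subrep R G \<rho> (?proj D)"
    using nQ proj[OF D] unfolding noetherian_subrep_def by blast
  then obtain F2 where F2: "finite F2" "\<And>t y. (t, y) \<in> F2 \<Longrightarrow> t \<in> Obj R \<and> y \<in> ?proj D t"
    and F2': "\<And>J t. subrep R G \<rho> J \<Longrightarrow> (\<And>t y. (t, y) \<in> F2 \<Longrightarrow> y \<in> J t) \<Longrightarrow> t \<in> Obj R \<Longrightarrow> ?proj D t \<subseteq> J t"
    by (rule fg_subrepE) blast
  define pre where "pre t y = (SOME x. x \<in> P t \<and> x \<otimes>\<^bsub>G t\<^esub> y \<in> D t)" for t y
  have pre: "pre t y \<in> P t \<and> pre t y \<otimes>\<^bsub>G t\<^esub> y \<in> D t" if "(t, y) \<in> F2" for t y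
    unfolding pre_def by (rule someI_ex) (use F2(2)[OF that] in blast)
  let ?F = "F1 \<union> (\<lambda>(t, y). (t, pre t y \<otimes>\<^bsub>G t\<^esub> y)) ` F2"
  have "D t \<subseteq> J t" if J: "subrep R G \<rho> J" and FJ: "\<forall>(t, x) \<in> ?F. x \<in> J t" and t: "t \<in> Obj R" for J t
  proof
    fix d assume d: "d \<in> D t"
    interpret G: comm_group "G t" using comm_group[OF t] .
    note P' = subrepD[OF P t] and Q' = subrepD[OF Q t] and D' = subrepD[OF D t] and J' = subrepD[OF J t]
    have JD: "subrep R G \<rho> (\<lambda>t. J t \<inter> D t)" using subrep_Int[OF J D] .
    obtain x y where xy: "x \<in> P t" "y \<in> Q t" "d = x \<otimes>\<^bsub>G t\<^esub> y" using DPQ t d by blast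
    \<comment> \<open>Generation is used for the intersection of \<open>J\<close> with
      \<open>D\<close> and not for \<open>J\<close> alone: the correction between \<open>x\<close>
      and \<open>x'\<close> then lies in \<open>D\<close> as well as in \<open>P\<close>, hence in
      the part generated by \<open>F1\<close>.\<close>
    have "?proj D t \<subseteq> ?proj (\<lambda>t. J t \<inter> D t) t"
    proof (rule F2'[OF proj[OF JD] _ t])
      fix t y assume *: "(t, y) \<in> F2"
      then have "pre t y \<otimes>\<^bsub>G t\<^esub> y \<in> J t" using FJ by force
      then show "y \<in> ?proj (\<lambda>t. J t \<inter> D t) t" using pre[OF *] F2(2)[OF *] by blast
    qed
    then obtain x' where x': "x' \<in> P t" "x' \<otimes>\<^bsub>G t\<^esub> y \<in> J t" "x' \<otimes>\<^bsub>G t\<^esub> y \<in> D t" using xy d by blast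
    note c = P'(2)[OF xy(1)] P'(2)[OF x'(1)] Q'(2)[OF xy(2)]
    have eq: "x \<otimes>\<^bsub>G t\<^esub> inv\<^bsub>G t\<^esub> x' = d \<otimes>\<^bsub>G t\<^esub> inv\<^bsub>G t\<^esub> (x' \<otimes>\<^bsub>G t\<^esub> y)"
    proof -
      have "y \<otimes>\<^bsub>G t\<^esub> inv\<^bsub>G t\<^esub> (x' \<otimes>\<^bsub>G t\<^esub> y) = inv\<^bsub>G t\<^esub> x'"
        using c by (simp add: G.inv_mult G.m_lcomm[of y "inv\<^bsub>G t\<^esub> x'"])
      then show ?thesis unfolding xy(3) using c by (simp add: G.m_assoc)
    qed
    have "x \<otimes>\<^bsub>G t\<^esub> inv\<^bsub>G t\<^esub> x' \<in> P t" using P'(4)[OF xy(1) P'(5)[OF x'(1)]] .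
    moreover have "x \<otimes>\<^bsub>G t\<^esub> inv\<^bsub>G t\<^esub> x' \<in> D t" unfolding eq using D'(4)[OF d D'(5)[OF x'(3)]] .
    ultimately have "x \<otimes>\<^bsub>G t\<^esub> inv\<^bsub>G t\<^esub> x' \<in> P t \<inter> D t" by simp
    moreover have "P t \<inter> D t \<subseteq> J t" using FJ by (intro F1'[OF J _ t]) auto
    ultimately have "(x \<otimes>\<^bsub>G t\<^esub> inv\<^bsub>G t\<^esub> x') \<otimes>\<^bsub>G t\<^esub> (x' \<otimes>\<^bsub>G t\<^esub> y) \<in> J t" using J'(4) x'(2) by blast
    moreover have "(x \<otimes>\<^bsub>G t\<^esub> inv\<^bsub>G t\<^esub> x') \<otimes>\<^bsub>G t\<^esub> (x' \<otimes>\<^bsub>G t\<^esub> y) = d"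
      unfolding eq using c xy(3) by (intro comm_group_cancel(1) comm_group t) auto
    ultimately show "d \<in> J t" by simp
  qed
  moreover have "\<forall>(t, x) \<in> ?F. t \<in> Obj R \<and> x \<in> D t" using F1(2) F2(2) pre by auto
  ultimately show "fg_subrep R G \<rho> D"
    unfolding fg_subrep_def using F1(1) F2(1) by (intro exI[of _ ?F]) blast
qed

end

section \<open>From noetherian generators to finitely generated right ideals\<close>

context module_category begin

abbreviation fg_submodule :: "('r, 'm, 'u) module_obj \<Rightarrow> ('r \<Rightarrow> 'u set) \<Rightarrow> bool" where
  "fg_submodule M \<equiv> fg_subrep R (fib M) (act M)"

abbreviation noetherian_submodule :: "('r, 'm, 'u) module_obj \<Rightarrow> ('r \<Rightarrow> 'u set) \<Rightarrow> bool" where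
  "noetherian_submodule M \<equiv> noetherian_subrep R (fib M) (act M)"

text \<open>\<open>is_finitely_generated\<close> quantifies over index categories whose objects and
  arrows lie in \<open>'u\<close>. The ordered set of natural numbers is therefore coded there,
  \<nu> naming the objects and \<gamma> the arrow from m to n for m \<le> n.\<close>

lemma sequence_category:
  obtains J :: "('u, 'u) category" and \<nu> :: "nat \<Rightarrow> 'u" and \<gamma> :: "nat \<times> nat \<Rightarrow> 'u"
  where "is_filtered J" "small (Obj J)" "small (Arr J)" "inj \<nu>" "inj \<gamma>" "Obj J = range \<nu>"
    "Arr J = \<gamma> ` {(m, n). m \<le> n}"
    "\<And>m n. Dom J (\<gamma> (m, n)) = \<nu> m" "\<And>m n. Cod J (\<gamma> (m, n)) = \<nu> n" "\<And>n. Ident J (\<nu> n) = \<gamma> (n, n)"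
    "\<And>l m n. Comp J (\<gamma> (m, n)) (\<gamma> (l, m)) = \<gamma> (l, n)"
proof -
  obtain \<nu> :: "nat \<Rightarrow> 'u" where \<nu>: "inj \<nu>" "small (range \<nu>)" using small_countable by blast
  define \<gamma> where "\<gamma> = \<nu> \<circ> prod_encode"
  have \<gamma>: "inj \<gamma>" unfolding \<gamma>_def using \<nu>(1) inj_prod_encode by (rule inj_compose)
  define s where "s = (\<lambda>a. fst (inv_into UNIV \<gamma> a))"
  define e where "e = (\<lambda>a. snd (inv_into UNIV \<gamma> a))"
  have se: "s (\<gamma> (m, n)) = m" "e (\<gamma> (m, n)) = n" for m n using \<gamma> by (simp_all add: s_def e_def)
  define J where "J = \<lparr>Obj = range \<nu>, Arr = \<gamma> ` {(m, n). m \<le> n}, Dom = (\<lambda>a. \<nu> (s a)), Cod = (\<lambda>a. \<nu> (e a)),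
    Ident = (\<lambda>x. \<gamma> (inv_into UNIV \<nu> x, inv_into UNIV \<nu> x)), Comp = (\<lambda>g f. \<gamma> (s f, e g))\<rparr>"
  have Hom: "a \<in> Hom J (\<nu> m) (\<nu> n) \<longleftrightarrow> m \<le> n \<and> a = \<gamma> (m, n)" for a m n
    using \<nu>(1) by (auto simp: Hom_def J_def se inj_eq)
  have "category J"
  proof
    show "Dom J f \<in> Obj J" "Cod J f \<in> Obj J" if "f \<in> Arr J" for f by (auto simp: J_def)
    fix W X Y Z f g h
    have ob: "\<exists>n. X = \<nu> n" if "X \<in> Obj J" for X using that by (auto simp: J_def)
    have obH: "\<exists>m n. X = \<nu> m \<and> Y = \<nu> n" if "f \<in> Hom J X Y" for X Y f using that by (auto simp: J_def Hom_def)
    show "Ident J X \<in> Hom J X X" if X: "X \<in> Obj J"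
    proof -
      obtain n where n: "X = \<nu> n" using ob[OF X] by blast
      show ?thesis unfolding n Hom using \<nu>(1) by (simp add: J_def)
    qed
    assume f: "f \<in> Hom J W X"
    obtain w x where wx: "W = \<nu> w" "X = \<nu> x" using obH[OF f] by blast
    have f': "w \<le> x" "f = \<gamma> (w, x)" using f by (simp_all add: wx Hom)
    show "Comp J f (Ident J W) = f" "Comp J (Ident J X) f = f" using \<nu>(1) by (simp_all add: f' J_def wx se)
    assume g: "g \<in> Hom J X Y"
    then obtain y where y: "Y = \<nu> y" using obH[OF g] by blast
    have g': "x \<le> y" "g = \<gamma> (x, y)" using g by (simp_all add: wx y Hom)
    show "Comp J g f \<in> Hom J W Y" unfolding wx y Hom using f' g' by (simp add: J_def se)
    assume h: "h \<in> Hom J Y Z"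
    show "Comp J h (Comp J g f) = Comp J (Comp J h g) f" by (simp add: J_def se)
  qed
  have "is_filtered J"
    unfolding is_filtered_def
  proof (intro conjI ballI)
    show "category J" by fact
    show "Obj J \<noteq> {}" by (simp add: J_def)
    fix i j assume "i \<in> Obj J" "j \<in> Obj J"
    then obtain m n where mn: "i = \<nu> m" "j = \<nu> n" by (auto simp: J_def)
    have "\<gamma> (m, max m n) \<in> Hom J i (\<nu> (max m n))" "\<gamma> (n, max m n) \<in> Hom J j (\<nu> (max m n))"
      unfolding mn Hom by auto
    moreover have "\<nu> (max m n) \<in> Obj J" by (simp add: J_def)
    ultimately show "\<exists>k \<in> Obj J. Hom J i k \<noteq> {} \<and> Hom J j k \<noteq> {}" by blast
    fix a b assume "a \<in> Hom J i j" "b \<in> Hom J i j"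
    then have ab: "a = b" unfolding mn Hom by simp
    have "\<gamma> (n, n) \<in> Hom J j j" unfolding mn Hom by simp
    then show "\<exists>k \<in> Obj J. \<exists>c \<in> Hom J j k. Comp J c a = Comp J c b" using ab \<open>j \<in> Obj J\<close> by blast
  qed
  moreover have "small (Obj J)" using \<nu>(2) by (simp add: J_def)
  moreover have "small (Arr J)" by (rule small_subset[OF \<nu>(2)]) (auto simp: J_def \<gamma>_def)
  moreover note \<nu>(1) \<gamma>
  moreover have "Obj J = range \<nu>" "Arr J = \<gamma> ` {(m, n). m \<le> n}"
    "\<And>m n. Dom J (\<gamma> (m, n)) = \<nu> m" "\<And>m n. Cod J (\<gamma> (m, n)) = \<nu> n" "\<And>n. Ident J (\<nu> n) = \<gamma> (n, n)"
    "\<And>l m n. Comp J (\<gamma> (m, n)) (\<gamma> (l, m)) = \<gamma> (l, n)"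
    using \<nu>(1) by (simp_all add: J_def se)
  ultimately show ?thesis by (rule that[of J \<nu> \<gamma>])
qed

text \<open>
  A submodule which is not finitely generated contains a strictly increasing sequence of submodules;
  its union is the colimit of the sequence, and the identity of the union does not lift to a stage.
\<close>

lemma noetherian_object:
  assumes M: "is_noetherian small Md M"
  shows "noetherian_submodule M (\<lambda>t. el M t)"
  unfolding noetherian_subrep_def
proof (intro allI impI; elim conjE)
  have MO: "M \<in> Obj Md" using M by (simp add: is_noetherian_def)
  interpret M: rep R "fib M" "act M" using module_rep[OF MO] .
  fix D assume D: "submodule M D"
  show "fg_submodule M D"
  proof (rule ccontr)
    assume nfg: "\<not> fg_submodule M D"
    define gen where "gen F t = {x \<in> el M t. \<forall>J. submodule M J \<and> (\<forall>(t, x) \<in> F. x \<in> J t) \<longrightarrow> x \<in> J t}" for F t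
    let ?ok = "\<lambda>F. finite F \<and> (\<forall>(t, x) \<in> F. t \<in> Obj R \<and> x \<in> D t)"
    have gen: "submodule M (gen F)" if "?ok F" for F
      unfolding gen_def using that subrepD(2)[OF D] by (intro M.subrep_generated category_axioms) auto
    have gen_in: "x \<in> gen F t" if "(t, x) \<in> F" "?ok F" for F t x
      using that subrepD(2)[OF D, of t x] unfolding gen_def by auto
    have gen_least: "gen F t \<subseteq> J t" if "submodule M J" "\<forall>(t, x) \<in> F. x \<in> J t" for F t J
      using that unfolding gen_def by blast
    have ex: "\<exists>p. fst p \<in> Obj R \<and> snd p \<in> D (fst p) \<and> snd p \<notin> gen F (fst p)" if F: "?ok F" for F
    proof (rule ccontr)
      assume "\<nexists>p. fst p \<in> Obj R \<and> snd p \<in> D (fst p) \<and> snd p \<notin> gen F (fst p)"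
      then have "D t \<subseteq> gen F t" if "t \<in> Obj R" for t using that by auto
      then have "fg_submodule M D"
        unfolding fg_subrep_def using F gen_least by (intro exI[of _ F]) blast
      then show False using nfg by simp
    qed
    define c where "c F = (SOME p. fst p \<in> Obj R \<and> snd p \<in> D (fst p) \<and> snd p \<notin> gen F (fst p))" for F
    have c: "fst (c F) \<in> Obj R \<and> snd (c F) \<in> D (fst (c F)) \<and> snd (c F) \<notin> gen F (fst (c F))" if "?ok F" for F
      unfolding c_def by (rule someI_ex[OF ex[OF that]])
    define Fs where "Fs = rec_nat {} (\<lambda>_ F. insert (c F) F)"
    have Fs_Suc: "Fs (Suc n) = insert (c (Fs n)) (Fs n)" for n by (simp add: Fs_def)
    have ok: "?ok (Fs n)" for n
    proof (induction n)
      case (Suc n)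
      then show ?case using c[OF Suc] by (auto simp: Fs_Suc case_prod_beta)
    qed (simp add: Fs_def)
    have Fs_mono: "Fs m \<subseteq> Fs n" if "m \<le> n" for m n
      using that by (rule lift_Suc_mono_le[rotated]) (auto simp: Fs_Suc)
    define Dn where "Dn n = gen (Fs n)" for n
    have Dn: "submodule M (Dn n)" for n unfolding Dn_def using gen[OF ok] .
    have Dn_mono: "Dn m t \<subseteq> Dn n t" if "m \<le> n" for m n t
      unfolding Dn_def using Fs_mono[OF that] gen_in[OF _ ok] by (intro gen_least[OF gen[OF ok]]) auto
    define DU where "DU t = (\<Union>n. Dn n t)" for t
    have DU: "submodule M DU"
    proof (rule M.subrepI)
      fix r x y assume r: "r \<in> Obj R" and "x \<in> DU r" "y \<in> DU r"
      then obtain m n where "x \<in> Dn m r" "y \<in> Dn n r" by (auto simp: DU_def)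
      then have "x \<in> Dn (max m n) r" "y \<in> Dn (max m n) r"
        using Dn_mono[of m "max m n" r] Dn_mono[of n "max m n" r] by auto
      then show "x \<cdot>[M,r] inv\<^bsub>fib M r\<^esub> y \<in> DU r" using subrepD(4,5)[OF Dn r] unfolding DU_def by blast
    next
      show "neut M r \<in> DU r" if "r \<in> Obj R" for r using subrepD(3)[OF Dn that] unfolding DU_def by blast
      show "x \<in> el M r" if "r \<in> Obj R" "x \<in> DU r" for r x
        using subrepD(2)[OF Dn that(1)] that(2) unfolding DU_def by blast
      show "act M a x \<in> DU t" if "a \<in> Hom R t r" "x \<in> DU r" for t r a x
        using subrep_act[OF Dn that(1)] that(2) unfolding DU_def by blast
    qed
    have "\<exists>N i. i \<in> Hom Md N M \<and> (\<forall>r \<in> Obj R. el N r = Dn n r \<and> (\<forall>x \<in> Dn n r. app i r x = x))" for n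
      using submodule_object[OF MO Dn[of n]] by blast
    then obtain N i where "\<And>n. True \<Longrightarrow> i n \<in> Hom Md (N n) M \<and>
        (\<forall>r \<in> Obj R. el (N n) r = Dn n r \<and> (\<forall>x \<in> Dn n r. app (i n) r x = x))"
      by (rule choice2E[of "\<lambda>_. True"]) (rule that)
    then have i: "\<And>n. i n \<in> Hom Md (N n) M"
      and N: "\<And>n r. r \<in> Obj R \<Longrightarrow> el (N n) r = Dn n r"
      and i_eq: "\<And>n r x. r \<in> Obj R \<Longrightarrow> x \<in> Dn n r \<Longrightarrow> app (i n) r x = x"
      by simp_all
    obtain NU iU where iU: "iU \<in> Hom Md NU M"
      and *: "\<forall>r \<in> Obj R. el NU r = DU r \<and> (\<forall>x \<in> DU r. app iU r x = x)"
      using submodule_object[OF MO DU] by (elim bexE) (rule that)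
    have NU: "el NU r = DU r" and iU_eq: "x \<in> DU r \<Longrightarrow> app iU r x = x" if "r \<in> Obj R" for r x
      using * that by blast+
    have Dn_DU: "Dn n r \<subseteq> DU r" for n r by (auto simp: DU_def)
    have incl: "\<exists>g \<in> Hom Md A B. \<forall>r \<in> Obj R. \<forall>x \<in> el A r. app g r x = x"
      if a: "a \<in> Hom Md A M" and b: "b \<in> Hom Md B M"
        and sub: "\<And>r. r \<in> Obj R \<Longrightarrow> el A r \<subseteq> el B r"
        and a_eq: "\<And>r x. r \<in> Obj R \<Longrightarrow> x \<in> el A r \<Longrightarrow> app a r x = x"
        and b_eq: "\<And>r x. r \<in> Obj R \<Longrightarrow> x \<in> el B r \<Longrightarrow> app b r x = x" for A B a b
    proof -
      have "\<exists>g \<in> Hom Md A B. Comp Md b g = a"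
      proof (rule factor_through_mono[OF b _ a])
        show "inj_on (app b r) (el B r)" if "r \<in> Obj R" for r using b_eq[OF that] by (simp add: inj_on_def)
        show "app a r x \<in> app b r ` el B r" if "r \<in> Obj R" "x \<in> el A r" for r x
          using a_eq[OF that] sub[OF that(1)] b_eq[OF that(1)] that(2) by force
      qed
      then obtain g where g: "g \<in> Hom Md A B" "Comp Md b g = a" by blast
      have "app g r x = x" if r: "r \<in> Obj R" and x: "x \<in> el A r" for r x
        using arg_cong[OF g(2), of "\<lambda>f. app f r x"] r x a_eq[OF r x] b_eq[OF r app_closed[OF g(1) r x]]
        by (simp add: app_Comp[OF g(1)])
      then show ?thesis using g(1) by blast
    qed
    have "\<exists>g. m \<le> n \<longrightarrow> g \<in> Hom Md (N m) (N n) \<and> (\<forall>r \<in> Obj R. \<forall>x \<in> Dn m r. app g r x = x)" for m n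
      using incl[OF i[of m] i[of n]] Dn_mono[of m n] N i_eq by auto
    then obtain j where j': "\<And>m n. m \<le> n \<Longrightarrow> j m n \<in> Hom Md (N m) (N n) \<and> (\<forall>r \<in> Obj R. \<forall>x \<in> Dn m r. app (j m n) r x = x)"
      by metis
    have j: "j m n \<in> Hom Md (N m) (N n)" and j_eq: "r \<in> Obj R \<Longrightarrow> x \<in> Dn m r \<Longrightarrow> app (j m n) r x = x"
      if "m \<le> n" for m n r x using j'[OF that] by auto
    have "\<exists>g. g \<in> Hom Md (N n) NU \<and> (\<forall>r \<in> Obj R. \<forall>x \<in> Dn n r. app g r x = x)" for n
      using incl[OF i[of n] iU] Dn_DU N NU i_eq iU_eq by auto
    then obtain \<iota> where \<iota>: "\<And>n. \<iota> n \<in> Hom Md (N n) NU" and \<iota>_eq: "\<And>n r x. r \<in> Obj R \<Longrightarrow> x \<in> Dn n r \<Longrightarrow> app (\<iota> n) r x = x"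
      by metis
    obtain J :: "('u, 'u) category" and \<nu> :: "nat \<Rightarrow> 'u" and \<gamma> :: "nat \<times> nat \<Rightarrow> 'u" where J: "is_filtered J" "small (Obj J)" "small (Arr J)" and \<nu>: "inj \<nu>" and \<gamma>: "inj \<gamma>"
      and ObjJ: "Obj J = range \<nu>" and ArrJ: "Arr J = \<gamma> ` {(m, n). m \<le> n}"
      and DomJ: "\<And>m n. Dom J (\<gamma> (m, n)) = \<nu> m" and CodJ: "\<And>m n. Cod J (\<gamma> (m, n)) = \<nu> n"
      and IdJ: "\<And>n. Ident J (\<nu> n) = \<gamma> (n, n)" and CompJ: "\<And>l m n. Comp J (\<gamma> (m, n)) (\<gamma> (l, m)) = \<gamma> (l, n)"
      by (rule sequence_category, rule that)
    interpret J: category J using J(1) by (simp add: is_filtered_def)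
    define \<Delta> where "\<Delta> = mk_functor J (\<lambda>x. N (inv_into UNIV \<nu> x)) (\<lambda>a. case inv_into UNIV \<gamma> a of (m, n) \<Rightarrow> j m n)"
    have \<Delta>O: "FObj \<Delta> (\<nu> n) = N n" for n using \<nu> by (simp add: \<Delta>_def ObjJ)
    have \<Delta>A: "FArr \<Delta> (\<gamma> (m, n)) = j m n" if "m \<le> n" for m n using \<gamma> that by (simp add: \<Delta>_def ArrJ)
    have HomJ: "\<exists>m n. m \<le> n \<and> f = \<gamma> (m, n) \<and> X = \<nu> m \<and> Y = \<nu> n" if "f \<in> Hom J X Y" for f X Y
      using that unfolding Hom_def ArrJ by (auto simp: DomJ CodJ) blast
    have NO: "N n \<in> Obj Md" for n using Hom_Mod_Obj(1)[OF i] .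
    have \<Delta>: "is_functor J Md \<Delta>"
      unfolding \<Delta>_def
    proof (rule J.is_functor_mk_functor)
      show "N (inv_into UNIV \<nu> x) \<in> Obj Md" for x using NO .
      fix f X Y assume f: "f \<in> Hom J X Y"
      obtain m n where mn: "m \<le> n" "f = \<gamma> (m, n)" "X = \<nu> m" "Y = \<nu> n" using HomJ[OF f] by blast
      show "(case inv_into UNIV \<gamma> f of (m, n) \<Rightarrow> j m n) \<in> Hom Md (N (inv_into UNIV \<nu> X)) (N (inv_into UNIV \<nu> Y))"
        using \<gamma> \<nu> j[OF mn(1)] by (simp add: mn)
      fix g Z assume g: "g \<in> Hom J Y Z"
      obtain n' l where nl: "n' \<le> l" "g = \<gamma> (n', l)" "Y = \<nu> n'" "Z = \<nu> l" using HomJ[OF g] by blast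
      have n': "n' = n" using nl(3) mn(4) \<nu> by (simp add: inj_eq)
      have "j m l = Comp Md (j n l) (j m n)"
        using mn(1) nl(1) n' j_eq N Dn_mono[OF mn(1), THEN subsetD]
        by (intro module_arrow_eqI[OF j Md.Comp_Hom[OF j j]]) (auto simp: app_Comp[OF j])
      then show "(case inv_into UNIV \<gamma> (Comp J g f) of (m, n) \<Rightarrow> j m n) =
         Comp Md (case inv_into UNIV \<gamma> g of (m, n) \<Rightarrow> j m n) (case inv_into UNIV \<gamma> f of (m, n) \<Rightarrow> j m n)"
        using \<gamma> by (simp add: mn nl n' CompJ)
    next
      fix X assume "X \<in> Obj J"
      then obtain n where n: "X = \<nu> n" by (auto simp: ObjJ)
      have "j n n = Ident Md (N n)"
        using j_eq N by (intro module_arrow_eqI[OF j Md.Ident_Hom[OF NO]]) (auto simp: app_Ident)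
      then show "(case inv_into UNIV \<gamma> (Ident J X) of (m, n) \<Rightarrow> j m n) = Ident Md (N (inv_into UNIV \<nu> X))"
        using \<gamma> \<nu> by (simp add: n IdJ)
    qed
    have mono: "is_mono Md (FArr \<Delta> a)" if a: "a \<in> Arr J" for a
    proof -
      obtain m n where mn: "m \<le> n" "a = \<gamma> (m, n)" using a by (auto simp: ArrJ)
      show ?thesis unfolding mn(2) \<Delta>A[OF mn(1)]
        using N j_eq[OF mn(1)] by (intro injective_is_mono[OF j[OF mn(1)]]) (auto simp: inj_on_def)
    qed
    have cocone: "is_cocone J Md \<Delta> NU (\<lambda>x. \<iota> (inv_into UNIV \<nu> x))"
      unfolding is_cocone_def
    proof (intro conjI ballI)
      show "NU \<in> Obj Md" using Hom_Mod_Obj(1)[OF iU] .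
      show "\<iota> (inv_into UNIV \<nu> x) \<in> Hom Md (FObj \<Delta> x) NU" if "x \<in> Obj J" for x
        using that \<iota> \<nu> by (auto simp: ObjJ \<Delta>O)
      fix a assume "a \<in> Arr J"
      then obtain m n where mn: "m \<le> n" "a = \<gamma> (m, n)" by (auto simp: ArrJ)
      have "Comp Md (\<iota> n) (j m n) = \<iota> m"
        using mn(1) j_eq \<iota>_eq N Dn_mono[OF mn(1), THEN subsetD]
        by (intro module_arrow_eqI[OF Md.Comp_Hom[OF j \<iota>] \<iota>]) (auto simp: app_Comp[OF j])
      then show "Comp Md (\<iota> (inv_into UNIV \<nu> (Cod J a))) (FArr \<Delta> a) = \<iota> (inv_into UNIV \<nu> (Dom J a))"
        using \<nu> mn by (simp add: CodJ DomJ \<Delta>A)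
    qed
    have "is_colimit J Md \<Delta> NU (\<lambda>x. \<iota> (inv_into UNIV \<nu> x))"
      unfolding is_colimit_def
    proof (intro conjI allI impI cocone)
      fix L' \<iota>' assume co: "is_cocone J Md \<Delta> L' \<iota>'"
      have L': "L' \<in> Obj Md" and \<iota>': "\<iota>' (\<nu> n) \<in> Hom Md (N n) L'" for n
        using co \<Delta>O by (auto simp: is_cocone_def ObjJ)
      have comp: "app (\<iota>' (\<nu> n)) r x = app (\<iota>' (\<nu> m)) r x" if "m \<le> n" "r \<in> Obj R" "x \<in> Dn m r" for m n r x
      proof -
        have "\<gamma> (m, n) \<in> Arr J" using that by (auto simp: ArrJ)
        then have "Comp Md (\<iota>' (\<nu> n)) (j m n) = \<iota>' (\<nu> m)" using co \<Delta>A[OF that(1)] unfolding is_cocone_def by (metis CodJ DomJ)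
        from arg_cong[OF this, of "\<lambda>f. app f r x"] show ?thesis
          using that j_eq[OF that] N by (simp add: app_Comp[OF j[OF that(1)]])
      qed
      have "direct_limit N (\<lambda>n. j n (Suc n)) NU \<iota>"
        unfolding direct_limit_def
      proof (intro conjI allI ballI impI j \<iota>)
        fix n r x assume r: "r \<in> Obj R" and "x \<in> el (N n) r"
        then have x: "x \<in> Dn n r" using N by simp
        show "app (\<iota> (Suc n)) r (app (j n (Suc n)) r x) = app (\<iota> n) r x"
          using j_eq[OF _ r x, of "Suc n"] \<iota>_eq[OF r x] \<iota>_eq[OF r, of x "Suc n"] Dn_mono[of n "Suc n" r] x by auto
        have "neut (N n) r \<in> Dn n r" using N[OF r] neut_closed[OF NO r] by simp
        moreover assume "app (\<iota> n) r x = neut NU r"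
        ultimately show "\<exists>m. ctr (\<lambda>n. j n (Suc n)) r n m x = neut (N (n + m)) r"
          using \<iota>_eq[OF r x] \<iota>_eq[OF r] app_one[OF \<iota> r, of n] by (intro exI[of _ 0]) simp
      next
        fix r z assume r: "r \<in> Obj R" and "z \<in> el NU r"
        then obtain n where n: "z \<in> Dn n r" using NU[OF r] by (auto simp: DU_def)
        then show "\<exists>n. \<exists>x \<in> el (N n) r. z = app (\<iota> n) r x" using \<iota>_eq[OF r n] N[OF r] by force
      qed simp
      then have "\<exists>h \<in> Hom Md NU L'. \<forall>n. \<forall>r \<in> Obj R. \<forall>x \<in> el (N n) r. app h r (app (\<iota> n) r x) = app (\<iota>' (\<nu> n)) r x"
      proof (rule direct_limit_universal[OF _ L' \<iota>'])
        show "app (\<iota>' (\<nu> (Suc k))) r (app (j k (Suc k)) r x) = app (\<iota>' (\<nu> k)) r x"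
          if "r \<in> Obj R" "x \<in> el (N k) r" for k r x
          using that comp[of k "Suc k" r x] j_eq[of k "Suc k" r x] N by simp
      qed
      then obtain hh where hH: "hh \<in> Hom Md NU L'"
        and *: "\<forall>n. \<forall>r \<in> Obj R. \<forall>x \<in> el (N n) r. app hh r (app (\<iota> n) r x) = app (\<iota>' (\<nu> n)) r x" by (elim bexE) (rule that)
      have h: "app hh r x = app (\<iota>' (\<nu> n)) r x" if "r \<in> Obj R" "x \<in> Dn n r" for r x n
        using * that \<iota>_eq N by simp
      show "\<exists>!h. h \<in> Hom Md NU L' \<and> (\<forall>x \<in> Obj J. Comp Md h (\<iota> (inv_into UNIV \<nu> x)) = \<iota>' x)"
      proof (intro ex1I conjI ballI)
        show "hh \<in> Hom Md NU L'" by (rule hH)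
        fix x assume "x \<in> Obj J"
        then obtain n where n: "x = \<nu> n" by (auto simp: ObjJ)
        have "Comp Md hh (\<iota> n) = \<iota>' (\<nu> n)"
          using h N NU \<iota>_eq Dn_DU[THEN subsetD] by (intro module_arrow_eqI[OF Md.Comp_Hom[OF \<iota> hH] \<iota>']) (auto simp: app_Comp[OF \<iota>])
        then show "Comp Md hh (\<iota> (inv_into UNIV \<nu> x)) = \<iota>' x" using \<nu> by (simp add: n)
      next
        fix g assume "g \<in> Hom Md NU L' \<and> (\<forall>x \<in> Obj J. Comp Md g (\<iota> (inv_into UNIV \<nu> x)) = \<iota>' x)"
        then have g: "g \<in> Hom Md NU L'" and g': "\<And>n. Comp Md g (\<iota> n) = \<iota>' (\<nu> n)" using \<nu> by (auto simp: ObjJ)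
        show "g = hh"
        proof (rule module_arrow_eqI[OF g hH])
          fix r x assume r: "r \<in> Obj R" and x: "x \<in> el NU r"
          then obtain n where n: "x \<in> Dn n r" using NU[OF r] by (auto simp: DU_def)
          show "app g r x = app hh r x"
            using arg_cong[OF g'[of n], of "\<lambda>f. app f r x"] r x n N[OF r] \<iota>_eq[OF r n] h[OF r n] by (simp add: app_Comp[OF \<iota>])
        qed
      qed
    qed
    moreover have "is_finitely_generated small Md NU"
    proof -
      have "is_mono Md iU" using NU iU_eq by (intro injective_is_mono[OF iU]) (auto simp: inj_on_def)
      then show ?thesis using M HomD[OF iU] unfolding is_noetherian_def by metis
    qed
    ultimately have "Hom_preserves_colimit J Md NU \<Delta> NU (\<lambda>x. \<iota> (inv_into UNIV \<nu> x))"
      using J \<Delta> mono unfolding is_finitely_generated_def by blast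
    moreover have "Ident Md NU \<in> Hom Md NU NU" using Md.Ident_Hom[OF Hom_Mod_Obj(1)[OF iU]] .
    ultimately obtain n g where g: "g \<in> Hom Md NU (N n)" "Ident Md NU = Comp Md (\<iota> n) g"
      using \<nu> unfolding Hom_preserves_colimit_def ObjJ by (auto simp: \<Delta>O)
    \<comment> \<open>The element adjoined at step \<open>n + 1\<close> belongs to the union but not
      to \<open>Dn n\<close>, whereas a factorisation of the identity through stage \<open>n\<close>
      would place it there.\<close>
    define r x where "r = fst (c (Fs n))" and "x = snd (c (Fs n))"
    have r: "r \<in> Obj R" and x: "x \<in> D r" "x \<notin> Dn n r" using c[OF ok[of n]] by (auto simp: r_def x_def Dn_def)
    have "x \<in> Dn (Suc n) r" unfolding Dn_def by (rule gen_in[OF _ ok]) (simp add: Fs_Suc r_def x_def)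
    then have xU: "x \<in> el NU r" using NU[OF r] by (auto simp: DU_def)
    have gx: "app g r x \<in> Dn n r" using app_closed[OF g(1) r xU] N[OF r] by simp
    have "x = app g r x"
      using arg_cong[OF g(2), of "\<lambda>f. app f r x"] r xU \<iota>_eq[OF r gx] by (simp add: app_Ident app_Comp[OF g(1)])
    then show False using gx x(2) by simp
  qed
qed

lemma noetherian_image:
  assumes h: "h \<in> Hom Md G H" and n: "noetherian_submodule G (\<lambda>t. el G t)"
  shows "noetherian_submodule H (\<lambda>t. app h t ` el G t)"
  unfolding noetherian_subrep_def
proof (intro allI impI; elim conjE)
  note O = Hom_Mod_Obj[OF h]
  fix D assume D: "submodule H D" and sub: "\<forall>t \<in> Obj R. D t \<subseteq> app h t ` el G t"
  let ?pre = "\<lambda>D t. {x \<in> el G t. app h t x \<in> D t}"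
  have pre: "submodule G (?pre D)" if D: "submodule H D" for D
  proof (rule rep.subrepI[OF module_rep[OF O(1)]])
    fix r x y assume r: "r \<in> Obj R" and "x \<in> ?pre D r" "y \<in> ?pre D r"
    then show "x \<cdot>[G,r] inv\<^bsub>fib G r\<^esub> y \<in> ?pre D r"
      using subrepD[OF D r] comm_group_closed[OF fib_comm_group[OF O(1) r]] by (simp add: app_mult[OF h] app_inv[OF h])
  next
    fix t r a x assume a: "a \<in> Hom R t r" and x: "x \<in> ?pre D r"
    then show "act G a x \<in> ?pre D t" using subrep_act[OF D a] app_act[OF h a] act_closed[OF O(1) a] by simp
  qed (use subrepD(3)[OF D] app_one[OF h] neut_closed[OF O(1)] in auto)
  have "fg_submodule G (?pre D)" using n pre[OF D] unfolding noetherian_subrep_def by blast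
  then obtain F where F: "finite F" "\<And>t x. (t, x) \<in> F \<Longrightarrow> t \<in> Obj R \<and> x \<in> ?pre D t"
    and F': "\<And>J t. submodule G J \<Longrightarrow> (\<And>t x. (t, x) \<in> F \<Longrightarrow> x \<in> J t) \<Longrightarrow> t \<in> Obj R \<Longrightarrow> ?pre D t \<subseteq> J t"
    by (rule fg_subrepE) blast
  have "D t \<subseteq> J t" if J: "submodule H J" and FJ: "\<forall>(t, x) \<in> (\<lambda>(t, x). (t, app h t x)) ` F. x \<in> J t" and t: "t \<in> Obj R" for J t
  proof -
    have "?pre D t \<subseteq> ?pre J t" using FJ F(2) by (intro F'[OF pre[OF J] _ t]) auto
    then show ?thesis using sub t by blast
  qed
  then show "fg_submodule H D"
    unfolding fg_subrep_def using F by (intro exI[of _ "(\<lambda>(t, x). (t, app h t x)) ` F"]) auto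
qed

text \<open>Local noetherianity speaks of some noetherian generators and not of the representable
  module \<open>H\<close> itself. Let \<open>U\<close> be the union of all noetherian submodules of
  \<open>H\<close>; since sums of two stay noetherian, \<open>U\<close> is a submodule. If the
  identity were outside \<open>U\<close>, the map from \<open>H\<close> to \<open>H / U\<close>
  would be nonzero, and a noetherian generator would detect this, although its image in
  \<open>H\<close> is noetherian and hence inside \<open>U\<close>. So the identity lies in one
  noetherian submodule, which must be all of \<open>H\<close>.\<close>

lemma ideals_fg:
  assumes ln: "is_locally_noetherian small Md" and r: "r \<in> Obj R"
    and I: "right_ideal r I"
  shows "fg_subrep R (yoneda r) precomp I"
proof -
  let ?G = "yoneda r" and ?\<rho> = precomp
  obtain H \<phi> where H: "H \<in> Obj Md" and \<phi>: "inj_on \<phi> (Arr R)" and fibH: "\<And>t. t \<in> Obj R \<Longrightarrow> el H t = \<phi> ` Hom R t r"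
    and \<phi>_Add: "\<And>t a a'. a \<in> Hom R t r \<Longrightarrow> a' \<in> Hom R t r \<Longrightarrow> \<phi> (Add R a a') = \<phi> a \<cdot>[H,t] \<phi> a'"
    and \<phi>_Comp: "\<And>s t a b. a \<in> Hom R t r \<Longrightarrow> b \<in> Hom R s t \<Longrightarrow> act H b (\<phi> a) = \<phi> (Comp R a b)"
    using representable[OF r] by auto
  interpret H: rep R "fib H" "act H" using module_rep[OF H] .
  interpret G: rep R ?G ?\<rho> using representable_rep[OF r] .
  have \<phi>_hom: "\<phi> \<in> hom (?G t) (fib H t)" if "t \<in> Obj R" for t
    using fibH[OF that] \<phi>_Add by (auto simp: hom_def)
  define U where "U t = \<Union>{P t |P. submodule H P \<and> noetherian_submodule H P}" for t
  have UI: "x \<in> U t" if "x \<in> P t" "submodule H P" "noetherian_submodule H P" for x t P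
    using that unfolding U_def by blast
  have UE: "\<exists>P. x \<in> P t \<and> submodule H P \<and> noetherian_submodule H P" if "x \<in> U t" for x t
    using that unfolding U_def by blast
  have one: "submodule H (\<lambda>t. {neut H t})"
    using act_one[OF H] by (intro H.subrepI)
      (auto simp: neut_closed[OF H] comm_group_eq_iff[OF fib_comm_group[OF H]])
  have none: "noetherian_submodule H (\<lambda>t. {neut H t})"
    unfolding noetherian_subrep_def fg_subrep_def
    by (intro allI impI exI[of _ "{}"]) (auto dest: subrepD(3))
  have U: "submodule H U"
  proof (rule H.subrepI)
    show "x \<in> el H t" if t: "t \<in> Obj R" and x: "x \<in> U t" for t x
    proof -
      obtain P where P: "x \<in> P t" "submodule H P" using UE[OF x] by blast
      show ?thesis using subrepD(2)[OF P(2) t P(1)] .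
    qed
    show "neut H t \<in> U t" for t by (rule UI[OF _ one none]) simp
    show "act H a x \<in> U t" if a: "a \<in> Hom R t s" and x: "x \<in> U s" for t s a x
    proof -
      obtain P where P: "x \<in> P s" "submodule H P" "noetherian_submodule H P"
        using UE[OF x] by blast
      show ?thesis using UI[OF subrep_act[OF P(2) a P(1)] P(2,3)] .
    qed
    fix t x y assume t: "t \<in> Obj R" and "x \<in> U t" "y \<in> U t"
    then obtain P Q where P: "x \<in> P t" "submodule H P" "noetherian_submodule H P"
      and Q: "y \<in> Q t" "submodule H Q" "noetherian_submodule H Q"
      using UE by meson
    have "inv\<^bsub>fib H t\<^esub> y \<in> Q t" using subrepD(5)[OF Q(2) t Q(1)] .
    then have "x \<cdot>[H,t] inv\<^bsub>fib H t\<^esub> y \<in> {x \<cdot>[H,t] y |x y. x \<in> P t \<and> y \<in> Q t}" using P(1) by blast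
    then show "x \<cdot>[H,t] inv\<^bsub>fib H t\<^esub> y \<in> U t"
      using H.subrep_sum[OF P(2) Q(2) category_axioms] H.noetherian_sum[OF P(2) Q(2) category_axioms P(3) Q(3)]
      by (rule UI)
  qed
  note idr = Ident_Hom[OF r]
  have "\<phi> (Ident R r) \<in> U r"
  proof (rule ccontr)
    assume no: "\<phi> (Ident R r) \<notin> U r"
    obtain Q p where p: "p \<in> Hom Md H Q"
      and *: "\<forall>t \<in> Obj R. app p t ` el H t = el Q t \<and> {x \<in> el H t. app p t x = neut Q t} = U t"
      using quotient_object[OF H U] by (elim bexE) (rule that)
    define z where "z = mk_arr H Q (\<lambda>t _. neut Q t)"
    note QO = Hom_Mod_Obj(2)[OF p]
    have z: "z \<in> Hom Md H Q"
      unfolding z_def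
    proof (intro mk_arr_Hom H QO)
      show "(\<lambda>_. neut Q t) \<in> hom (fib H t) (fib Q t)" if "t \<in> Obj R" for t
        using fib_comm_group[OF QO that] by (auto simp: hom_def comm_group_def group_def intro: monoid.one_closed monoid.l_one[symmetric])
    qed (simp add: act_one[OF QO])
    have idH: "\<phi> (Ident R r) \<in> el H r" using fibH[OF r] idr by simp
    have "app p r (\<phi> (Ident R r)) \<noteq> neut Q r" using * r no idH by blast
    moreover have "app z r (\<phi> (Ident R r)) = neut Q r" using r idH by (simp add: z_def)
    ultimately have "p \<noteq> z" by auto
    obtain X where X: "is_generating Md X" "\<And>G. G \<in> X \<Longrightarrow> is_noetherian small Md G"
      using ln unfolding is_locally_noetherian_def by blast
    obtain G h where G: "G \<in> X" and h: "h \<in> Hom Md G H" and ne: "Comp Md p h \<noteq> Comp Md z h"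
      using X(1) p z \<open>p \<noteq> z\<close> H QO unfolding is_generating_def by blast
    have "Comp Md p h = Comp Md z h"
    proof (rule module_arrow_eqI[OF Md.Comp_Hom[OF h p] Md.Comp_Hom[OF h z]])
      fix t x assume t: "t \<in> Obj R" and x: "x \<in> el G t"
      have "app h t x \<in> U t"
        using x image_subrep[OF h carrier_subrep[OF Hom_Mod_Obj(1)[OF h]]] noetherian_image[OF h noetherian_object[OF X(2)[OF G]]]
        by (intro UI[of _ "\<lambda>t. app h t ` el G t"]) auto
      then have "app p t (app h t x) = neut Q t" using * t by blast
      then show "app (Comp Md p h) t x = app (Comp Md z h) t x"
        using t x app_closed[OF h t x] by (simp add: app_Comp[OF h] z_def)
    qed
    then show False using ne by simp
  qed
  then obtain P where P: "\<phi> (Ident R r) \<in> P r" "submodule H P" "noetherian_submodule H P"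
    using UE by blast
  have all: "el H t \<subseteq> P t" if t: "t \<in> Obj R" for t
  proof
    fix x assume "x \<in> el H t"
    then obtain a where a: "a \<in> Hom R t r" "x = \<phi> a" using fibH[OF t] by auto
    have "act H a (\<phi> (Ident R r)) = x" using \<phi>_Comp[OF idr a(1)] a Comp_Ident_left by simp
    then show "x \<in> P t" using subrep_act[OF P(2) a(1) P(1)] by simp
  qed
  have tr: "submodule H (\<lambda>t. \<phi> ` K t)" if K: "subrep R ?G ?\<rho> K" for K
  proof (rule H.subrepI)
    note K' = subrepD[OF K]
    show "x \<in> el H t" if "t \<in> Obj R" "x \<in> \<phi> ` K t" for t x using that K'(2)[OF that(1)] fibH by auto
    show "neut H t \<in> \<phi> ` K t" if t: "t \<in> Obj R" for t
      using K'(3)[OF t] hom_oneI[OF \<phi>_hom[OF t] G.comm_group[OF t] fib_comm_group[OF H t]] by (metis image_eqI)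
    show "act H a x \<in> \<phi> ` K t" if "a \<in> Hom R t s" "x \<in> \<phi> ` K s" for t s a x
      using that \<phi>_Comp[OF _ that(1)] K'(2)[OF Hom_Obj(2)[OF that(1)]] subrep_act[OF K that(1)] by auto
    fix t x y assume t: "t \<in> Obj R" and "x \<in> \<phi> ` K t" "y \<in> \<phi> ` K t"
    then obtain a b where ab: "a \<in> K t" "b \<in> K t" "x = \<phi> a" "y = \<phi> b" by blast
    have "x \<cdot>[H,t] inv\<^bsub>fib H t\<^esub> y = \<phi> (a \<otimes>\<^bsub>?G t\<^esub> inv\<^bsub>?G t\<^esub> b)"
      using hom_mult[OF \<phi>_hom[OF t], of a "inv\<^bsub>?G t\<^esub> b"] hom_invI[OF \<phi>_hom[OF t] G.comm_group[OF t] fib_comm_group[OF H t]]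
        K'(2)[OF t] K'(5)[OF t] ab by simp
    then show "x \<cdot>[H,t] inv\<^bsub>fib H t\<^esub> y \<in> \<phi> ` K t" using K'(4,5)[OF t] ab by blast
  qed
  have "fg_submodule H (\<lambda>t. \<phi> ` I t)"
    using P(3) tr[OF I] all subrepD(2)[OF tr[OF I]] unfolding noetherian_subrep_def by blast
  then obtain F where F: "finite F" "\<And>t x. (t, x) \<in> F \<Longrightarrow> t \<in> Obj R \<and> x \<in> \<phi> ` I t"
    and F': "\<And>J t. submodule H J \<Longrightarrow> (\<And>t x. (t, x) \<in> F \<Longrightarrow> x \<in> J t) \<Longrightarrow> t \<in> Obj R \<Longrightarrow> \<phi> ` I t \<subseteq> J t"
    by (rule fg_subrepE) blast
  define \<psi> where "\<psi> = inv_into (Arr R) \<phi>"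
  have \<psi>: "\<psi> (\<phi> a) = a" if "a \<in> Hom R t r" for a t
    using inv_into_f_f[OF \<phi>] HomD(1)[OF that] by (simp add: \<psi>_def)
  have IH: "a \<in> Hom R t r" if "t \<in> Obj R" "a \<in> I t" for a t using subrepD(2)[OF I that] by simp
  have "I t \<subseteq> J t" if J: "subrep R ?G ?\<rho> J" and FJ: "\<forall>(t, x) \<in> (\<lambda>(t, x). (t, \<psi> x)) ` F. x \<in> J t" and t: "t \<in> Obj R" for J t
  proof
    fix a assume a: "a \<in> I t"
    have "\<phi> ` I t \<subseteq> \<phi> ` J t"
    proof (rule F'[OF tr[OF J] _ t])
      fix t x assume tx: "(t, x) \<in> F"
      then obtain a where "a \<in> I t" "x = \<phi> a" "t \<in> Obj R" using F(2) by blast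
      then show "x \<in> \<phi> ` J t" using FJ tx \<psi>[OF IH] by force
    qed
    then obtain b where b: "b \<in> J t" "\<phi> a = \<phi> b" using a by blast
    then have "b \<in> Hom R t r" using subrepD(2)[OF J t] by simp
    then show "a \<in> J t" using \<psi>[OF IH[OF t a]] \<psi> b by metis
  qed
  moreover have "\<forall>(t, x) \<in> (\<lambda>(t, x). (t, \<psi> x)) ` F. t \<in> Obj R \<and> x \<in> I t"
    using F(2) \<psi>[OF IH] by fastforce
  ultimately show ?thesis
    unfolding fg_subrep_def using F(1) by (intro exI[of _ "(\<lambda>(t, x). (t, \<psi> x)) ` F"]) blast
qed

end

section \<open>Saturation passes to sequential colimits\<close>

context hereditary_class begin

lemma annihilator_subrep:
  assumes M: "M \<in> Obj Md" and r: "r \<in> Obj R" and y: "y \<in> el M r"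
  shows "right_ideal r (ann R M r y)"
proof -
  show ?thesis
  proof (rule subrep_of_mult[OF representable_rep[OF r]])
    show "x \<in> carrier (yoneda r t)" if "x \<in> ann R M r y t" for x t using that by (simp add: ann_def)
    show "\<one>\<^bsub>yoneda r t\<^esub> \<in> ann R M r y t" if t: "t \<in> Obj R" for t
      using rep_zero[OF module_rep[OF M] t r y] comm_group_closed(1)[OF Hom_comm_group[OF t r]] by (simp add: ann_def)
    show "a \<otimes>\<^bsub>yoneda r t\<^esub> b \<in> ann R M r y t" if t: "t \<in> Obj R" and "a \<in> ann R M r y t" "b \<in> ann R M r y t" for t a b
    proof -
      interpret G: comm_group "fib M t" using fib_comm_group[OF M t] .
      show ?thesis using that act_Add[OF M ann_Hom[OF that(2)] ann_Hom[OF that(3)] y] Add_Hom by (simp add: ann_def)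
    qed
    show "Comp R a b \<in> ann R M r y s" if b: "b \<in> Hom R s t" and a: "a \<in> ann R M r y t" for s t b a
      using a act_Comp[OF M _ b y] act_one[OF M b] Comp_Hom[OF b] by (simp add: ann_def)
  qed
qed

text \<open>Adjoins the generator \<open>a0\<close> with prescribed image \<open>y\<close>. The
  assumption \<open>compat\<close> says that \<open>y\<close> obeys every relation of
  \<open>a0\<close> over \<open>K\<close>, exactly what makes the assignment of \<open>g b\<close>
  plus \<open>act M c y\<close> to \<open>b\<close> plus \<open>Comp R a0 c\<close> well defined.
  The last conjunct retains this formula, so that the new homomorphism can later be compared with
  the given one.\<close>

lemma ideal_hom_extend:
  assumes M: "M \<in> Obj Md" and r: "r \<in> Obj R" and K: "right_ideal r K" and g: "ideal_hom R M K g"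
    and a0: "a0 \<in> Hom R t0 r" and y: "y \<in> el M t0"
    and compat: "\<And>s c. c \<in> Hom R s t0 \<Longrightarrow> Comp R a0 c \<in> K s \<Longrightarrow> g (Comp R a0 c) = act M c y"
  shows "\<exists>K' g'. right_ideal r K' \<and> ideal_hom R M K' g' \<and>
    (\<forall>t \<in> Obj R. K t \<subseteq> K' t) \<and> a0 \<in> K' t0 \<and>
    (\<forall>s \<in> Obj R. \<forall>d \<in> K' s. \<exists>b \<in> K s. \<exists>c \<in> Hom R s t0. d = Add R b (Comp R a0 c) \<and> g' d = g b \<cdot>[M,s] act M c y)"
proof -
  interpret Y: rep R "yoneda r" precomp using representable_rep[OF r] .
  note t0 = Hom_Obj(1)[OF a0]
  interpret Y0: rep R "yoneda t0" precomp using representable_rep[OF t0] .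
  note K' = subrepD[OF K]
  have KH: "b \<in> Hom R s r" if "s \<in> Obj R" "b \<in> K s" for s b using K'(2)[OF that] by simp
  have g_in: "g b \<in> el M s" if "s \<in> Obj R" "b \<in> K s" for s b using g that by (simp add: ideal_hom_def)
  have g_add: "g (Add R b b') = g b \<cdot>[M,s] g b'" if "s \<in> Obj R" "b \<in> K s" "b' \<in> K s" for s b b'
    using g that by (simp add: ideal_hom_def)
  have c_in: "act M c y \<in> el M s" if "c \<in> Hom R s t0" for s c using act_closed[OF M that y] .
  define P where "P s d z \<longleftrightarrow> (\<exists>b \<in> K s. \<exists>c \<in> Hom R s t0. d = Add R b (Comp R a0 c) \<and> z = g b \<cdot>[M,s] act M c y)" for s d z
  have P_add: "P s (Add R d d') (z \<cdot>[M,s] z')" if s: "s \<in> Obj R" and P: "P s d z" "P s d' z'" for s d d' z z'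
  proof -
    interpret G: comm_group "fib M s" using fib_comm_group[OF M s] .
    interpret H: comm_group "yoneda r s" using Y.comm_group[OF s] .
    obtain b c where b: "b \<in> K s" and c: "c \<in> Hom R s t0" and d: "d = Add R b (Comp R a0 c)" "z = g b \<cdot>[M,s] act M c y"
      using P(1) unfolding P_def by blast
    obtain b' c' where b': "b' \<in> K s" and c': "c' \<in> Hom R s t0" and d': "d' = Add R b' (Comp R a0 c')" "z' = g b' \<cdot>[M,s] act M c' y"
      using P(2) unfolding P_def by blast
    have "Add R d d' = Add R (Add R b b') (Comp R a0 (Add R c c'))"
      using KH[OF s b] KH[OF s b'] Comp_Hom[OF c a0] Comp_Hom[OF c' a0] H.m_assoc H.m_lcomm H.m_closed
      by (simp add: d d' Comp_Add_right[OF c c' a0])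
    moreover have "z \<cdot>[M,s] z' = g (Add R b b') \<cdot>[M,s] act M (Add R c c') y"
      using g_in[OF s b] g_in[OF s b'] c_in[OF c] c_in[OF c'] 
      by (simp add: d d' g_add[OF s b b'] act_Add[OF M c c' y] G.m_assoc G.m_lcomm)
    moreover have "Add R b b' \<in> K s" using K'(4)[OF s b b'] by simp
    ultimately show ?thesis unfolding P_def using Add_Hom[OF c c'] by blast
  qed
  have P_act: "P s (Comp R d e) (act M e z)" if e: "e \<in> Hom R s t" and P: "P t d z" for s t d e z
  proof -
    note st = Hom_Obj[OF e]
    obtain b c where b: "b \<in> K t" and c: "c \<in> Hom R t t0" and d: "d = Add R b (Comp R a0 c)" "z = g b \<cdot>[M,t] act M c y"
      using P unfolding P_def by blast
    have "Comp R d e = Add R (Comp R b e) (Comp R a0 (Comp R c e))"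
      using Comp_Add_left[OF e KH[OF st(2) b] Comp_Hom[OF c a0]] Comp_assoc[OF e c a0] by (simp add: d)
    moreover have "act M e z = g (Comp R b e) \<cdot>[M,s] act M (Comp R c e) y"
      using act_mult[OF M e g_in[OF st(2) b] c_in[OF c]] act_Comp[OF M c e y] g b e by (simp add: d ideal_hom_def)
    moreover have "Comp R b e \<in> K s" using subrep_act[OF K e b] .
    ultimately show ?thesis unfolding P_def using Comp_Hom[OF e c] by blast
  qed
  \<comment> \<open>Well-definedness reduces to the value at zero. If \<open>b\<close> and
    \<open>Comp R a0 c\<close> cancel, then \<open>Comp R a0 c\<close> lies in \<open>K\<close>, and
    \<open>compat\<close> evaluates both contributions by \<open>g\<close>.\<close>
  have P_zero: "z = neut M s" if s: "s \<in> Obj R" and P: "P s (Zero R s r) z" for s z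
  proof -
    interpret G: comm_group "fib M s" using fib_comm_group[OF M s] .
    interpret H: comm_group "yoneda r s" using Y.comm_group[OF s] .
    obtain b c where b: "b \<in> K s" and c: "c \<in> Hom R s t0" and d: "Zero R s r = Add R b (Comp R a0 c)" "z = g b \<cdot>[M,s] act M c y"
      using P unfolding P_def by blast
    have "Comp R a0 c = inv\<^bsub>yoneda r s\<^esub> b"
      using H.inv_equality[of "Comp R a0 c" b] H.m_comm[of b "Comp R a0 c"] d(1) KH[OF s b] Comp_Hom[OF c a0] by simp
    then have ac: "Comp R a0 c \<in> K s" using K'(5)[OF s b] by simp
    have "z = g (Add R b (Comp R a0 c))" using g_add[OF s b ac] compat[OF c ac] d(2) by simp
    also have "\<dots> = g (Zero R s r)" using d(1) by simp
    finally have z: "z = g (Zero R s r)" .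
    have 0: "Zero R s r \<in> K s" using K'(3)[OF s] by simp
    have "Add R (Zero R s r) (Zero R s r) = Zero R s r" using H.l_one[OF H.one_closed] by simp
    then have "z \<cdot>[M,s] z = z" using g_add[OF s 0 0] z by simp
    then show ?thesis using g_in[OF s 0] z G.l_cancel_one by simp
  qed
  have P_in: "d \<in> Hom R s r" "z \<in> el M s" if "s \<in> Obj R" "P s d z" for s d z
    using that KH Comp_Hom[OF _ a0] Add_Hom g_in c_in fib_mult_closed[OF M] unfolding P_def by blast+
  have P_inv: "P s (inv\<^bsub>yoneda r s\<^esub> d) (inv\<^bsub>fib M s\<^esub> z)" if s: "s \<in> Obj R" and P: "P s d z" for s d z
    using P_act[OF neg_Hom[OF s] P] rep_neg[OF representable_rep[OF r] s, of d] rep_neg[OF module_rep[OF M] s, of z] P_in[OF s P]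
    by simp
  have P_unique: "z = z'" if s: "s \<in> Obj R" and P: "P s d z" "P s d z'" for s d z z'
  proof -
    interpret H: comm_group "yoneda r s" using Y.comm_group[OF s] .
    have "P s (Zero R s r) (z \<cdot>[M,s] inv\<^bsub>fib M s\<^esub> z')"
      using P_add[OF s P(1) P_inv[OF s P(2)]] H.r_inv[of d] P_in(1)[OF s P(1)] by simp
    from P_zero[OF s this] show ?thesis
      using comm_group_eq_iff[OF fib_comm_group[OF M s]] P_in(2)[OF s P(1)] P_in(2)[OF s P(2)] by simp
  qed
  define K2 where "K2 s = {d. \<exists>z. P s d z}" for s
  define g2 where "g2 d = (THE z. P (Dom R d) d z)" for d
  have g2: "g2 d = z" if "s \<in> Obj R" "P s d z" for s d z
    unfolding g2_def HomD(2)[OF P_in(1)[OF that]] using P_unique[OF that(1)] that(2) by (intro the_equality) auto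
  have P0: "P s b (g b)" if s: "s \<in> Obj R" and b: "b \<in> K s" for s b
  proof -
    interpret G: comm_group "fib M s" using fib_comm_group[OF M s] .
    interpret H: comm_group "yoneda r s" using Y.comm_group[OF s] .
    interpret H0: comm_group "yoneda t0 s" using Y0.comm_group[OF s] .
    have "Comp R a0 (Zero R s t0) = Zero R s r" using rep_zero[OF representable_rep[OF r] s t0, of a0] a0 by simp
    moreover have "act M (Zero R s t0) y = neut M s" using rep_zero[OF module_rep[OF M] s t0 y] .
    ultimately have "b = Add R b (Comp R a0 (Zero R s t0))" "g b = g b \<cdot>[M,s] act M (Zero R s t0) y"
      using H.r_one[of b] KH[OF s b] g_in[OF s b] by simp_all
    then show ?thesis unfolding P_def using b H0.one_closed by force
  qed
  have "right_ideal r K2"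
  proof (rule Y.subrepI)
    show "x \<in> carrier (yoneda r s)" if "s \<in> Obj R" "x \<in> K2 s" for s x using that P_in(1) unfolding K2_def by auto
    show "\<one>\<^bsub>yoneda r s\<^esub> \<in> K2 s" if "s \<in> Obj R" for s using P0[OF that K'(3)[OF that]] unfolding K2_def by blast
    show "x \<otimes>\<^bsub>yoneda r s\<^esub> inv\<^bsub>yoneda r s\<^esub> x' \<in> K2 s" if s: "s \<in> Obj R" and x: "x \<in> K2 s" "x' \<in> K2 s" for s x x'
    proof -
      obtain z z' where "P s x z" "P s x' z'" using x unfolding K2_def by blast
      from P_add[OF s this(1) P_inv[OF s this(2)]] show ?thesis unfolding K2_def by auto
    qed
    show "Comp R x e \<in> K2 s" if "e \<in> Hom R s t" "x \<in> K2 t" for s t e x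
      using that P_act[OF that(1)] unfolding K2_def by blast
  qed
  moreover have "ideal_hom R M K2 g2"
    unfolding ideal_hom_def
  proof (intro conjI ballI allI impI; (elim conjE)?)
    fix s d assume s: "s \<in> Obj R" and "d \<in> K2 s"
    then obtain z where z: "P s d z" unfolding K2_def by blast
    show "g2 d \<in> el M s" using g2[OF s z] P_in(2)[OF s z] by simp
    fix d' assume "d' \<in> K2 s"
    then obtain z' where z': "P s d' z'" unfolding K2_def by blast
    show "g2 (Add R d d') = g2 d \<cdot>[M,s] g2 d'" using g2[OF s P_add[OF s z z']] g2[OF s z] g2[OF s z'] by simp
  next
    fix s t e d assume e: "e \<in> Hom R s t" and "d \<in> K2 t"
    then obtain z where z: "P t d z" unfolding K2_def by blast
    show "g2 (Comp R d e) = act M e (g2 d)"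
      using g2[OF Hom_Obj(1)[OF e] P_act[OF e z]] g2[OF Hom_Obj(2)[OF e] z] by simp
  qed
  moreover have "\<forall>t \<in> Obj R. K t \<subseteq> K2 t" using P0 unfolding K2_def by blast
  moreover have "a0 \<in> K2 t0"
  proof -
    interpret H: comm_group "yoneda r t0" using Y.comm_group[OF t0] .
    have "Zero R t0 r \<in> K t0" using K'(3)[OF t0] by simp
    moreover have "a0 = Add R (Zero R t0 r) (Comp R a0 (Ident R t0))"
      using H.l_one[of a0] a0 Comp_Ident_right[OF a0] by simp
    ultimately show ?thesis unfolding K2_def P_def using Ident_Hom[OF t0] by blast
  qed
  moreover have "\<forall>s \<in> Obj R. \<forall>d \<in> K2 s. \<exists>b \<in> K s. \<exists>c \<in> Hom R s t0. d = Add R b (Comp R a0 c) \<and> g2 d = g b \<cdot>[M,s] act M c y"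
  proof (intro ballI)
    fix s d assume s: "s \<in> Obj R" and "d \<in> K2 s"
    then obtain z where z: "P s d z" unfolding K2_def by blast
    show "\<exists>b \<in> K s. \<exists>c \<in> Hom R s t0. d = Add R b (Comp R a0 c) \<and> g2 d = g b \<cdot>[M,s] act M c y"
      using z g2[OF s z] unfolding P_def by simp
  qed
  ultimately show ?thesis by blast
qed

text \<open>A homomorphism on a dense ideal with values in \<open>L\<close> has to be lifted to a
  single stage, where saturation applies. Values at finitely many generators lift at once, but a
  lift must also respect relations. The induction therefore lifts \<open>f\<close> on a right ideal
  \<open>K\<close> containing the generators treated so far; the relations of the next generator
  over \<open>K\<close> form a right ideal that is finitely generated too, so they all hold after
  finitely many further stages.\<close>

lemma saturated_direct_limit:
  assumes ln: "is_locally_noetherian small Md" and dl: "direct_limit M c L \<iota>" and sat: "\<And>k. saturated (M k)"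
  shows "saturated L"
  unfolding saturated_def
proof (intro conjI allI impI; (elim conjE)?)
  note arr = direct_limit_arr[OF dl]
  have MO: "M k \<in> Obj Md" for k using Hom_Mod_Obj(1)[OF arr(1)] .
  show LO: "L \<in> Obj Md" using Hom_Mod_Obj(2)[OF arr(2)] .
  fix r Q q f assume r: "r \<in> Obj R" and Q: "Q \<in> \<T>" and q: "q \<in> el Q r" and f: "ideal_hom R L (ann R Q r q) f"
  let ?I = "ann R Q r q"
  have I: "right_ideal r ?I" using annihilator_subrep[OF T_Obj[OF Q] r q] .
  obtain F where F: "finite F" "\<And>t a. (t, a) \<in> F \<Longrightarrow> t \<in> Obj R \<and> a \<in> ?I t"
    and F': "\<And>J t. right_ideal r J \<Longrightarrow> (\<And>t a. (t, a) \<in> F \<Longrightarrow> a \<in> J t) \<Longrightarrow> t \<in> Obj R \<Longrightarrow> ?I t \<subseteq> J t"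
    using ideals_fg[OF ln r I] by (rule fg_subrepE) blast
  note cl = ctr_closed[where M = M and c = c, OF arr(1)]
  note cact = ctr_act[where M = M and c = c, OF arr(1)]
  note cone = ctr_one[where M = M and c = c, OF arr(1)]
  note cmult = ctr_mult[where M = M and c = c, OF arr(1)]
  have uniform: "\<exists>n0. \<forall>n\<ge>n0. \<forall>p \<in> X. B p n" if "finite X" "\<And>p. p \<in> X \<Longrightarrow> \<exists>n0 :: nat. \<forall>n\<ge>n0. B p n" for X :: "('r \<times> 'm) set" and B
    using that
  proof (induction rule: finite_induct)
    case (insert p X)
    obtain n1 where "\<forall>n\<ge>n1. \<forall>p \<in> X. B p n" using insert by blast
    moreover obtain n2 where "\<forall>n\<ge>n2. B p n" using insert.prems[of p] by blast
    ultimately show ?case by (intro exI[of _ "max n1 n2"]) simp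
  qed simp
  \<comment> \<open>Uniqueness. Agreement on the finitely many generators of the ideal already holds
    at a finite stage, and saturation of that stage identifies the representatives.\<close>
  have inj: "z = z'" if z: "z \<in> el L r" "z' \<in> el L r"
    and eq: "\<And>t a. t \<in> Obj R \<Longrightarrow> a \<in> ?I t \<Longrightarrow> act L a z = act L a z'" for z z'
  proof -
    obtain k0 x0 where x0: "x0 \<in> el (M k0) r" "z = app (\<iota> k0) r x0" using direct_limit_ex[OF dl r z(1)] by blast
    obtain k x' where k: "k \<ge> k0" and x': "x' \<in> el (M k) r" "z' = app (\<iota> k) r x'" using direct_limit_ex[OF dl r z(2), of k0] by blast
    define x where "x = ctr c r k0 (k - k0) x0"
    have x: "x \<in> el (M k) r" "z = app (\<iota> k) r x"
      using cl[OF r x0(1), of "k - k0"] direct_limit_ctr[OF dl r x0(1), of "k - k0"] k x0(2) by (simp_all add: x_def)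
    have "\<exists>n0. \<forall>n\<ge>n0. \<forall>p \<in> F. ctr c (fst p) k n (act (M k) (snd p) x) = ctr c (fst p) k n (act (M k) (snd p) x')"
    proof (rule uniform[OF F(1)])
      fix p assume "p \<in> F"
      then have p: "fst p \<in> Obj R" "snd p \<in> ?I (fst p)" using F(2)[of "fst p" "snd p"] by simp_all
      note pH = ann_Hom[OF p(2)]
      have "app (\<iota> k) (fst p) (act (M k) (snd p) x) = app (\<iota> k) (fst p) (act (M k) (snd p) x')"
        using app_act[OF arr(2) pH x(1)] app_act[OF arr(2) pH x'(1)] x(2) x'(2) eq[OF p] by simp
      then show "\<exists>n0. \<forall>n\<ge>n0. ctr c (fst p) k n (act (M k) (snd p) x) = ctr c (fst p) k n (act (M k) (snd p) x')"
        by (rule direct_limit_eq[OF dl p(1) act_closed[OF MO pH x(1)] act_closed[OF MO pH x'(1)]])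
    qed
    then obtain n where n: "\<And>t a. (t, a) \<in> F \<Longrightarrow> ctr c t k n (act (M k) a x) = ctr c t k n (act (M k) a x')" by fastforce
    define w where "w = ctr c r k n x \<cdot>[(M (k + n)),r] inv\<^bsub>fib (M (k + n)) r\<^esub> ctr c r k n x'"
    note cx = cl[OF r x(1), of n] cl[OF r x'(1), of n]
    note gg = fib_comm_group[OF MO r]
    have w: "w \<in> el (M (k + n)) r" unfolding w_def using cx comm_group_closed[OF gg] by simp
    have act_w: "act (M (k + n)) a w = act (M (k + n)) a (ctr c r k n x) \<cdot>[(M (k + n)),t]
      inv\<^bsub>fib (M (k + n)) t\<^esub> act (M (k + n)) a (ctr c r k n x')" if "a \<in> Hom R t r" for a t
      unfolding w_def using act_mult[OF MO that cx(1) comm_group_closed(3)[OF gg cx(2)]] act_inv[OF MO that cx(2)] by simp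
    \<comment> \<open>The annihilator of \<open>w\<close> is a right ideal containing the generators
      of the dense ideal, hence all of it.\<close>
    have "?I t \<subseteq> ann R (M (k + n)) r w t" if t: "t \<in> Obj R" for t
    proof (rule F'[OF annihilator_subrep[OF MO r w] _ t])
      fix t a assume ta: "(t, a) \<in> F"
      then have t: "t \<in> Obj R" and a: "a \<in> Hom R t r" using F(2)[OF ta] ann_Hom by auto
      have "act (M (k + n)) a (ctr c r k n x) = act (M (k + n)) a (ctr c r k n x')"
        using n[OF ta] cact[OF a x(1)] cact[OF a x'(1)] by simp
      then show "a \<in> ann R (M (k + n)) r w t"
        using a act_w[OF a] act_closed[OF MO a cx(2)] comm_group_eq_iff[OF fib_comm_group[OF MO t]] by (simp add: ann_def)
    qed
    then have "act (M (k + n)) a w = act (M (k + n)) a (neut (M (k + n)) r)" if "t \<in> Obj R" "a \<in> ?I t" for t a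
      using that act_one[OF MO ann_Hom[OF that(2)]] by (auto simp: ann_def)
    then have "w = neut (M (k + n)) r"
      using saturated_unique[OF sat r Q q w comm_group_closed(1)[OF gg]] by blast
    then have "ctr c r k n x = ctr c r k n x'" unfolding w_def using comm_group_eq_iff[OF gg cx] by simp
    then show "z = z'" using direct_limit_ctr[OF dl r x(1), of n] direct_limit_ctr[OF dl r x'(1), of n] x(2) x'(2) by simp
  qed
  have "\<exists>k K g. right_ideal r K \<and> (\<forall>t \<in> Obj R. K t \<subseteq> ?I t) \<and> (\<forall>(t, a) \<in> F0. a \<in> K t) \<and>
      ideal_hom R (M k) K g \<and> (\<forall>t \<in> Obj R. \<forall>a \<in> K t. app (\<iota> k) t (g a) = f a)"
    if "finite F0" "F0 \<subseteq> F" for F0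
    using that
  proof (induction rule: finite_induct)
    case empty
    define K where "K t = {Zero R t r}" for t
    interpret Y: rep R "yoneda r" precomp using representable_rep[OF r] .
    have g1: "neut (M 0) r \<in> el (M 0) r" using neut_closed[OF MO r] .
    have zH: "Zero R t r \<in> Hom R t r" if "t \<in> Obj R" for t using comm_group_closed(1)[OF Y.comm_group[OF that]] by simp
    have zI: "Zero R t r \<in> ?I t" if "t \<in> Obj R" for t using subrepD(3)[OF I that] by simp
    have zz: "Add R (Zero R t r) (Zero R t r) = Zero R t r" if t: "t \<in> Obj R" for t
    proof -
      interpret H: comm_group "yoneda r t" using Y.comm_group[OF t] .
      show ?thesis using H.l_one[OF H.one_closed] by simp
    qed
    have zc: "Comp R (Zero R t r) b = Zero R s r" if b: "b \<in> Hom R s t" for s t b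
      using hom_oneI[OF Y.hom[OF b] Y.comm_group[OF Hom_Obj(2)[OF b]] Y.comm_group[OF Hom_Obj(1)[OF b]]] by simp
    have K: "right_ideal r K"
      by (rule subrep_of_mult[OF representable_rep[OF r]]) (use zH zc zz in \<open>auto simp: K_def\<close>)
    define g where "g a = neut (M 0) (Dom R a)" for a
    have gz: "g (Zero R t r) = neut (M 0) t" if "t \<in> Obj R" for t using HomD(2)[OF zH[OF that]] by (simp add: g_def)
    have one1: "neut N t \<cdot>[N,t] neut N t = neut N t" if "N \<in> Obj Md" "t \<in> Obj R" for N t
      using fib_comm_group[OF that] by (simp add: comm_group_def group_def monoid.l_one monoid.one_closed)
    have "ideal_hom R (M 0) K g"
      unfolding ideal_hom_def
    proof (intro conjI ballI allI impI; (elim conjE)?)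
      fix t a assume t: "t \<in> Obj R" and a: "a \<in> K t"
      show "g a \<in> el (M 0) t" using a gz[OF t] neut_closed[OF MO t] by (simp add: K_def)
      fix a' assume "a' \<in> K t"
      then show "g (Add R a a') = g a \<cdot>[(M 0),t] g a'" using a gz[OF t] zz[OF t] one1[OF MO t] by (simp add: K_def)
    next
      fix s t b a assume b: "b \<in> Hom R s t" and a: "a \<in> K t"
      then show "g (Comp R a b) = act (M 0) b (g a)"
        using zc[OF b] gz[OF Hom_Obj(1)[OF b]] gz[OF Hom_Obj(2)[OF b]] act_one[OF MO b] by (simp add: K_def)
    qed
    moreover have "app (\<iota> 0) t (g a) = f a" if t: "t \<in> Obj R" and a: "a \<in> K t" for t a
    proof -
      interpret G: comm_group "fib L t" using fib_comm_group[OF LO t] .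
      have "f (Zero R t r) \<in> el L t" "f (Zero R t r) \<cdot>[L,t] f (Zero R t r) = f (Zero R t r)"
        using f t zI[OF t] zz[OF t] unfolding ideal_hom_def by metis+
      then have "f (Zero R t r) = neut L t" using G.l_cancel_one by simp
      then show ?thesis using a gz[OF t] app_one[OF arr(2) t] by (simp add: K_def)
    qed
    moreover have "\<forall>t \<in> Obj R. K t \<subseteq> ?I t" using zI by (simp add: K_def)
    ultimately show ?case using K by (intro exI[of _ 0] exI[of _ K] exI[of _ g]) simp
  next
    case (insert p F0)
    obtain t0 a0 where p: "p = (t0, a0)" by (cases p)
    have t0: "t0 \<in> Obj R" and a0I: "a0 \<in> ?I t0" using F(2)[of t0 a0] insert.prems p by auto
    note a0 = ann_Hom[OF a0I]
    obtain k K g where K: "right_ideal r K" and KI: "\<And>t. t \<in> Obj R \<Longrightarrow> K t \<subseteq> ?I t"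
      and KF: "\<forall>(t, a) \<in> F0. a \<in> K t" and g: "ideal_hom R (M k) K g"
      and gf: "\<And>t a. t \<in> Obj R \<Longrightarrow> a \<in> K t \<Longrightarrow> app (\<iota> k) t (g a) = f a"
      using insert.IH insert.prems by auto
    have KH: "a \<in> Hom R t r" if "t \<in> Obj R" "a \<in> K t" for t a using subrepD(2)[OF K that] by simp
    have g_in: "g b \<in> el (M k) s" if "s \<in> Obj R" "b \<in> K s" for s b using g that by (simp add: ideal_hom_def)
    have "f a0 \<in> el L t0" using f t0 a0I by (simp add: ideal_hom_def)
    then obtain k' y0 where k': "k' \<ge> k" "y0 \<in> el (M k') t0" "f a0 = app (\<iota> k') t0 y0"
      using direct_limit_ex[OF dl t0, of "f a0" k] by blast
    \<comment> \<open>The relations of the new generator over \<open>K\<close>: those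
      \<open>d\<close> for which \<open>Comp R a0 d\<close> already has a value under
      \<open>g\<close>.\<close>
    define J where "J s = {d \<in> Hom R s t0. Comp R a0 d \<in> K s}" for s
    have zero: "Comp R a0 (Zero R s t0) = Zero R s r" if "s \<in> Obj R" for s
      using rep_zero[OF representable_rep[OF r] that t0, of a0] a0 by simp
    have zeroH: "Zero R s t0 \<in> Hom R s t0" if "s \<in> Obj R" for s
      using comm_group_closed(1)[OF Hom_comm_group[OF that t0]] by simp
    have J: "right_ideal t0 J"
    proof (rule subrep_of_mult[OF representable_rep[OF t0]])
      fix s assume s: "s \<in> Obj R"
      show "d \<in> carrier (yoneda t0 s)" if "d \<in> J s" for d using that by (simp add: J_def)
      show "\<one>\<^bsub>yoneda t0 s\<^esub> \<in> J s" using zero[OF s] zeroH[OF s] subrepD(3)[OF K s] by (simp add: J_def)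
      show "d \<otimes>\<^bsub>yoneda t0 s\<^esub> e \<in> J s" if "d \<in> J s" "e \<in> J s" for d e
        using that Comp_Add_right[of d s t0 e a0 r] a0 Add_Hom subrepD(4)[OF K s, of "Comp R a0 d" "Comp R a0 e"] by (simp add: J_def)
    next
      fix s t b d assume b: "b \<in> Hom R s t" and d: "d \<in> J t"
      then show "Comp R d b \<in> J s"
        using Comp_Hom[OF b] Comp_assoc[OF b _ a0] subrep_act[OF K b] by (simp add: J_def)
    qed
    obtain E where E: "finite E" "\<And>s d. (s, d) \<in> E \<Longrightarrow> s \<in> Obj R \<and> d \<in> J s"
      and E': "\<And>B s. right_ideal t0 B \<Longrightarrow> (\<And>s d. (s, d) \<in> E \<Longrightarrow> d \<in> B s) \<Longrightarrow> s \<in> Obj R \<Longrightarrow> J s \<subseteq> B s"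
      using ideals_fg[OF ln t0 J] by (rule fg_subrepE) blast
    define g1 where "g1 a = ctr c (Dom R a) k (k' - k) (g a)" for a
    have g1_eq: "g1 a = ctr c t k (k' - k) (g a)" if "t \<in> Obj R" "a \<in> K t" for t a
      using HomD(2)[OF KH[OF that]] by (simp add: g1_def)
    have g1_in: "g1 a \<in> el (M k') t" if "t \<in> Obj R" "a \<in> K t" for t a
      using cl[OF that(1) g_in[OF that], of "k' - k"] g1_eq[OF that] k'(1) by simp
    \<comment> \<open>Each relation in \<open>E\<close> is satisfied in \<open>L\<close>, because
      \<open>f\<close> is a homomorphism, and so at a later stage; being finitely many, they share
      one.\<close>
    have "\<exists>n0. \<forall>n\<ge>n0. \<forall>p \<in> E. ctr c (fst p) k' n (g1 (Comp R a0 (snd p))) = ctr c (fst p) k' n (act (M k') (snd p) y0)"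
    proof (rule uniform[OF E(1)])
      fix p assume "p \<in> E"
      then have s: "fst p \<in> Obj R" and "snd p \<in> J (fst p)" using E(2)[of "fst p" "snd p"] by simp_all
      then have pH: "snd p \<in> Hom R (fst p) t0" and pK: "Comp R a0 (snd p) \<in> K (fst p)" by (simp_all add: J_def)
      have "app (\<iota> k') (fst p) (g1 (Comp R a0 (snd p))) = f (Comp R a0 (snd p))"
        using direct_limit_ctr[OF dl s g_in[OF s pK], of "k' - k"] gf[OF s pK] g1_eq[OF s pK] k'(1) by simp
      also have "\<dots> = act L (snd p) (f a0)" using f pH a0I by (simp add: ideal_hom_def)
      also have "\<dots> = app (\<iota> k') (fst p) (act (M k') (snd p) y0)" using app_act[OF arr(2) pH k'(2)] k'(3) by simp
      finally show "\<exists>n0. \<forall>n\<ge>n0. ctr c (fst p) k' n (g1 (Comp R a0 (snd p))) = ctr c (fst p) k' n (act (M k') (snd p) y0)"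
        by (rule direct_limit_eq[OF dl s g1_in[OF s pK] act_closed[OF MO pH k'(2)]])
    qed
    then obtain n where n: "\<And>s d. (s, d) \<in> E \<Longrightarrow> ctr c s k' n (g1 (Comp R a0 d)) = ctr c s k' n (act (M k') d y0)" by fastforce
    define N where "N = M (k' + n)"
    define y where "y = ctr c t0 k' n y0"
    define g2 where "g2 a = ctr c (Dom R a) k' n (g1 a)" for a
    have NO: "N \<in> Obj Md" unfolding N_def using MO .
    have yN: "y \<in> el N t0" unfolding y_def N_def using cl[OF t0 k'(2)] .
    have g2_eq: "g2 a = ctr c t k' n (g1 a)" if "t \<in> Obj R" "a \<in> K t" for t a
      using HomD(2)[OF KH[OF that]] by (simp add: g2_def)
    have g2_in: "g2 a \<in> el N t" if "t \<in> Obj R" "a \<in> K t" for t a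
      using cl[OF that(1) g1_in[OF that], of n] g2_eq[OF that] by (simp add: N_def)
    have \<iota>N: "\<iota> (k' + n) \<in> Hom Md N L" unfolding N_def using arr(2) .
    have g2f: "app (\<iota> (k' + n)) t (g2 a) = f a" if "t \<in> Obj R" "a \<in> K t" for t a
      using direct_limit_ctr[OF dl that(1) g1_in[OF that], of n] direct_limit_ctr[OF dl that(1) g_in[OF that], of "k' - k"]
        gf[OF that] g1_eq[OF that] g2_eq[OF that] k'(1) by simp
    have yf: "app (\<iota> (k' + n)) t0 y = f a0" unfolding y_def using direct_limit_ctr[OF dl t0 k'(2)] k'(3) by simp
    have g2: "ideal_hom R N K g2"
      unfolding ideal_hom_def
    proof (intro conjI ballI allI impI; (elim conjE)?)
      fix t a assume t: "t \<in> Obj R" and a: "a \<in> K t"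
      show "g2 a \<in> el N t" using g2_in[OF t a] .
      fix a' assume a': "a' \<in> K t"
      have aa: "Add R a a' \<in> K t" using subrepD(4)[OF K t a a'] by simp
      have "g1 (Add R a a') = g1 a \<cdot>[(M k'),t] g1 a'"
        using g t a a' g1_eq[OF t aa] g1_eq[OF t a] g1_eq[OF t a'] cmult[OF t g_in[OF t a] g_in[OF t a'], of "k' - k"] k'(1)
        by (simp add: ideal_hom_def)
      then show "g2 (Add R a a') = g2 a \<cdot>[N,t] g2 a'"
        using g2_eq[OF t aa] g2_eq[OF t a] g2_eq[OF t a'] cmult[OF t g1_in[OF t a] g1_in[OF t a'], of n] by (simp add: N_def)
    next
      fix s t b a assume b: "b \<in> Hom R s t" and a: "a \<in> K t"
      note st = Hom_Obj[OF b]
      have ab: "Comp R a b \<in> K s" using subrep_act[OF K b a] .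
      have "g1 (Comp R a b) = act (M k') b (g1 a)"
        using g b a g1_eq[OF st(1) ab] g1_eq[OF st(2) a] cact[OF b g_in[OF st(2) a], of "k' - k"] k'(1) by (simp add: ideal_hom_def)
      then show "g2 (Comp R a b) = act N b (g2 a)"
        using g2_eq[OF st(1) ab] g2_eq[OF st(2) a] cact[OF b g1_in[OF st(2) a], of n] by (simp add: N_def)
    qed
    have compat: "g2 (Comp R a0 d) = act N d y" if d: "d \<in> Hom R s t0" and dK: "Comp R a0 d \<in> K s" for s d
    proof -
      \<comment> \<open>The relations that hold at the new stage form a right ideal. It contains the
        generators \<open>E\<close> of \<open>J\<close>, so every relation holds there.\<close>
      define B where "B s = {d \<in> J s. g2 (Comp R a0 d) = act N d y}" for s
      have "J s \<subseteq> B s" if s: "s \<in> Obj R" for s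
      proof (rule E'[OF _ _ s])
        show "d \<in> B s" if sd: "(s, d) \<in> E" for s d
        proof -
          have s: "s \<in> Obj R" and dJ: "d \<in> J s" using E(2)[OF sd] by auto
          then have dH: "d \<in> Hom R s t0" and dK: "Comp R a0 d \<in> K s" by (simp_all add: J_def)
          show ?thesis using n[OF sd] g2_eq[OF s dK] cact[OF dH k'(2), of n] dJ by (simp add: B_def y_def N_def)
        qed
        show "right_ideal t0 B"
        proof (rule subrep_of_mult[OF representable_rep[OF t0]])
          fix s assume s: "s \<in> Obj R"
          show "d \<in> carrier (yoneda t0 s)" if "d \<in> B s" for d using that by (simp add: B_def J_def)
          have 0: "Zero R s r \<in> K s" using subrepD(3)[OF K s] by simp
          have id0: "Zero R s s \<in> Hom R s s" using comm_group_closed(1)[OF Hom_comm_group[OF s s]] by simp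
          have "Comp R (Zero R s r) (Zero R s s) = Zero R s r"
            using rep_zero[OF representable_rep[OF r] s s, of "Zero R s r"] KH[OF s 0] by simp
          then have "g2 (Zero R s r) = act N (Zero R s s) (g2 (Zero R s r))" using g2 id0 0 unfolding ideal_hom_def by metis
          also have "\<dots> = act N (Zero R s t0) y"
            using rep_zero[OF module_rep[OF NO] s s g2_in[OF s 0]] rep_zero[OF module_rep[OF NO] s t0 yN] by simp
          finally show "\<one>\<^bsub>yoneda t0 s\<^esub> \<in> B s" using subrepD(3)[OF J s] zero[OF s] by (simp add: B_def)
          fix d e assume "d \<in> B s" "e \<in> B s"
          then have de: "d \<in> J s" "e \<in> J s" "g2 (Comp R a0 d) = act N d y" "g2 (Comp R a0 e) = act N e y" by (simp_all add: B_def)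
          then have deH: "d \<in> Hom R s t0" "e \<in> Hom R s t0" "Comp R a0 d \<in> K s" "Comp R a0 e \<in> K s" by (simp_all add: J_def)
          have "g2 (Comp R a0 (Add R d e)) = act N (Add R d e) y"
            using g2 s deH de(3,4) Comp_Add_right[OF deH(1,2) a0] act_Add[OF NO deH(1,2) yN] by (simp add: ideal_hom_def)
          then show "d \<otimes>\<^bsub>yoneda t0 s\<^esub> e \<in> B s" using subrepD(4)[OF J s de(1,2)] by (simp add: B_def)
        next
          fix s t b d assume b: "b \<in> Hom R s t" and d: "d \<in> B t"
          then have dJ: "d \<in> Hom R t t0" "Comp R a0 d \<in> K t" "d \<in> J t" by (simp_all add: B_def J_def)
          have "g2 (Comp R a0 (Comp R d b)) = act N b (g2 (Comp R a0 d))"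
            using g2 b dJ(2) Comp_assoc[OF b dJ(1) a0] by (simp add: ideal_hom_def)
          then show "Comp R d b \<in> B s"
            using d subrep_act[OF J b dJ(3)] act_Comp[OF NO dJ(1) b yN] by (simp add: B_def)
        qed
      qed
      moreover have "d \<in> J s" "s \<in> Obj R" using d dK Hom_Obj(1)[OF d] by (simp_all add: J_def)
      ultimately show ?thesis unfolding B_def by blast
    qed
    obtain K' g' where K': "right_ideal r K'" and g': "ideal_hom R N K' g'"
      and KK: "\<forall>t \<in> Obj R. K t \<subseteq> K' t" and a0K: "a0 \<in> K' t0"
      and dec: "\<forall>s \<in> Obj R. \<forall>d \<in> K' s. \<exists>b \<in> K s. \<exists>c \<in> Hom R s t0. d = Add R b (Comp R a0 c) \<and> g' d = g2 b \<cdot>[N,s] act N c y"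
      by (rule exE[OF ideal_hom_extend[OF NO r K g2 a0 yN]])
        (erule (1) compat, elim exE conjE, rule that, assumption+)
    have "d \<in> ?I s \<and> app (\<iota> (k' + n)) s (g' d) = f d" if s: "s \<in> Obj R" and d: "d \<in> K' s" for s d
    proof -
      obtain b e where b: "b \<in> K s" and e: "e \<in> Hom R s t0" and eq: "d = Add R b (Comp R a0 e)" "g' d = g2 b \<cdot>[N,s] act N e y"
        using dec s d by blast
      have bI: "b \<in> ?I s" using KI[OF s] b by blast
      have eI: "Comp R a0 e \<in> ?I s" using ann_Comp[OF Q q a0I e] .
      have "app (\<iota> (k' + n)) s (g' d) = f b \<cdot>[L,s] act L e (f a0)"
        using app_mult[OF \<iota>N s g2_in[OF s b] act_closed[OF NO e yN]] g2f[OF s b] app_act[OF \<iota>N e yN] yf eq(2) by simp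
      also have "\<dots> = f d" using f s bI eI a0I e eq(1) by (simp add: ideal_hom_def)
      finally show ?thesis using ann_Add[OF Q q bI eI] eq(1) by simp
    qed
    moreover have "\<forall>(t, a) \<in> insert p F0. a \<in> K' t" using a0K p KF KK F(2) insert.prems by fastforce
    ultimately show ?case
      using K' g' unfolding N_def by (intro exI[of _ "k' + n"] exI[of _ K'] exI[of _ g']) blast
  qed
  from this[OF F(1) subset_refl] obtain k K g where K: "right_ideal r K" "\<forall>t \<in> Obj R. K t \<subseteq> ?I t" "\<forall>(t, a) \<in> F. a \<in> K t"
    and g: "ideal_hom R (M k) K g" and gf: "\<forall>t \<in> Obj R. \<forall>a \<in> K t. app (\<iota> k) t (g a) = f a"
    by (elim exE conjE) (rule that)
  have IK: "?I t \<subseteq> K t" if "t \<in> Obj R" for t using K(3) by (intro F'[OF K(1) _ that]) blast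
  have eqK: "K t = ?I t" if "t \<in> Obj R" for t using IK[OF that] K(2) that by blast
  have "ideal_hom R (M k) ?I g"
    using g eqK Hom_Obj unfolding ideal_hom_def by (metis (no_types, lifting))
  from saturatedD[OF sat r Q q this] obtain y where y: "y \<in> el (M k) r"
    "\<And>t a. t \<in> Obj R \<Longrightarrow> a \<in> ?I t \<Longrightarrow> g a = act (M k) a y" by blast
  have ex: "f a = act L a (app (\<iota> k) r y)" if "t \<in> Obj R" "a \<in> ?I t" for t a
    using gf that eqK[OF that(1)] y(2)[OF that] app_act[OF arr(2) ann_Hom[OF that(2)] y(1)] by metis
  show "\<exists>!y. y \<in> el L r \<and> (\<forall>t \<in> Obj R. \<forall>a \<in> ?I t. f a = act L a y)"
  proof (rule ex1I[of _ "app (\<iota> k) r y"])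
    show "app (\<iota> k) r y \<in> el L r \<and> (\<forall>t \<in> Obj R. \<forall>a \<in> ?I t. f a = act L a (app (\<iota> k) r y))"
      using ex app_closed[OF arr(2) r y(1)] by simp
    fix z assume "z \<in> el L r \<and> (\<forall>t \<in> Obj R. \<forall>a \<in> ?I t. f a = act L a z)"
    then show "z = app (\<iota> k) r y" using inj[of z "app (\<iota> k) r y"] ex app_closed[OF arr(2) r y(1)] by metis
  qed
qed

end

section \<open>The shift functors and their right adjoints\<close>

lemma precomp_functor_simps [simp]:
  "V \<in> Obj (functor_category C D) \<Longrightarrow> FObj (precomp_functor B C D P) V = functor_comp B V P"
  "\<alpha> \<in> Hom (functor_category C D) V W \<Longrightarrow> FArr (precomp_functor B C D P) \<alpha> =
    mk_nat B (functor_comp B V P) (functor_comp B W P) (\<lambda>X. Map \<alpha> (FObj P X))"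
proof -
  show "V \<in> Obj (functor_category C D) \<Longrightarrow> FObj (precomp_functor B C D P) V = functor_comp B V P"
    by (simp add: precomp_functor_def)
  assume "\<alpha> \<in> Hom (functor_category C D) V W"
  then show "FArr (precomp_functor B C D P) \<alpha> =
    mk_nat B (functor_comp B V P) (functor_comp B W P) (\<lambda>X. Map \<alpha> (FObj P X))"
    using HomD(1)[of \<alpha> "functor_category C D" V W] by (simp add: precomp_functor_def mk_nat_def Hom_functor_category)
qed

lemma is_functor_precomp_functor:
  assumes "category B" "category C" "category D" and P: "is_functor B C P"
  shows "is_functor (functor_category C D) (functor_category B D) (precomp_functor B C D P)"
proof -
  interpret B: category B by fact
  interpret C: category C by fact
  interpret D: category D by fact
  interpret CD: category "functor_category C D" using category_functor_category[OF C.category_axioms D.category_axioms] .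
  interpret BD: category "functor_category B D" using category_functor_category[OF B.category_axioms D.category_axioms] .
  have 1: "functor_comp B V P \<in> Obj (functor_category B D)" if "V \<in> Obj (functor_category C D)" for V
    using that B.is_functor_functor_comp[OF P] by simp
  have 2: "mk_nat B (functor_comp B V P) (functor_comp B W P) (\<lambda>X. Map \<alpha> (FObj P X))
      \<in> Hom (functor_category B D) (functor_comp B V P) (functor_comp B W P)"
    if \<alpha>: "\<alpha> \<in> Hom (functor_category C D) V W" for \<alpha> V W
  proof (rule B.mk_nat_Hom)
    show "is_functor B D (functor_comp B V P)" "is_functor B D (functor_comp B W P)"
      using B.is_functor_functor_comp[OF P] nat_trans_functor[OF \<alpha>] by auto
    show "Map \<alpha> (FObj P X) \<in> Hom D (FObj (functor_comp B V P) X) (FObj (functor_comp B W P) X)" if "X \<in> Obj B" for X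
      using nat_trans_component[OF \<alpha> functor_FObj[OF P that]] that by simp
    show "Comp D (Map \<alpha> (FObj P Y)) (FArr (functor_comp B V P) f) = Comp D (FArr (functor_comp B W P) f) (Map \<alpha> (FObj P X))"
      if "f \<in> Hom B X Y" for f X Y
      using nat_trans_natural[OF \<alpha> functor_FArr[OF P that]] that by simp
  qed
  have eq: "precomp_functor B C D P = mk_functor (functor_category C D) (FObj (precomp_functor B C D P)) (FArr (precomp_functor B C D P))"
    unfolding mk_functor_def by (simp add: precomp_functor_def)
  show ?thesis
  proof (subst eq, rule CD.is_functor_mk_functor)
    show "FObj (precomp_functor B C D P) V \<in> Obj (functor_category B D)" if "V \<in> Obj (functor_category C D)" for V
      using that 1[OF that] by simp
    show "FArr (precomp_functor B C D P) \<alpha> \<in> Hom (functor_category B D) (FObj (precomp_functor B C D P) V) (FObj (precomp_functor B C D P) W)"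
      if "\<alpha> \<in> Hom (functor_category C D) V W" for \<alpha> V W
      using 2[OF that] CD.Hom_Obj[OF that] that by simp
    show "FArr (precomp_functor B C D P) (Ident (functor_category C D) V) = Ident (functor_category B D) (FObj (precomp_functor B C D P) V)"
      if V: "V \<in> Obj (functor_category C D)" for V
      using 2[OF CD.Ident_Hom[OF V]] V functor_FObj[OF P] BD.Ident_Hom[OF 1[OF V]]
      by (intro nat_trans_eqI[where C = B and D = D]) (auto simp: precomp_functor_simps(2)[OF CD.Ident_Hom[OF V]])
    show "FArr (precomp_functor B C D P) (Comp (functor_category C D) \<beta> \<alpha>) =
        Comp (functor_category B D) (FArr (precomp_functor B C D P) \<beta>) (FArr (precomp_functor B C D P) \<alpha>)"
      if \<alpha>: "\<alpha> \<in> Hom (functor_category C D) V W" and \<beta>: "\<beta> \<in> Hom (functor_category C D) W U" for \<alpha> \<beta> V W U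
      using 2[OF CD.Comp_Hom[OF \<alpha> \<beta>]] BD.Comp_Hom[OF 2[OF \<alpha>] 2[OF \<beta>]] functor_FObj[OF P]
      by (intro nat_trans_eqI[where C = B and D = D and F = "functor_comp B V P" and G = "functor_comp B U P"])
        (auto simp: precomp_functor_simps(2)[OF CD.Comp_Hom[OF \<alpha> \<beta>]] precomp_functor_simps(2)[OF \<alpha>] precomp_functor_simps(2)[OF \<beta>])
  qed
qed

section \<open>The sets X + [k] and the functors adding k points\<close>

lemma in_disj_add: "x \<in> disj_add k S \<longleftrightarrow> x < k \<or> (k \<le> x \<and> x - k \<in> S)"
  unfolding disj_add_def by (auto simp: image_iff) (metis le_add_diff_inverse2)

lemma disj_add_simps:
  "disj_add 0 S = S" "disj_add (Suc k) S = disj_add k (disj_add 1 S)" "finite (disj_add k S) \<longleftrightarrow> finite S"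
proof -
  show "disj_add 0 S = S" by (simp add: disj_add_def)
  show "disj_add (Suc k) S = disj_add k (disj_add 1 S)"
    by (rule Set.set_eqI) (auto simp: in_disj_add)
  show "finite (disj_add k S) \<longleftrightarrow> finite S"
    unfolding disj_add_def using finite_imageD[of "\<lambda>x. x + k" S] by (auto simp: inj_on_def)
qed

lemma FObj_FI_add: "finite S \<Longrightarrow> FObj (FI_add k) S = disj_add k S"
  by (simp add: FI_add_def)

lemma FArr_FI_add:
  assumes "\<phi> \<in> Hom FI S X"
  shows "FArr (FI_add k) \<phi> = mk_inj (disj_add k S) (disj_add k X) (\<lambda>x. if x < k then x else Map \<phi> (x - k) + k)"
  using assms HomD(1)[OF assms] by (simp add: FI_add_def mk_inj_def Hom_FI)

lemma FI_add_Hom: 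
  assumes \<phi>: "\<phi> \<in> Hom FI S X"
  shows "FArr (FI_add k) \<phi> \<in> Hom FI (disj_add k S) (disj_add k X)"
  unfolding FArr_FI_add[OF \<phi>]
proof (rule mk_inj_Hom)
  show "finite (disj_add k S)" "finite (disj_add k X)" using \<phi> by (auto simp: disj_add_simps(3) Hom_FI)
  show "(\<lambda>x. if x < k then x else Map \<phi> (x - k) + k) ` disj_add k S \<subseteq> disj_add k X"
    using Map_FI_in[OF \<phi>] by (auto simp: in_disj_add)
  show "inj_on (\<lambda>x. if x < k then x else Map \<phi> (x - k) + k) (disj_add k S)"
  proof (rule inj_onI)
    fix x y assume "x \<in> disj_add k S" "y \<in> disj_add k S"
      and "(if x < k then x else Map \<phi> (x - k) + k) = (if y < k then y else Map \<phi> (y - k) + k)"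
    then show "x = y" using inj_onD[OF Map_FI_inj[OF \<phi>], of "x - k" "y - k"] by (auto simp: in_disj_add split: if_splits)
  qed
qed

lemma Map_FI_add:
  "\<phi> \<in> Hom FI S X \<Longrightarrow> x \<in> disj_add k S \<Longrightarrow> Map (FArr (FI_add k) \<phi>) x = (if x < k then x else Map \<phi> (x - k) + k)"
  by (simp add: FArr_FI_add)

lemma FI_add_Suc:
  assumes \<phi>: "\<phi> \<in> Hom FI S X"
  shows "FArr (FI_add (Suc k)) \<phi> = FArr (FI_add k) (FArr (FI_add 1) \<phi>)"
proof (rule FI_arrow_eqI)
  show "FArr (FI_add (Suc k)) \<phi> \<in> Hom FI (disj_add (Suc k) S) (disj_add (Suc k) X)" using FI_add_Hom[OF \<phi>] .
  show "FArr (FI_add k) (FArr (FI_add 1) \<phi>) \<in> Hom FI (disj_add (Suc k) S) (disj_add (Suc k) X)"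
    unfolding disj_add_simps(2) using FI_add_Hom[OF FI_add_Hom[OF \<phi>]] .
  fix x assume x: "x \<in> disj_add (Suc k) S"
  then have "x \<in> disj_add k (disj_add 1 S)" "k \<le> x \<Longrightarrow> x - k \<in> disj_add 1 S"
    unfolding disj_add_simps(2) by (auto simp: in_disj_add)
  then show "Map (FArr (FI_add (Suc k)) \<phi>) x = Map (FArr (FI_add k) (FArr (FI_add 1) \<phi>)) x"
    using x Map_FI_add[OF \<phi> x] Map_FI_add[OF FI_add_Hom[OF \<phi>], of x k 1] Map_FI_add[OF \<phi>, of "x - k" 1] by auto
qed

lemma is_functor_FI_add: "is_functor FI FI (FI_add k)"
proof -
  have eq: "FI_add k = mk_functor FI (FObj (FI_add k)) (FArr (FI_add k))"
    unfolding mk_functor_def by (simp add: FI_add_def)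
  show ?thesis
  proof (subst eq, rule FI.is_functor_mk_functor)
    show "FObj (FI_add k) S \<in> Obj FI" if "S \<in> Obj FI" for S using that by (simp add: FObj_FI_add disj_add_simps)
    show "FArr (FI_add k) \<phi> \<in> Hom FI (FObj (FI_add k) S) (FObj (FI_add k) X)" if "\<phi> \<in> Hom FI S X" for \<phi> S X
      using FI_add_Hom[OF that] that by (simp add: FObj_FI_add Hom_FI)
    fix S assume S: "S \<in> Obj FI"
    show "FArr (FI_add k) (Ident FI S) = Ident FI (FObj (FI_add k) S)"
      using S FI_add_Hom[OF FI.Ident_Hom[OF S]]
      by (intro FI_arrow_eqI[OF _ FI.Ident_Hom])
        (auto simp: FObj_FI_add disj_add_simps Map_FI_add[OF FI.Ident_Hom[OF S]] Map_Ident_FI in_disj_add)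
  next
    fix \<phi> \<psi> S X Y assume \<phi>: "\<phi> \<in> Hom FI S X" and \<psi>: "\<psi> \<in> Hom FI X Y"
    show "FArr (FI_add k) (Comp FI \<psi> \<phi>) = Comp FI (FArr (FI_add k) \<psi>) (FArr (FI_add k) \<phi>)"
    proof (rule FI_arrow_eqI[OF FI_add_Hom[OF FI.Comp_Hom[OF \<phi> \<psi>]] FI.Comp_Hom[OF FI_add_Hom[OF \<phi>] FI_add_Hom[OF \<psi>]]])
      fix x assume x: "x \<in> disj_add k S"
      show "Map (FArr (FI_add k) (Comp FI \<psi> \<phi>)) x = Map (Comp FI (FArr (FI_add k) \<psi>) (FArr (FI_add k) \<phi>)) x"
        unfolding Map_Comp_FI[OF FI_add_Hom[OF \<phi>] x] Map_FI_add[OF FI.Comp_Hom[OF \<phi> \<psi>] x] Map_FI_add[OF \<phi> x]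
        using x Map_FI_in[OF FI_add_Hom[OF \<phi>, of k] x] Map_FI_add[OF \<psi>, of "Map (FArr (FI_add k) \<phi>) x" k] Map_FI_add[OF \<phi> x]
        by (auto simp: Map_Comp_FI[OF \<phi>] in_disj_add)
    qed
  qed
qed

section \<open>Universal property of an adjunction and iterated functors\<close>

lemma adjunction_universal:
  assumes "category C" "category D" and adj: "is_adjunction C D F G \<eta> \<epsilon>"
    and A: "A \<in> Obj C" and \<beta>: "\<beta> \<in> Hom D (FObj F A) Y"
  shows "\<exists>!\<gamma>. \<gamma> \<in> Hom C A (FObj G Y) \<and> Comp D (Map \<epsilon> Y) (FArr F \<gamma>) = \<beta>"
proof -
  interpret C: category C by fact
  interpret D: category D by fact
  have F: "is_functor C D F" and G: "is_functor D C G"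
    and \<eta>: "\<eta> \<in> Hom (functor_category C C) (id_functor C) (functor_comp C G F)"
    and \<epsilon>: "\<epsilon> \<in> Hom (functor_category D D) (functor_comp D F G) (id_functor D)"
    and tri1: "\<And>X. X \<in> Obj C \<Longrightarrow> Comp D (Map \<epsilon> (FObj F X)) (FArr F (Map \<eta> X)) = Ident D (FObj F X)"
    and tri2: "\<And>Y. Y \<in> Obj D \<Longrightarrow> Comp C (FArr G (Map \<epsilon> Y)) (Map \<eta> (FObj G Y)) = Ident C (FObj G Y)"
    using adj by (auto simp: is_adjunction_def)
  have Y: "Y \<in> Obj D" using D.Hom_Obj[OF \<beta>] by simp
  have \<eta>c: "Map \<eta> X \<in> Hom C X (FObj G (FObj F X))" if "X \<in> Obj C" for X
    using nat_trans_component[OF \<eta> that] that by simp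
  have \<epsilon>c: "Map \<epsilon> X \<in> Hom D (FObj F (FObj G X)) X" if "X \<in> Obj D" for X
    using nat_trans_component[OF \<epsilon> that] that by simp
  have FA: "FObj F A \<in> Obj D" using functor_FObj[OF F A] .
  have \<epsilon>n: "Comp D (Map \<epsilon> Y) (FArr F (FArr G \<beta>)) = Comp D \<beta> (Map \<epsilon> (FObj F A))"
    using nat_trans_natural[OF \<epsilon> \<beta>] \<beta> by simp
  show ?thesis
  proof (rule ex1I)
    let ?\<gamma> = "Comp C (FArr G \<beta>) (Map \<eta> A)"
    have \<gamma>: "?\<gamma> \<in> Hom C A (FObj G Y)" using C.Comp_Hom[OF \<eta>c[OF A] functor_FArr[OF G \<beta>]] .
    have "Comp D (Map \<epsilon> Y) (FArr F ?\<gamma>) = Comp D (Map \<epsilon> Y) (Comp D (FArr F (FArr G \<beta>)) (FArr F (Map \<eta> A)))"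
      using functor_Comp[OF F \<eta>c[OF A] functor_FArr[OF G \<beta>]] by simp
    also have "\<dots> = Comp D (Comp D \<beta> (Map \<epsilon> (FObj F A))) (FArr F (Map \<eta> A))"
      using D.Comp_assoc[OF functor_FArr[OF F \<eta>c[OF A]] functor_FArr[OF F functor_FArr[OF G \<beta>]] \<epsilon>c[OF Y]] \<epsilon>n by simp
    also have "\<dots> = \<beta>"
      using D.Comp_assoc[OF functor_FArr[OF F \<eta>c[OF A]] \<epsilon>c[OF FA] \<beta>] tri1[OF A] D.Comp_Ident_right[OF \<beta>] by simp
    finally show "?\<gamma> \<in> Hom C A (FObj G Y) \<and> Comp D (Map \<epsilon> Y) (FArr F ?\<gamma>) = \<beta>" using \<gamma> by simp
    fix \<gamma> assume "\<gamma> \<in> Hom C A (FObj G Y) \<and> Comp D (Map \<epsilon> Y) (FArr F \<gamma>) = \<beta>"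
    then have \<gamma>: "\<gamma> \<in> Hom C A (FObj G Y)" and eq: "Comp D (Map \<epsilon> Y) (FArr F \<gamma>) = \<beta>" by auto
    have GY: "FObj G Y \<in> Obj C" using functor_FObj[OF G Y] .
    have GF\<gamma>: "FArr G (FArr F \<gamma>) \<in> Hom C (FObj G (FObj F A)) (FObj G (FObj F (FObj G Y)))"
      using functor_FArr[OF G functor_FArr[OF F \<gamma>]] .
    have "?\<gamma> = Comp C (Comp C (FArr G (Map \<epsilon> Y)) (FArr G (FArr F \<gamma>))) (Map \<eta> A)"
      using functor_Comp[OF G functor_FArr[OF F \<gamma>] \<epsilon>c[OF Y]] eq by simp
    also have "\<dots> = Comp C (FArr G (Map \<epsilon> Y)) (Comp C (Map \<eta> (FObj G Y)) \<gamma>)"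
      using C.Comp_assoc[OF \<eta>c[OF A] GF\<gamma> functor_FArr[OF G \<epsilon>c[OF Y]]] nat_trans_natural[OF \<eta> \<gamma>] \<gamma> by simp
    also have "\<dots> = \<gamma>"
      using C.Comp_assoc[OF \<gamma> \<eta>c[OF GY] functor_FArr[OF G \<epsilon>c[OF Y]]] tri2[OF Y] C.Comp_Ident_left[OF \<gamma>] by simp
    finally show "\<gamma> = ?\<gamma>" by simp
  qed
qed

text \<open>\<open>functor_pow\<close> splits off its outermost factor, whereas the recursion for
  the counit of the composite adjunction needs the innermost one.\<close>

lemma (in category) functor_pow_commute:
  assumes F: "is_functor C C F"
  shows "X \<in> Obj C \<Longrightarrow> FObj (functor_pow C F n) (FObj F X) = FObj (functor_pow C F (Suc n)) X"
    and "f \<in> Hom C X Y \<Longrightarrow> FArr (functor_pow C F n) (FArr F f) = FArr (functor_pow C F (Suc n)) f"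
proof -
  show "X \<in> Obj C \<Longrightarrow> FObj (functor_pow C F n) (FObj F X) = FObj (functor_pow C F (Suc n)) X"
    using functor_FObj[OF F] by (induction n) simp_all
  show "f \<in> Hom C X Y \<Longrightarrow> FArr (functor_pow C F n) (FArr F f) = FArr (functor_pow C F (Suc n)) f"
    using functor_FArr[OF F, of f X Y] by (induction n) simp_all
qed

context module_category begin

abbreviation "Sh \<equiv> shift small R"

lemma is_functor_shift: "is_functor FM FM (Sh k)"
  unfolding shift_def FIMod_def
  by (rule is_functor_precomp_functor[OF category_FI category_FI Md.category_axioms is_functor_FI_add])

lemma FObj_shift: "V \<in> Obj FM \<Longrightarrow> FObj (Sh k) V = functor_comp FI V (FI_add k)"
  by (simp add: shift_def FIMod_def)

lemma shift_at: "V \<in> Obj FM \<Longrightarrow> finite S \<Longrightarrow> FObj (FObj (Sh k) V) S = FObj V (disj_add k S)"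
  by (simp add: FObj_shift FObj_FI_add)

lemma FArr_shift_at: "V \<in> Obj FM \<Longrightarrow> \<phi> \<in> Hom FI S X \<Longrightarrow> FArr (FObj (Sh k) V) \<phi> = FArr V (FArr (FI_add k) \<phi>)"
  by (simp add: FObj_shift)

lemma Map_shift: "\<alpha> \<in> Hom FM V W \<Longrightarrow> finite S \<Longrightarrow> Map (FArr (Sh k) \<alpha>) S = Map \<alpha> (disj_add k S)"
  by (simp add: shift_def FIMod_def FObj_FI_add)

lemma shift_Obj: "V \<in> Obj FM \<Longrightarrow> FObj (Sh k) V \<in> Obj FM"
  using functor_FObj[OF is_functor_shift] .

lemma shift_0:
  assumes V: "V \<in> Obj FM"
  shows "FObj (Sh 0) V = V"
proof -
  have "FArr (FI_add 0) \<phi> = \<phi>" if \<phi>: "\<phi> \<in> Hom FI S X" for \<phi> S X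
    using FI_add_Hom[OF \<phi>, of 0] \<phi> by (intro FI_arrow_eqI[of _ S X]) (auto simp: disj_add_simps Map_FI_add[OF \<phi>])
  then show ?thesis
    using V shift_Obj[OF V] shift_at[OF V, of _ 0] FArr_shift_at[OF V, of _ _ _ 0]
    by (intro functor_eqI[of FI Md _ Md]) (auto simp: Obj_FIMod disj_add_simps dest: Arr_Hom)
qed

lemma shift_0_arr: "\<alpha> \<in> Hom FM V W \<Longrightarrow> FArr (Sh 0) \<alpha> = \<alpha>"
  using functor_FArr[OF is_functor_shift, of \<alpha> V W 0] shift_0 Hom_FIMod_Obj[of \<alpha> V W]
  by (intro FI_module_arrow_eqI[of _ V W]) (auto simp: Map_shift disj_add_simps)

lemma shift_Suc:
  assumes V: "V \<in> Obj FM"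
  shows "FObj (Sh (Suc k)) V = FObj (Sh 1) (FObj (Sh k) V)"
proof (rule functor_eqI[of FI Md _ Md])
  show "is_functor FI Md (FObj (Sh (Suc k)) V)" "is_functor FI Md (FObj (Sh 1) (FObj (Sh k) V))"
    using shift_Obj V by (simp_all add: Obj_FIMod)
  show "FObj (FObj (Sh (Suc k)) V) S = FObj (FObj (Sh 1) (FObj (Sh k) V)) S" if "S \<in> Obj FI" for S
    using that V shift_Obj[OF V] disj_add_simps(2)[of k S] by (simp add: shift_at disj_add_simps(3))
  show "FArr (FObj (Sh (Suc k)) V) \<phi> = FArr (FObj (Sh 1) (FObj (Sh k) V)) \<phi>" if "\<phi> \<in> Arr FI" for \<phi>
    using FArr_shift_at[OF V Arr_Hom[OF that], of "Suc k"] FArr_shift_at[OF shift_Obj[OF V] Arr_Hom[OF that], of 1 k]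
      FArr_shift_at[OF V FI_add_Hom[OF Arr_Hom[OF that]], of k 1] FI_add_Suc[OF Arr_Hom[OF that], of k] by simp
qed

lemma shift_Suc_arr:
  assumes \<alpha>: "\<alpha> \<in> Hom FM V W"
  shows "FArr (Sh (Suc k)) \<alpha> = FArr (Sh 1) (FArr (Sh k) \<alpha>)"
proof (rule FI_module_arrow_eqI)
  note Sh = functor_FArr[OF is_functor_shift]
  show "FArr (Sh (Suc k)) \<alpha> \<in> Hom FM (FObj (Sh (Suc k)) V) (FObj (Sh (Suc k)) W)" using Sh[OF \<alpha>] .
  show "FArr (Sh 1) (FArr (Sh k) \<alpha>) \<in> Hom FM (FObj (Sh (Suc k)) V) (FObj (Sh (Suc k)) W)"
    unfolding shift_Suc[OF Hom_FIMod_Obj(1)[OF \<alpha>]] shift_Suc[OF Hom_FIMod_Obj(2)[OF \<alpha>]] using Sh[OF Sh[OF \<alpha>]] .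
  show "comp_at (FArr (Sh (Suc k)) \<alpha>) S r x = comp_at (FArr (Sh 1) (FArr (Sh k) \<alpha>)) S r x" if "finite S" for S r x
    using that disj_add_simps(2)[of k S]
    by (simp add: Map_shift[OF \<alpha>] Map_shift[OF Sh[OF \<alpha>]] disj_add_simps(3))
qed

end

section \<open>The composite adjunction of S^k and T^k\<close>

locale shift_adjunction = module_category small R
  for small :: "'u set \<Rightarrow> bool" and R :: "('r, 'm) preadditive" +
  fixes T :: "('r, 'm, 'u) FImod_functor" and \<eta> \<epsilon> :: "('r, 'm, 'u) FImod_nat_trans"
  assumes adj: "is_adjunction FM FM (Sh 1) T \<eta> \<epsilon>"
begin

lemma T_functor: "is_functor FM FM T"
  and \<eta>: "\<eta> \<in> Hom (functor_category FM FM) (id_functor FM) (functor_comp FM T (Sh 1))"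
  and \<epsilon>: "\<epsilon> \<in> Hom (functor_category FM FM) (functor_comp FM (Sh 1) T) (id_functor FM)"
  and triangle: "X \<in> Obj FM \<Longrightarrow> Comp FM (Map \<epsilon> (FObj (Sh 1) X)) (FArr (Sh 1) (Map \<eta> X)) = Ident FM (FObj (Sh 1) X)"
  using adj by (auto simp: is_adjunction_def)

abbreviation "Tp \<equiv> functor_pow FM T"

lemmas Tp_functor = FM.is_functor_functor_pow[OF T_functor]
lemmas Sh_Hom = functor_FArr[OF is_functor_shift]
lemmas T_Hom = functor_FArr[OF T_functor]
lemmas Tp_Hom = functor_FArr[OF Tp_functor]
lemmas T_Obj = functor_FObj[OF T_functor]
lemmas Tp_Obj = functor_FObj[OF Tp_functor]

lemma \<eta>_Hom: "X \<in> Obj FM \<Longrightarrow> Map \<eta> X \<in> Hom FM X (FObj T (FObj (Sh 1) X))"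
  using nat_trans_component[OF \<eta>] by simp

lemma \<epsilon>_Hom: "X \<in> Obj FM \<Longrightarrow> Map \<epsilon> X \<in> Hom FM (FObj (Sh 1) (FObj T X)) X"
  using nat_trans_component[OF \<epsilon>] by simp

lemma \<eta>_natural: "f \<in> Hom FM X Y \<Longrightarrow> Comp FM (Map \<eta> Y) f = Comp FM (FArr T (FArr (Sh 1) f)) (Map \<eta> X)"
  using nat_trans_natural[OF \<eta>, of f X Y] by simp

lemma \<epsilon>_natural: "f \<in> Hom FM X Y \<Longrightarrow> Comp FM (Map \<epsilon> Y) (FArr (Sh 1) (FArr T f)) = Comp FM f (Map \<epsilon> X)"
  using nat_trans_natural[OF \<epsilon>, of f X Y] by simp

text \<open>The counit S^k T^k Y -> Y of the composite adjunction, built as S (S^k T^k) T Y -> S T Y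
  -> Y.\<close>

primrec counit :: "nat \<Rightarrow> ('r, 'm, 'u) FImod_obj \<Rightarrow> ('r, 'm, 'u) FImod_arr" where
  "counit 0 Y = Ident FM Y"
| "counit (Suc k) Y = Comp FM (Map \<epsilon> Y) (FArr (Sh 1) (counit k (FObj T Y)))"

lemma Tp_Suc: "Y \<in> Obj FM \<Longrightarrow> FObj (Tp (Suc k)) Y = FObj (Tp k) (FObj T Y)"
  and Tp_Suc_arr: "f \<in> Hom FM X Y \<Longrightarrow> FArr (Tp (Suc k)) f = FArr (Tp k) (FArr T f)"
  using FM.functor_pow_commute[OF T_functor] by simp_all

lemma counit_Hom: "Y \<in> Obj FM \<Longrightarrow> counit k Y \<in> Hom FM (FObj (Sh k) (FObj (Tp k) Y)) Y"
proof (induction k arbitrary: Y)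
  case 0
  then show ?case using FM.Ident_Hom by (simp add: shift_0)
next
  case (Suc k)
  have "FObj (Sh (Suc k)) (FObj (Tp (Suc k)) Y) = FObj (Sh 1) (FObj (Sh k) (FObj (Tp k) (FObj T Y)))"
    using shift_Suc[OF Tp_Obj[OF T_Obj[OF Suc.prems]]] Tp_Suc[OF Suc.prems] by simp
  then show ?case
    using FM.Comp_Hom[OF Sh_Hom[OF Suc.IH[OF T_Obj[OF Suc.prems]]] \<epsilon>_Hom[OF Suc.prems]] by simp
qed

lemma counit_Suc_shift:
  assumes Y: "Y \<in> Obj FM" and \<alpha>: "\<alpha> \<in> Hom FM A (FObj (Tp k) (FObj T Y))"
  shows "Comp FM (counit (Suc k) Y) (FArr (Sh (Suc k)) \<alpha>) =
    Comp FM (Map \<epsilon> Y) (FArr (Sh 1) (Comp FM (counit k (FObj T Y)) (FArr (Sh k) \<alpha>)))"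
  using FM.Comp_assoc[OF Sh_Hom[OF Sh_Hom[OF \<alpha>]] Sh_Hom[OF counit_Hom[OF T_Obj[OF Y]]] \<epsilon>_Hom[OF Y]]
    functor_Comp[OF is_functor_shift Sh_Hom[OF \<alpha>] counit_Hom[OF T_Obj[OF Y]]] by (simp add: shift_Suc_arr[OF \<alpha>])

text \<open>Two successive transpositions: an arrow from S^(k+1) A to Y corresponds to one from S^k
  A to T Y by the single adjunction, and then, by induction applied to T Y, to one from A to T^(k+1)
  Y.\<close>

lemma counit_universal:
  assumes "A \<in> Obj FM" "Y \<in> Obj FM" "\<beta> \<in> Hom FM (FObj (Sh k) A) Y"
  shows "\<exists>!\<alpha>. \<alpha> \<in> Hom FM A (FObj (Tp k) Y) \<and> Comp FM (counit k Y) (FArr (Sh k) \<alpha>) = \<beta>"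
  using assms(2,3)
proof (induction k arbitrary: Y \<beta>)
  case 0
  have "\<alpha> \<in> Hom FM A (FObj (Tp 0) Y) \<and> Comp FM (counit 0 Y) (FArr (Sh 0) \<alpha>) = \<beta> \<longleftrightarrow> \<alpha> = \<beta>" for \<alpha>
    using 0 assms(1) FM.Comp_Ident_left by (auto simp: shift_0 shift_0_arr)
  then show ?case by simp
next
  case (Suc k)
  note Y = Suc.prems(1)
  have \<beta>: "\<beta> \<in> Hom FM (FObj (Sh 1) (FObj (Sh k) A)) Y" using Suc.prems(2) shift_Suc[OF assms(1)] by simp
  from adjunction_universal[OF FM.category_axioms FM.category_axioms adj shift_Obj[OF assms(1)] \<beta>]
  obtain \<gamma> where \<gamma>: "\<gamma> \<in> Hom FM (FObj (Sh k) A) (FObj T Y)" "Comp FM (Map \<epsilon> Y) (FArr (Sh 1) \<gamma>) = \<beta>"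
    and \<gamma>_unique: "\<And>\<gamma>'. \<gamma>' \<in> Hom FM (FObj (Sh k) A) (FObj T Y) \<Longrightarrow> Comp FM (Map \<epsilon> Y) (FArr (Sh 1) \<gamma>') = \<beta> \<Longrightarrow> \<gamma>' = \<gamma>"
    by blast
  have "\<alpha> \<in> Hom FM A (FObj (Tp (Suc k)) Y) \<and> Comp FM (counit (Suc k) Y) (FArr (Sh (Suc k)) \<alpha>) = \<beta> \<longleftrightarrow>
      \<alpha> \<in> Hom FM A (FObj (Tp k) (FObj T Y)) \<and> Comp FM (counit k (FObj T Y)) (FArr (Sh k) \<alpha>) = \<gamma>" (is "?L \<longleftrightarrow> ?R") for \<alpha>
  proof
    assume L: ?L
    then have \<alpha>: "\<alpha> \<in> Hom FM A (FObj (Tp k) (FObj T Y))" using Tp_Suc[OF Y] by simp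
    then show ?R
      using L counit_Suc_shift[OF Y \<alpha>] \<gamma>_unique[OF FM.Comp_Hom[OF Sh_Hom[OF \<alpha>] counit_Hom[OF T_Obj[OF Y]]]] by simp
  next
    assume R: ?R
    then show ?L using counit_Suc_shift[OF Y, of \<alpha> A k] \<gamma>(2) Tp_Suc[OF Y] by simp
  qed
  then show ?case using Suc.IH[OF T_Obj[OF Y] \<gamma>(1)] by simp
qed

end

section \<open>Elements of \<open>T^k S^k W\<close> as natural families\<close>

text \<open>Iterated pairing. Only finite index sets are admissible: for small meaning countable, an
  infinite power of a two-element set is no longer small.\<close>

lemma (in universe) finite_function_code:
  assumes "finite I" "small A"
  shows "\<exists>\<kappa> :: ('i \<Rightarrow> 'u) \<Rightarrow> 'u. inj_on \<kappa> (I \<rightarrow>\<^sub>E A) \<and> small (\<kappa> ` (I \<rightarrow>\<^sub>E A))"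
  using assms(1)
proof (induction rule: finite_induct)
  case empty
  have "PiE {} (\<lambda>_. A) = {\<lambda>_. undefined}" by simp
  then show ?case using small_finite by (intro exI[of _ "\<lambda>_. undefined"]) simp
next
  case (insert i I)
  then obtain \<kappa> :: "('i \<Rightarrow> 'u) \<Rightarrow> 'u" where \<kappa>: "inj_on \<kappa> (I \<rightarrow>\<^sub>E A)" "small (\<kappa> ` (I \<rightarrow>\<^sub>E A))" by blast
  obtain \<pi> :: "'u \<times> 'u \<Rightarrow> 'u" where \<pi>: "inj \<pi>" using pairing by blast
  define \<kappa>' where "\<kappa>' f = \<pi> (f i, \<kappa> (restrict f I))" for f
  have r: "restrict f I \<in> I \<rightarrow>\<^sub>E A" "f i \<in> A" if "f \<in> insert i I \<rightarrow>\<^sub>E A" for f using that by auto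
  have "inj_on \<kappa>' (insert i I \<rightarrow>\<^sub>E A)"
  proof (rule inj_onI)
    fix f g assume f: "f \<in> insert i I \<rightarrow>\<^sub>E A" and g: "g \<in> insert i I \<rightarrow>\<^sub>E A" and eq: "\<kappa>' f = \<kappa>' g"
    have "f i = g i" "restrict f I = restrict g I"
      using eq \<pi> inj_onD[OF \<kappa>(1) _ r(1)[OF f] r(1)[OF g]] by (auto simp: \<kappa>'_def inj_eq)
    then have "f x = g x" if "x \<in> insert i I" for x using that by (metis insertE restrict_apply')
    then show "f = g" using PiE_ext[OF f g] by blast
  qed
  moreover have "small (\<kappa>' ` (insert i I \<rightarrow>\<^sub>E A))"
    by (rule small_subset[OF small_Times[OF assms(2) \<kappa>(2), of \<pi>]]) (use r in \<open>auto simp: \<kappa>'_def\<close>)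
  ultimately show ?case by blast
qed

lemma finite_Hom_FI: "finite (Hom FI S X)"
proof (cases "finite S \<and> finite X")
  case True
  have "Hom FI S X \<subseteq> (\<lambda>f. \<lparr>Src = S, Trg = X, Map = f\<rparr>) ` (S \<rightarrow>\<^sub>E X)"
    by (auto simp: Hom_FI image_iff intro!: bexI arrow.equality)
  then show ?thesis using True finite_PiE[of S "\<lambda>_. X"] finite_subset by blast
next
  case False
  then have "Hom FI S X = {}" by (auto simp: Hom_FI)
  then show ?thesis by simp
qed

context module_category begin

text \<open>The FI-version of \<open>module_of_rep\<close>: a system of representations that is
  functorial in finite sets, and is coded injectively with small image, becomes an FI-module.
  Injectivity provides the decoding through which the structure maps are transported.\<close>

lemma fi_module_of_rep:
  assumes rep: "\<And>S. finite S \<Longrightarrow> rep R (G S) (\<rho> S)"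
    and inj: "\<And>S r. finite S \<Longrightarrow> r \<in> Obj R \<Longrightarrow> inj_on (q S r) (carrier (G S r))"
    and sm: "\<And>S r. finite S \<Longrightarrow> r \<in> Obj R \<Longrightarrow> small (q S r ` carrier (G S r))"
    and fi: "\<And>S X \<phi> r. \<phi> \<in> Hom FI S X \<Longrightarrow> r \<in> Obj R \<Longrightarrow> fi \<phi> r \<in> hom (G S r) (G X r)"
    and fi_act: "\<And>S X \<phi> t r a x. \<phi> \<in> Hom FI S X \<Longrightarrow> a \<in> Hom R t r \<Longrightarrow> x \<in> carrier (G S r) \<Longrightarrow>
      fi \<phi> t (\<rho> S a x) = \<rho> X a (fi \<phi> r x)"
    and fi_id: "\<And>S r x. finite S \<Longrightarrow> r \<in> Obj R \<Longrightarrow> x \<in> carrier (G S r) \<Longrightarrow> fi (Ident FI S) r x = x"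
    and fi_comp: "\<And>S X Y \<phi> \<psi> r x. \<phi> \<in> Hom FI S X \<Longrightarrow> \<psi> \<in> Hom FI X Y \<Longrightarrow> r \<in> Obj R \<Longrightarrow> x \<in> carrier (G S r) \<Longrightarrow>
      fi (Comp FI \<psi> \<phi>) r x = fi \<psi> r (fi \<phi> r x)"
  shows "\<exists>V \<in> Obj FM.
    (\<forall>S r. finite S \<and> r \<in> Obj R \<longrightarrow> el (FObj V S) r = q S r ` carrier (G S r) \<and> q S r \<in> hom (G S r) (fib (FObj V S) r)) \<and>
    (\<forall>S t r a x. finite S \<and> a \<in> Hom R t r \<and> x \<in> carrier (G S r) \<longrightarrow> act (FObj V S) a (q S r x) = q S t (\<rho> S a x)) \<and>
    (\<forall>S X \<phi> r x. \<phi> \<in> Hom FI S X \<and> r \<in> Obj R \<and> x \<in> carrier (G S r) \<longrightarrow> push V \<phi> r (q S r x) = q X r (fi \<phi> r x))"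
proof -
  have eq: "x = y" if "finite S" "r \<in> Obj R" "x \<in> carrier (G S r)" "y \<in> carrier (G S r)" "q S r x = q S r y" for S r x y
    using inj_onD[OF inj[OF that(1,2)] that(5,3,4)] .
  have "\<exists>M. M \<in> Obj Md \<and> (\<forall>r \<in> Obj R. el M r = q S r ` carrier (G S r) \<and> q S r \<in> hom (G S r) (fib M r)) \<and>
    (\<forall>t r a x. a \<in> Hom R t r \<and> x \<in> carrier (G S r) \<longrightarrow> act M a (q S r x) = q S t (\<rho> S a x))" (is "\<exists>M. ?P S M") if S: "finite S" for S
  proof (rule module_of_rep[OF rep[OF S], unfolded Bex_def])
    fix r x x' y y' assume r: "r \<in> Obj R" and "x \<in> carrier (G S r)" "x' \<in> carrier (G S r)" "y \<in> carrier (G S r)" "y' \<in> carrier (G S r)"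
      "q S r x = q S r x'" "q S r y = q S r y'"
    then show "q S r (x \<otimes>\<^bsub>G S r\<^esub> y) = q S r (x' \<otimes>\<^bsub>G S r\<^esub> y')" using eq[OF S r] by metis
  next
    fix t r a x x' assume "a \<in> Hom R t r" "x \<in> carrier (G S r)" "x' \<in> carrier (G S r)" "q S r x = q S r x'"
    then show "q S t (\<rho> S a x) = q S t (\<rho> S a x')" using eq[OF S Hom_Obj(2)[of a t r]] by metis
  qed (use sm[OF S] in auto)
  then obtain M where M': "\<And>S. finite S \<Longrightarrow> ?P S (M S)" by (rule choice1E) (assumption, rule that)
  have MO: "M S \<in> Obj Md" if "finite S" for S using M' that by blast
  have fibM: "el (M S) r = q S r ` carrier (G S r)" and q_hom: "q S r \<in> hom (G S r) (fib (M S) r)"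
    if "finite S" "r \<in> Obj R" for S r using M'[OF that(1)] that(2) by simp_all
  have actM: "act (M S) a (q S r x) = q S t (\<rho> S a x)" if "finite S" "a \<in> Hom R t r" "x \<in> carrier (G S r)" for S t r a x
    using M'[OF that(1)] that(2,3) by simp
  define d where "d S r = inv_into (carrier (G S r)) (q S r)" for S r
  have d: "d S r (q S r x) = x" if "finite S" "r \<in> Obj R" "x \<in> carrier (G S r)" for S r x
    using that inj by (simp add: d_def)
  define h where "h \<phi> = mk_arr (M (Src \<phi>)) (M (Trg \<phi>)) (\<lambda>r u. q (Trg \<phi>) r (fi \<phi> r (d (Src \<phi>) r u)))" for \<phi>
  have h: "h \<phi> \<in> Hom Md (M S) (M X)" and h_eq: "r \<in> Obj R \<Longrightarrow> x \<in> carrier (G S r) \<Longrightarrow> app (h \<phi>) r (q S r x) = q X r (fi \<phi> r x)"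
    if \<phi>: "\<phi> \<in> Hom FI S X" for \<phi> S X r x
  proof -
    have st: "Src \<phi> = S" "Trg \<phi> = X" "finite S" "finite X" using \<phi> by (auto simp: Hom_FI)
    show "h \<phi> \<in> Hom Md (M S) (M X)"
      unfolding h_def st(1,2)
    proof (intro mk_arr_Hom MO st homI)
      fix r u assume r: "r \<in> Obj R" and "u \<in> el (M S) r"
      then obtain x where x: "x \<in> carrier (G S r)" "u = q S r x" using fibM[OF st(3) r] by blast
      then show "q X r (fi \<phi> r (d S r u)) \<in> el (M X) r"
        using fibM[OF st(4) r] d[OF st(3) r] hom_in_carrier[OF fi[OF \<phi> r]] by simp
      fix v assume "v \<in> el (M S) r"
      then obtain y where y: "y \<in> carrier (G S r)" "v = q S r y" using fibM[OF st(3) r] by blast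
      have xy: "x \<otimes>\<^bsub>G S r\<^esub> y \<in> carrier (G S r)" using comm_group_closed(2)[OF rep.comm_group[OF rep[OF st(3)] r] x(1) y(1)] .
      have "u \<cdot>[(M S),r] v = q S r (x \<otimes>\<^bsub>G S r\<^esub> y)" using hom_mult[OF q_hom[OF st(3) r] x(1) y(1)] x y by simp
      then show "q X r (fi \<phi> r (d S r (u \<cdot>[(M S),r] v))) = q X r (fi \<phi> r (d S r u)) \<cdot>[(M X),r] q X r (fi \<phi> r (d S r v))"
        using d[OF st(3) r xy] d[OF st(3) r x(1)] d[OF st(3) r y(1)] x(2) y(2) hom_mult[OF fi[OF \<phi> r] x(1) y(1)]
          hom_mult[OF q_hom[OF st(4) r] hom_in_carrier[OF fi[OF \<phi> r] x(1)] hom_in_carrier[OF fi[OF \<phi> r] y(1)]] by simp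
    next
      fix t r a u assume a: "a \<in> Hom R t r" and "u \<in> el (M S) r"
      note tr = Hom_Obj[OF a]
      obtain x where x: "x \<in> carrier (G S r)" "u = q S r x" using \<open>u \<in> _\<close> fibM[OF st(3) tr(2)] by blast
      have "\<rho> S a x \<in> carrier (G S t)" using rep.closed[OF rep[OF st(3)] a x(1)] .
      then show "q X t (fi \<phi> t (d S t (act (M S) a u))) = act (M X) a (q X r (fi \<phi> r (d S r u)))"
        using d[OF st(3) tr(1)] d[OF st(3) tr(2) x(1)] actM[OF st(3) a x(1)] fi_act[OF \<phi> a x(1)]
          actM[OF st(4) a hom_in_carrier[OF fi[OF \<phi> tr(2)] x(1)]] x(2) by simp
    qed
    assume "r \<in> Obj R" "x \<in> carrier (G S r)"
    then show "app (h \<phi>) r (q S r x) = q X r (fi \<phi> r x)" using d[OF st(3)] fibM[OF st(3)] by (simp add: h_def st)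
  qed
  have "mk_functor FI M h \<in> Obj FM"
  proof (rule mk_functor_FIMod[OF MO h])
    show "app (h (Ident FI S)) r u = u" if S: "finite S" and r: "r \<in> Obj R" and u: "u \<in> el (M S) r" for S r u
      using u h_eq[OF FI.Ident_Hom r] S fi_id[OF S r] fibM[OF S r] by auto
    show "app (h (Comp FI \<psi> \<phi>)) r u = app (h \<psi>) r (app (h \<phi>) r u)"
      if \<phi>: "\<phi> \<in> Hom FI S X" and \<psi>: "\<psi> \<in> Hom FI X Y" and r: "r \<in> Obj R" and u: "u \<in> el (M S) r" for S X Y \<phi> \<psi> r u
      using u h_eq[OF \<phi> r] h_eq[OF \<psi> r hom_in_carrier[OF fi[OF \<phi> r]]] h_eq[OF FI.Comp_Hom[OF \<phi> \<psi>] r] fi_comp[OF \<phi> \<psi> r]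
        fibM[OF Hom_FI_finite(1)[OF \<phi>] r] by auto
  qed
  then show ?thesis
    using fibM q_hom actM h_eq Hom_FI_finite by (intro bexI[of _ "mk_functor FI M h"]) auto
qed

end

section \<open>The stages T^k S^k W and the families of their elements\<close>

locale shift_tower = shift_adjunction small R T \<eta> \<epsilon>
  for small :: "'u set \<Rightarrow> bool" and R :: "('r, 'm) preadditive" and T \<eta> \<epsilon> +
  fixes W :: "('r, 'm, 'u) FImod_obj"
  assumes W: "W \<in> Obj FM"
begin

declare counit.simps [simp del]

text \<open>The stages of the colimit for a fixed \<open>W\<close>, which later becomes the torsion
  envelope of an FI-module.\<close>

definition Z :: "nat \<Rightarrow> ('r, 'm, 'u) FImod_obj" where "Z k = FObj (Tp k) (FObj (Sh k) W)"
definition trans :: "nat \<Rightarrow> ('r, 'm, 'u) FImod_arr" where "trans k = FArr (Tp k) (Map \<eta> (FObj (Sh k) W))"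
text \<open>The member at \<theta> of the natural family of \<open>x\<close>: push \<open>x\<close>
  forward along \<theta> into the value of the stage at X + [k], then apply the counit
  there.\<close>

definition val :: "nat \<Rightarrow> nat set \<Rightarrow> FI_arr \<Rightarrow> 'r \<Rightarrow> 'u \<Rightarrow> 'u" where
  "val k X \<theta> r x = comp_at (counit k (FObj (Sh k) W)) X r (push (Z k) \<theta> r x)"

lemma Z_Obj: "Z k \<in> Obj FM"
  unfolding Z_def using Tp_Obj[OF shift_Obj[OF W]] .

lemma trans_Hom: "trans k \<in> Hom FM (Z k) (Z (Suc k))"
  unfolding trans_def Z_def shift_Suc[OF W] Tp_Suc[OF shift_Obj[OF shift_Obj[OF W]]]
  using Tp_Hom[OF \<eta>_Hom[OF shift_Obj[OF W]]] .

lemma e_Hom: "counit k (FObj (Sh k) W) \<in> Hom FM (FObj (Sh k) (Z k)) (FObj (Sh k) W)"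
  unfolding Z_def using counit_Hom[OF shift_Obj[OF W]] .

lemma finite_disj_add: "\<theta> \<in> Hom FI S (disj_add k X) \<Longrightarrow> finite X"
  by (simp add: Hom_FI disj_add_simps)

lemma ZS: "finite X \<Longrightarrow> FObj (FObj (Sh k) (Z k)) X = FObj (Z k) (disj_add k X)"
  and WS: "finite X \<Longrightarrow> FObj (FObj (Sh k) W) X = FObj W (disj_add k X)"
  by (simp_all add: shift_at Z_Obj W)

lemma e_at: "finite X \<Longrightarrow> Map (counit k (FObj (Sh k) W)) X \<in> Hom Md (FObj (Z k) (disj_add k X)) (FObj W (disj_add k X))"
  using component_Mod[OF e_Hom, of X k] by (simp add: ZS WS)

context
  fixes \<theta> S k X
  assumes \<theta>: "\<theta> \<in> Hom FI S (disj_add k X)"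
begin

lemma val_arr: "Comp Md (Map (counit k (FObj (Sh k) W)) X) (FArr (Z k) \<theta>) \<in> Hom Md (FObj (Z k) S) (FObj W (disj_add k X))"
  using Md.Comp_Hom[OF FArr_Mod[OF Z_Obj \<theta>] e_at[OF finite_disj_add[OF \<theta>]]] .

lemma val_eq: "r \<in> Obj R \<Longrightarrow> x \<in> el (FObj (Z k) S) r \<Longrightarrow>
    val k X \<theta> r x = app (Comp Md (Map (counit k (FObj (Sh k) W)) X) (FArr (Z k) \<theta>)) r x"
  by (simp add: val_def app_Comp[OF FArr_Mod[OF Z_Obj \<theta>]])

lemma val_closed: "r \<in> Obj R \<Longrightarrow> x \<in> el (FObj (Z k) S) r \<Longrightarrow> val k X \<theta> r x \<in> el (FObj W (disj_add k X)) r"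
  using app_closed[OF val_arr] by (simp add: val_eq)

lemma val_hom: "r \<in> Obj R \<Longrightarrow> val k X \<theta> r \<in> hom (fib (FObj (Z k) S) r) (fib (FObj W (disj_add k X)) r)"
  using app_mult[OF val_arr] fib_mult_closed[OF Hom_Mod_Obj(1)[OF val_arr]]
  by (auto simp: hom_def val_eq val_closed[unfolded val_eq] app_closed[OF val_arr])

lemma val_act: "a \<in> Hom R t r \<Longrightarrow> x \<in> el (FObj (Z k) S) r \<Longrightarrow>
    val k X \<theta> t (act (FObj (Z k) S) a x) = act (FObj W (disj_add k X)) a (val k X \<theta> r x)"
  using app_act[OF val_arr] act_closed[OF Hom_Mod_Obj(1)[OF val_arr]] by (simp add: val_eq Hom_Obj)

lemma val_push:
  assumes \<phi>: "\<phi> \<in> Hom FI S' S" and r: "r \<in> Obj R" and x: "x \<in> el (FObj (Z k) S') r"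
  shows "val k X \<theta> r (push (Z k) \<phi> r x) = val k X (Comp FI \<theta> \<phi>) r x"
  using push_Comp[OF Z_Obj \<phi> \<theta> r x] by (simp add: val_def)

lemma val_natural:
  assumes f: "f \<in> Hom FI X X'" and r: "r \<in> Obj R" and x: "x \<in> el (FObj (Z k) S) r"
  shows "push W (FArr (FI_add k) f) r (val k X \<theta> r x) = val k X' (Comp FI (FArr (FI_add k) f) \<theta>) r x"
proof -
  note fin = Hom_FI_finite[OF f]
  have p: "push (Z k) \<theta> r x \<in> el (FObj (FObj (Sh k) (Z k)) X) r"
    using push_closed[OF Z_Obj \<theta> r x] by (simp add: ZS[OF fin(1)])
  show ?thesis
    using component_push[OF e_Hom f r p] push_Comp[OF Z_Obj \<theta> FI_add_Hom[OF f] r x]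
    by (simp add: val_def FArr_shift_at[OF Z_Obj f] FArr_shift_at[OF W f])
qed

end

text \<open>The elements with trivial family form a subfunctor \<open>N\<close> of the stage. Its
  inclusion and the zero map have the same transpose, so they coincide by uniqueness in the
  universal property, and \<open>N\<close> vanishes. The difference of two elements with equal
  families lies in \<open>N\<close>.\<close>

lemma val_inject:
  assumes S: "finite S" and r: "r \<in> Obj R" and x: "x \<in> el (FObj (Z k) S) r" "y \<in> el (FObj (Z k) S) r"
    and eq: "\<And>X \<theta>. \<theta> \<in> Hom FI S (disj_add k X) \<Longrightarrow> val k X \<theta> r x = val k X \<theta> r y"
  shows "x = y"
proof -
  define K where "K S r = {x \<in> el (FObj (Z k) S) r. \<forall>X \<theta>. \<theta> \<in> Hom FI S (disj_add k X) \<longrightarrow>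
    val k X \<theta> r x = neut (FObj W (disj_add k X)) r}" for S r
  have gZ: "comm_group (fib (FObj (Z k) S) r)" if "finite S" "r \<in> Obj R" for S r using fib_comm_group[OF FObj_Mod[OF Z_Obj that(1)] that(2)] .
  have gW: "comm_group (fib (FObj W (disj_add k X)) r)" if "\<theta> \<in> Hom FI S (disj_add k X)" "r \<in> Obj R" for S X \<theta> r
    using fib_comm_group[OF FObj_Mod[OF W Hom_FI_finite(2)[OF that(1)]] that(2)] .
  have diff: "x \<cdot>[(FObj (Z k) S),r] inv\<^bsub>fib (FObj (Z k) S) r\<^esub> y \<in> K S r"
    if S: "finite S" and r: "r \<in> Obj R" and x: "x \<in> el (FObj (Z k) S) r" "y \<in> el (FObj (Z k) S) r"
      and eq: "\<And>X \<theta>. \<theta> \<in> Hom FI S (disj_add k X) \<Longrightarrow> val k X \<theta> r x = val k X \<theta> r y" for S r x y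
  proof -
    note iy = comm_group_closed(3)[OF gZ[OF S r] x(2)]
    have "val k X \<theta> r (x \<cdot>[(FObj (Z k) S),r] inv\<^bsub>fib (FObj (Z k) S) r\<^esub> y) = neut (FObj W (disj_add k X)) r"
      if \<theta>: "\<theta> \<in> Hom FI S (disj_add k X)" for X \<theta>
      using hom_mult[OF val_hom[OF \<theta> r] x(1) iy] hom_invI[OF val_hom[OF \<theta> r] gZ[OF S r] gW[OF \<theta> r] x(2)] eq[OF \<theta>]
        comm_group_eq_iff[OF gW[OF \<theta> r] val_closed[OF \<theta> r x(1)] val_closed[OF \<theta> r x(2)]] by simp
    then show ?thesis using comm_group_closed(2)[OF gZ[OF S r] x(1) iy] by (simp add: K_def)
  qed
  have "\<exists>N \<in> Obj FM. \<exists>i \<in> Hom FM N (Z k). \<forall>S. finite S \<longrightarrow>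
    (\<forall>r \<in> Obj R. el (FObj N S) r = K S r \<and> (\<forall>x \<in> K S r. comp_at i S r x = x))"
  proof (rule subfunctor[OF Z_Obj])
    fix S :: "nat set" assume S: "finite S"
    show "submodule (FObj (Z k) S) (K S)"
    proof (rule rep.subrepI[OF module_rep[OF FObj_Mod[OF Z_Obj S]]])
      show "neut (FObj (Z k) S) r \<in> K S r" if "r \<in> Obj R" for r
        using hom_oneI[OF val_hom gZ gW] that S comm_group_closed(1)[OF gZ[OF S that]] by (simp add: K_def)
      show "act (FObj (Z k) S) a x \<in> K S t" if a: "a \<in> Hom R t r" and "x \<in> K S r" for t r a x
        using that(2) val_act[OF _ a] act_closed[OF FObj_Mod[OF Z_Obj S] a] act_one[OF FObj_Mod[OF W Hom_FI_finite(2)] a] by (simp add: K_def)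
      show "x \<cdot>[(FObj (Z k) S),r] inv\<^bsub>fib (FObj (Z k) S) r\<^esub> y \<in> K S r" if "r \<in> Obj R" "x \<in> K S r" "y \<in> K S r" for r x y
        using that by (intro diff S) (auto simp: K_def)
    qed (simp add: K_def)
  next
    fix S S' \<phi> r x assume \<phi>: "\<phi> \<in> Hom FI S S'" and r: "r \<in> Obj R" and x: "x \<in> K S r"
    then show "push (Z k) \<phi> r x \<in> K S' r"
      using push_closed[OF Z_Obj \<phi> r] val_push[OF _ \<phi> r] FI.Comp_Hom[OF \<phi>] by (simp add: K_def)
  qed
  then obtain N i where i: "i \<in> Hom FM N (Z k)" and *: "\<forall>S. finite S \<longrightarrow>
    (\<forall>r \<in> Obj R. el (FObj N S) r = K S r \<and> (\<forall>x \<in> K S r. comp_at i S r x = x))"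
    by (elim bexE) (rule that)
  have N: "el (FObj N S) r = K S r" and i_eq: "x \<in> K S r \<Longrightarrow> comp_at i S r x = x" if "finite S" "r \<in> Obj R" for S r x
    using * that by blast+
  note NO = Hom_FIMod_Obj(1)[OF i]
  define z where "z = zero_nat N (Z k)"
  have z: "z \<in> Hom FM N (Z k)" unfolding z_def by (rule zero_nat_Hom[OF NO Z_Obj])
  have "Comp FM (counit k (FObj (Sh k) W)) (FArr (Sh k) i) = Comp FM (counit k (FObj (Sh k) W)) (FArr (Sh k) z)"
  proof (rule FI_module_arrow_eqI[OF FM.Comp_Hom[OF Sh_Hom[OF i] e_Hom] FM.Comp_Hom[OF Sh_Hom[OF z] e_Hom]])
    fix X r x assume X: "finite X" and r: "r \<in> Obj R" and x: "x \<in> el (FObj (FObj (Sh k) N) X) r"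
    have XX: "finite (disj_add k X)" using X by (simp add: disj_add_simps)
    have xN: "x \<in> el (FObj N (disj_add k X)) r" using x by (simp add: shift_at NO X)
    then have xK: "x \<in> K (disj_add k X) r" using N[OF XX r] by simp
    \<comment> \<open>The component of the counit at X is the member of the family at the identity
      of X + [k], so an element with trivial family is killed by it.\<close>
    have id: "Ident FI (disj_add k X) \<in> Hom FI (disj_add k X) (disj_add k X)" using FI.Ident_Hom XX by simp
    have "comp_at (counit k (FObj (Sh k) W)) X r x = neut (FObj W (disj_add k X)) r"
    proof -
      have "val k X (Ident FI (disj_add k X)) r x = neut (FObj W (disj_add k X)) r" using xK id unfolding K_def by blast
      moreover have "x \<in> el (FObj (Z k) (disj_add k X)) r" using xK by (simp add: K_def)
      ultimately show ?thesis using push_Ident[OF Z_Obj XX r, of x] by (simp add: val_def)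
    qed
    moreover have "comp_at z (disj_add k X) r x = neut (FObj (Z k) (disj_add k X)) r"
      using xN r XX by (simp add: z_def)
    ultimately show "comp_at (Comp FM (counit k (FObj (Sh k) W)) (FArr (Sh k) i)) X r x =
        comp_at (Comp FM (counit k (FObj (Sh k) W)) (FArr (Sh k) z)) X r x"
      using component_Comp[OF Sh_Hom[OF i] X r x] component_Comp[OF Sh_Hom[OF z] X r x] i_eq[OF XX r xK] app_one[OF e_at[OF X] r]
      by (simp add: Map_shift[OF i X] Map_shift[OF z X])
  qed
  moreover have "Comp FM (counit k (FObj (Sh k) W)) (FArr (Sh k) i) \<in> Hom FM (FObj (Sh k) N) (FObj (Sh k) W)"
    using FM.Comp_Hom[OF Sh_Hom[OF i] e_Hom] .
  ultimately have "i = z"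
    using counit_universal[OF NO shift_Obj[OF W], of _ k] i z unfolding Z_def by (metis (no_types, lifting))
  have "x \<cdot>[(FObj (Z k) S),r] inv\<^bsub>fib (FObj (Z k) S) r\<^esub> y \<in> K S r" using diff[OF S r x eq] .
  then have "x \<cdot>[(FObj (Z k) S),r] inv\<^bsub>fib (FObj (Z k) S) r\<^esub> y = neut (FObj (Z k) S) r"
    using i_eq[OF S r, of "x \<cdot>[(FObj (Z k) S),r] inv\<^bsub>fib (FObj (Z k) S) r\<^esub> y"] \<open>i = z\<close> N[OF S r] S r by (simp add: z_def)
  then show "x = y" using comm_group_eq_iff[OF gZ[OF S r] x] by simp
qed

end

text \<open>The index type is arbitrary, so the sets are adjoined one by one; each step is a
  countable union taking two values.\<close>

lemma (in universe) small_UN_finite: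
  assumes "finite I" "\<And>i. i \<in> I \<Longrightarrow> small (F i)"
  shows "small (\<Union>i\<in>I. F i)"
  using assms
proof (induction rule: finite_induct)
  case (insert i I)
  have "small (\<Union>n :: nat. if n = 0 then F i else (\<Union>i\<in>I. F i))" using insert by (intro small_UN_nat) auto
  moreover have "(\<Union>n :: nat. if n = 0 then F i else (\<Union>i\<in>I. F i)) = (\<Union>i\<in>insert i I. F i)"
    by (auto split: if_splits)
  ultimately show ?case by simp
qed (simp add: small_finite)

text \<open>Leave the points that \<theta> sends into [k] as they are, and let every other point of
  S stand for itself in Y. The map \<theta>' does this, and f restores the original images. Since Y
  is a subset of S, only finitely many \<theta>' occur for given S and k, while X was
  arbitrary.\<close>

lemma FI_decomposition:
  assumes \<theta>: "\<theta> \<in> Hom FI S (disj_add k X)"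
  shows "\<exists>Y \<theta>' f. Y \<subseteq> S \<and> \<theta>' \<in> Hom FI S (disj_add k Y) \<and> f \<in> Hom FI Y X \<and> \<theta> = Comp FI (FArr (FI_add k) f) \<theta>'"
proof -
  define Y where "Y = {x \<in> S. k \<le> Map \<theta> x}"
  define \<theta>' where "\<theta>' = mk_inj S (disj_add k Y) (\<lambda>x. if Map \<theta> x < k then Map \<theta> x else x + k)"
  define f where "f = mk_inj Y X (\<lambda>x. Map \<theta> x - k)"
  note inj = Map_FI_inj[OF \<theta>] note img = Map_FI_in[OF \<theta>]
  have fin: "finite S" "finite X" "finite Y" using \<theta> by (auto simp: Hom_FI disj_add_simps(3) Y_def)
  have \<theta>': "\<theta>' \<in> Hom FI S (disj_add k Y)"
    unfolding \<theta>'_def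
  proof (rule mk_inj_Hom)
    show "(\<lambda>x. if Map \<theta> x < k then Map \<theta> x else x + k) ` S \<subseteq> disj_add k Y"
      by (auto simp: in_disj_add Y_def)
    show "inj_on (\<lambda>x. if Map \<theta> x < k then Map \<theta> x else x + k) S"
      using inj by (auto simp: inj_on_def split: if_splits)
  qed (use fin in \<open>auto simp: disj_add_simps(3)\<close>)
  have f: "f \<in> Hom FI Y X"
    unfolding f_def
  proof (rule mk_inj_Hom)
    show "(\<lambda>x. Map \<theta> x - k) ` Y \<subseteq> X" using img by (force simp: Y_def in_disj_add)
    show "inj_on (\<lambda>x. Map \<theta> x - k) Y"
    proof (rule inj_onI)
      fix x y assume xy: "x \<in> Y" "y \<in> Y" "Map \<theta> x - k = Map \<theta> y - k"
      then have "Map \<theta> x = Map \<theta> y" by (auto simp: Y_def)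
      then show "x = y" using inj_onD[OF inj] xy by (auto simp: Y_def)
    qed
  qed (use fin in auto)
  have "Map \<theta> x = Map (Comp FI (FArr (FI_add k) f) \<theta>') x" if x: "x \<in> S" for x
  proof -
    have "Map (Comp FI (FArr (FI_add k) f) \<theta>') x = Map (FArr (FI_add k) f) (Map \<theta>' x)" using Map_Comp_FI[OF \<theta>' x] .
    also have "\<dots> = (if Map \<theta>' x < k then Map \<theta>' x else Map f (Map \<theta>' x - k) + k)"
      using Map_FI_add[OF f Map_FI_in[OF \<theta>' x]] .
    also have "\<dots> = Map \<theta> x" using x by (simp add: \<theta>'_def f_def Y_def)
    finally show ?thesis by simp
  qed
  then have "\<theta> = Comp FI (FArr (FI_add k) f) \<theta>'"
    by (rule FI_arrow_eqI[OF \<theta> FI.Comp_Hom[OF \<theta>' FI_add_Hom[OF f]]])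
  moreover have "Y \<subseteq> S" by (auto simp: Y_def)
  ultimately show ?thesis using \<theta>' f by blast
qed

section \<open>Natural families as an FI-module\<close>

context shift_tower begin

definition idx :: "nat \<Rightarrow> nat set \<Rightarrow> (nat set \<times> FI_arr) set" where
  "idx k S = {(X, \<theta>). \<theta> \<in> Hom FI S (disj_add k X)}"

abbreviation WX :: "nat \<Rightarrow> nat set \<times> FI_arr \<Rightarrow> ('r, 'm, 'u) module_obj" where
  "WX k i \<equiv> FObj W (disj_add k (fst i))"

abbreviation fprod :: "nat \<Rightarrow> nat set \<Rightarrow> 'r \<Rightarrow> (nat set \<times> FI_arr \<Rightarrow> 'u) monoid" where
  "fprod k S \<equiv> \<lambda>r. product_group (idx k S) (\<lambda>i. fib (WX k i) r)"

abbreviation fact :: "nat \<Rightarrow> nat set \<Rightarrow> 'm \<Rightarrow> (nat set \<times> FI_arr \<Rightarrow> 'u) \<Rightarrow> nat set \<times> FI_arr \<Rightarrow> 'u" where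
  "fact k S \<equiv> \<lambda>a v. \<lambda>i \<in> idx k S. act (WX k i) a (v i)"

definition families :: "nat \<Rightarrow> nat set \<Rightarrow> 'r \<Rightarrow> (nat set \<times> FI_arr \<Rightarrow> 'u) set" where
  "families k S r = {v \<in> carrier (fprod k S r). \<forall>X X' f \<theta>. \<theta> \<in> Hom FI S (disj_add k X) \<and> f \<in> Hom FI X X' \<longrightarrow>
    push W (FArr (FI_add k) f) r (v (X, \<theta>)) = v (X', Comp FI (FArr (FI_add k) f) \<theta>)}"

lemma idx_Obj: "i \<in> idx k S \<Longrightarrow> WX k i \<in> Obj Md"
  using FObj_Mod[OF W Hom_FI_finite(2)] by (auto simp: idx_def)

lemma idx_Comp: "\<theta> \<in> Hom FI S (disj_add k X) \<Longrightarrow> f \<in> Hom FI X X' \<Longrightarrow> (X', Comp FI (FArr (FI_add k) f) \<theta>) \<in> idx k S"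
  using FI.Comp_Hom[OF _ FI_add_Hom] by (auto simp: idx_def)

lemma idx_group: "i \<in> idx k S \<Longrightarrow> r \<in> Obj R \<Longrightarrow> comm_group (fib (WX k i) r)"
  using fib_comm_group[OF idx_Obj] .

lemma fprod_rep: "rep R (fprod k S) (fact k S)"
proof (rule rep.intro)
  show "comm_group (fprod k S r)" if r: "r \<in> Obj R" for r
  proof (rule group.group_comm_groupI)
    show "Group.group (fprod k S r)"
      using idx_group[OF _ r] by (intro product_group) (auto simp: comm_group.axioms)
    show "x \<otimes>\<^bsub>fprod k S r\<^esub> y = y \<otimes>\<^bsub>fprod k S r\<^esub> x" if "x \<in> carrier (fprod k S r)" "y \<in> carrier (fprod k S r)" for x y
    proof -
      have "x i \<cdot>[(WX k i),r] y i = y i \<cdot>[(WX k i),r] x i" if i: "i \<in> idx k S" for i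
        using comm_monoid.m_comm[OF comm_group.axioms(1)[OF idx_group[OF i r]]] \<open>x \<in> _\<close> \<open>y \<in> _\<close> i by (simp add: PiE_iff)
      then show ?thesis unfolding mult_product_group by (rule restrict_ext)
    qed
  qed
  show "fact k S a \<in> hom (fprod k S r) (fprod k S t)" if a: "a \<in> Hom R t r" for a t r
  proof (rule homI)
    show "fact k S a x \<in> carrier (fprod k S t)" if "x \<in> carrier (fprod k S r)" for x
      using that act_closed[OF idx_Obj a] by (auto simp: PiE_iff)
    show "fact k S a (x \<otimes>\<^bsub>fprod k S r\<^esub> y) = fact k S a x \<otimes>\<^bsub>fprod k S t\<^esub> fact k S a y"
      if "x \<in> carrier (fprod k S r)" "y \<in> carrier (fprod k S r)" for x y
    proof (rule extensionalityI[of _ "idx k S"])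
      fix i assume i: "i \<in> idx k S"
      then show "fact k S a (x \<otimes>\<^bsub>fprod k S r\<^esub> y) i = (fact k S a x \<otimes>\<^bsub>fprod k S t\<^esub> fact k S a y) i"
        using act_mult[OF idx_Obj[OF i] a, of "x i" "y i"] that by (simp add: PiE_iff)
    qed simp_all
  qed
  show "fact k S (Ident R r) x = x" if "r \<in> Obj R" "x \<in> carrier (fprod k S r)" for r x
    using that act_Ident[OF idx_Obj that(1)] by (auto simp: PiE_iff fun_eq_iff extensional_def)
  show "fact k S (Comp R a b) x = fact k S b (fact k S a x)"
    if "a \<in> Hom R t r" "b \<in> Hom R s t" "x \<in> carrier (fprod k S r)" for a b t r s x
    using that(3) act_Comp[OF idx_Obj that(1,2)] by (auto simp: PiE_iff fun_eq_iff)
  show "fact k S (Add R a a') x = fact k S a x \<otimes>\<^bsub>fprod k S t\<^esub> fact k S a' x"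
    if "a \<in> Hom R t r" "a' \<in> Hom R t r" "x \<in> carrier (fprod k S r)" for a a' t r x
    using that(3) act_Add[OF idx_Obj that(1,2)] by (auto simp: PiE_iff fun_eq_iff)
qed

lemma familiesD:
  assumes "v \<in> families k S r"
  shows "i \<in> idx k S \<Longrightarrow> v i \<in> el (WX k i) r"
    and "\<theta> \<in> Hom FI S (disj_add k X) \<Longrightarrow> f \<in> Hom FI X X' \<Longrightarrow>
      push W (FArr (FI_add k) f) r (v (X, \<theta>)) = v (X', Comp FI (FArr (FI_add k) f) \<theta>)"
    and "v \<in> extensional (idx k S)"
  using assms by (auto simp: families_def PiE_iff)

lemma families_subrep: "subrep R (fprod k S) (fact k S) (families k S)"
proof (rule subrep_of_mult[OF fprod_rep])
  show "x \<in> carrier (fprod k S r)" if "x \<in> families k S r" for r x using that by (simp add: families_def)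
  fix r assume r: "r \<in> Obj R"
  have inW: "(X, \<theta>) \<in> idx k S" if "\<theta> \<in> Hom FI S (disj_add k X)" for X \<theta> using that by (simp add: idx_def)
  note pA = FArr_Mod[OF W FI_add_Hom]
  show "\<one>\<^bsub>fprod k S r\<^esub> \<in> families k S r"
    using comm_group_closed(1)[OF idx_group[OF _ r]] app_one[OF pA r] by (auto simp: families_def inW idx_Comp)
  fix x y assume x: "x \<in> families k S r" and y: "y \<in> families k S r"
  show "x \<otimes>\<^bsub>fprod k S r\<^esub> y \<in> families k S r"
    unfolding families_def
  proof (intro CollectI conjI allI impI; (elim conjE)?)
    show "x \<otimes>\<^bsub>fprod k S r\<^esub> y \<in> carrier (fprod k S r)"
      using familiesD(1)[OF x] familiesD(1)[OF y] comm_group_closed[OF idx_group[OF _ r]] by auto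
    fix X X' f \<theta> assume \<theta>: "\<theta> \<in> Hom FI S (disj_add k X)" and f: "f \<in> Hom FI X X'"
    note i = inW[OF \<theta>] and i' = idx_Comp[OF \<theta> f]
    have xi: "x (X, \<theta>) \<in> el (FObj W (disj_add k X)) r" "y (X, \<theta>) \<in> el (FObj W (disj_add k X)) r"
      using familiesD(1)[OF x i] familiesD(1)[OF y i] by simp_all
    show "push W (FArr (FI_add k) f) r ((x \<otimes>\<^bsub>fprod k S r\<^esub> y) (X, \<theta>)) =
        (x \<otimes>\<^bsub>fprod k S r\<^esub> y) (X', Comp FI (FArr (FI_add k) f) \<theta>)"
      using i i' app_mult[OF pA[OF f] r xi] familiesD(2)[OF x \<theta> f] familiesD(2)[OF y \<theta> f] by simp
  qed
next
  fix t r a x assume a: "a \<in> Hom R t r" and x: "x \<in> families k S r"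
  show "fact k S a x \<in> families k S t"
    unfolding families_def
  proof (intro CollectI conjI allI impI; (elim conjE)?)
    show "fact k S a x \<in> carrier (fprod k S t)" using familiesD(1)[OF x] act_closed[OF idx_Obj a] by auto
    fix X X' f \<theta> assume \<theta>: "\<theta> \<in> Hom FI S (disj_add k X)" and f: "f \<in> Hom FI X X'"
    have i: "(X, \<theta>) \<in> idx k S" using \<theta> by (simp add: idx_def)
    have "x (X, \<theta>) \<in> el (FObj W (disj_add k X)) r" using familiesD(1)[OF x i] by simp
    from app_act[OF FArr_Mod[OF W FI_add_Hom[OF f]] a this]
    show "push W (FArr (FI_add k) f) t (fact k S a x (X, \<theta>)) = fact k S a x (X', Comp FI (FArr (FI_add k) f) \<theta>)"
      using i idx_Comp[OF \<theta> f] familiesD(2)[OF x \<theta> f] by simp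
  qed
qed

text \<open>The natural families themselves form an FI-module \<open>V\<close>, on which
  \<open>FI\<close> acts by precomposition. Taking the member at the identity of X + [k] defines a
  morphism from S^k V to S^k W; its transpose from \<open>V\<close> to the stage sends the code of a
  family to an element having that family.\<close>

lemma val_surject:
  assumes S: "finite S" and r: "r \<in> Obj R"
    and v_in: "\<And>X \<theta>. \<theta> \<in> Hom FI S (disj_add k X) \<Longrightarrow> v X \<theta> \<in> el (FObj W (disj_add k X)) r"
    and v_nat: "\<And>X X' f \<theta>. \<theta> \<in> Hom FI S (disj_add k X) \<Longrightarrow> f \<in> Hom FI X X' \<Longrightarrow>
      push W (FArr (FI_add k) f) r (v X \<theta>) = v X' (Comp FI (FArr (FI_add k) f) \<theta>)"
  shows "\<exists>x \<in> el (FObj (Z k) S) r. \<forall>X \<theta>. \<theta> \<in> Hom FI S (disj_add k X) \<longrightarrow> val k X \<theta> r x = v X \<theta>"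
proof -
  define G where "G S r = (fprod k S r)\<lparr>carrier := families k S r\<rparr>" for S r
  have Grep: "rep R (G S) (fact k S)" for S
    unfolding G_def using rep_subrep[OF fprod_rep preadditive_category_axioms families_subrep] .
  \<comment> \<open>By \<open>FI_decomposition\<close> the members indexed by subsets of
    \<open>S\<close> determine a family, and these indices are finite in number. Restriction to
    \<open>J S\<close> is thus faithful and leaves something that can be coded in
    \<open>'u\<close>.\<close>
  define J where "J S = {i \<in> idx k S. fst i \<subseteq> S}" for S
  have J: "finite (J S)" if "finite S" for S
  proof (rule finite_subset)
    show "J S \<subseteq> (SIGMA X : Pow S. Hom FI S (disj_add k X))" by (auto simp: J_def idx_def)
    show "finite (SIGMA X : Pow S. Hom FI S (disj_add k X))" using that finite_Hom_FI by auto
  qed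
  have det: "u = u'" if u: "u \<in> families k S r" "u' \<in> families k S r" and eq: "restrict u (J S) = restrict u' (J S)" for S r u u'
  proof (rule extensionalityI[OF familiesD(3)[OF u(1)] familiesD(3)[OF u(2)]])
    fix i assume i: "i \<in> idx k S"
    obtain X \<theta> where X: "i = (X, \<theta>)" "\<theta> \<in> Hom FI S (disj_add k X)" using i by (auto simp: idx_def)
    obtain Y \<theta>' f where Y: "Y \<subseteq> S" "\<theta>' \<in> Hom FI S (disj_add k Y)" "f \<in> Hom FI Y X" "\<theta> = Comp FI (FArr (FI_add k) f) \<theta>'"
      using FI_decomposition[OF X(2)] by blast
    have "(Y, \<theta>') \<in> J S" using Y by (simp add: J_def idx_def)
    then have "u (Y, \<theta>') = u' (Y, \<theta>')" using fun_cong[OF eq, of "(Y, \<theta>')"] by simp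
    then show "u i = u' i" using familiesD(2)[OF u(1) Y(2,3)] familiesD(2)[OF u(2) Y(2,3)] X Y(4) by simp
  qed
  define A where "A S r = (\<Union>i \<in> J S. el (WX k i) r)" for S r
  have A: "small (A S r)" if "finite S" "r \<in> Obj R" for S r
    unfolding A_def using J[OF that(1)] fib_small[OF idx_Obj that(2)] by (intro small_UN_finite) (auto simp: J_def)
  define code where "code S r = (SOME \<kappa> :: (nat set \<times> FI_arr \<Rightarrow> 'u) \<Rightarrow> 'u. inj_on \<kappa> (J S \<rightarrow>\<^sub>E A S r) \<and> small (\<kappa> ` (J S \<rightarrow>\<^sub>E A S r)))" for S r
  have code: "inj_on (code S r) (J S \<rightarrow>\<^sub>E A S r) \<and> small (code S r ` (J S \<rightarrow>\<^sub>E A S r))" if "finite S" "r \<in> Obj R" for S r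
    unfolding code_def by (rule someI_ex[OF finite_function_code[OF J[OF that(1)] A[OF that]]])
  define q where "q S r u = code S r (restrict u (J S))" for S r u
  have rJ: "restrict u (J S) \<in> J S \<rightarrow>\<^sub>E A S r" if "u \<in> families k S r" for u S r
    using familiesD(1)[OF that] by (auto simp: A_def J_def)
  define fi where "fi \<phi> (r :: 'r) u = (\<lambda>i \<in> idx k (Trg \<phi>). u (fst i, Comp FI (snd i) \<phi>))" for \<phi> r and u :: "nat set \<times> FI_arr \<Rightarrow> 'u"
  have fi_at: "fi \<phi> r u (X, \<theta>) = u (X, Comp FI \<theta> \<phi>)" if "\<phi> \<in> Hom FI S S'" "\<theta> \<in> Hom FI S' (disj_add k X)" for \<phi> r u S S' X \<theta>
    using that by (auto simp: fi_def idx_def Hom_FI)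
  have idxC: "(X, Comp FI \<theta> \<phi>) \<in> idx k S" if "\<phi> \<in> Hom FI S S'" "(X, \<theta>) \<in> idx k S'" for \<phi> S S' X \<theta>
    using that FI.Comp_Hom[OF that(1)] by (simp add: idx_def)
  have fi_fam: "fi \<phi> r u \<in> families k S' r" if \<phi>: "\<phi> \<in> Hom FI S S'" and u: "u \<in> families k S r" for \<phi> S S' r u
    unfolding families_def
  proof (intro CollectI conjI allI impI; (elim conjE)?)
    have T: "Trg \<phi> = S'" using \<phi> by (simp add: Hom_FI)
    have "u (X, Comp FI \<theta> \<phi>) \<in> el (FObj W (disj_add k X)) r" if "(X, \<theta>) \<in> idx k S'" for X \<theta>
      using familiesD(1)[OF u idxC[OF \<phi> that]] by simp
    then show "fi \<phi> r u \<in> carrier (fprod k S' r)" by (auto simp: fi_def T)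
    fix X X' f \<theta> assume \<theta>: "\<theta> \<in> Hom FI S' (disj_add k X)" and f: "f \<in> Hom FI X X'"
    show "push W (FArr (FI_add k) f) r (fi \<phi> r u (X, \<theta>)) = fi \<phi> r u (X', Comp FI (FArr (FI_add k) f) \<theta>)"
      using fi_at[OF \<phi> \<theta>] fi_at[OF \<phi> FI.Comp_Hom[OF \<theta> FI_add_Hom[OF f]]] familiesD(2)[OF u FI.Comp_Hom[OF \<phi> \<theta>] f]
        FI.Comp_assoc[OF \<phi> \<theta> FI_add_Hom[OF f]] by simp
  qed
  have "\<exists>V \<in> Obj FM.
    (\<forall>S r. finite S \<and> r \<in> Obj R \<longrightarrow> el (FObj V S) r = q S r ` carrier (G S r) \<and> q S r \<in> hom (G S r) (fib (FObj V S) r)) \<and>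
    (\<forall>S t r a x. finite S \<and> a \<in> Hom R t r \<and> x \<in> carrier (G S r) \<longrightarrow> act (FObj V S) a (q S r x) = q S t (fact k S a x)) \<and>
    (\<forall>S X \<phi> r x. \<phi> \<in> Hom FI S X \<and> r \<in> Obj R \<and> x \<in> carrier (G S r) \<longrightarrow> push V \<phi> r (q S r x) = q X r (fi \<phi> r x))"
    (is "\<exists>V \<in> _. ?P V")
  proof (rule fi_module_of_rep)
    show "rep R (G S) (fact k S)" for S using Grep .
    show "inj_on (q S r) (carrier (G S r))" if "finite S" "r \<in> Obj R" for S r
    proof (rule inj_onI)
      fix u u' assume u: "u \<in> carrier (G S r)" "u' \<in> carrier (G S r)" and eq: "q S r u = q S r u'"
      then have uf: "u \<in> families k S r" "u' \<in> families k S r" by (simp_all add: G_def)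
      then show "u = u'" using det[OF uf] inj_onD[OF conjunct1[OF code[OF that]] _ rJ[OF uf(1)] rJ[OF uf(2)]] eq by (simp add: q_def)
    qed
    show "small (q S r ` carrier (G S r))" if "finite S" "r \<in> Obj R" for S r
      by (rule small_subset[OF conjunct2[OF code[OF that]]]) (use rJ in \<open>auto simp: q_def G_def\<close>)
    fix S S' \<phi> r assume \<phi>: "\<phi> \<in> Hom FI S S'" and r: "r \<in> Obj R"
    have T: "Trg \<phi> = S'" using \<phi> by (simp add: Hom_FI)
    show "fi \<phi> r \<in> hom (G S r) (G S' r)"
    proof (rule homI)
      show "fi \<phi> r u \<in> carrier (G S' r)" if "u \<in> carrier (G S r)" for u using fi_fam[OF \<phi>] that by (simp add: G_def)
      show "fi \<phi> r (u \<otimes>\<^bsub>G S r\<^esub> u') = fi \<phi> r u \<otimes>\<^bsub>G S' r\<^esub> fi \<phi> r u'" for u u'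
        using idxC[OF \<phi>] by (auto simp: G_def fi_def T fun_eq_iff)
    qed
    fix x assume x: "x \<in> carrier (G S r)"
    fix S'' \<psi> assume \<psi>: "\<psi> \<in> Hom FI S' S''"
    have T2: "Trg \<psi> = S''" "Trg (Comp FI \<psi> \<phi>) = S''" using \<psi> FI.Comp_Hom[OF \<phi> \<psi>] by (auto simp: Hom_FI)
    show "fi (Comp FI \<psi> \<phi>) r x = fi \<psi> r (fi \<phi> r x)"
    proof (rule extensionalityI[of _ "idx k S''"])
      fix i assume i: "i \<in> idx k S''"
      obtain X \<theta> where X: "i = (X, \<theta>)" "\<theta> \<in> Hom FI S'' (disj_add k X)" using i by (auto simp: idx_def)
      show "fi (Comp FI \<psi> \<phi>) r x i = fi \<psi> r (fi \<phi> r x) i"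
        using fi_at[OF FI.Comp_Hom[OF \<phi> \<psi>] X(2)] fi_at[OF \<psi> X(2)] fi_at[OF \<phi> FI.Comp_Hom[OF \<psi> X(2)]] FI.Comp_assoc[OF \<phi> \<psi> X(2)] X(1) by simp
    qed (auto simp: fi_def T2)
  next
    fix S S' \<phi> t r a x assume \<phi>: "\<phi> \<in> Hom FI S S'" and a: "a \<in> Hom R t r" and x: "x \<in> carrier (G S r)"
    have T: "Trg \<phi> = S'" using \<phi> by (simp add: Hom_FI)
    show "fi \<phi> t (fact k S a x) = fact k S' a (fi \<phi> r x)"
      using idxC[OF \<phi>] by (auto simp: fi_def T fun_eq_iff)
  next
    fix S r x assume S: "finite S" and r: "r \<in> Obj R" and x: "x \<in> carrier (G S r)"
    have id: "Ident FI S \<in> Hom FI S S" using FI.Ident_Hom S by simp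
    have T: "Trg (Ident FI S) = S" by (simp add: Ident_FI)
    show "fi (Ident FI S) r x = x"
    proof (rule extensionalityI[of _ "idx k S"])
      show "x \<in> extensional (idx k S)" using x familiesD(3) by (simp add: G_def)
      fix i assume i: "i \<in> idx k S"
      obtain X \<theta> where X: "i = (X, \<theta>)" "\<theta> \<in> Hom FI S (disj_add k X)" using i by (auto simp: idx_def)
      show "fi (Ident FI S) r x i = x i" using fi_at[OF id X(2)] FI.Comp_Ident_right[OF X(2)] X(1) by simp
    qed (simp add: fi_def T)
  qed
  then obtain V where V: "V \<in> Obj FM" and *: "?P V"
    by (elim bexE) (rule that)
  note V1 = conjunct1[OF *, THEN spec, THEN spec, THEN mp, OF conjI]
  note V2 = conjunct1[OF conjunct2[OF *], THEN spec, THEN spec, THEN spec, THEN spec, THEN spec, THEN mp, OF conjI[OF _ conjI]]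
  note V3 = conjunct2[OF conjunct2[OF *], THEN spec, THEN spec, THEN spec, THEN spec, THEN spec, THEN mp, OF conjI[OF _ conjI]]
  have fibV: "el (FObj V S) r = q S r ` families k S r" if "finite S" "r \<in> Obj R" for S r
    using conjunct1[OF V1[OF that]] by (simp add: G_def)
  define dec where "dec S r = inv_into (families k S r) (q S r)" for S r
  have dec: "dec S r (q S r u) = u" if "finite S" "r \<in> Obj R" "u \<in> families k S r" for S r u
  proof -
    have "inj_on (q S r) (families k S r)"
    proof (rule inj_onI)
      fix u u' assume uf: "u \<in> families k S r" "u' \<in> families k S r" and eq: "q S r u = q S r u'"
      then show "u = u'" using det[OF uf] inj_onD[OF conjunct1[OF code[OF that(1,2)]] _ rJ[OF uf(1)] rJ[OF uf(2)]] by (simp add: q_def)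
    qed
    then show ?thesis using that(3) by (simp add: dec_def)
  qed
  have idk: "Ident FI (disj_add k X) \<in> Hom FI (disj_add k X) (disj_add k X)" if "finite X" for X
    using FI.Ident_Hom that by (simp add: disj_add_simps(3))
  \<comment> \<open>Evaluation at the identity, after decoding. Its naturality in X is the
    naturality condition on families, read at \<theta> equal to the identity.\<close>
  define ev where "ev X = mk_arr (FObj V (disj_add k X)) (FObj W (disj_add k X))
      (\<lambda>r y. dec (disj_add k X) r y (X, Ident FI (disj_add k X)))" for X
  have ev_eq: "app (ev X) r (q (disj_add k X) r u) = u (X, Ident FI (disj_add k X))"
    if "finite X" "r \<in> Obj R" "u \<in> families k (disj_add k X) r" for X r u
    using that dec[of "disj_add k X" r u] fibV[of "disj_add k X" r] by (simp add: ev_def disj_add_simps(3))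
  have ev: "ev X \<in> Hom Md (FObj V (disj_add k X)) (FObj W (disj_add k X))" (is "_ \<in> Hom Md (FObj V ?D) _") if X: "finite X" for X
  proof -
    let ?i = "(X, Ident FI ?D)"
    have XX: "finite ?D" using X by (simp add: disj_add_simps(3))
    have i: "?i \<in> idx k ?D" using idk[OF X] by (simp add: idx_def)
    show ?thesis
      unfolding ev_def
    proof (intro mk_arr_Hom homI FObj_Mod V W)
      show "finite ?D" "finite ?D" by (rule XX)+
      fix r y assume r: "r \<in> Obj R" and "y \<in> el (FObj V ?D) r"
      then obtain u where u: "u \<in> families k ?D r" "y = q ?D r u" using fibV[OF XX r] by blast
      then show "dec ?D r y ?i \<in> el (FObj W ?D) r"
        using dec[OF XX r u(1)] familiesD(1)[OF u(1) i] by simp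
      fix y' assume "y' \<in> el (FObj V ?D) r"
      then obtain u' where u': "u' \<in> families k ?D r" "y' = q ?D r u'" using fibV[OF XX r] by blast
      have m: "u \<otimes>\<^bsub>G ?D r\<^esub> u' \<in> families k ?D r"
        using comm_group_closed(2)[OF rep.comm_group[OF Grep r], of u "disj_add k X" u'] u(1) u'(1) by (simp add: G_def)
      have "y \<cdot>[(FObj V ?D),r] y' = q ?D r (u \<otimes>\<^bsub>G ?D r\<^esub> u')"
        using hom_mult[OF conjunct2[OF V1[OF XX r]], of u u'] u u' by (simp add: G_def)
      then show "dec ?D r (y \<cdot>[(FObj V ?D),r] y') ?i =
          dec ?D r y ?i \<cdot>[(FObj W ?D),r] dec ?D r y' ?i"
        using dec[OF XX r m] dec[OF XX r u(1)] dec[OF XX r u'(1)] u(2) u'(2) i by (simp add: G_def)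
    next
      fix t r a y assume a: "a \<in> Hom R t r" and "y \<in> el (FObj V ?D) r"
      note tr = Hom_Obj[OF a]
      obtain u where u: "u \<in> families k ?D r" "y = q ?D r u" using \<open>y \<in> _\<close> fibV[OF XX tr(2)] by blast
      have "act (FObj V ?D) a y = q ?D t (fact k ?D a u)"
        using V2[OF XX a, of u] u by (simp add: G_def)
      moreover have "fact k ?D a u \<in> families k ?D t" using subrep_act[OF families_subrep a u(1)] .
      ultimately show "dec ?D t (act (FObj V ?D) a y) ?i =
          act (FObj W ?D) a (dec ?D r y ?i)"
        using dec[OF XX tr(1)] dec[OF XX tr(2) u(1)] u(2) i by simp
    qed
  qed
  have ev_nat: "mk_nat FI (FObj (Sh k) V) (FObj (Sh k) W) ev \<in> Hom FM (FObj (Sh k) V) (FObj (Sh k) W)"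
  proof (rule mk_nat_FIMod[OF shift_Obj[OF V] shift_Obj[OF W]])
    show "ev X \<in> Hom Md (FObj (FObj (Sh k) V) X) (FObj (FObj (Sh k) W) X)" if "finite X" for X
      using ev[OF that] that by (simp add: shift_at V W)
    fix X X' f r y assume f: "f \<in> Hom FI X X'" and r: "r \<in> Obj R" and y: "y \<in> el (FObj (FObj (Sh k) V) X) r"
    note fin = Hom_FI_finite[OF f]
    have XX: "finite (disj_add k X)" using fin by (simp add: disj_add_simps(3))
    obtain u where u: "u \<in> families k (disj_add k X) r" "y = q (disj_add k X) r u"
      using y fibV[OF XX r] by (auto simp: shift_at V fin)
    note kf = FI_add_Hom[OF f, of k]
    have "push V (FArr (FI_add k) f) r y = q (disj_add k X') r (fi (FArr (FI_add k) f) r u)"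
      using V3[OF kf r, of u] u by (simp add: G_def)
    then have "app (ev X') r (push (FObj (Sh k) V) f r y) = u (X', FArr (FI_add k) f)"
      using ev_eq[OF fin(2) r fi_fam[OF kf u(1)]] fi_at[OF kf idk[OF fin(2)]] FI.Comp_Ident_left[OF kf]
      by (simp add: FArr_shift_at[OF V f])
    also have "\<dots> = push W (FArr (FI_add k) f) r (u (X, Ident FI (disj_add k X)))"
      using familiesD(2)[OF u(1) idk[OF fin(1)] f] FI.Comp_Ident_right[OF kf] by simp
    finally show "app (ev X') r (push (FObj (Sh k) V) f r y) = push (FObj (Sh k) W) f r (app (ev X) r y)"
      using ev_eq[OF fin(1) r u(1)] u(2) by (simp add: FArr_shift_at[OF W f])
  qed
  obtain \<alpha> where \<alpha>: "\<alpha> \<in> Hom FM V (Z k)"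
    and \<alpha>_eq: "Comp FM (counit k (FObj (Sh k) W)) (FArr (Sh k) \<alpha>) = mk_nat FI (FObj (Sh k) V) (FObj (Sh k) W) ev"
    using counit_universal[OF V shift_Obj[OF W] ev_nat] unfolding Z_def by blast
  define w where "w = (\<lambda>(X, \<theta>) \<in> idx k S. v X \<theta>)"
  have w: "w \<in> families k S r"
    using v_in v_nat idx_Comp by (auto simp: families_def w_def idx_def)
  define x where "x = comp_at \<alpha> S r (q S r w)"
  have qw: "q S r w \<in> el (FObj V S) r" using fibV[OF S r] w by simp
  have xZ: "x \<in> el (FObj (Z k) S) r" unfolding x_def using app_closed[OF component_Mod[OF \<alpha> S] r qw] .
  have "val k X \<theta> r x = v X \<theta>" if \<theta>: "\<theta> \<in> Hom FI S (disj_add k X)" for X \<theta>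
  proof -
    note X = finite_disj_add[OF \<theta>]
    have XX: "finite (disj_add k X)" using X by (simp add: disj_add_simps(3))
    have pw: "push V \<theta> r (q S r w) = q (disj_add k X) r (fi \<theta> r w)" using V3[OF \<theta> r, of w] w by (simp add: G_def)
    have pV: "push V \<theta> r (q S r w) \<in> el (FObj (FObj (Sh k) V) X) r"
      using push_closed[OF V \<theta> r qw] by (simp add: shift_at V X)
    have "push (Z k) \<theta> r x = comp_at \<alpha> (disj_add k X) r (push V \<theta> r (q S r w))"
      unfolding x_def using component_push[OF \<alpha> \<theta> r qw] by simp
    then have "val k X \<theta> r x = comp_at (Comp FM (counit k (FObj (Sh k) W)) (FArr (Sh k) \<alpha>)) X r (push V \<theta> r (q S r w))"
      using component_Comp[OF Sh_Hom[OF \<alpha>] X r pV] by (simp add: val_def Map_shift[OF \<alpha> X])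
    also have "\<dots> = app (ev X) r (q (disj_add k X) r (fi \<theta> r w))" using X by (simp add: \<alpha>_eq pw)
    also have "\<dots> = w (X, \<theta>)"
      using ev_eq[OF X r fi_fam[OF \<theta> w]] fi_at[OF \<theta> idk[OF X]] FI.Comp_Ident_left[OF \<theta>] by simp
    also have "\<dots> = v X \<theta>" using \<theta> by (simp add: w_def idx_def)
    finally show ?thesis .
  qed
  then show ?thesis using xZ by blast
qed

end

section \<open>Saturation of the stages\<close>

locale torsion_tower = shift_tower small R T \<eta> \<epsilon> W + hereditary_class small R \<T>
  for small :: "'u set \<Rightarrow> bool" and R :: "('r, 'm) preadditive" and T \<eta> \<epsilon> W \<T> +
  assumes W_saturated: "finite S \<Longrightarrow> saturated (FObj W S)"
begin

text \<open>The extension problem is solved member by member in the saturated values of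
  \<open>W\<close>. Since each solution is unique, the solutions are compatible and form a natural
  family; \<open>val_surject\<close> realises it, and \<open>val_inject\<close> carries both the
  defining equations and uniqueness back to the stage.\<close>

lemma Z_saturated:
  assumes S: "finite S"
  shows "saturated (FObj (Z k) S)"
  unfolding saturated_def
proof (intro conjI allI impI; (elim conjE)?)
  show ZO: "FObj (Z k) S \<in> Obj Md" using FObj_Mod[OF Z_Obj S] .
  fix r Q q f assume r: "r \<in> Obj R" and Q: "Q \<in> \<T>" and q: "q \<in> el Q r" and f: "ideal_hom R (FObj (Z k) S) (ann R Q r q) f"
  let ?I = "ann R Q r q"
  have f_in: "f a \<in> el (FObj (Z k) S) t" if "t \<in> Obj R" "a \<in> ?I t" for t a using f that by (simp add: ideal_hom_def)
  define good where "good X \<theta> y \<longleftrightarrow> y \<in> el (FObj W (disj_add k X)) r \<and>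
    (\<forall>t \<in> Obj R. \<forall>a \<in> ?I t. val k X \<theta> t (f a) = act (FObj W (disj_add k X)) a y)" for X \<theta> y
  have good_ex: "\<exists>!y. good X \<theta> y" if \<theta>: "\<theta> \<in> Hom FI S (disj_add k X)" for X \<theta>
  proof -
    \<comment> \<open>\<open>ideal_hom\<close> expects a function of the arrow alone, so the object
      t is recovered as the domain of \<open>a\<close>.\<close>
    have eq: "val k X \<theta> (Dom R a) (f a) = val k X \<theta> t (f a)" if "a \<in> ?I t" for t a using HomD(2)[OF ann_Hom[OF that]] by simp
    have sat: "saturated (FObj W (disj_add k X))" using W_saturated[OF Hom_FI_finite(2)[OF \<theta>]] .
    have "ideal_hom R (FObj W (disj_add k X)) ?I (\<lambda>a. val k X \<theta> (Dom R a) (f a))"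
      unfolding ideal_hom_def
    proof (intro conjI ballI allI impI; (elim conjE)?)
      fix t a assume t: "t \<in> Obj R" and a: "a \<in> ?I t"
      show "val k X \<theta> (Dom R a) (f a) \<in> el (FObj W (disj_add k X)) t"
        using val_closed[OF \<theta> t f_in[OF t a]] eq[OF a] by simp
      fix a' assume a': "a' \<in> ?I t"
      show "val k X \<theta> (Dom R (Add R a a')) (f (Add R a a')) =
          val k X \<theta> (Dom R a) (f a) \<cdot>[(FObj W (disj_add k X)),t] val k X \<theta> (Dom R a') (f a')"
        using eq[OF ann_Add[OF Q q a a']] eq[OF a] eq[OF a'] f t a a' hom_mult[OF val_hom[OF \<theta> t] f_in[OF t a] f_in[OF t a']]
        by (simp add: ideal_hom_def)
    next
      fix s t b a assume b: "b \<in> Hom R s t" and a: "a \<in> ?I t"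
      show "val k X \<theta> (Dom R (Comp R a b)) (f (Comp R a b)) = act (FObj W (disj_add k X)) b (val k X \<theta> (Dom R a) (f a))"
        using eq[OF ann_Comp[OF Q q a b]] eq[OF a] f a b val_act[OF \<theta> b f_in[OF Hom_Obj(2)[OF b] a]] by (simp add: ideal_hom_def)
    qed
    from saturatedD[OF sat r Q q this] show ?thesis unfolding good_def using eq by (simp cong: ball_cong)
  qed
  define v where "v X \<theta> = (THE y. good X \<theta> y)" for X \<theta>
  have v: "good X \<theta> (v X \<theta>)" if "\<theta> \<in> Hom FI S (disj_add k X)" for X \<theta>
    unfolding v_def using theI'[OF good_ex[OF that]] .
  have "\<exists>x \<in> el (FObj (Z k) S) r. \<forall>X \<theta>. \<theta> \<in> Hom FI S (disj_add k X) \<longrightarrow> val k X \<theta> r x = v X \<theta>"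
  proof (rule val_surject[OF S r])
    show "v X \<theta> \<in> el (FObj W (disj_add k X)) r" if "\<theta> \<in> Hom FI S (disj_add k X)" for X \<theta>
      using v[OF that] by (simp add: good_def)
    fix X X' g \<theta> assume \<theta>: "\<theta> \<in> Hom FI S (disj_add k X)" and g: "g \<in> Hom FI X X'"
    note kg = FI_add_Hom[OF g, of k]
    note vX = v[OF \<theta>, unfolded good_def]
    have "good X' (Comp FI (FArr (FI_add k) g) \<theta>) (push W (FArr (FI_add k) g) r (v X \<theta>))"
      unfolding good_def
    proof (intro conjI ballI)
      show "push W (FArr (FI_add k) g) r (v X \<theta>) \<in> el (FObj W (disj_add k X')) r"
        using push_closed[OF W kg r] vX by simp
      fix t a assume t: "t \<in> Obj R" and a: "a \<in> ?I t"
      show "val k X' (Comp FI (FArr (FI_add k) g) \<theta>) t (f a) = act (FObj W (disj_add k X')) a (push W (FArr (FI_add k) g) r (v X \<theta>))"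
        using val_natural[OF \<theta> g t f_in[OF t a]] vX t a app_act[OF FArr_Mod[OF W kg] ann_Hom[OF a], of "v X \<theta>"] by simp
    qed
    then show "push W (FArr (FI_add k) g) r (v X \<theta>) = v X' (Comp FI (FArr (FI_add k) g) \<theta>)"
      using v[OF FI.Comp_Hom[OF \<theta> kg]] good_ex[OF FI.Comp_Hom[OF \<theta> kg]] by blast
  qed
  then obtain x where x: "x \<in> el (FObj (Z k) S) r"
    and xv: "\<And>X \<theta>. \<theta> \<in> Hom FI S (disj_add k X) \<Longrightarrow> val k X \<theta> r x = v X \<theta>" by blast
  have good_iff: "(\<forall>t \<in> Obj R. \<forall>a \<in> ?I t. f a = act (FObj (Z k) S) a y) \<longleftrightarrow>
      (\<forall>X \<theta>. \<theta> \<in> Hom FI S (disj_add k X) \<longrightarrow> good X \<theta> (val k X \<theta> r y))" if y: "y \<in> el (FObj (Z k) S) r" for y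
  proof
    assume *: "\<forall>t \<in> Obj R. \<forall>a \<in> ?I t. f a = act (FObj (Z k) S) a y"
    have "val k X \<theta> t (f a) = act (FObj W (disj_add k X)) a (val k X \<theta> r y)"
      if "\<theta> \<in> Hom FI S (disj_add k X)" "t \<in> Obj R" "a \<in> ?I t" for X \<theta> t a
      using val_act[OF that(1) ann_Hom[OF that(3)] y] * that by simp
    then show "\<forall>X \<theta>. \<theta> \<in> Hom FI S (disj_add k X) \<longrightarrow> good X \<theta> (val k X \<theta> r y)"
      using val_closed[OF _ r y] unfolding good_def by blast
  next
    assume g: "\<forall>X \<theta>. \<theta> \<in> Hom FI S (disj_add k X) \<longrightarrow> good X \<theta> (val k X \<theta> r y)"
    show "\<forall>t \<in> Obj R. \<forall>a \<in> ?I t. f a = act (FObj (Z k) S) a y"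
    proof (intro ballI)
      fix t a assume t: "t \<in> Obj R" and a: "a \<in> ?I t"
      show "f a = act (FObj (Z k) S) a y"
      proof (rule val_inject[OF S t f_in[OF t a] act_closed[OF ZO ann_Hom[OF a] y]])
        fix X \<theta> assume \<theta>: "\<theta> \<in> Hom FI S (disj_add k X)"
        show "val k X \<theta> t (f a) = val k X \<theta> t (act (FObj (Z k) S) a y)"
          using g \<theta> t a val_act[OF \<theta> ann_Hom[OF a] y] unfolding good_def by metis
      qed
    qed
  qed
  show "\<exists>!y. y \<in> el (FObj (Z k) S) r \<and> (\<forall>t \<in> Obj R. \<forall>a \<in> ?I t. f a = act (FObj (Z k) S) a y)"
  proof (rule ex1I[of _ x])
    show "x \<in> el (FObj (Z k) S) r \<and> (\<forall>t \<in> Obj R. \<forall>a \<in> ?I t. f a = act (FObj (Z k) S) a x)"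
      using x good_iff[OF x] xv v by simp
    fix y assume *: "y \<in> el (FObj (Z k) S) r \<and> (\<forall>t \<in> Obj R. \<forall>a \<in> ?I t. f a = act (FObj (Z k) S) a y)"
    note y = conjunct1[OF *]
    note g = iffD1[OF good_iff[OF y] conjunct2[OF *], THEN spec, THEN spec, THEN mp]
    show "y = x"
    proof (rule val_inject[OF S r y x])
      show "val k X \<theta> r y = val k X \<theta> r x" if "\<theta> \<in> Hom FI S (disj_add k X)" for X \<theta>
        using g[OF that] v[OF that] good_ex[OF that] xv[OF that] by auto
    qed
  qed
qed

end

section \<open>Extending and factoring injections of finite sets\<close>

lemma FI_extend:
  assumes \<phi>: "\<phi> \<in> Hom FI S S'" and \<theta>: "\<theta> \<in> Hom FI S Y" and card: "card S' \<le> card Y"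
  shows "\<exists>\<psi> \<in> Hom FI S' Y. Comp FI \<psi> \<phi> = \<theta>"
proof -
  have fin: "finite S" "finite S'" "finite Y" using \<phi> \<theta> by (simp_all add: Hom_FI)
  note inj = Map_FI_inj[OF \<phi>] Map_FI_inj[OF \<theta>]
  define I where "I = Map \<phi> ` S"
  define J where "J = Map \<theta> ` S"
  have sub: "I \<subseteq> S'" "J \<subseteq> Y" using Map_FI_in[OF \<phi>] Map_FI_in[OF \<theta>] by (auto simp: I_def J_def)
  have cards: "card I = card S" "card J = card S" using inj by (simp_all add: I_def J_def card_image)
  have "card (S' - I) \<le> card (Y - J)"
    using card cards sub fin by (simp add: card_Diff_subset finite_subset)
  then obtain p where p: "p ` (S' - I) \<subseteq> Y - J" "inj_on p (S' - I)"
    using card_le_inj[of "S' - I" "Y - J"] fin by blast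
  define q where "q z = (if z \<in> I then Map \<theta> (inv_into S (Map \<phi>) z) else p z)" for z
  have q\<phi>: "q (Map \<phi> x) = Map \<theta> x" if "x \<in> S" for x using inv_into_f_f[OF inj(1) that] that by (simp add: q_def I_def)
  have qI: "q z \<in> J" if "z \<in> I" for z using that q\<phi> by (auto simp: I_def J_def)
  have qN: "q z \<in> Y - J" if "z \<in> S' - I" for z using that p(1) by (auto simp: q_def)
  have \<psi>: "mk_inj S' Y q \<in> Hom FI S' Y"
  proof (rule mk_inj_Hom[OF fin(2,3)])
    show "q ` S' \<subseteq> Y" using qI qN sub by blast
    have I: "z = z'" if "z \<in> I" "z' \<in> I" "q z = q z'" for z z'
    proof -
      obtain x x' where x: "x \<in> S" "z = Map \<phi> x" "x' \<in> S" "z' = Map \<phi> x'" using \<open>z \<in> I\<close> \<open>z' \<in> I\<close> by (auto simp: I_def)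
      then have "Map \<theta> x = Map \<theta> x'" using q\<phi> \<open>q z = q z'\<close> by simp
      then show ?thesis using inj_onD[OF inj(2) _ x(1,3)] x(2,4) by simp
    qed
    have N: "z = z'" if "z \<in> S' - I" "z' \<in> S' - I" "q z = q z'" for z z'
      using inj_onD[OF p(2) _ that(1,2)] that by (simp add: q_def)
    have X: "q z \<noteq> q z'" if "z \<in> I" "z' \<in> S' - I" for z z'
      using qI[OF that(1)] qN[OF that(2)] by auto
    show "inj_on q S'"
    proof (rule inj_onI)
      fix z z' assume z: "z \<in> S'" "z' \<in> S'" "q z = q z'"
      then show "z = z'" using I[of z z'] N[of z z'] X[of z z'] X[of z' z] by (cases "z \<in> I"; cases "z' \<in> I") simp_all
    qed
  qed
  have "Comp FI (mk_inj S' Y q) \<phi> = \<theta>"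
    by (rule FI_arrow_eqI[OF FI.Comp_Hom[OF \<phi> \<psi>] \<theta>]) (simp add: Map_Comp_FI[OF \<phi>] Map_FI_in[OF \<phi>] q\<phi>)
  with \<psi> show ?thesis by blast
qed

text \<open>The two images together have at most \<open>2 * card S\<close> points, so they fit into
  a subset of \<open>Y\<close> of the same size as \<open>P\<close>. A bijection from
  \<open>P\<close> onto that subset is the common factor.\<close>

lemma FI_common_factor:
  assumes \<psi>: "\<psi> \<in> Hom FI S Y" "\<psi>' \<in> Hom FI S Y" and P: "finite P" "2 * card S \<le> card P" "card P \<le> card Y"
  shows "\<exists>\<chi> \<in> Hom FI P Y. \<exists>j \<in> Hom FI S P. \<exists>j' \<in> Hom FI S P. Comp FI \<chi> j = \<psi> \<and> Comp FI \<chi> j' = \<psi>'"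
proof -
  have fin: "finite S" "finite Y" using \<psi>(1) by (simp_all add: Hom_FI)
  define A where "A = Map \<psi> ` S \<union> Map \<psi>' ` S"
  have A: "A \<subseteq> Y" using Map_FI_in[OF \<psi>(1)] Map_FI_in[OF \<psi>(2)] by (auto simp: A_def)
  have "card A \<le> card S + card S"
    using card_Un_le[of "Map \<psi> ` S" "Map \<psi>' ` S"] card_image_le[OF fin(1), of "Map \<psi>"] card_image_le[OF fin(1), of "Map \<psi>'"]
    unfolding A_def by linarith
  then have "card A \<le> card P" using P(2) by linarith
  then obtain B where B: "A \<subseteq> B" "B \<subseteq> Y" "card B = card P"
    using exists_subset_between[OF _ P(3) A fin(2)] by blast
  have fB: "finite B" using B(2) fin(2) finite_subset by blast
  obtain c where c: "bij_betw c P B" using finite_same_card_bij[OF P(1) fB] B(3) by auto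
  have \<chi>: "mk_inj P Y c \<in> Hom FI P Y"
    by (rule mk_inj_Hom[OF P(1) fin(2)]) (use c B(2) in \<open>auto simp: bij_betw_def\<close>)
  have lift: "\<exists>j \<in> Hom FI S P. Comp FI (mk_inj P Y c) j = \<rho>" if \<rho>: "\<rho> \<in> Hom FI S Y" and im: "Map \<rho> ` S \<subseteq> B" for \<rho>
  proof -
    have cB: "inv_into P c z \<in> P" "c (inv_into P c z) = z" if "z \<in> B" for z
      using bij_betw_inv_into_right[OF c that] that c inv_into_into[of z c P] by (auto simp: bij_betw_def)
    have j: "mk_inj S P (\<lambda>x. inv_into P c (Map \<rho> x)) \<in> Hom FI S P"
    proof (rule mk_inj_Hom[OF fin(1) P(1)])
      show "(\<lambda>x. inv_into P c (Map \<rho> x)) ` S \<subseteq> P" using im cB(1) by blast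
      show "inj_on (\<lambda>x. inv_into P c (Map \<rho> x)) S"
      proof (rule inj_onI)
        fix x y assume xy: "x \<in> S" "y \<in> S" "inv_into P c (Map \<rho> x) = inv_into P c (Map \<rho> y)"
        then have B: "Map \<rho> x \<in> B" "Map \<rho> y \<in> B" using im by (simp_all add: image_subset_iff)
        then have "Map \<rho> x = Map \<rho> y" using arg_cong[OF xy(3), of c] by (simp only: cB(2))
        then show "x = y" using inj_onD[OF Map_FI_inj[OF \<rho>] _ xy(1,2)] by simp
      qed
    qed
    have "Comp FI (mk_inj P Y c) (mk_inj S P (\<lambda>x. inv_into P c (Map \<rho> x))) = \<rho>"
    proof (rule FI_arrow_eqI[OF FI.Comp_Hom[OF j \<chi>] \<rho>])
      fix x assume x: "x \<in> S"
      then have "Map \<rho> x \<in> B" using im by blast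
      then show "Map (Comp FI (mk_inj P Y c) (mk_inj S P (\<lambda>x. inv_into P c (Map \<rho> x)))) x = Map \<rho> x"
        using x cB by (simp add: Map_Comp_FI[OF j])
    qed
    with j show ?thesis by blast
  qed
  obtain j where j: "j \<in> Hom FI S P" "Comp FI (mk_inj P Y c) j = \<psi>"
    using lift[OF \<psi>(1)] B(1) by (auto simp: A_def)
  obtain j' where j': "j' \<in> Hom FI S P" "Comp FI (mk_inj P Y c) j' = \<psi>'"
    using lift[OF \<psi>(2)] B(1) by (auto simp: A_def)
  show ?thesis using \<chi> j j' by blast
qed

lemma card_disj_add: "finite X \<Longrightarrow> card (disj_add k X) = k + card X"
  unfolding disj_add_def by (subst card_Un_disjoint) (auto simp: card_image)

lemma FI_enlarge:
  assumes "finite S"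
  shows "mk_inj S (disj_add n S) (\<lambda>x. x + n) \<in> Hom FI S (disj_add n S)"
  using assms by (intro mk_inj_Hom) (auto simp: disj_add_simps(3) in_disj_add)

section \<open>The colimit is closed for the hat class\<close>

locale torsion_limit = torsion_tower small R T \<eta> \<epsilon> W \<T>
  for small :: "'u set \<Rightarrow> bool" and R :: "('r, 'm) preadditive" and T \<eta> \<epsilon> W \<T> +
  fixes L :: "('r, 'm, 'u) FImod_obj" and \<iota> :: "nat \<Rightarrow> ('r, 'm, 'u) FImod_arr"
  assumes locally_noetherian: "is_locally_noetherian small Md"
    and \<iota>: "\<iota> k \<in> Hom FM (Z k) L"
    and limit: "finite S \<Longrightarrow> direct_limit (\<lambda>k. FObj (Z k) S) (\<lambda>k. Map (trans k) S) (FObj L S) (\<lambda>k. Map (\<iota> k) S)"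
begin

lemma L_Obj: "L \<in> Obj FM"
  using Hom_FIMod_Obj(2)[OF \<iota>] .

lemma L_saturated: "finite S \<Longrightarrow> saturated (FObj L S)"
  using saturated_direct_limit[OF locally_noetherian limit Z_saturated] .

abbreviation stage :: "nat set \<Rightarrow> 'r \<Rightarrow> nat \<Rightarrow> nat \<Rightarrow> 'u \<Rightarrow> 'u" where
  "stage S \<equiv> ctr (\<lambda>k. Map (trans k) S)"

lemma stage_closed: "finite S \<Longrightarrow> r \<in> Obj R \<Longrightarrow> x \<in> el (FObj (Z k) S) r \<Longrightarrow>
    stage S r k n x \<in> el (FObj (Z (k + n)) S) r"
  using ctr_closed[where M = "\<lambda>k. FObj (Z k) S" and c = "\<lambda>k. Map (trans k) S", OF direct_limit_arr(1)[OF limit]] .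

lemma stage_\<iota>: "finite S \<Longrightarrow> r \<in> Obj R \<Longrightarrow> x \<in> el (FObj (Z k) S) r \<Longrightarrow>
    comp_at (\<iota> (k + n)) S r (stage S r k n x) = comp_at (\<iota> k) S r x"
  using direct_limit_ctr[OF limit] .

lemma stage_push:
  assumes \<phi>: "\<phi> \<in> Hom FI S X" and r: "r \<in> Obj R" and x: "x \<in> el (FObj (Z k) S) r"
  shows "stage X r k n (push (Z k) \<phi> r x) = push (Z (k + n)) \<phi> r (stage S r k n x)"
proof (induction n)
  case (Suc n)
  then show ?case using component_push[OF trans_Hom \<phi> r stage_closed[OF Hom_FI_finite(1)[OF \<phi>] r x]] by simp
qed simp

text \<open>At such a stage every \<theta> from S to X + [k] extends along \<phi>, since X + [k] has
  at least \<open>card S'\<close> points even for empty X. The family of an element is thus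
  determined by its push along \<phi>, and pushing is injective.\<close>

lemma val_factor_unique:
  assumes \<phi>: "\<phi> \<in> Hom FI S S'" and k: "card S' \<le> k" and r: "r \<in> Obj R"
    and x: "x \<in> el (FObj (Z k) S) r" "y \<in> el (FObj (Z k) S) r"
    and eq: "push (Z k) \<phi> r x = push (Z k) \<phi> r y"
  shows "x = y"
proof (rule val_inject[OF Hom_FI_finite(1)[OF \<phi>] r x])
  fix X \<theta> assume \<theta>: "\<theta> \<in> Hom FI S (disj_add k X)"
  have "card S' \<le> card (disj_add k X)" using k card_disj_add[OF finite_disj_add[OF \<theta>], of k] by simp
  then obtain \<psi> where \<psi>: "\<psi> \<in> Hom FI S' (disj_add k X)" "Comp FI \<psi> \<phi> = \<theta>" using FI_extend[OF \<phi> \<theta>] by blast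
  show "val k X \<theta> r x = val k X \<theta> r y"
    using val_push[OF \<psi>(1) \<phi> r x(1)] val_push[OF \<psi>(1) \<phi> r x(2)] eq \<psi>(2) by simp
qed

lemma L_push_inj:
  assumes \<phi>: "\<phi> \<in> Hom FI S S'" and r: "r \<in> Obj R"
    and x: "x \<in> el (FObj L S) r" "y \<in> el (FObj L S) r"
    and eq: "push L \<phi> r x = push L \<phi> r y"
  shows "x = y"
proof -
  note fin = Hom_FI_finite[OF \<phi>]
  obtain k x0 where x0: "x0 \<in> el (FObj (Z k) S) r" "x = comp_at (\<iota> k) S r x0"
    using direct_limit_ex[OF limit[OF fin(1)] r x(1)] by blast
  obtain k' y0 where y0: "k \<le> k'" "y0 \<in> el (FObj (Z k') S) r" "y = comp_at (\<iota> k') S r y0"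
    using direct_limit_ex[OF limit[OF fin(1)] r x(2), of k] by blast
  define x1 where "x1 = stage S r k (k' - k) x0"
  have x1: "x1 \<in> el (FObj (Z k') S) r" "x = comp_at (\<iota> k') S r x1"
    using stage_closed[OF fin(1) r x0(1), of "k' - k"] stage_\<iota>[OF fin(1) r x0(1), of "k' - k"] x0(2) y0(1) by (simp_all add: x1_def)
  have pc: "push (Z k') \<phi> r z \<in> el (FObj (Z k') S') r" if "z \<in> el (FObj (Z k') S) r" for z
    using push_closed[OF Z_Obj \<phi> r that] .
  have "comp_at (\<iota> k') S' r (push (Z k') \<phi> r x1) = comp_at (\<iota> k') S' r (push (Z k') \<phi> r y0)"
    using component_push[OF \<iota> \<phi> r x1(1)] component_push[OF \<iota> \<phi> r y0(2)] eq x1(2) y0(3) by simp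
  from direct_limit_eq[OF limit[OF fin(2)] r pc[OF x1(1)] pc[OF y0(2)] this]
  obtain n0 where n0: "\<And>n. n0 \<le> n \<Longrightarrow> stage S' r k' n (push (Z k') \<phi> r x1) = stage S' r k' n (push (Z k') \<phi> r y0)" by blast
  \<comment> \<open>\<open>n0\<close> makes the pushed elements equal, and \<open>card S'\<close>
    reaches a stage where pushing along \<phi> is injective.\<close>
  define n where "n = n0 + card S'"
  have "stage S r k' n x1 = stage S r k' n y0"
  proof (rule val_factor_unique[OF \<phi> _ r stage_closed[OF fin(1) r x1(1)] stage_closed[OF fin(1) r y0(2)]])
    show "card S' \<le> k' + n" by (simp add: n_def)
    show "push (Z (k' + n)) \<phi> r (stage S r k' n x1) = push (Z (k' + n)) \<phi> r (stage S r k' n y0)"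
      using n0[of n] stage_push[OF \<phi> r x1(1)] stage_push[OF \<phi> r y0(2)] by (simp add: n_def)
  qed
  then show ?thesis using stage_\<iota>[OF fin(1) r x1(1), of n] stage_\<iota>[OF fin(1) r y0(2), of n] x1(2) y0(3) by simp
qed

text \<open>
  A natural family is determined by its member at one enlargement \<open>i : S \<rightarrow> P\<close>. Once that member is
  represented at a stage \<open>k\<close> where all pairs of injections \<open>P \<rightarrow> Q\<close> agreeing on \<open>S\<close> push it to the same
  element, its values at the injections \<open>P \<rightarrow> disj_add k X\<close> only depend on the restrictions to \<open>S\<close>.
\<close>

lemma L_extension:
  assumes S: "finite S" and r: "r \<in> Obj R"
    and y: "\<And>X \<phi>. \<phi> \<in> Hom FI S X \<Longrightarrow> N \<le> card X \<Longrightarrow> y X \<phi> \<in> el (FObj L X) r"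
    and nat: "\<And>X X' f \<phi>. \<phi> \<in> Hom FI S X \<Longrightarrow> N \<le> card X \<Longrightarrow> f \<in> Hom FI X X' \<Longrightarrow> push L f r (y X \<phi>) = y X' (Comp FI f \<phi>)"
  shows "\<exists>x \<in> el (FObj L S) r. \<forall>X \<phi>. \<phi> \<in> Hom FI S X \<and> N \<le> card X \<longrightarrow> push L \<phi> r x = y X \<phi>"
proof -
  define P where "P = disj_add N S"
  define i where "i = mk_inj S P (\<lambda>x. x + N)"
  have i: "i \<in> Hom FI S P" unfolding i_def P_def using FI_enlarge[OF S] .
  have P: "finite P" "N \<le> card P" using S card_disj_add[OF S, of N] by (simp_all add: P_def disj_add_simps(3))
  \<comment> \<open>Two injections of \<open>P\<close> into a set with at least
    \<open>2 * card P\<close> points factor through \<open>Q\<close>, so every comparison of such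
    pairs takes place inside this one finite set.\<close>
  define Q where "Q = {..<2 * card P}"
  have Q: "finite Q" "card Q = 2 * card P" by (simp_all add: Q_def)
  obtain k0 y0 where y0: "y0 \<in> el (FObj (Z k0) P) r" "y P i = comp_at (\<iota> k0) P r y0"
    using direct_limit_ex[OF limit[OF P(1)] r y[OF i P(2)]] by blast
  \<comment> \<open>For a pair in \<open>F\<close> compatibility of the family gives equal pushes in
    \<open>L\<close>. The pairs are finitely many, so one stage realises all these
    equalities.\<close>
  define F where "F = {(j, j'). j \<in> Hom FI P Q \<and> j' \<in> Hom FI P Q \<and> Comp FI j i = Comp FI j' i}"
  have F: "finite F" by (rule finite_subset[of _ "Hom FI P Q \<times> Hom FI P Q"]) (auto simp: F_def finite_Hom_FI)
  have "\<forall>p \<in> F. eventually (\<lambda>n. stage Q r k0 n (push (Z k0) (fst p) r y0) = stage Q r k0 n (push (Z k0) (snd p) r y0)) sequentially"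
  proof
    fix p assume "p \<in> F"
    then obtain j j' where p: "p = (j, j')" and j: "j \<in> Hom FI P Q" "j' \<in> Hom FI P Q" and ji: "Comp FI j i = Comp FI j' i"
      by (auto simp: F_def)
    have "comp_at (\<iota> k0) Q r (push (Z k0) j r y0) = comp_at (\<iota> k0) Q r (push (Z k0) j' r y0)"
      using component_push[OF \<iota> j(1) r y0(1)] component_push[OF \<iota> j(2) r y0(1)] nat[OF i P(2) j(1)] nat[OF i P(2) j(2)] ji y0(2)
      by simp
    from direct_limit_eq[OF limit[OF Q(1)] r push_closed[OF Z_Obj j(1) r y0(1)] push_closed[OF Z_Obj j(2) r y0(1)] this]
    show "eventually (\<lambda>n. stage Q r k0 n (push (Z k0) (fst p) r y0) = stage Q r k0 n (push (Z k0) (snd p) r y0)) sequentially"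
      by (simp add: p eventually_sequentially)
  qed
  then have "eventually (\<lambda>n. \<forall>p \<in> F. stage Q r k0 n (push (Z k0) (fst p) r y0) = stage Q r k0 n (push (Z k0) (snd p) r y0)) sequentially"
    by (simp add: eventually_ball_finite_distrib[OF F])
  then obtain n0 where n0: "\<And>n p. n0 \<le> n \<Longrightarrow> p \<in> F \<Longrightarrow>
      stage Q r k0 n (push (Z k0) (fst p) r y0) = stage Q r k0 n (push (Z k0) (snd p) r y0)"
    unfolding eventually_sequentially by blast
  \<comment> \<open>\<open>n0\<close> serves the equalities indexed by \<open>F\<close>. The summand
    \<open>card Q\<close> ensures that X + [k] has at least as many points as \<open>Q\<close>, and
    so as \<open>P\<close>, for every X.\<close>
  define n where "n = n0 + card Q"
  define k where "k = k0 + n"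
  define y1 where "y1 = stage P r k0 n y0"
  have y1: "y1 \<in> el (FObj (Z k) P) r" "y P i = comp_at (\<iota> k) P r y1"
    using stage_closed[OF P(1) r y0(1)] stage_\<iota>[OF P(1) r y0(1)] y0(2) by (simp_all add: y1_def k_def)
  have F1: "push (Z k) j r y1 = push (Z k) j' r y1" if "j \<in> Hom FI P Q" "j' \<in> Hom FI P Q" "Comp FI j i = Comp FI j' i" for j j'
  proof -
    have le: "n0 \<le> n" by (simp add: n_def)
    have inF: "(j, j') \<in> F" using that by (simp add: F_def)
    show ?thesis unfolding k_def y1_def
      using n0[OF le inF] stage_push[OF that(1) r y0(1), of n] stage_push[OF that(2) r y0(1), of n] by simp
  qed
  have kQ: "card Q \<le> card (disj_add k X)" if "finite X" for X using card_disj_add[OF that, of k] by (simp add: k_def n_def)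
  have indep: "val k X \<psi> r y1 = val k X \<psi>' r y1"
    if \<psi>: "\<psi> \<in> Hom FI P (disj_add k X)" "\<psi>' \<in> Hom FI P (disj_add k X)" and eq: "Comp FI \<psi> i = Comp FI \<psi>' i" for X \<psi> \<psi>'
  proof -
    obtain \<chi> j j' where \<chi>: "\<chi> \<in> Hom FI Q (disj_add k X)" and j: "j \<in> Hom FI P Q" "j' \<in> Hom FI P Q"
      and f: "Comp FI \<chi> j = \<psi>" "Comp FI \<chi> j' = \<psi>'"
      using FI_common_factor[OF \<psi> Q(1) _ kQ[OF finite_disj_add[OF \<psi>(1)]]] Q(2) by auto
    have "Comp FI \<chi> (Comp FI j i) = Comp FI \<chi> (Comp FI j' i)"
      using FI.Comp_assoc[OF i j(1) \<chi>] FI.Comp_assoc[OF i j(2) \<chi>] f eq by simp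
    \<comment> \<open>The injection \<chi> can be cancelled, so the pair of j and j' belongs to
      \<open>F\<close>.\<close>
    then have "Comp FI j i = Comp FI j' i"
    proof (intro FI_arrow_eqI[OF FI.Comp_Hom[OF i j(1)] FI.Comp_Hom[OF i j(2)]])
      fix x assume "Comp FI \<chi> (Comp FI j i) = Comp FI \<chi> (Comp FI j' i)" and x: "x \<in> S"
      then have "Map \<chi> (Map (Comp FI j i) x) = Map \<chi> (Map (Comp FI j' i) x)"
        using Map_Comp_FI[OF FI.Comp_Hom[OF i j(1)] x, of \<chi>] Map_Comp_FI[OF FI.Comp_Hom[OF i j(2)] x, of \<chi>] by simp
      then show "Map (Comp FI j i) x = Map (Comp FI j' i) x"
        using inj_onD[OF Map_FI_inj[OF \<chi>]] Map_FI_in[OF FI.Comp_Hom[OF i j(1)] x] Map_FI_in[OF FI.Comp_Hom[OF i j(2)] x] by blast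
    qed
    from F1[OF j this] show ?thesis
      using val_push[OF \<chi> j(1) r y1(1)] val_push[OF \<chi> j(2) r y1(1)] f by simp
  qed
  have "\<exists>\<psi>. \<psi> \<in> Hom FI P (disj_add k (fst p)) \<and> Comp FI \<psi> i = snd p"
    if \<theta>: "snd p \<in> Hom FI S (disj_add k (fst p))" for p
  proof -
    have "card P \<le> card (disj_add k (fst p))" using kQ[OF finite_disj_add[OF \<theta>]] Q(2) by linarith
    then show ?thesis using FI_extend[OF i \<theta>] by blast
  qed
  then obtain ext where ext: "\<And>p. snd p \<in> Hom FI S (disj_add k (fst p)) \<Longrightarrow>
      ext p \<in> Hom FI P (disj_add k (fst p)) \<and> Comp FI (ext p) i = snd p" by (rule choice1E) (assumption, rule that)
  \<comment> \<open>Any extension of \<theta> along \<open>i\<close> may be used; by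
    \<open>indep\<close> the value depends only on \<theta>.\<close>
  define v where "v X \<theta> = val k X (ext (X, \<theta>)) r y1" for X \<theta>
  have v: "v X (Comp FI \<psi> i) = val k X \<psi> r y1" if \<psi>: "\<psi> \<in> Hom FI P (disj_add k X)" for X \<psi>
    unfolding v_def using indep[OF _ \<psi>] ext[of "(X, Comp FI \<psi> i)"] FI.Comp_Hom[OF i \<psi>] by simp
  have "\<exists>x \<in> el (FObj (Z k) S) r. \<forall>X \<theta>. \<theta> \<in> Hom FI S (disj_add k X) \<longrightarrow> val k X \<theta> r x = v X \<theta>"
  proof (rule val_surject[OF S r])
    fix X \<theta> assume \<theta>: "\<theta> \<in> Hom FI S (disj_add k X)"
    have e: "ext (X, \<theta>) \<in> Hom FI P (disj_add k X)" "Comp FI (ext (X, \<theta>)) i = \<theta>" using ext[of "(X, \<theta>)"] \<theta> by simp_all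
    show "v X \<theta> \<in> el (FObj W (disj_add k X)) r" unfolding v_def using val_closed[OF e(1) r y1(1)] .
    fix X' f assume f: "f \<in> Hom FI X X'"
    note kf = FI_add_Hom[OF f, of k]
    have "push W (FArr (FI_add k) f) r (v X \<theta>) = val k X' (Comp FI (FArr (FI_add k) f) (ext (X, \<theta>))) r y1"
      unfolding v_def using val_natural[OF e(1) f r y1(1)] .
    also have "\<dots> = v X' (Comp FI (FArr (FI_add k) f) \<theta>)"
      using v[OF FI.Comp_Hom[OF e(1) kf]] FI.Comp_assoc[OF i e(1) kf] e(2) by simp
    finally show "push W (FArr (FI_add k) f) r (v X \<theta>) = v X' (Comp FI (FArr (FI_add k) f) \<theta>)" .
  qed
  then obtain x0 where x0: "x0 \<in> el (FObj (Z k) S) r"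
    and x0v: "\<And>X \<theta>. \<theta> \<in> Hom FI S (disj_add k X) \<Longrightarrow> val k X \<theta> r x0 = v X \<theta>" by blast
  have ix0: "push (Z k) i r x0 = y1"
  proof (rule val_inject[OF P(1) r push_closed[OF Z_Obj i r x0] y1(1)])
    fix X \<psi> assume \<psi>: "\<psi> \<in> Hom FI P (disj_add k X)"
    show "val k X \<psi> r (push (Z k) i r x0) = val k X \<psi> r y1"
      using val_push[OF \<psi> i r x0] x0v[OF FI.Comp_Hom[OF i \<psi>]] v[OF \<psi>] by simp
  qed
  define x where "x = comp_at (\<iota> k) S r x0"
  have x: "x \<in> el (FObj L S) r" unfolding x_def using app_closed[OF component_Mod[OF \<iota> S] r x0] .
  have ix: "push L i r x = y P i" unfolding x_def using component_push[OF \<iota> i r x0] ix0 y1(2) by simp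
  have "push L \<phi> r x = y X \<phi>" if \<phi>: "\<phi> \<in> Hom FI S X" and X: "N \<le> card X" for X \<phi>
  proof -
    note fX = Hom_FI_finite(2)[OF \<phi>]
    \<comment> \<open>X may be too small to receive an extension along \<open>i\<close>. Adding
      \<open>card P\<close> points makes room, and injectivity of pushing in \<open>L\<close> brings
      the equality back to X.\<close>
    define X' where "X' = disj_add (card P) X"
    obtain g where g: "g \<in> Hom FI X X'" unfolding X'_def using FI_enlarge[OF fX] by blast
    have "card P \<le> card X'" using card_disj_add[OF fX] by (simp add: X'_def)
    then obtain f where f: "f \<in> Hom FI P X'" "Comp FI f i = Comp FI g \<phi>" using FI_extend[OF i FI.Comp_Hom[OF \<phi> g]] by blast
    show ?thesis
    proof (rule L_push_inj[OF g r push_closed[OF L_Obj \<phi> r x] y[OF \<phi> X]])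
      have "push L g r (push L \<phi> r x) = push L f r (push L i r x)"
        using push_Comp[OF L_Obj \<phi> g r x] push_Comp[OF L_Obj i f(1) r x] f(2) by simp
      also have "\<dots> = push L g r (y X \<phi>)" using ix nat[OF i P(2) f(1)] nat[OF \<phi> X g] f(2) by simp
      finally show "push L g r (push L \<phi> r x) = push L g r (y X \<phi>)" .
    qed
  qed
  with x show ?thesis by blast
qed

text \<open>One test object suffices: \<open>disj_add N S\<close> has at least \<open>N\<close>
  points, and pushing into it is injective on \<open>L\<close>.\<close>

lemma L_separated:
  assumes S: "finite S" and r: "r \<in> Obj R"
    and x: "x \<in> el (FObj L S) r" "x' \<in> el (FObj L S) r"
    and eq: "\<And>X \<phi>. \<phi> \<in> Hom FI S X \<Longrightarrow> N \<le> card X \<Longrightarrow> push L \<phi> r x = push L \<phi> r x'"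
  shows "x = x'"
proof (rule L_push_inj[OF FI_enlarge[OF S] r x eq[OF FI_enlarge[OF S]]])
  show "N \<le> card (disj_add N S)" using card_disj_add[OF S] by simp
qed

lemma L_hom_unique:
  assumes X: "finite X" and u: "torsion_iso A B u"
    and h: "h \<in> Hom Md B (FObj L X)" "h' \<in> Hom Md B (FObj L X)" and eq: "Comp Md h u = Comp Md h' u"
  shows "h = h'"
  using inj_onD[OF bij_betw_imp_inj_on[OF saturated_bij[OF L_saturated[OF X] u]] eq h] .

lemma L_hom_exists:
  assumes X: "finite X" and u: "torsion_iso A B u" and g: "g \<in> Hom Md A (FObj L X)"
  shows "\<exists>h. h \<in> Hom Md B (FObj L X) \<and> Comp Md h u = g"
proof -
  have "g \<in> (\<lambda>g. Comp Md g u) ` Hom Md B (FObj L X)"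
    using bij_betw_imp_surj_on[OF saturated_bij[OF L_saturated[OF X] u]] g by simp
  then show ?thesis by (elim imageE) (intro exI conjI, assumption, simp)
qed

text \<open>For sets with at least \<open>N\<close> points saturation gives the extension
  \<open>H X\<close>. On an arbitrary set the value at \<open>b\<close> is glued from the images of
  \<open>b\<close> under these extensions, and additivity, linearity and naturality of the result
  are checked after pushing to large sets, where \<open>L_separated\<close> applies.\<close>

lemma L_factor_exists:
  assumes u: "u \<in> Hom FM A B" and N: "\<And>X. finite X \<Longrightarrow> N \<le> card X \<Longrightarrow> torsion_iso (FObj A X) (FObj B X) (Map u X)"
    and g: "g \<in> Hom FM A L"
  shows "\<exists>h \<in> Hom FM B L. Comp FM h u = g"
proof -
  note AB = Hom_FIMod_Obj[OF u]
  have "\<exists>h. h \<in> Hom Md (FObj B X) (FObj L X) \<and> Comp Md h (Map u X) = Map g X" if "finite X \<and> N \<le> card X" for X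
    using that by (elim conjE) (rule L_hom_exists[OF _ N component_Mod[OF g]])
  then obtain H where *: "\<And>X. finite X \<and> N \<le> card X \<Longrightarrow>
      H X \<in> Hom Md (FObj B X) (FObj L X) \<and> Comp Md (H X) (Map u X) = Map g X"
    by (rule choice1E) (assumption, rule that)
  note H = *[THEN conjunct1, OF conjI] and Hu = *[THEN conjunct2, OF conjI]
  have Hu_at: "app (H X) r (comp_at u X r a) = comp_at g X r a"
    if "finite X" "N \<le> card X" "r \<in> Obj R" "a \<in> el (FObj A X) r" for X r a
    using app_Comp[OF component_Mod[OF u that(1)] that(3,4), of "H X"] Hu[OF that(1,2)] by simp
  \<comment> \<open>Both ways around the square restrict along \<open>u\<close> to the same
    morphism, because \<open>g\<close> is natural, so uniqueness of extensions identifies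
    them.\<close>
  have H_nat: "app (H X') r (push B f r b) = push L f r (app (H X) r b)"
    if f: "f \<in> Hom FI X X'" and X: "N \<le> card X" and r: "r \<in> Obj R" and b: "b \<in> el (FObj B X) r" for f X X' r b
  proof -
    note fin = Hom_FI_finite[OF f]
    have X': "N \<le> card X'" using X card_inj_on_le[OF Map_FI_inj[OF f] _ fin(2)] Map_FI_in[OF f] by (force simp: image_subset_iff)
    note fB = FArr_Mod[OF AB(2) f] and fL = FArr_Mod[OF L_Obj f]
    note uX = component_Mod[OF u fin(1)]
    have h1: "Comp Md (H X') (FArr B f) \<in> Hom Md (FObj B X) (FObj L X')" using Md.Comp_Hom[OF fB H[OF fin(2) X']] .
    have h2: "Comp Md (FArr L f) (H X) \<in> Hom Md (FObj B X) (FObj L X')" using Md.Comp_Hom[OF H[OF fin(1) X] fL] .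
    have "Comp Md (H X') (FArr B f) = Comp Md (FArr L f) (H X)"
    proof (rule L_hom_unique[OF fin(2) N[OF fin(1) X] h1 h2], rule module_arrow_eqI[OF Md.Comp_Hom[OF uX h1] Md.Comp_Hom[OF uX h2]])
      fix s a assume s: "s \<in> Obj R" and a: "a \<in> el (FObj A X) s"
      have ua: "comp_at u X s a \<in> el (FObj B X) s" using app_closed[OF uX s a] .
      have "app (Comp Md (Comp Md (H X') (FArr B f)) (Map u X)) s a = app (H X') s (push B f s (comp_at u X s a))"
        using app_Comp[OF uX s a] app_Comp[OF fB s ua] by simp
      also have "\<dots> = comp_at g X' s (push A f s a)"
        using component_push[OF u f s a] Hu_at[OF fin(2) X' s push_closed[OF AB(1) f s a]] by simp
      also have "\<dots> = push L f s (comp_at g X s a)" using component_push[OF g f s a] .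
      also have "\<dots> = app (Comp Md (Comp Md (FArr L f) (H X)) (Map u X)) s a"
        using app_Comp[OF uX s a] app_Comp[OF H[OF fin(1) X] s ua] Hu_at[OF fin(1) X s a] by simp
      finally show "app (Comp Md (Comp Md (H X') (FArr B f)) (Map u X)) s a = app (Comp Md (Comp Md (FArr L f) (H X)) (Map u X)) s a" .
    qed
    then show ?thesis using app_Comp[OF fB r b, of "H X'"] app_Comp[OF H[OF fin(1) X] r b, of "FArr L f"] by simp
  qed
  have "\<exists>hh. \<forall>S r b. finite S \<and> r \<in> Obj R \<and> b \<in> el (FObj B S) r \<longrightarrow> hh S r b \<in> el (FObj L S) r \<and>
      (\<forall>X \<phi>. \<phi> \<in> Hom FI S X \<and> N \<le> card X \<longrightarrow> push L \<phi> r (hh S r b) = app (H X) r (push B \<phi> r b))" (is "\<exists>hh. \<forall>S r b. ?A S r b \<longrightarrow> ?P S r b (hh S r b)")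
  proof -
    have "?P S r b (SOME x. ?P S r b x)" if "?A S r b" for S r b
    proof (rule someI_ex)
      have S: "finite S" and r: "r \<in> Obj R" and b: "b \<in> el (FObj B S) r" using that by simp_all
      \<comment> \<open>The family sends \<phi> to the value of \<open>H X\<close> at the push of
        \<open>b\<close>. Naturality of \<open>H\<close> on large sets is exactly the compatibility
        needed for gluing.\<close>
      have "\<exists>x \<in> el (FObj L S) r. \<forall>X \<phi>. \<phi> \<in> Hom FI S X \<and> N \<le> card X \<longrightarrow> push L \<phi> r x = app (H X) r (push B \<phi> r b)"
      proof (rule L_extension[OF S r])
        show "app (H X) r (push B \<phi> r b) \<in> el (FObj L X) r" if "\<phi> \<in> Hom FI S X" "N \<le> card X" for X \<phi>
          using app_closed[OF H[OF Hom_FI_finite(2)[OF that(1)] that(2)] r push_closed[OF AB(2) that(1) r b]] .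
        show "push L f r (app (H X) r (push B \<phi> r b)) = app (H X') r (push B (Comp FI f \<phi>) r b)"
          if "\<phi> \<in> Hom FI S X" "N \<le> card X" "f \<in> Hom FI X X'" for X X' f \<phi>
          using H_nat[OF that(3,2) r push_closed[OF AB(2) that(1) r b]] push_Comp[OF AB(2) that(1,3) r b] by simp
      qed
      then show "\<exists>x. ?P S r b x" by blast
    qed
    then show ?thesis by (intro exI[of _ "\<lambda>S r b. SOME x. ?P S r b x"]) blast
  qed
  then obtain hh where *: "\<forall>S r b. finite S \<and> r \<in> Obj R \<and> b \<in> el (FObj B S) r \<longrightarrow> hh S r b \<in> el (FObj L S) r \<and>
      (\<forall>X \<phi>. \<phi> \<in> Hom FI S X \<and> N \<le> card X \<longrightarrow> push L \<phi> r (hh S r b) = app (H X) r (push B \<phi> r b))"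
    by (elim exE) (rule that)
  note hh_all = *[THEN spec, THEN spec, THEN spec, THEN mp, OF conjI[OF _ conjI]]
  note hh_in = hh_all[THEN conjunct1] and hh = hh_all[THEN conjunct2, THEN spec, THEN spec, THEN mp, OF _ _ _ conjI]
  have hh_arr: "mk_arr (FObj B S) (FObj L S) (hh S) \<in> Hom Md (FObj B S) (FObj L S)" if S: "finite S" for S
  proof (intro mk_arr_Hom homI FObj_Mod AB(2) L_Obj S)
    fix r b assume r: "r \<in> Obj R" and b: "b \<in> el (FObj B S) r"
    show "hh S r b \<in> el (FObj L S) r" using hh_in[OF S r b] .
    fix b' assume b': "b' \<in> el (FObj B S) r"
    have bb: "b \<cdot>[(FObj B S),r] b' \<in> el (FObj B S) r"
      using fib_mult_closed[OF FObj_Mod[OF AB(2) S] r b b'] .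
    show "hh S r (b \<cdot>[(FObj B S),r] b') = hh S r b \<cdot>[(FObj L S),r] hh S r b'"
    proof (rule L_separated[OF S r hh_in[OF S r bb] fib_mult_closed[OF FObj_Mod[OF L_Obj S] r hh_in[OF S r b] hh_in[OF S r b']], of N])
      fix X \<phi> assume \<phi>: "\<phi> \<in> Hom FI S X" and X: "N \<le> card X"
      show "push L \<phi> r (hh S r (b \<cdot>[(FObj B S),r] b')) = push L \<phi> r (hh S r b \<cdot>[(FObj L S),r] hh S r b')"
        using hh[OF S r bb \<phi> X] hh[OF S r b \<phi> X] hh[OF S r b' \<phi> X] app_mult[OF FArr_Mod[OF AB(2) \<phi>] r b b']
          app_mult[OF FArr_Mod[OF L_Obj \<phi>] r hh_in[OF S r b] hh_in[OF S r b']]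
          app_mult[OF H[OF Hom_FI_finite(2)[OF \<phi>] X] r push_closed[OF AB(2) \<phi> r b] push_closed[OF AB(2) \<phi> r b']] by simp
    qed
  next
    fix t r a b assume a: "a \<in> Hom R t r" and b: "b \<in> el (FObj B S) r"
    note tr = Hom_Obj[OF a]
    have ab: "act (FObj B S) a b \<in> el (FObj B S) t" using act_closed[OF FObj_Mod[OF AB(2) S] a b] .
    show "hh S t (act (FObj B S) a b) = act (FObj L S) a (hh S r b)"
    proof (rule L_separated[OF S tr(1) hh_in[OF S tr(1) ab] act_closed[OF FObj_Mod[OF L_Obj S] a hh_in[OF S tr(2) b]], of N])
      fix X \<phi> assume \<phi>: "\<phi> \<in> Hom FI S X" and X: "N \<le> card X"
      show "push L \<phi> t (hh S t (act (FObj B S) a b)) = push L \<phi> t (act (FObj L S) a (hh S r b))"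
        using hh[OF S tr(1) ab \<phi> X] hh[OF S tr(2) b \<phi> X] app_act[OF FArr_Mod[OF AB(2) \<phi>] a b]
          app_act[OF FArr_Mod[OF L_Obj \<phi>] a hh_in[OF S tr(2) b]]
          app_act[OF H[OF Hom_FI_finite(2)[OF \<phi>] X] a push_closed[OF AB(2) \<phi> tr(2) b]] by simp
    qed
  qed
  define h where "h = mk_nat FI B L (\<lambda>S. mk_arr (FObj B S) (FObj L S) (hh S))"
  have h_at: "comp_at h S r b = hh S r b" if "finite S" "r \<in> Obj R" "b \<in> el (FObj B S) r" for S r b
    using that by (simp add: h_def)
  have h: "h \<in> Hom FM B L"
    unfolding h_def
  proof (rule mk_nat_FIMod[OF AB(2) L_Obj hh_arr])
    fix S X \<phi> r b assume \<phi>: "\<phi> \<in> Hom FI S X" and r: "r \<in> Obj R" and b: "b \<in> el (FObj B S) r"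
    note fin = Hom_FI_finite[OF \<phi>] and pb = push_closed[OF AB(2) \<phi> r b]
    have "hh X r (push B \<phi> r b) = push L \<phi> r (hh S r b)"
    proof (rule L_separated[OF fin(2) r hh_in[OF fin(2) r pb] push_closed[OF L_Obj \<phi> r hh_in[OF fin(1) r b]], of N])
      fix Y \<psi> assume \<psi>: "\<psi> \<in> Hom FI X Y" and Y: "N \<le> card Y"
      show "push L \<psi> r (hh X r (push B \<phi> r b)) = push L \<psi> r (push L \<phi> r (hh S r b))"
        using hh[OF fin(2) r pb \<psi> Y] hh[OF fin(1) r b FI.Comp_Hom[OF \<phi> \<psi>] Y] push_Comp[OF AB(2) \<phi> \<psi> r b]
          push_Comp[OF L_Obj \<phi> \<psi> r hh_in[OF fin(1) r b]] by simp
    qed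
    then show "app (mk_arr (FObj B X) (FObj L X) (hh X)) r (push B \<phi> r b) = push L \<phi> r (app (mk_arr (FObj B S) (FObj L S) (hh S)) r b)"
      using r b pb by simp
  qed
  have "Comp FM h u = g"
  proof (rule FI_module_arrow_eqI[OF FM.Comp_Hom[OF u h] g])
    fix S r a assume S: "finite S" and r: "r \<in> Obj R" and a: "a \<in> el (FObj A S) r"
    have ua: "comp_at u S r a \<in> el (FObj B S) r" using app_closed[OF component_Mod[OF u S] r a] .
    have "hh S r (comp_at u S r a) = comp_at g S r a"
    proof (rule L_separated[OF S r hh_in[OF S r ua] app_closed[OF component_Mod[OF g S] r a], of N])
      fix X \<phi> assume \<phi>: "\<phi> \<in> Hom FI S X" and X: "N \<le> card X"
      show "push L \<phi> r (hh S r (comp_at u S r a)) = push L \<phi> r (comp_at g S r a)"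
        using hh[OF S r ua \<phi> X] component_push[OF u \<phi> r a] component_push[OF g \<phi> r a]
          Hu_at[OF Hom_FI_finite(2)[OF \<phi>] X r push_closed[OF AB(1) \<phi> r a]] by simp
    qed
    then show "comp_at (Comp FM h u) S r a = comp_at g S r a"
      using component_Comp[OF u S r a] h_at[OF S r ua] by simp
  qed
  with h show ?thesis by blast
qed

lemma L_factor_unique:
  assumes u: "u \<in> Hom FM A B" and N: "\<And>X. finite X \<Longrightarrow> N \<le> card X \<Longrightarrow> torsion_iso (FObj A X) (FObj B X) (Map u X)"
    and h: "h \<in> Hom FM B L" "h' \<in> Hom FM B L" and eq: "Comp FM h u = Comp FM h' u"
  shows "h = h'"
proof (rule FI_module_arrow_eqI[OF h])
  note AB = Hom_FIMod_Obj[OF u]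
  have large: "Map h X = Map h' X" if X: "finite X" "N \<le> card X" for X
  proof (rule L_hom_unique[OF X(1) N[OF X] component_Mod[OF h(1) X(1)] component_Mod[OF h(2) X(1)]])
    have "Map (Comp FM h u) X = Map (Comp FM h' u) X" using eq by simp
    then show "Comp Md (Map h X) (Map u X) = Comp Md (Map h' X) (Map u X)" using X by (simp add: FIMod_def)
  qed
  fix S r b assume S: "finite S" and r: "r \<in> Obj R" and b: "b \<in> el (FObj B S) r"
  show "comp_at h S r b = comp_at h' S r b"
  proof (rule L_separated[OF S r app_closed[OF component_Mod[OF h(1) S] r b] app_closed[OF component_Mod[OF h(2) S] r b], of N])
    fix X \<phi> assume \<phi>: "\<phi> \<in> Hom FI S X" and X: "N \<le> card X"
    show "push L \<phi> r (comp_at h S r b) = push L \<phi> r (comp_at h' S r b)"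
      using component_push[OF h(1) \<phi> r b] component_push[OF h(2) \<phi> r b] large[OF Hom_FI_finite(2)[OF \<phi>] X] by simp
  qed
qed

theorem L_torsion_hat_closed: "is_closed_object FM (torsion_hat small R \<T>) L"
  unfolding is_closed_object_def
proof (intro conjI allI impI L_Obj)
  fix u assume iso: "is_iso_mod FM (torsion_hat small R \<T>) u"
  define A B where "A = Dom FM u" and "B = Cod FM u"
  have u: "u \<in> Hom FM A B" using iso by (auto simp: is_iso_mod_def A_def B_def intro: Arr_Hom)
  obtain N where N: "\<And>X. finite X \<Longrightarrow> N \<le> card X \<Longrightarrow> torsion_iso (FObj A X) (FObj B X) (Map u X)"
    using pointwise_torsion_iso[OF u iso] by blast
  show "bij_betw (\<lambda>g. Comp FM g u) (Hom FM (Cod FM u) L) (Hom FM (Dom FM u) L)"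
    unfolding A_def[symmetric] B_def[symmetric]
  proof (rule bij_betwI')
    show "(Comp FM h u = Comp FM h' u) = (h = h')" if "h \<in> Hom FM B L" "h' \<in> Hom FM B L" for h h'
      using L_factor_unique[OF u N that] by blast
    show "Comp FM h u \<in> Hom FM A L" if "h \<in> Hom FM B L" for h using FM.Comp_Hom[OF u that] .
    show "\<exists>h \<in> Hom FM B L. g = Comp FM h u" if "g \<in> Hom FM A L" for g
      using L_factor_exists[OF u N that] by blast
  qed
qed

end

section \<open>The localization functor\<close>

lemma postcomp_functor_simps [simp]:
  "V \<in> Obj (functor_category B C) \<Longrightarrow> FObj (postcomp_functor B C G) V = functor_comp B G V"
  "\<alpha> \<in> Hom (functor_category B C) V W \<Longrightarrow> FArr (postcomp_functor B C G) \<alpha> =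
    mk_nat B (functor_comp B G V) (functor_comp B G W) (\<lambda>X. FArr G (Map \<alpha> X))"
proof -
  show "V \<in> Obj (functor_category B C) \<Longrightarrow> FObj (postcomp_functor B C G) V = functor_comp B G V"
    by (simp add: postcomp_functor_def)
  assume "\<alpha> \<in> Hom (functor_category B C) V W"
  then show "FArr (postcomp_functor B C G) \<alpha> = mk_nat B (functor_comp B G V) (functor_comp B G W) (\<lambda>X. FArr G (Map \<alpha> X))"
    using HomD(1)[of \<alpha> "functor_category B C" V W] by (simp add: postcomp_functor_def mk_nat_def Hom_functor_category)
qed

lemma is_functor_postcomp_functor:
  assumes "category B" "category C" "category D" and G: "is_functor C D G"
  shows "is_functor (functor_category B C) (functor_category B D) (postcomp_functor B C G)"
proof -
  interpret B: category B by fact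
  interpret C: category C by fact
  interpret D: category D by fact
  interpret BC: category "functor_category B C" using category_functor_category[OF B.category_axioms C.category_axioms] .
  interpret BD: category "functor_category B D" using category_functor_category[OF B.category_axioms D.category_axioms] .
  have 1: "functor_comp B G V \<in> Obj (functor_category B D)" if "V \<in> Obj (functor_category B C)" for V
    using that B.is_functor_functor_comp[OF _ G] by simp
  have 2: "mk_nat B (functor_comp B G V) (functor_comp B G W) (\<lambda>X. FArr G (Map \<alpha> X))
      \<in> Hom (functor_category B D) (functor_comp B G V) (functor_comp B G W)"
    if \<alpha>: "\<alpha> \<in> Hom (functor_category B C) V W" for \<alpha> V W
  proof (rule B.mk_nat_Hom)
    show "is_functor B D (functor_comp B G V)" "is_functor B D (functor_comp B G W)"
      using B.is_functor_functor_comp[OF _ G] nat_trans_functor[OF \<alpha>] by auto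
    show "FArr G (Map \<alpha> X) \<in> Hom D (FObj (functor_comp B G V) X) (FObj (functor_comp B G W) X)" if "X \<in> Obj B" for X
      using functor_FArr[OF G nat_trans_component[OF \<alpha> that]] that by simp
    fix f X Y assume f: "f \<in> Hom B X Y"
    note XY = B.Hom_Obj[OF f] and VW = nat_trans_functor[OF \<alpha>]
    show "Comp D (FArr G (Map \<alpha> Y)) (FArr (functor_comp B G V) f) = Comp D (FArr (functor_comp B G W) f) (FArr G (Map \<alpha> X))"
      using functor_Comp[OF G functor_FArr[OF VW(1) f] nat_trans_component[OF \<alpha> XY(2)]]
        functor_Comp[OF G nat_trans_component[OF \<alpha> XY(1)] functor_FArr[OF VW(2) f]] nat_trans_natural[OF \<alpha> f] f by simp
  qed
  have eq: "postcomp_functor B C G = mk_functor (functor_category B C) (FObj (postcomp_functor B C G)) (FArr (postcomp_functor B C G))"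
    unfolding mk_functor_def by (simp add: postcomp_functor_def)
  show ?thesis
  proof (subst eq, rule BC.is_functor_mk_functor)
    show "FObj (postcomp_functor B C G) V \<in> Obj (functor_category B D)" if "V \<in> Obj (functor_category B C)" for V
      using that 1[OF that] by simp
    show "FArr (postcomp_functor B C G) \<alpha> \<in> Hom (functor_category B D) (FObj (postcomp_functor B C G) V) (FObj (postcomp_functor B C G) W)"
      if "\<alpha> \<in> Hom (functor_category B C) V W" for \<alpha> V W
      using 2[OF that] BC.Hom_Obj[OF that] that by simp
    show "FArr (postcomp_functor B C G) (Ident (functor_category B C) V) = Ident (functor_category B D) (FObj (postcomp_functor B C G) V)"
      if V: "V \<in> Obj (functor_category B C)" for V
      using 2[OF BC.Ident_Hom[OF V]] V functor_Ident[OF G] functor_FObj[of B C V] BD.Ident_Hom[OF 1[OF V]]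
      by (intro nat_trans_eqI[where C = B and D = D]) (auto simp: postcomp_functor_simps(2)[OF BC.Ident_Hom[OF V]])
    show "FArr (postcomp_functor B C G) (Comp (functor_category B C) \<beta> \<alpha>) =
        Comp (functor_category B D) (FArr (postcomp_functor B C G) \<beta>) (FArr (postcomp_functor B C G) \<alpha>)"
      if \<alpha>: "\<alpha> \<in> Hom (functor_category B C) V W" and \<beta>: "\<beta> \<in> Hom (functor_category B C) W U" for \<alpha> \<beta> V W U
      using 2[OF BC.Comp_Hom[OF \<alpha> \<beta>]] BD.Comp_Hom[OF 2[OF \<alpha>] 2[OF \<beta>]]
        functor_Comp[OF G nat_trans_component[OF \<alpha>] nat_trans_component[OF \<beta>]]
      by (intro nat_trans_eqI[where C = B and D = D and F = "functor_comp B G V" and G = "functor_comp B G U"])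
        (auto simp: postcomp_functor_simps(2)[OF BC.Comp_Hom[OF \<alpha> \<beta>]] postcomp_functor_simps(2)[OF \<alpha>] postcomp_functor_simps(2)[OF \<beta>])
  qed
qed

lemma (in category) closed_object_iso:
  assumes L: "is_closed_object C \<S> L" and h: "h \<in> Hom C L L'" "h' \<in> Hom C L' L"
    and hh: "Comp C h' h = Ident C L" "Comp C h h' = Ident C L'"
  shows "is_closed_object C \<S> L'"
  unfolding is_closed_object_def
proof (intro conjI allI impI)
  show "L' \<in> Obj C" using Hom_Obj(2)[OF h(1)] .
  fix u assume iso: "is_iso_mod C \<S> u"
  define A B where "A = Dom C u" and "B = Cod C u"
  have u: "u \<in> Hom C A B" using iso by (auto simp: is_iso_mod_def A_def B_def intro: Arr_Hom)
  have bij: "bij_betw (\<lambda>g. Comp C g u) (Hom C B L) (Hom C A L)"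
    using L iso unfolding is_closed_object_def A_def B_def by blast
  have cancel: "Comp C h (Comp C h' g) = g" if "g \<in> Hom C X L'" for g X
    using Comp_assoc[OF that h(2,1)] hh(2) Comp_Ident_left[OF that] by simp
  show "bij_betw (\<lambda>g. Comp C g u) (Hom C (Cod C u) L') (Hom C (Dom C u) L')"
    unfolding A_def[symmetric] B_def[symmetric]
  proof (rule bij_betwI')
    show "Comp C g u \<in> Hom C A L'" if "g \<in> Hom C B L'" for g using Comp_Hom[OF u that] .
    fix g assume g: "g \<in> Hom C B L'"
    fix g' assume g': "g' \<in> Hom C B L'"
    show "(Comp C g u = Comp C g' u) = (g = g')"
    proof
      assume eq: "Comp C g u = Comp C g' u"
      have "Comp C (Comp C h' g) u = Comp C (Comp C h' g') u"
        using Comp_assoc[OF u g h(2)] Comp_assoc[OF u g' h(2)] eq by simp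
      then have "Comp C h' g = Comp C h' g'"
        using inj_onD[OF bij_betw_imp_inj_on[OF bij]] Comp_Hom[OF g h(2)] Comp_Hom[OF g' h(2)] by simp
      then have "Comp C h (Comp C h' g) = Comp C h (Comp C h' g')" by (rule arg_cong)
      then show "g = g'" by (simp only: cancel[OF g] cancel[OF g'])
    qed simp
  next
    fix g assume g: "g \<in> Hom C A L'"
    have "Comp C h' g \<in> (\<lambda>g. Comp C g u) ` Hom C B L" using bij_betw_imp_surj_on[OF bij] Comp_Hom[OF g h(2)] by simp
    then obtain k where k: "k \<in> Hom C B L" "Comp C h' g = Comp C k u" by (rule imageE) simp
    have "g = Comp C (Comp C h k) u" using cancel[OF g] k(2) Comp_assoc[OF u k(1) h(1)] by simp
    then show "\<exists>k \<in> Hom C B L'. g = Comp C k u" using Comp_Hom[OF k(1) h(1)] by blast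
  qed
qed

section \<open>Assembling the functor and the canonical morphism\<close>

locale localization = shift_adjunction small R T \<eta> \<epsilon> + hereditary_class small R \<T>
  for small :: "'u set \<Rightarrow> bool" and R :: "('r, 'm) preadditive" and T \<eta> \<epsilon> \<T> +
  fixes E :: "('r, 'm, 'u) module_functor" and e :: "('r, 'm, 'u) module_nat_trans"
  assumes noetherian: "is_locally_noetherian small Md" and envelope: "is_envelope_functor Md \<T> E e"
begin

abbreviation EE :: "('r, 'm, 'u) FImod_functor" where "EE \<equiv> FI_envelope small R E"
abbreviation Lf :: "nat \<Rightarrow> ('r, 'm, 'u) FImod_functor" where "Lf \<equiv> L_functor small R E T"
abbreviation cm :: "nat \<Rightarrow> ('r, 'm, 'u) FImod_obj \<Rightarrow> ('r, 'm, 'u) FImod_arr" where "cm \<equiv> c_map small R E T \<eta>"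
abbreviation lm :: "nat \<Rightarrow> ('r, 'm, 'u) FImod_obj \<Rightarrow> ('r, 'm, 'u) FImod_arr" where "lm \<equiv> l_map small R E e T \<eta>"
abbreviation im :: "('r, 'm, 'u) FImod_obj \<Rightarrow> ('r, 'm, 'u) FImod_arr" where "im \<equiv> i_map E e"

lemma E_functor: "is_functor Md Md E" and e_Hom: "e \<in> Hom (functor_category Md Md) (id_functor Md) E"
  and envelope_closed: "M \<in> Obj Md \<Longrightarrow> is_closed_object Md \<T> (FObj E M)"
proof -
  show *: "is_functor Md Md E" "e \<in> Hom (functor_category Md Md) (id_functor Md) E"
    using envelope by (simp_all add: is_envelope_functor_def)
  assume M: "M \<in> Obj Md"
  have "is_closed_object Md \<T> (Cod Md (Map e M))"
    using envelope M by (simp add: is_envelope_functor_def is_envelope_def)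
  then show "is_closed_object Md \<T> (FObj E M)" using HomD(3)[OF nat_trans_component[OF *(2) M]] by simp
qed

lemma EE_functor: "is_functor FM FM EE"
  unfolding FI_envelope_def FIMod_def
  using is_functor_postcomp_functor[OF FI.category_axioms Md.category_axioms Md.category_axioms E_functor] .

lemma EE_Obj: "V \<in> Obj FM \<Longrightarrow> FObj EE V \<in> Obj FM"
  by (rule functor_FObj[OF EE_functor])

lemma FObj_EE: "V \<in> Obj FM \<Longrightarrow> FObj EE V = functor_comp FI E V"
  by (simp add: FI_envelope_def FIMod_def)

lemma Lf_functor: "is_functor FM FM (Lf k)"
  unfolding L_functor_def
  using FM.is_functor_functor_comp[OF FM.is_functor_functor_comp[OF EE_functor is_functor_shift] Tp_functor] .

lemma FObj_Lf: "V \<in> Obj FM \<Longrightarrow> FObj (Lf k) V = FObj (Tp k) (FObj (Sh k) (FObj EE V))"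
  by (simp add: L_functor_def)

lemma FArr_Lf: "f \<in> Hom FM V V' \<Longrightarrow> FArr (Lf k) f = FArr (Tp k) (FArr (Sh k) (FArr EE f))"
  by (simp add: L_functor_def)

lemma tower: "V \<in> Obj FM \<Longrightarrow> torsion_tower small R T \<eta> \<epsilon> (FObj EE V) \<T>"
proof (unfold_locales)
  assume V: "V \<in> Obj FM"
  show "FObj EE V \<in> Obj FM" using EE_Obj[OF V] .
  show "saturated (FObj (FObj EE V) S)" if "finite S" for S
    using closed_imp_saturated[OF envelope_closed[OF FObj_Mod[OF V that]]] that by (simp add: FObj_EE[OF V])
qed

lemma tower_Z: "V \<in> Obj FM \<Longrightarrow> shift_tower.Z small R T (FObj EE V) k = FObj (Lf k) V"
  and tower_trans: "V \<in> Obj FM \<Longrightarrow> shift_tower.trans small R T \<eta> (FObj EE V) k = cm k V"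
proof -
  assume V: "V \<in> Obj FM"
  interpret torsion_tower small R T \<eta> \<epsilon> "FObj EE V" \<T> using tower[OF V] .
  show "Z k = FObj (Lf k) V" unfolding Z_def FObj_Lf[OF V] ..
  show "local.trans k = cm k V" unfolding trans_def c_map_def ..
qed

lemma cm_Hom: "V \<in> Obj FM \<Longrightarrow> cm k V \<in> Hom FM (FObj (Lf k) V) (FObj (Lf (Suc k)) V)"
proof -
  assume V: "V \<in> Obj FM"
  interpret torsion_tower small R T \<eta> \<epsilon> "FObj EE V" \<T> using tower[OF V] .
  show ?thesis using trans_Hom[of k] unfolding tower_Z[OF V] tower_trans[OF V] .
qed

lemma direct_limit_closed:
  assumes V: "V \<in> Obj FM" and \<iota>: "\<And>k. \<iota> k \<in> Hom FM (FObj (Lf k) V) L"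
    and dl: "\<And>S. finite S \<Longrightarrow>
      direct_limit (\<lambda>k. FObj (FObj (Lf k) V) S) (\<lambda>k. Map (cm k V) S) (FObj L S) (\<lambda>k. Map (\<iota> k) S)"
  shows "is_closed_object FM (torsion_hat small R \<T>) L"
proof -
  interpret torsion_tower small R T \<eta> \<epsilon> "FObj EE V" \<T> using tower[OF V] .
  interpret torsion_limit small R T \<eta> \<epsilon> "FObj EE V" \<T> L \<iota>
    by unfold_locales (use noetherian \<iota> dl in \<open>simp_all add: tower_Z[OF V] tower_trans[OF V]\<close>)
  show ?thesis using L_torsion_hat_closed .
qed

lemma colimit_exists:
  assumes V: "V \<in> Obj FM"
  shows "\<exists>L \<iota>. is_seq_colimit FM (\<lambda>k. FObj (Lf k) V) (\<lambda>k. cm k V) L \<iota> \<and>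
    is_closed_object FM (torsion_hat small R \<T>) L"
proof -
  obtain L \<iota> where \<iota>: "\<And>k. \<iota> k \<in> Hom FM (FObj (Lf k) V) L"
    and dl: "\<And>S. finite S \<Longrightarrow>
      direct_limit (\<lambda>k. FObj (FObj (Lf k) V) S) (\<lambda>k. Map (cm k V) S) (FObj L S) (\<lambda>k. Map (\<iota> k) S)"
    using FI_direct_limit_exists[of "\<lambda>k. cm k V" "\<lambda>k. FObj (Lf k) V", OF cm_Hom[OF V]] by blast
  show ?thesis
    using FI_direct_limit_is_colimit[of \<iota> "\<lambda>k. FObj (Lf k) V", OF \<iota> cm_Hom[OF V] dl] direct_limit_closed[OF V \<iota> dl] by blast
qed

text \<open>Closedness is known for the colimit built from elements. Any other colimit of the same
  sequence is isomorphic to it, and closedness is invariant under isomorphism.\<close>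

lemma colimit_closed:
  assumes V: "V \<in> Obj FM" and L: "is_seq_colimit FM (\<lambda>k. FObj (Lf k) V) (\<lambda>k. cm k V) L \<iota>"
  shows "is_closed_object FM (torsion_hat small R \<T>) L"
proof -
  obtain L' \<iota>' where L': "is_seq_colimit FM (\<lambda>k. FObj (Lf k) V) (\<lambda>k. cm k V) L' \<iota>'"
    and closed: "is_closed_object FM (torsion_hat small R \<T>) L'" using colimit_exists[OF V] by blast
  obtain h h' where h: "h \<in> Hom FM L' L" "h' \<in> Hom FM L L'" "Comp FM h' h = Ident FM L'" "Comp FM h h' = Ident FM L"
    using seq_colimit_unique[OF L' L] by blast
  show ?thesis using FM.closed_object_iso[OF closed h] .
qed

text \<open>Naturality of the unit at the shifted envelope of \<open>f\<close>, carried through T^k.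
  Of the k + 1 factors on each side, T^(k+1) gives up its innermost one and S^(k+1) its outermost
  one, which are the two that meet the unit.\<close>

lemma cm_natural:
  assumes f: "f \<in> Hom FM V V'"
  shows "Comp FM (cm k V') (FArr (Lf k) f) = Comp FM (FArr (Lf (Suc k)) f) (cm k V)"
proof -
  note VV = FM.Hom_Obj[OF f]
  define g where "g = FArr (Sh k) (FArr EE f)"
  define X X' where "X = FObj (Sh k) (FObj EE V)" and "X' = FObj (Sh k) (FObj EE V')"
  have Ef: "FArr EE f \<in> Hom FM (FObj EE V) (FObj EE V')" using functor_FArr[OF EE_functor f] .
  have g: "g \<in> Hom FM X X'" unfolding g_def X_def X'_def using Sh_Hom[OF Ef] .
  note XX = FM.Hom_Obj[OF g]
  have Tg: "FArr T (FArr (Sh 1) g) \<in> Hom FM (FObj T (FObj (Sh 1) X)) (FObj T (FObj (Sh 1) X'))" using T_Hom[OF Sh_Hom[OF g]] .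
  have "FArr (Lf (Suc k)) f = FArr (Tp k) (FArr T (FArr (Sh 1) g))"
    using Tp_Suc_arr[OF Sh_Hom[OF g], of k] shift_Suc_arr[OF Ef, of k] by (simp add: FArr_Lf[OF f] g_def)
  then have "Comp FM (FArr (Lf (Suc k)) f) (cm k V) = FArr (Tp k) (Comp FM (FArr T (FArr (Sh 1) g)) (Map \<eta> X))"
    using functor_Comp[OF Tp_functor \<eta>_Hom[OF XX(1)] Tg] by (simp add: c_map_def X_def)
  also have "\<dots> = FArr (Tp k) (Comp FM (Map \<eta> X') g)" using \<eta>_natural[OF g] by simp
  also have "\<dots> = Comp FM (cm k V') (FArr (Lf k) f)"
    using functor_Comp[OF Tp_functor g \<eta>_Hom[OF XX(2)]] by (simp add: c_map_def X'_def FArr_Lf[OF f] g_def)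
  finally show ?thesis by simp
qed

lemma im_Hom: "V \<in> Obj FM \<Longrightarrow> im V \<in> Hom FM V (FObj EE V)"
proof -
  assume V: "V \<in> Obj FM"
  then have Vf: "is_functor FI Md V" by (simp add: Obj_FIMod)
  have "mk_nat FI V (functor_comp FI E V) (\<lambda>S. Map e (FObj V S)) \<in> Hom (functor_category FI Md) V (functor_comp FI E V)"
  proof (rule FI.mk_nat_Hom[OF Vf FI.is_functor_functor_comp[OF Vf E_functor]])
    show "Map e (FObj V S) \<in> Hom Md (FObj V S) (FObj (functor_comp FI E V) S)" if "S \<in> Obj FI" for S
      using nat_trans_component[OF e_Hom functor_FObj[OF Vf that]] functor_FObj[OF Vf that] that by simp
    show "Comp Md (Map e (FObj V X)) (FArr V \<phi>) = Comp Md (FArr (functor_comp FI E V) \<phi>) (Map e (FObj V S))"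
      if "\<phi> \<in> Hom FI S X" for \<phi> S X
      using nat_trans_natural[OF e_Hom functor_FArr[OF Vf that]] functor_FArr[OF Vf that] that by simp
  qed
  then show ?thesis unfolding FObj_EE[OF V] by (simp add: i_map_def mk_nat_def FIMod_def)
qed

lemma im_natural:
  assumes f: "f \<in> Hom FM V V'"
  shows "Comp FM (im V') f = Comp FM (FArr EE f) (im V)"
proof (rule nat_trans_eqI[of _ FI Md V "FObj EE V'"])
  note VV = FM.Hom_Obj[OF f]
  show "Comp FM (im V') f \<in> Hom (functor_category FI Md) V (FObj EE V')"
    using FM.Comp_Hom[OF f im_Hom[OF VV(2)]] by (simp add: FIMod_def)
  show "Comp FM (FArr EE f) (im V) \<in> Hom (functor_category FI Md) V (FObj EE V')"
    using FM.Comp_Hom[OF im_Hom[OF VV(1)] functor_FArr[OF EE_functor f]] by (simp add: FIMod_def)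
  fix S assume S: "S \<in> Obj FI"
  have fS: "Map f S \<in> Hom Md (FObj V S) (FObj V' S)" using component_Mod[OF f] S by simp
  have f': "f \<in> Hom (functor_category FI Md) V V'" using f by (simp add: FIMod_def)
  have "Map (FArr EE f) S = FArr E (Map f S)"
    unfolding FI_envelope_def postcomp_functor_simps(2)[OF f'] using S by (rule Map_mk_nat)
  then show "Map (Comp FM (im V') f) S = Map (Comp FM (FArr EE f) (im V)) S"
    using nat_trans_natural[OF e_Hom fS] fS S by (simp add: FIMod_def i_map_def)
qed

lemma unit_pow_Hom: "V \<in> Obj FM \<Longrightarrow> unit_pow small R T \<eta> k (FObj EE V) \<in> Hom FM (FObj EE V) (FObj (Lf k) V)"
proof (induction k)
  case 0
  then show ?case using FM.Ident_Hom[OF EE_Obj] EE_Obj by (simp add: FObj_Lf shift_0)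
next
  case (Suc k)
  then show ?case using FM.Comp_Hom[OF Suc.IH[OF Suc.prems] cm_Hom[OF Suc.prems]] by (simp add: c_map_def)
qed

lemma lm_Hom: "V \<in> Obj FM \<Longrightarrow> lm k V \<in> Hom FM V (FObj (Lf k) V)"
  unfolding l_map_def using FM.Comp_Hom[OF im_Hom unit_pow_Hom] .

lemma lm_Suc:
  assumes V: "V \<in> Obj FM"
  shows "lm (Suc k) V = Comp FM (cm k V) (lm k V)"
  using FM.Comp_assoc[OF im_Hom[OF V] unit_pow_Hom[OF V, of k] cm_Hom[OF V, of k]] by (simp add: l_map_def c_map_def)

lemma lm_natural:
  assumes f: "f \<in> Hom FM V V'"
  shows "Comp FM (lm 0 V') f = Comp FM (FArr (Lf 0) f) (lm 0 V)"
proof -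
  have Ef: "FArr EE f \<in> Hom FM (FObj EE V) (FObj EE V')" using functor_FArr[OF EE_functor f] .
  have "lm 0 U = im U" if "U \<in> Obj FM" for U using FM.Comp_Ident_left[OF im_Hom[OF that]] by (simp add: l_map_def)
  moreover have "FArr (Lf 0) f = FArr EE f"
    using Ef by (simp add: FArr_Lf[OF f] shift_0_arr[OF Ef])
  ultimately show ?thesis using im_natural[OF f] FM.Hom_Obj[OF f] by simp
qed

theorem localization_functor_exists:
  "\<exists>\<L> \<iota> l. is_functor FM (Cl FM (torsion_hat small R \<T>)) \<L> \<and>
    (\<forall>k. \<iota> k \<in> Hom (functor_category FM FM) (Lf k) \<L>) \<and>
    l \<in> Hom (functor_category FM FM) (id_functor FM) \<L> \<and>
    (\<forall>V \<in> Obj FM. is_seq_colimit FM (\<lambda>k. FObj (Lf k) V) (\<lambda>k. cm k V) (FObj \<L> V) (\<lambda>k. Map (\<iota> k) V) \<and>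
      (\<forall>k. Map l V = Comp FM (Map (\<iota> k) V) (lm k V)))"
proof -
  obtain L \<iota> where *: "\<And>V. V \<in> Obj FM \<Longrightarrow> is_seq_colimit FM (\<lambda>k. FObj (Lf k) V) (\<lambda>k. cm k V) (L V) (\<iota> V) \<and>
    is_closed_object FM (torsion_hat small R \<T>) (L V)" by (rule choice2E[OF colimit_exists]) (assumption, rule that)
  note colim = *[THEN conjunct1] and closed = *[THEN conjunct2]
  have cocone: "is_seq_cocone FM (\<lambda>k. FObj (Lf k) V) (\<lambda>k. cm k V) (L V) (\<iota> V)" if "V \<in> Obj FM" for V
    using colim[OF that] unfolding is_seq_colimit_def by (rule conjunct1)
  have L_Obj: "L V \<in> Obj FM" if "V \<in> Obj FM" for V using cocone[OF that] by (simp add: is_seq_cocone_def)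
  have \<iota>: "\<iota> V k \<in> Hom FM (FObj (Lf k) V) (L V)" and \<iota>_cm: "Comp FM (\<iota> V (Suc k)) (cm k V) = \<iota> V k" if "V \<in> Obj FM" for V k
    using cocone[OF that] by (simp_all add: is_seq_cocone_def)
  have univ: "\<exists>!h. h \<in> Hom FM (L V) L' \<and> (\<forall>k. Comp FM h (\<iota> V k) = \<iota>' k)"
    if "V \<in> Obj FM" "is_seq_cocone FM (\<lambda>k. FObj (Lf k) V) (\<lambda>k. cm k V) L' \<iota>'" for V L' \<iota>'
    using colim[OF that(1)] that(2) unfolding is_seq_colimit_def by simp
  have eqI: "h = h'" if V: "V \<in> Obj FM" and h: "h \<in> Hom FM (L V) L'" "h' \<in> Hom FM (L V) L'"
    and eq: "\<And>k. Comp FM h (\<iota> V k) = Comp FM h' (\<iota> V k)" for V L' h h'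
  proof -
    have "Comp FM (Comp FM h (\<iota> V (Suc k))) (cm k V) = Comp FM h (\<iota> V k)" for k
      using FM.Comp_assoc[OF cm_Hom[OF V, of k] \<iota>[OF V, of "Suc k"] h(1)] \<iota>_cm[OF V, of k] by simp
    then have "is_seq_cocone FM (\<lambda>k. FObj (Lf k) V) (\<lambda>k. cm k V) L' (\<lambda>k. Comp FM h (\<iota> V k))"
      unfolding is_seq_cocone_def using FM.Hom_Obj(2)[OF h(1)] FM.Comp_Hom[OF \<iota>[OF V] h(1)] by simp
    from univ[OF V this] obtain a where a: "\<forall>y. y \<in> Hom FM (L V) L' \<and> (\<forall>k. Comp FM y (\<iota> V k) = Comp FM h (\<iota> V k)) \<longrightarrow> y = a"
      by (elim ex1E) (rule that)
    have "h = a" by (rule a[THEN spec, THEN mp]) (simp add: h(1))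
    moreover have "h' = a" by (rule a[THEN spec, THEN mp]) (simp add: h(2) eq)
    ultimately show ?thesis by simp
  qed
  \<comment> \<open>The arrow induced between the chosen colimits by the morphisms of stages, which
    \<open>cm_natural\<close> turns into a cocone. Functoriality then follows from uniqueness,
    tested on every stage.\<close>
  define arr where "arr f = (THE h. h \<in> Hom FM (L (Dom FM f)) (L (Cod FM f)) \<and>
    (\<forall>k. Comp FM h (\<iota> (Dom FM f) k) = Comp FM (\<iota> (Cod FM f) k) (FArr (Lf k) f)))" for f
  have arr_all: "arr f \<in> Hom FM (L V) (L V') \<and> (\<forall>k. Comp FM (arr f) (\<iota> V k) = Comp FM (\<iota> V' k) (FArr (Lf k) f))"
    if f: "f \<in> Hom FM V V'" for f V V'
  proof -
    note VV = FM.Hom_Obj[OF f] and Lff = functor_FArr[OF Lf_functor f]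
    have "is_seq_cocone FM (\<lambda>k. FObj (Lf k) V) (\<lambda>k. cm k V) (L V') (\<lambda>k. Comp FM (\<iota> V' k) (FArr (Lf k) f))"
      unfolding is_seq_cocone_def
    proof (intro conjI allI)
      show "L V' \<in> Obj FM" using L_Obj[OF VV(2)] .
      fix k
      show "Comp FM (\<iota> V' k) (FArr (Lf k) f) \<in> Hom FM (FObj (Lf k) V) (L V')" using FM.Comp_Hom[OF Lff \<iota>[OF VV(2)]] .
      have "Comp FM (Comp FM (\<iota> V' (Suc k)) (FArr (Lf (Suc k)) f)) (cm k V) = Comp FM (\<iota> V' (Suc k)) (Comp FM (cm k V') (FArr (Lf k) f))"
        using FM.Comp_assoc[OF cm_Hom[OF VV(1)] Lff \<iota>[OF VV(2)]] cm_natural[OF f] by simp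
      also have "\<dots> = Comp FM (\<iota> V' k) (FArr (Lf k) f)"
        using FM.Comp_assoc[OF Lff cm_Hom[OF VV(2)] \<iota>[OF VV(2)]] \<iota>_cm[OF VV(2)] by simp
      finally show "Comp FM (Comp FM (\<iota> V' (Suc k)) (FArr (Lf (Suc k)) f)) (cm k V) = Comp FM (\<iota> V' k) (FArr (Lf k) f)" .
    qed
    from theI'[OF univ[OF VV(1) this]] show ?thesis unfolding arr_def HomD(2)[OF f] HomD(3)[OF f] .
  qed
  note arr = arr_all[THEN conjunct1] and arr_\<iota> = arr_all[THEN conjunct2, THEN spec]
  have arr_Ident: "arr (Ident FM V) = Ident FM (L V)" if V: "V \<in> Obj FM" for V
  proof (rule eqI[OF V arr[OF FM.Ident_Hom[OF V]] FM.Ident_Hom[OF L_Obj[OF V]]])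
    show "Comp FM (arr (Ident FM V)) (\<iota> V k) = Comp FM (Ident FM (L V)) (\<iota> V k)" for k
      using arr_\<iota>[OF FM.Ident_Hom[OF V]] functor_Ident[OF Lf_functor V] FM.Comp_Ident_left[OF \<iota>[OF V]] FM.Comp_Ident_right[OF \<iota>[OF V]] by simp
  qed
  have arr_Comp: "arr (Comp FM g f) = Comp FM (arr g) (arr f)" if f: "f \<in> Hom FM U V" and g: "g \<in> Hom FM V V'" for f g U V V'
  proof (rule eqI[OF FM.Hom_Obj(1)[OF f] arr[OF FM.Comp_Hom[OF f g]] FM.Comp_Hom[OF arr[OF f] arr[OF g]]])
    fix k
    note \<iota>3 = \<iota>[OF FM.Hom_Obj(1)[OF f], of k] \<iota>[OF FM.Hom_Obj(1)[OF g], of k] \<iota>[OF FM.Hom_Obj(2)[OF g], of k]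
    note Lff = functor_FArr[OF Lf_functor f, of k] and Lfg = functor_FArr[OF Lf_functor g, of k]
    have "Comp FM (Comp FM (arr g) (arr f)) (\<iota> U k) = Comp FM (arr g) (Comp FM (\<iota> V k) (FArr (Lf k) f))"
      using FM.Comp_assoc[OF \<iota>3(1) arr[OF f] arr[OF g]] arr_\<iota>[OF f, of k] by simp
    also have "\<dots> = Comp FM (Comp FM (\<iota> V' k) (FArr (Lf k) g)) (FArr (Lf k) f)"
      using FM.Comp_assoc[OF Lff \<iota>3(2) arr[OF g]] arr_\<iota>[OF g, of k] by simp
    also have "\<dots> = Comp FM (\<iota> V' k) (FArr (Lf k) (Comp FM g f))"
      using FM.Comp_assoc[OF Lff Lfg \<iota>3(3)] functor_Comp[OF Lf_functor f g, of k] by simp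
    finally show "Comp FM (arr (Comp FM g f)) (\<iota> U k) = Comp FM (Comp FM (arr g) (arr f)) (\<iota> U k)"
      using arr_\<iota>[OF FM.Comp_Hom[OF f g], of k] by simp
  qed
  define \<L> where "\<L> = mk_functor FM L arr"
  have \<L>: "is_functor FM FM \<L>"
    unfolding \<L>_def by (rule FM.is_functor_mk_functor[OF L_Obj arr arr_Ident arr_Comp])
  have \<L>_at: "FObj \<L> V = L V" if "V \<in> Obj FM" for V using that by (simp add: \<L>_def)
  have \<L>_arr: "FArr \<L> f = arr f" if "f \<in> Hom FM V V'" for f V V' using that by (simp add: \<L>_def)
  have \<L>_Cl: "is_functor FM (Cl FM (torsion_hat small R \<T>)) \<L>"
    unfolding \<L>_def Cl_def
  proof (rule FM.is_functor_mk_functor)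
    show "L V \<in> Obj (full_subcategory FM {L. is_closed_object FM (torsion_hat small R \<T>) L})" if "V \<in> Obj FM" for V
      using L_Obj[OF that] closed[OF that] by simp
    show "arr f \<in> Hom (full_subcategory FM {L. is_closed_object FM (torsion_hat small R \<T>) L}) (L V) (L V')" if f: "f \<in> Hom FM V V'" for f V V'
      using arr[OF f] closed[OF FM.Hom_Obj(1)[OF f]] closed[OF FM.Hom_Obj(2)[OF f]] by (simp add: Hom_full_subcategory)
  qed (simp_all add: arr_Ident arr_Comp)
  define \<iota>' where "\<iota>' k = mk_nat FM (Lf k) \<L> (\<lambda>V. \<iota> V k)" for k
  have \<iota>': "\<iota>' k \<in> Hom (functor_category FM FM) (Lf k) \<L>" for k
    unfolding \<iota>'_def
  proof (rule FM.mk_nat_Hom[OF Lf_functor \<L>])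
    show "\<iota> V k \<in> Hom FM (FObj (Lf k) V) (FObj \<L> V)" if "V \<in> Obj FM" for V using \<iota>[OF that] \<L>_at[OF that] by simp
    show "Comp FM (\<iota> V' k) (FArr (Lf k) f) = Comp FM (FArr \<L> f) (\<iota> V k)" if "f \<in> Hom FM V V'" for f V V'
      using arr_\<iota>[OF that] \<L>_arr[OF that] by simp
  qed
  have \<iota>'_at: "Map (\<iota>' k) V = \<iota> V k" if "V \<in> Obj FM" for V k using that by (simp add: \<iota>'_def)
  \<comment> \<open>Stage 0 is enough to define the morphism: by \<open>lm_Suc\<close> and the
    cocone equations the composite with any other stage is the same arrow.\<close>
  define l where "l = mk_nat FM (id_functor FM) \<L> (\<lambda>V. Comp FM (\<iota> V 0) (lm 0 V))"
  have l: "l \<in> Hom (functor_category FM FM) (id_functor FM) \<L>"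
    unfolding l_def
  proof (rule FM.mk_nat_Hom[OF FM.is_functor_id_functor \<L>])
    show "Comp FM (\<iota> V 0) (lm 0 V) \<in> Hom FM (FObj (id_functor FM) V) (FObj \<L> V)" if "V \<in> Obj FM" for V
      using FM.Comp_Hom[OF lm_Hom[OF that] \<iota>[OF that]] that \<L>_at[OF that] by simp
    fix f V V' assume f: "f \<in> Hom FM V V'"
    note VV = FM.Hom_Obj[OF f]
    have "Comp FM (Comp FM (\<iota> V' 0) (lm 0 V')) f = Comp FM (\<iota> V' 0) (Comp FM (FArr (Lf 0) f) (lm 0 V))"
      using FM.Comp_assoc[OF f lm_Hom[OF VV(2), of 0] \<iota>[OF VV(2), of 0]] lm_natural[OF f] by simp
    also have "\<dots> = Comp FM (Comp FM (arr f) (\<iota> V 0)) (lm 0 V)"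
      using FM.Comp_assoc[OF lm_Hom[OF VV(1)] functor_FArr[OF Lf_functor f] \<iota>[OF VV(2)]] arr_\<iota>[OF f] by simp
    also have "\<dots> = Comp FM (FArr \<L> f) (Comp FM (\<iota> V 0) (lm 0 V))"
      using FM.Comp_assoc[OF lm_Hom[OF VV(1)] \<iota>[OF VV(1)] arr[OF f]] \<L>_arr[OF f] by simp
    finally show "Comp FM (Comp FM (\<iota> V' 0) (lm 0 V')) (FArr (id_functor FM) f) = Comp FM (FArr \<L> f) (Comp FM (\<iota> V 0) (lm 0 V))"
      using f by simp
  qed
  have l_at: "Map l V = Comp FM (\<iota> V k) (lm k V)" if V: "V \<in> Obj FM" for V k
  proof (induction k)
    case 0
    then show ?case using V by (simp add: l_def)
  next
    case (Suc k)
    have "Comp FM (\<iota> V (Suc k)) (lm (Suc k) V) = Comp FM (\<iota> V k) (lm k V)"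
      using FM.Comp_assoc[OF lm_Hom[OF V] cm_Hom[OF V] \<iota>[OF V]] \<iota>_cm[OF V] lm_Suc[OF V] by simp
    then show ?case using Suc by simp
  qed
  show ?thesis
  proof (intro exI[of _ \<L>] exI[of _ \<iota>'] exI[of _ l] conjI ballI allI \<L>_Cl \<iota>' l)
    fix V assume V: "V \<in> Obj FM"
    show "is_seq_colimit FM (\<lambda>k. FObj (Lf k) V) (\<lambda>k. cm k V) (FObj \<L> V) (\<lambda>k. Map (\<iota>' k) V)"
      using colim[OF V] \<iota>'_at[OF V] \<L>_at[OF V] by simp
    show "Map l V = Comp FM (Map (\<iota>' k) V) (lm k V)" for k using l_at[OF V] \<iota>'_at[OF V] by simp
  qed
qed

end

theorem theorem3:
  fixes small :: "'u set \<Rightarrow> bool"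
    and R :: "('r, 'm) preadditive"
    and \<T> \<F> :: "('r, 'm, 'u) module_obj set"
    and E :: "('r, 'm, 'u) module_functor" and e :: "('r, 'm, 'u) module_nat_trans"
    and T :: "('r, 'm, 'u) FImod_functor" and \<eta> \<epsilon> :: "('r, 'm, 'u) FImod_nat_trans"
  assumes "universe small"
    and "preadditive_category R" and "small_category small R"
    and "is_locally_noetherian small (Mod small R)"
    and "is_hereditary_torsion_theory (Mod small R) \<T> \<F>"
    and "is_envelope_functor (Mod small R) \<T> E e"
    and "is_adjunction (FIMod small R) (FIMod small R) (shift small R 1) T \<eta> \<epsilon>"
  shows
    "(\<exists>\<L> \<iota> l.
        is_functor (FIMod small R) (Cl (FIMod small R) (torsion_hat small R \<T>)) \<L> \<and>
        (\<forall>k. \<iota> k \<in> Hom (functor_category (FIMod small R) (FIMod small R))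
                     (L_functor small R E T k) \<L>) \<and>
        l \<in> Hom (functor_category (FIMod small R) (FIMod small R))
              (id_functor (FIMod small R)) \<L> \<and>
        (\<forall>V \<in> Obj (FIMod small R).
          is_seq_colimit (FIMod small R) (\<lambda>k. FObj (L_functor small R E T k) V)
            (\<lambda>k. c_map small R E T \<eta> k V) (FObj \<L> V) (\<lambda>k. Map (\<iota> k) V) \<and>
          (\<forall>k. Map l V = Comp (FIMod small R) (Map (\<iota> k) V) (l_map small R E e T \<eta> k V)))) \<and>
     (\<forall>V \<in> Obj (FIMod small R). \<forall>L \<iota>.
        is_seq_colimit (FIMod small R) (\<lambda>k. FObj (L_functor small R E T k) V)
          (\<lambda>k. c_map small R E T \<eta> k V) L \<iota> \<longrightarrow>
        is_closed_object (FIMod small R) (torsion_hat small R \<T>) L)"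
proof -
  interpret module_category small R
    by (intro module_category.intro module_category_axioms.intro assms(1-3))
  have tt: "\<T> \<subseteq> Obj Md" "\<forall>X \<in> Obj Md. \<exists>T \<in> \<T>. \<exists>F \<in> \<F>. \<exists>i \<in> Hom Md T X. \<exists>p \<in> Hom Md X F. is_short_exact Md i p"
    and hereditary: "\<forall>m. is_mono Md m \<and> Cod Md m \<in> \<T> \<longrightarrow> Dom Md m \<in> \<T>"
    using assms(5) unfolding is_hereditary_torsion_theory_def is_torsion_theory_def by simp_all
  interpret localization small R T \<eta> \<epsilon> \<T> E e
  proof unfold_locales
    \<comment> \<open>The torsion part in the decomposition of a zero module is a member of the
      class.\<close>
    show "\<T> \<noteq> {}" using tt(2) zero_module by blast
  qed (use assms tt(1) hereditary in auto)
  show ?thesis using localization_functor_exists colimit_closed by blast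
qed

end
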